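(* Let $\mathcal{A}$ be a 2-ring. Then the category $\mathcal{A}\text{-Mod}$ of $\mathcal{A}$-modules (i.e. of $SPC$-functors $\mathcal{A}\to SPC$ and $SPC$-natural transformations between them) is isomorphic to the category of $T$-algebras and their morphisms for the doctrine $T=\mathcal{A}\otimes-$ on $SPC$, described as follows. A $T$-algebra $(\mathcal{M},\varphi,\beta,\gamma)$ consists of a symmetric Picard category $\mathcal{M}$, a strict arrow $\varphi:\mathcal{A}\otimes\mathcal{M}\to\mathcal{M}$ in $SPC$ and 2-cells $\beta:\varphi\circ(1\otimes\varphi)\circ A'\Rightarrow\varphi\circ(c\otimes 1):(\mathcal{A}\otimes\mathcal{A})\otimes\mathcal{M}\to\mathcal{M}$ and $\gamma:1_{\mathcal{M}}\Rightarrow\varphi\circ(u\otimes 1)\circ L':\mathcal{M}\to\mathcal{M}$ in $SPC$ such that (writing $*$ for whiskering and $\cdot$ for vertical composition) (T1) $[\beta*((c\otimes1)\otimes1)]\cdot[\beta*((1\otimes\varphi)\circ A')]=[\varphi*(\alpha\otimes1)]\cdot[\beta*(((1\otimes c)\otimes1)\circ(A'\otimes1))]\cdot[\varphi*(1\otimes\beta)*(A'\circ(A'\otimes1))]$ as 2-cells between arrows $((\mathcal{A}\otimes\mathcal{A})\otimes\mathcal{A})\otimes\mathcal{M}\to\mathcal{M}$; (T2) $\varphi*(\rho\otimes1)=[\beta*(((1\otimes u)\otimes1)\circ(R'\otimes1))]\cdot[\varphi*(1\otimes\gamma)]$ as 2-cells between arrows $\mathcal{A}\otimes\mathcal{M}\to\mathcal{M}$;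 (T3) $\varphi*(\lambda\otimes1)=[\beta*(((u\otimes1)\otimes1)\circ(L'\otimes1))]\cdot[(\varphi\circ(1\otimes\varphi)\circ(u\otimes1))*\theta]^{-1}\cdot[\gamma*\varphi]$ as 2-cells between arrows $\mathcal{A}\otimes\mathcal{M}\to\mathcal{M}$. A morphism $(H,\delta):(\mathcal{M},\varphi,\beta,\gamma)\to(\mathcal{N},\psi,\beta,\gamma)$ consists of an arrow $H:\mathcal{M}\to\mathcal{N}$ of $SPC$ and a 2-cell $\delta:\psi\circ(1\otimes H)\Rightarrow H\circ\varphi:\mathcal{A}\otimes\mathcal{M}\to\mathcal{N}$ such that (M1) $[\delta*(c\otimes1)]\cdot[\beta*(1\otimes H)]=[H*\beta]\cdot[\delta*((1\otimes\varphi)\circ A')]\cdot[\psi*(1\otimes\delta)*A']$; (M2) $H*\gamma=[\delta*((u\otimes1)\circ L')]\cdot[\gamma*H]$.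
   Context: A symmetric Picard category is a symmetric monoidal category whose underlying category is a groupoid, with a chosen object $a^{\bullet}$ and isomorphism $j_a:I\to a^{\bullet}\otimes a$ for each object $a$. $SPC$ is the 2-category of symmetric Picard categories, symmetric monoidal functors and monoidal natural transformations. An arrow $F$ of $SPC$ is strict if it preserves the monoidal structure strictly and $F(a^\bullet)=(Fa)^\bullet$, $F(j_a)=j_{Fa}$. $[\mathcal{B},\mathcal{C}]$ is the internal hom: symmetric monoidal functors and monoidal transformations, with structure pointwise from $\mathcal{C}$. $[F,1]$ and $[1,F]$ denote pre- and post-composition with $F$; $[\mathcal{D},-]:[\mathcal{B},\mathcal{C}]\to[[\mathcal{D},\mathcal{B}],[\mathcal{D},\mathcal{C}]]$ is $F\mapsto[1,F]$. An arrow $F:\mathcal{B}\to[\mathcal{C},\mathcal{D}]$ has a dual $F^*:\mathcal{C}\to[\mathcal{B},\mathcal{D}]$, $F^*(c)(b)=F(b)(c)$, similarly for 2-cells; it comes from an isomorphism $[\mathcal{B},[\mathcal{C},\mathcal{D}]]\cong[\mathcal{C},[\mathcal{B},\mathcal{D}]]$. An $n$-linear map $\mathcal{A}_1\times\dots\times\mathcal{A}_n\to\mathcal{B}$ is an object of $[\mathcal{A}_1,[\mathcal{A}_2,\dots,[\mathcal{A}_n,\mathcal{B}]\dots]]$, and an $n$-linear natural transformation is an arrow there. Tensor: $\mathcal{B}\otimes\mathcal{C}$ has an arrow $\eta:\mathcal{B}\to[\mathcal{C},\mathcal{B}\otimes\mathcal{C}]$ such that $Rn(F)=[1,F]\circ\eta$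 defines an isomorphism, 2-natural in $\mathcal{D}$ with respect to strict arrows, from the category of strict arrows $\mathcal{B}\otimes\mathcal{C}\to\mathcal{D}$ (and all 2-cells between them) to $SPC(\mathcal{B},[\mathcal{C},\mathcal{D}])$. $Rn$ is defined on all arrows and 2-cells; $En(G)$ is the strict arrow with $Rn(En(G))=G$, and $En\dashv Rn$ with identity unit, so that for $F$ strict and any $G:\mathcal{B}\otimes\mathcal{C}\to\mathcal{D}$, $Rn$ is a bijection from 2-cells $F\Rightarrow G$ to 2-cells $Rn(F)\Rightarrow Rn(G)$. $\otimes$ is a 2-functor $SPC\times SPC\to SPC$: $F\otimes G$ is the strict arrow with $Rn(F\otimes G)=[G,1]\circ\eta\circ F$ (similarly on 2-cells). $\mathcal{I}$ is the free symmetric Picard category on one generator $\star$ (for every $\mathcal{B}$ and object $b$ of $\mathcal{B}$ there is a unique strict arrow $\mathcal{I}\to\mathcal{B}$ sending $\star$ to $b$); $ev_\star:[\mathcal{I},\mathcal{B}]\to\mathcal{B}$ is evaluation at $\star$. $L'_{\mathcal{B}}=ev_\star\circ\eta^*:\mathcal{B}\to[\mathcal{I},\mathcal{I}\otimes\mathcal{B}]\to\mathcal{I}\otimes\mathcal{B}$; $R'_{\mathcal{B}}=ev_\star\circ\eta:\mathcal{B}\to[\mathcal{I},\mathcal{B}\otimes\mathcal{I}]\to\mathcal{B}\otimes\mathcal{I}$; $A':(\mathcal{B}\otimes\mathcal{C})\otimes\mathcal{D}\to\mathcal{B}\otimes(\mathcal{C}\otimes\mathcal{D})$ is the strict arrow,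 with $Rn(A')$ strict, such that $Rn(Rn(A'))$ is the composite $\mathcal{B}\xrightarrow{\eta}[\mathcal{C}\otimes\mathcal{D},\mathcal{B}\otimes(\mathcal{C}\otimes\mathcal{D})]\xrightarrow{[\mathcal{D},-]}[[\mathcal{D},\mathcal{C}\otimes\mathcal{D}],[\mathcal{D},\mathcal{B}\otimes(\mathcal{C}\otimes\mathcal{D})]]\xrightarrow{[\eta,1]}[\mathcal{C},[\mathcal{D},\mathcal{B}\otimes(\mathcal{C}\otimes\mathcal{D})]]$. $\theta:A'\circ(L'_{\mathcal{A}}\otimes1)\Rightarrow L'_{\mathcal{A}\otimes\mathcal{M}}:\mathcal{A}\otimes\mathcal{M}\to\mathcal{I}\otimes(\mathcal{A}\otimes\mathcal{M})$ is the 2-cell with $Rn(\theta)$ the identity (domain and codomain have the same image under $Rn$, and the domain is strict). 2-ring: a symmetric Picard category $\mathcal{A}$ with a bilinear map $(a,b)\mapsto a.b$, $\mathcal{A}\times\mathcal{A}\to\mathcal{A}$, an object $1_{\mathcal{A}}$, a trilinear natural transformation $\alpha_{a,b,c}:a.(b.c)\to(a.b).c$ and linear natural transformations $\rho_a:a\to a.1_{\mathcal{A}}$, $\lambda_a:a\to1_{\mathcal{A}}.a$ such that the pentagon $\alpha_{k.h,g,f}\circ\alpha_{k,h,g.f}=(\alpha_{k,h,g}.f)\circ\alpha_{k,h.g,f}\circ(k.\alpha_{h,g,f})$ and the triangle $\alpha_{g,1,f}\circ(g.\lambda_f)=\rho_g.f$ commute. Equivalently (this presentation is used in (T1)–(T3))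 it is given by strict arrows $c:\mathcal{A}\otimes\mathcal{A}\to\mathcal{A}$ (with $Rn(c)$ the multiplication $\mathcal{A}\to[\mathcal{A},\mathcal{A}]$) and $u:\mathcal{I}\to\mathcal{A}$ (with $u(\star)=1_{\mathcal{A}}$), and 2-cells $\alpha:c\circ(1\otimes c)\circ A'\Rightarrow c\circ(c\otimes1)$ (with $Rn(Rn(\alpha))$ the trilinear natural transformation with components $\alpha_{a,b,c}:a.(b.c)\to(a.b).c$), $\rho:1\Rightarrow c\circ(1\otimes u)\circ R'$, $\lambda:1\Rightarrow c\circ(u\otimes1)\circ L'$ (equal respectively to the linear natural transformations with components $\rho_a:a\to a.1_{\mathcal{A}}$ and $\lambda_a:a\to1_{\mathcal{A}}.a$). $\mathcal{A}$-modules: an $SPC$-functor from $\mathcal{A}$ (a one-object $SPC$-enriched category) to $SPC$ amounts to a symmetric Picard category $\mathcal{M}$, an arrow $\varphi':\mathcal{A}\to[\mathcal{M},\mathcal{M}]$ of $SPC$ (write $a.m=\varphi'(a)(m)$), a trilinear natural transformation $\beta_{a,b,m}:a.(b.m)\to(a.b).m$ and a linear natural transformation $\gamma_m:m\to1_{\mathcal{A}}.m$ with $\beta_{a.b,c,m}\circ\beta_{a,b,c.m}=(\alpha_{a,b,c}.m)\circ\beta_{a,b.c,m}\circ(a.\beta_{b,c,m})$, $\beta_{a,1,m}\circ(a.\gamma_m)=\rho_a.m$ and $\beta_{1,a,m}\circ\gamma_{a.m}=\lambda_a.m$. An $SPC$-natural transformation (module morphism) amounts to an arrow $H:\mathcal{M}\to\mathcal{N}$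 of $SPC$ with a bilinear natural transformation $\delta_{a,m}:a.H(m)\to H(a.m)$ such that $H(\gamma_m)=\delta_{1,m}\circ\gamma_{H(m)}$ and $\delta_{a.b,m}\circ\beta_{a,b,Hm}=H(\beta_{a,b,m})\circ\delta_{a,b.m}\circ(a.\delta_{b,m})$. Composition of morphisms (of modules and of $T$-algebras) is by composing arrows of $SPC$ and pasting the 2-cells $\delta$. *)

theory Defs
  imports "HOL-Library.FuncSet"
begin

section \<open>Categories\<close>

record ('o, 'a) cat =
  Obj :: "'o set"
  Arr :: "'a set"
  Dom :: "'a \<Rightarrow> 'o"
  Cod :: "'a \<Rightarrow> 'o"
  Id :: "'o \<Rightarrow> 'a"
  Comp :: "'a \<Rightarrow> 'a \<Rightarrow> 'a"  (infixr "\<cdot>\<index>" 60)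

definition hom :: "('o, 'a, 'z) cat_scheme \<Rightarrow> 'o \<Rightarrow> 'o \<Rightarrow> 'a set" where
  "hom C a b = {f \<in> Arr C. Dom C f = a \<and> Cod C f = b}"

locale category =
  fixes C :: "('o, 'a, 'z) cat_scheme" (structure)
  assumes Dom_closed: "f \<in> Arr C \<Longrightarrow> Dom C f \<in> Obj C"
    and Cod_closed: "f \<in> Arr C \<Longrightarrow> Cod C f \<in> Obj C"
    and Id_hom: "a \<in> Obj C \<Longrightarrow> Id C a \<in> hom C a a"
    and Comp_hom: "f \<in> hom C a b \<Longrightarrow> g \<in> hom C b c \<Longrightarrow> g \<cdot> f \<in> hom C a c"
    and Comp_Id_left: "f \<in> hom C a b \<Longrightarrow> Id C b \<cdot> f = f"
    and Comp_Id_right: "f \<in> hom C a b \<Longrightarrow> f \<cdot> Id C a = f"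
    and Comp_assoc: "f \<in> hom C a b \<Longrightarrow> g \<in> hom C b c \<Longrightarrow> h \<in> hom C c d \<Longrightarrow>
      (h \<cdot> g) \<cdot> f = h \<cdot> (g \<cdot> f)"

definition inverse_of :: "('o, 'a, 'z) cat_scheme \<Rightarrow> 'a \<Rightarrow> 'a \<Rightarrow> bool" where
  "inverse_of C f g \<longleftrightarrow> f \<in> Arr C \<and> g \<in> hom C (Cod C f) (Dom C f)
     \<and> Comp C g f = Id C (Dom C f) \<and> Comp C f g = Id C (Cod C f)"

definition is_iso :: "('o, 'a, 'z) cat_scheme \<Rightarrow> 'a \<Rightarrow> bool" where
  "is_iso C f \<longleftrightarrow> (\<exists>g. inverse_of C f g)"

definition inv_arr :: "('o, 'a, 'z) cat_scheme \<Rightarrow> 'a \<Rightarrow> 'a" where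
  "inv_arr C f = (THE g. inverse_of C f g)"

definition is_functor ::
    "('o, 'a, 'y) cat_scheme \<Rightarrow> ('p, 'b, 'z) cat_scheme \<Rightarrow> ('o \<Rightarrow> 'p) \<Rightarrow> ('a \<Rightarrow> 'b) \<Rightarrow> bool" where
  "is_functor C D Fo Fa \<longleftrightarrow>
     (\<forall>a \<in> Obj C. Fo a \<in> Obj D \<and> Fa (Id C a) = Id D (Fo a)) \<and>
     (\<forall>f \<in> Arr C. Fa f \<in> hom D (Fo (Dom C f)) (Fo (Cod C f))) \<and>
     (\<forall>f \<in> Arr C. \<forall>g \<in> Arr C. Cod C f = Dom C g \<longrightarrow> Fa (Comp C g f) = Comp D (Fa g) (Fa f))"

definition isomorphic_categories ::
    "('o, 'a, 'y) cat_scheme \<Rightarrow> ('p, 'b, 'z) cat_scheme \<Rightarrow> bool" where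
  "isomorphic_categories C D \<longleftrightarrow> category C \<and> category D \<and>
     (\<exists>Fo Fa Go Ga. is_functor C D Fo Fa \<and> is_functor D C Go Ga \<and>
        (\<forall>a \<in> Obj C. Go (Fo a) = a) \<and> (\<forall>f \<in> Arr C. Ga (Fa f) = f) \<and>
        (\<forall>a \<in> Obj D. Fo (Go a) = a) \<and> (\<forall>f \<in> Arr D. Fa (Ga f) = f))"


section \<open>Symmetric Picard categories\<close>

record ('o, 'a) spc = "('o, 'a) cat" +
  tensO :: "'o \<Rightarrow> 'o \<Rightarrow> 'o"  (infixr "\<otimes>\<index>" 70)
  tensA :: "'a \<Rightarrow> 'a \<Rightarrow> 'a"  (infixr "\<boxtimes>\<index>" 70)
  Unit :: "'o"  ("\<one>\<index>")
  assoc :: "'o \<Rightarrow> 'o \<Rightarrow> 'o \<Rightarrow> 'a"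
  lunit :: "'o \<Rightarrow> 'a"
  runit :: "'o \<Rightarrow> 'a"
  symm :: "'o \<Rightarrow> 'o \<Rightarrow> 'a"
  bul :: "'o \<Rightarrow> 'o"
  bulj :: "'o \<Rightarrow> 'a"

locale symmetric_monoidal_category = category C
  for C :: "('o, 'a) spc" (structure) +
  assumes tensO_closed: "a \<in> Obj C \<Longrightarrow> b \<in> Obj C \<Longrightarrow> a \<otimes> b \<in> Obj C"
    and Unit_closed: "\<one> \<in> Obj C"
    and tensA_hom: "f \<in> hom C a b \<Longrightarrow> g \<in> hom C c d \<Longrightarrow> f \<boxtimes> g \<in> hom C (a \<otimes> c) (b \<otimes> d)"
    and tens_Id: "a \<in> Obj C \<Longrightarrow> b \<in> Obj C \<Longrightarrow> Id C a \<boxtimes> Id C b = Id C (a \<otimes> b)"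
    and tens_Comp: "f \<in> hom C a b \<Longrightarrow> f' \<in> hom C b c \<Longrightarrow> g \<in> hom C a' b' \<Longrightarrow> g' \<in> hom C b' c' \<Longrightarrow>
      (f' \<cdot> f) \<boxtimes> (g' \<cdot> g) = (f' \<boxtimes> g') \<cdot> (f \<boxtimes> g)"
    and assoc_hom: "a \<in> Obj C \<Longrightarrow> b \<in> Obj C \<Longrightarrow> c \<in> Obj C \<Longrightarrow>
      assoc C a b c \<in> hom C ((a \<otimes> b) \<otimes> c) (a \<otimes> (b \<otimes> c))"
    and assoc_iso: "a \<in> Obj C \<Longrightarrow> b \<in> Obj C \<Longrightarrow> c \<in> Obj C \<Longrightarrow> is_iso C (assoc C a b c)"
    and assoc_nat: "f \<in> hom C a a' \<Longrightarrow> g \<in> hom C b b' \<Longrightarrow> h \<in> hom C c c' \<Longrightarrow>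
      assoc C a' b' c' \<cdot> ((f \<boxtimes> g) \<boxtimes> h) = (f \<boxtimes> (g \<boxtimes> h)) \<cdot> assoc C a b c"
    and lunit_hom: "a \<in> Obj C \<Longrightarrow> lunit C a \<in> hom C (\<one> \<otimes> a) a"
    and lunit_iso: "a \<in> Obj C \<Longrightarrow> is_iso C (lunit C a)"
    and lunit_nat: "f \<in> hom C a b \<Longrightarrow> lunit C b \<cdot> (Id C \<one> \<boxtimes> f) = f \<cdot> lunit C a"
    and runit_hom: "a \<in> Obj C \<Longrightarrow> runit C a \<in> hom C (a \<otimes> \<one>) a"
    and runit_iso: "a \<in> Obj C \<Longrightarrow> is_iso C (runit C a)"
    and runit_nat: "f \<in> hom C a b \<Longrightarrow> runit C b \<cdot> (f \<boxtimes> Id C \<one>) = f \<cdot> runit C a"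
    and symm_hom: "a \<in> Obj C \<Longrightarrow> b \<in> Obj C \<Longrightarrow> symm C a b \<in> hom C (a \<otimes> b) (b \<otimes> a)"
    and symm_nat: "f \<in> hom C a a' \<Longrightarrow> g \<in> hom C b b' \<Longrightarrow>
      symm C a' b' \<cdot> (f \<boxtimes> g) = (g \<boxtimes> f) \<cdot> symm C a b"
    and symm_symm: "a \<in> Obj C \<Longrightarrow> b \<in> Obj C \<Longrightarrow> symm C b a \<cdot> symm C a b = Id C (a \<otimes> b)"
    and pentagon: "a \<in> Obj C \<Longrightarrow> b \<in> Obj C \<Longrightarrow> c \<in> Obj C \<Longrightarrow> d \<in> Obj C \<Longrightarrow>
      assoc C a b (c \<otimes> d) \<cdot> assoc C (a \<otimes> b) c d
        = (Id C a \<boxtimes> assoc C b c d) \<cdot> assoc C a (b \<otimes> c) d \<cdot> (assoc C a b c \<boxtimes> Id C d)"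
    and triangle: "a \<in> Obj C \<Longrightarrow> b \<in> Obj C \<Longrightarrow>
      (Id C a \<boxtimes> lunit C b) \<cdot> assoc C a \<one> b = runit C a \<boxtimes> Id C b"
    and hexagon: "a \<in> Obj C \<Longrightarrow> b \<in> Obj C \<Longrightarrow> c \<in> Obj C \<Longrightarrow>
      assoc C b c a \<cdot> symm C a (b \<otimes> c) \<cdot> assoc C a b c
        = (Id C b \<boxtimes> symm C a c) \<cdot> assoc C b a c \<cdot> (symm C a b \<boxtimes> Id C c)"

locale symmetric_picard_category = symmetric_monoidal_category C
  for C :: "('o, 'a) spc" (structure) +
  assumes groupoid: "f \<in> Arr C \<Longrightarrow> is_iso C f"
    and bul_closed: "a \<in> Obj C \<Longrightarrow> bul C a \<in> Obj C"
    and bulj_hom: "a \<in> Obj C \<Longrightarrow> bulj C a \<in> hom C \<one> (bul C a \<otimes> a)"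

lemma (in symmetric_picard_category) arr_typing:
  "a \<in> Obj C \<Longrightarrow>
    Id C a \<in> Arr C \<and> Dom C (Id C a) = a \<and> Cod C (Id C a) = a"
  "f \<in> Arr C \<Longrightarrow> g \<in> Arr C \<Longrightarrow>
    Cod C f = Dom C g \<Longrightarrow>
    Comp C g f \<in> Arr C \<and> Dom C (Comp C g f) = Dom C f \<and> Cod C (Comp C g f) = Cod C g"
  "f \<in> Arr C \<Longrightarrow> g \<in> Arr C \<Longrightarrow>
    tensA C f g \<in> Arr C \<and> Dom C (tensA C f g) = tensO C (Dom C f) (Dom C g) \<and> Cod C (tensA C f g) = tensO C (Cod C f) (Cod C g)"
  "a \<in> Obj C \<Longrightarrow> b \<in> Obj C \<Longrightarrow> c \<in> Obj C \<Longrightarrow>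
    assoc C a b c \<in> Arr C \<and> Dom C (assoc C a b c) = tensO C (tensO C a b) c \<and> Cod C (assoc C a b c) = tensO C a (tensO C b c)"
  "a \<in> Obj C \<Longrightarrow>
    lunit C a \<in> Arr C \<and> Dom C (lunit C a) = tensO C (Unit C) a \<and> Cod C (lunit C a) = a"
  "a \<in> Obj C \<Longrightarrow>
    runit C a \<in> Arr C \<and> Dom C (runit C a) = tensO C a (Unit C) \<and> Cod C (runit C a) = a"
  "a \<in> Obj C \<Longrightarrow> b \<in> Obj C \<Longrightarrow>
    symm C a b \<in> Arr C \<and> Dom C (symm C a b) = tensO C a b \<and> Cod C (symm C a b) = tensO C b a"
  subgoal using Id_hom by (auto simp: hom_def)
  subgoal using Comp_hom by (auto simp: hom_def)
  subgoal using tensA_hom by (auto simp: hom_def)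
  subgoal using assoc_hom by (auto simp: hom_def)
  subgoal using lunit_hom by (auto simp: hom_def)
  subgoal using runit_hom by (auto simp: hom_def)
  subgoal using symm_hom by (auto simp: hom_def)
  done

text \<open>The operations of a symmetric Picard category are total functions in HOL.  The following
  normal form (no information outside the carriers) is imposed on the underlying categories of
  modules and algebras, so that distinct objects of the categories of modules and algebras are
  mathematically distinct.\<close>

definition spc_normal :: "('o, 'a) spc \<Rightarrow> bool" where
  "spc_normal C \<longleftrightarrow>
     Dom C \<in> extensional (Arr C) \<and> Cod C \<in> extensional (Arr C) \<and> Id C \<in> extensional (Obj C) \<and>
     (\<forall>g f. \<not> (f \<in> Arr C \<and> g \<in> Arr C \<and> Cod C f = Dom C g) \<longrightarrow> Comp C g f = undefined) \<and>
     (\<forall>a b. \<not> (a \<in> Obj C \<and> b \<in> Obj C) \<longrightarrow> tensO C a b = undefined \<and> symm C a b = undefined) \<and>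
     (\<forall>f g. \<not> (f \<in> Arr C \<and> g \<in> Arr C) \<longrightarrow> tensA C f g = undefined) \<and>
     (\<forall>a b c. \<not> (a \<in> Obj C \<and> b \<in> Obj C \<and> c \<in> Obj C) \<longrightarrow> assoc C a b c = undefined) \<and>
     lunit C \<in> extensional (Obj C) \<and> runit C \<in> extensional (Obj C) \<and>
     bul C \<in> extensional (Obj C) \<and> bulj C \<in> extensional (Obj C)"

text \<open>The canonical interchange \<open>(a \<otimes> b) \<otimes> (c \<otimes> d) \<rightarrow> (a \<otimes> c) \<otimes> (b \<otimes> d)\<close>.\<close>

definition interchange :: "('o, 'a) spc \<Rightarrow> 'o \<Rightarrow> 'o \<Rightarrow> 'o \<Rightarrow> 'o \<Rightarrow> 'a" where
  "interchange C a b c d =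
     (let t = tensO C; w = tensA C; i = Id C in
      Comp C (inv_arr C (assoc C a c (t b d)))
       (Comp C (w (i a) (assoc C c b d))
         (Comp C (w (i a) (w (symm C b c) (i d)))
           (Comp C (w (i a) (inv_arr C (assoc C b c d)))
             (assoc C a b (t c d))))))"

text \<open>The assignment \<open>a \<mapsto> a\<^sup>\<bullet>\<close> extends uniquely to arrows, and acquires unique comparison
  arrows with the tensor and the unit, subject to compatibility with the arrows
  \<open>j\<^sub>a : I \<rightarrow> a\<^sup>\<bullet> \<otimes> a\<close>.\<close>

definition bul_arr :: "('o, 'a) spc \<Rightarrow> 'a \<Rightarrow> 'a" where
  "bul_arr C f = (THE g. g \<in> hom C (bul C (Dom C f)) (bul C (Cod C f)) \<and>
     Comp C (tensA C g f) (bulj C (Dom C f)) = bulj C (Cod C f))"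

definition bul_tens :: "('o, 'a) spc \<Rightarrow> 'o \<Rightarrow> 'o \<Rightarrow> 'a" where
  "bul_tens C a b = (THE g. g \<in> hom C (tensO C (bul C a) (bul C b)) (bul C (tensO C a b)) \<and>
     Comp C (tensA C g (Id C (tensO C a b)))
       (Comp C (interchange C (bul C a) a (bul C b) b)
         (Comp C (tensA C (bulj C a) (bulj C b)) (inv_arr C (lunit C (Unit C)))))
     = bulj C (tensO C a b))"

definition bul_unit :: "('o, 'a) spc \<Rightarrow> 'a" where
  "bul_unit C = (THE g. g \<in> hom C (Unit C) (bul C (Unit C)) \<and>
     Comp C (tensA C g (Id C (Unit C))) (inv_arr C (lunit C (Unit C))) = bulj C (Unit C))"


section \<open>Symmetric monoidal functors and monoidal natural transformations\<close>

text \<open>In a record for an arrow or a 2-cell of \<open>SPC\<close>, all functions are undefined outside the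
  carrier, so that equality of records is equality of arrows, respectively 2-cells.\<close>

definition restrict2 :: "'o set \<Rightarrow> ('o \<Rightarrow> 'o \<Rightarrow> 'b) \<Rightarrow> 'o \<Rightarrow> 'o \<Rightarrow> 'b" where
  "restrict2 A f = (\<lambda>x y. if x \<in> A \<and> y \<in> A then f x y else undefined)"

record ('o, 'a, 'p, 'b) smf =
  Src :: "('o, 'a) spc"
  Tgt :: "('p, 'b) spc"
  fobj :: "'o \<Rightarrow> 'p"
  farr :: "'a \<Rightarrow> 'b"
  ften :: "'o \<Rightarrow> 'o \<Rightarrow> 'b"
  funit :: "'b"

locale symmetric_monoidal_functor =
  B: symmetric_picard_category "Src F" + C: symmetric_picard_category "Tgt F"
  for F :: "('o, 'a, 'p, 'b) smf" +
  assumes fobj_ext: "fobj F \<in> extensional (Obj (Src F))"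
    and farr_ext: "farr F \<in> extensional (Arr (Src F))"
    and ften_ext: "restrict2 (Obj (Src F)) (ften F) = ften F"
    and fobj_closed: "x \<in> Obj (Src F) \<Longrightarrow> fobj F x \<in> Obj (Tgt F)"
    and farr_hom: "f \<in> hom (Src F) x y \<Longrightarrow> farr F f \<in> hom (Tgt F) (fobj F x) (fobj F y)"
    and farr_Id: "x \<in> Obj (Src F) \<Longrightarrow> farr F (Id (Src F) x) = Id (Tgt F) (fobj F x)"
    and farr_Comp: "f \<in> hom (Src F) x y \<Longrightarrow> g \<in> hom (Src F) y z \<Longrightarrow>
      farr F (g \<cdot>\<^bsub>Src F\<^esub> f) = farr F g \<cdot>\<^bsub>Tgt F\<^esub> farr F f"
    and ften_hom: "x \<in> Obj (Src F) \<Longrightarrow> y \<in> Obj (Src F) \<Longrightarrow>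
      ften F x y \<in> hom (Tgt F) (fobj F x \<otimes>\<^bsub>Tgt F\<^esub> fobj F y) (fobj F (x \<otimes>\<^bsub>Src F\<^esub> y))"
    and funit_hom: "funit F \<in> hom (Tgt F) \<one>\<^bsub>Tgt F\<^esub> (fobj F \<one>\<^bsub>Src F\<^esub>)"
    and ften_nat: "f \<in> hom (Src F) x x' \<Longrightarrow> g \<in> hom (Src F) y y' \<Longrightarrow>
      farr F (f \<boxtimes>\<^bsub>Src F\<^esub> g) \<cdot>\<^bsub>Tgt F\<^esub> ften F x y
        = ften F x' y' \<cdot>\<^bsub>Tgt F\<^esub> (farr F f \<boxtimes>\<^bsub>Tgt F\<^esub> farr F g)"
    and ften_assoc: "x \<in> Obj (Src F) \<Longrightarrow> y \<in> Obj (Src F) \<Longrightarrow> z \<in> Obj (Src F) \<Longrightarrow>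
      farr F (assoc (Src F) x y z) \<cdot>\<^bsub>Tgt F\<^esub> ften F (x \<otimes>\<^bsub>Src F\<^esub> y) z
          \<cdot>\<^bsub>Tgt F\<^esub> (ften F x y \<boxtimes>\<^bsub>Tgt F\<^esub> Id (Tgt F) (fobj F z))
        = ften F x (y \<otimes>\<^bsub>Src F\<^esub> z) \<cdot>\<^bsub>Tgt F\<^esub> (Id (Tgt F) (fobj F x) \<boxtimes>\<^bsub>Tgt F\<^esub> ften F y z)
          \<cdot>\<^bsub>Tgt F\<^esub> assoc (Tgt F) (fobj F x) (fobj F y) (fobj F z)"
    and ften_lunit: "x \<in> Obj (Src F) \<Longrightarrow>
      farr F (lunit (Src F) x) \<cdot>\<^bsub>Tgt F\<^esub> ften F \<one>\<^bsub>Src F\<^esub> x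
          \<cdot>\<^bsub>Tgt F\<^esub> (funit F \<boxtimes>\<^bsub>Tgt F\<^esub> Id (Tgt F) (fobj F x))
        = lunit (Tgt F) (fobj F x)"
    and ften_runit: "x \<in> Obj (Src F) \<Longrightarrow>
      farr F (runit (Src F) x) \<cdot>\<^bsub>Tgt F\<^esub> ften F x \<one>\<^bsub>Src F\<^esub>
          \<cdot>\<^bsub>Tgt F\<^esub> (Id (Tgt F) (fobj F x) \<boxtimes>\<^bsub>Tgt F\<^esub> funit F)
        = runit (Tgt F) (fobj F x)"
    and ften_symm: "x \<in> Obj (Src F) \<Longrightarrow> y \<in> Obj (Src F) \<Longrightarrow>
      farr F (symm (Src F) x y) \<cdot>\<^bsub>Tgt F\<^esub> ften F x y
        = ften F y x \<cdot>\<^bsub>Tgt F\<^esub> symm (Tgt F) (fobj F x) (fobj F y)"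

definition strict_smf :: "('o, 'a, 'p, 'b) smf \<Rightarrow> bool" where
  "strict_smf F \<longleftrightarrow> symmetric_monoidal_functor F \<and>
     (\<forall>x \<in> Obj (Src F). \<forall>y \<in> Obj (Src F).
        fobj F (x \<otimes>\<^bsub>Src F\<^esub> y) = fobj F x \<otimes>\<^bsub>Tgt F\<^esub> fobj F y \<and>
        ften F x y = Id (Tgt F) (fobj F x \<otimes>\<^bsub>Tgt F\<^esub> fobj F y)) \<and>
     fobj F \<one>\<^bsub>Src F\<^esub> = \<one>\<^bsub>Tgt F\<^esub> \<and> funit F = Id (Tgt F) \<one>\<^bsub>Tgt F\<^esub> \<and>
     (\<forall>x \<in> Obj (Src F).
        fobj F (bul (Src F) x) = bul (Tgt F) (fobj F x) \<and>
        farr F (bulj (Src F) x) = bulj (Tgt F) (fobj F x))"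

definition arrows :: "('o, 'a) spc \<Rightarrow> ('p, 'b) spc \<Rightarrow> ('o, 'a, 'p, 'b) smf set" where
  "arrows B C = {F. symmetric_monoidal_functor F \<and> Src F = B \<and> Tgt F = C}"

definition strict_arrows :: "('o, 'a) spc \<Rightarrow> ('p, 'b) spc \<Rightarrow> ('o, 'a, 'p, 'b) smf set" where
  "strict_arrows B C = {F \<in> arrows B C. strict_smf F}"

record ('o, 'a, 'p, 'b) mnt =
  nsrc :: "('o, 'a, 'p, 'b) smf"
  ntgt :: "('o, 'a, 'p, 'b) smf"
  ncomp :: "'o \<Rightarrow> 'b"  (infixl "\<diamondop>" 90)

definition mnt_dom :: "('o, 'a, 'p, 'b) mnt \<Rightarrow> ('o, 'a) spc" where
  "mnt_dom \<sigma> = Src (nsrc \<sigma>)"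

definition mnt_cod :: "('o, 'a, 'p, 'b) mnt \<Rightarrow> ('p, 'b) spc" where
  "mnt_cod \<sigma> = Tgt (nsrc \<sigma>)"

locale monoidal_transformation =
  F: symmetric_monoidal_functor "nsrc \<sigma>" + G: symmetric_monoidal_functor "ntgt \<sigma>"
  for \<sigma> :: "('o, 'a, 'p, 'b) mnt" +
  assumes same_Src: "Src (ntgt \<sigma>) = mnt_dom \<sigma>"
    and same_Tgt: "Tgt (ntgt \<sigma>) = mnt_cod \<sigma>"
    and ncomp_ext: "ncomp \<sigma> \<in> extensional (Obj (mnt_dom \<sigma>))"
    and ncomp_hom: "x \<in> Obj (mnt_dom \<sigma>) \<Longrightarrow>
      \<sigma> \<diamondop> x \<in> hom (mnt_cod \<sigma>) (fobj (nsrc \<sigma>) x) (fobj (ntgt \<sigma>) x)"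
    and natural: "f \<in> hom (mnt_dom \<sigma>) x y \<Longrightarrow>
      \<sigma> \<diamondop> y \<cdot>\<^bsub>mnt_cod \<sigma>\<^esub> farr (nsrc \<sigma>) f = farr (ntgt \<sigma>) f \<cdot>\<^bsub>mnt_cod \<sigma>\<^esub> \<sigma> \<diamondop> x"
    and monoidal_tens: "x \<in> Obj (mnt_dom \<sigma>) \<Longrightarrow> y \<in> Obj (mnt_dom \<sigma>) \<Longrightarrow>
      \<sigma> \<diamondop> (x \<otimes>\<^bsub>mnt_dom \<sigma>\<^esub> y) \<cdot>\<^bsub>mnt_cod \<sigma>\<^esub> ften (nsrc \<sigma>) x y
        = ften (ntgt \<sigma>) x y \<cdot>\<^bsub>mnt_cod \<sigma>\<^esub> (\<sigma> \<diamondop> x \<boxtimes>\<^bsub>mnt_cod \<sigma>\<^esub> \<sigma> \<diamondop> y)"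
    and monoidal_unit:
      "\<sigma> \<diamondop> \<one>\<^bsub>mnt_dom \<sigma>\<^esub> \<cdot>\<^bsub>mnt_cod \<sigma>\<^esub> funit (nsrc \<sigma>) = funit (ntgt \<sigma>)"

definition cells ::
    "('o, 'a, 'p, 'b) smf \<Rightarrow> ('o, 'a, 'p, 'b) smf \<Rightarrow> ('o, 'a, 'p, 'b) mnt set" where
  "cells F G = {\<sigma>. monoidal_transformation \<sigma> \<and> nsrc \<sigma> = F \<and> ntgt \<sigma> = G}"


section \<open>The 2-category structure\<close>

definition idF :: "('o, 'a) spc \<Rightarrow> ('o, 'a, 'o, 'a) smf" where
  "idF C = \<lparr>Src = C, Tgt = C,
     fobj = (\<lambda>x \<in> Obj C. x), farr = (\<lambda>f \<in> Arr C. f),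
     ften = restrict2 (Obj C) (\<lambda>x y. Id C (x \<otimes>\<^bsub>C\<^esub> y)), funit = Id C \<one>\<^bsub>C\<^esub>\<rparr>"

definition compF ::
    "('p, 'b, 'q, 'c) smf \<Rightarrow> ('o, 'a, 'p, 'b) smf \<Rightarrow> ('o, 'a, 'q, 'c) smf"
    (infixr "\<circ>\<^sub>F" 60) where
  "G \<circ>\<^sub>F F = \<lparr>Src = Src F, Tgt = Tgt G,
     fobj = (\<lambda>x \<in> Obj (Src F). fobj G (fobj F x)),
     farr = (\<lambda>f \<in> Arr (Src F). farr G (farr F f)),
     ften = restrict2 (Obj (Src F))
       (\<lambda>x y. farr G (ften F x y) \<cdot>\<^bsub>Tgt G\<^esub> ften G (fobj F x) (fobj F y)),
     funit = farr G (funit F) \<cdot>\<^bsub>Tgt G\<^esub> funit G\<rparr>"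

definition id2 :: "('o, 'a, 'p, 'b) smf \<Rightarrow> ('o, 'a, 'p, 'b) mnt" where
  "id2 F = \<lparr>nsrc = F, ntgt = F, ncomp = (\<lambda>x \<in> Obj (Src F). Id (Tgt F) (fobj F x))\<rparr>"

definition vcomp ::
    "('o, 'a, 'p, 'b) mnt \<Rightarrow> ('o, 'a, 'p, 'b) mnt \<Rightarrow> ('o, 'a, 'p, 'b) mnt"
    (infixr "\<cdot>\<^sub>V" 55) where
  "\<tau> \<cdot>\<^sub>V \<sigma> = \<lparr>nsrc = nsrc \<sigma>, ntgt = ntgt \<tau>,
     ncomp = (\<lambda>x \<in> Obj (mnt_dom \<sigma>). \<tau> \<diamondop> x \<cdot>\<^bsub>mnt_cod \<sigma>\<^esub> \<sigma> \<diamondop> x)\<rparr>"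

definition inv2 :: "('o, 'a, 'p, 'b) mnt \<Rightarrow> ('o, 'a, 'p, 'b) mnt" where
  "inv2 \<sigma> = \<lparr>nsrc = ntgt \<sigma>, ntgt = nsrc \<sigma>,
     ncomp = (\<lambda>x \<in> Obj (mnt_dom \<sigma>). inv_arr (mnt_cod \<sigma>) (\<sigma> \<diamondop> x))\<rparr>"

text \<open>Whiskering \<open>H * \<sigma>\<close> and \<open>\<sigma> * F\<close> of a 2-cell with an arrow.\<close>

definition whiskL ::
    "('p, 'b, 'q, 'c) smf \<Rightarrow> ('o, 'a, 'p, 'b) mnt \<Rightarrow> ('o, 'a, 'q, 'c) mnt"
    (infixr "*\<^sub>L" 65) where
  "H *\<^sub>L \<sigma> = \<lparr>nsrc = H \<circ>\<^sub>F nsrc \<sigma>, ntgt = H \<circ>\<^sub>F ntgt \<sigma>,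
     ncomp = (\<lambda>x \<in> Obj (mnt_dom \<sigma>). farr H (\<sigma> \<diamondop> x))\<rparr>"

definition whiskR ::
    "('p, 'b, 'q, 'c) mnt \<Rightarrow> ('o, 'a, 'p, 'b) smf \<Rightarrow> ('o, 'a, 'q, 'c) mnt"
    (infixl "*\<^sub>R" 66) where
  "\<sigma> *\<^sub>R F = \<lparr>nsrc = nsrc \<sigma> \<circ>\<^sub>F F, ntgt = ntgt \<sigma> \<circ>\<^sub>F F,
     ncomp = (\<lambda>x \<in> Obj (Src F). \<sigma> \<diamondop> fobj F x)\<rparr>"


section \<open>The internal hom\<close>

type_synonym ('o, 'a, 'p, 'b) ihom = "(('o, 'a, 'p, 'b) smf, ('o, 'a, 'p, 'b) mnt) spc"

text \<open>The pointwise structure on arrows \<open>B \<rightarrow> C\<close>.\<close>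

definition tensF ::
    "('o, 'a, 'p, 'b) smf \<Rightarrow> ('o, 'a, 'p, 'b) smf \<Rightarrow> ('o, 'a, 'p, 'b) smf" where
  "tensF F G = \<lparr>Src = Src F, Tgt = Tgt F,
     fobj = (\<lambda>x \<in> Obj (Src F). fobj F x \<otimes>\<^bsub>Tgt F\<^esub> fobj G x),
     farr = (\<lambda>f \<in> Arr (Src F). farr F f \<boxtimes>\<^bsub>Tgt F\<^esub> farr G f),
     ften = restrict2 (Obj (Src F)) (\<lambda>x y. (ften F x y \<boxtimes>\<^bsub>Tgt F\<^esub> ften G x y)
       \<cdot>\<^bsub>Tgt F\<^esub> interchange (Tgt F) (fobj F x) (fobj G x) (fobj F y) (fobj G y)),
     funit = (funit F \<boxtimes>\<^bsub>Tgt F\<^esub> funit G) \<cdot>\<^bsub>Tgt F\<^esub> inv_arr (Tgt F) (lunit (Tgt F) \<one>\<^bsub>Tgt F\<^esub>)\<rparr>"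

definition unitF :: "('o, 'a) spc \<Rightarrow> ('p, 'b) spc \<Rightarrow> ('o, 'a, 'p, 'b) smf" where
  "unitF B C = \<lparr>Src = B, Tgt = C,
     fobj = (\<lambda>x \<in> Obj B. \<one>\<^bsub>C\<^esub>), farr = (\<lambda>f \<in> Arr B. Id C \<one>\<^bsub>C\<^esub>),
     ften = restrict2 (Obj B) (\<lambda>x y. lunit C \<one>\<^bsub>C\<^esub>), funit = Id C \<one>\<^bsub>C\<^esub>\<rparr>"

definition bulF :: "('o, 'a, 'p, 'b) smf \<Rightarrow> ('o, 'a, 'p, 'b) smf" where
  "bulF F = \<lparr>Src = Src F, Tgt = Tgt F,
     fobj = (\<lambda>x \<in> Obj (Src F). bul (Tgt F) (fobj F x)),
     farr = (\<lambda>f \<in> Arr (Src F). bul_arr (Tgt F) (farr F f)),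
     ften = restrict2 (Obj (Src F)) (\<lambda>x y.
       bul_arr (Tgt F) (ften F x y) \<cdot>\<^bsub>Tgt F\<^esub> bul_tens (Tgt F) (fobj F x) (fobj F y)),
     funit = bul_arr (Tgt F) (funit F) \<cdot>\<^bsub>Tgt F\<^esub> bul_unit (Tgt F)\<rparr>"

definition ihom :: "('o, 'a) spc \<Rightarrow> ('p, 'b) spc \<Rightarrow> ('o, 'a, 'p, 'b) ihom" where
  "ihom B C = \<lparr>Obj = arrows B C,
     Arr = {\<sigma>. monoidal_transformation \<sigma> \<and> mnt_dom \<sigma> = B \<and> mnt_cod \<sigma> = C},
     Dom = nsrc, Cod = ntgt, Id = id2, Comp = vcomp,
     tensO = tensF,
     tensA = (\<lambda>\<sigma> \<tau>. \<lparr>nsrc = tensF (nsrc \<sigma>) (nsrc \<tau>), ntgt = tensF (ntgt \<sigma>) (ntgt \<tau>),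
       ncomp = (\<lambda>x \<in> Obj B. \<sigma> \<diamondop> x \<boxtimes>\<^bsub>C\<^esub> \<tau> \<diamondop> x)\<rparr>),
     Unit = unitF B C,
     assoc = (\<lambda>F G H. \<lparr>nsrc = tensF (tensF F G) H, ntgt = tensF F (tensF G H),
       ncomp = (\<lambda>x \<in> Obj B. assoc C (fobj F x) (fobj G x) (fobj H x))\<rparr>),
     lunit = (\<lambda>F. \<lparr>nsrc = tensF (unitF B C) F, ntgt = F,
       ncomp = (\<lambda>x \<in> Obj B. lunit C (fobj F x))\<rparr>),
     runit = (\<lambda>F. \<lparr>nsrc = tensF F (unitF B C), ntgt = F,
       ncomp = (\<lambda>x \<in> Obj B. runit C (fobj F x))\<rparr>),
     symm = (\<lambda>F G. \<lparr>nsrc = tensF F G, ntgt = tensF G F,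
       ncomp = (\<lambda>x \<in> Obj B. symm C (fobj F x) (fobj G x))\<rparr>),
     bul = bulF,
     bulj = (\<lambda>F. \<lparr>nsrc = unitF B C, ntgt = tensF (bulF F) F,
       ncomp = (\<lambda>x \<in> Obj B. bulj C (fobj F x))\<rparr>)\<rparr>"

text \<open>\<open>hom_post X F\<close> is \<open>[1,F] : [X,B] \<rightarrow> [X,C]\<close> and \<open>hom_pre F X\<close> is
  \<open>[F,1] : [C,X] \<rightarrow> [B,X]\<close>, for \<open>F : B \<rightarrow> C\<close>; similarly for 2-cells.\<close>

definition hom_post :: "('o, 'a) spc \<Rightarrow> ('p, 'b, 'q, 'c) smf \<Rightarrow>
    (('o, 'a, 'p, 'b) smf, ('o, 'a, 'p, 'b) mnt, ('o, 'a, 'q, 'c) smf, ('o, 'a, 'q, 'c) mnt) smf"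
  where
  "hom_post X F = \<lparr>Src = ihom X (Src F), Tgt = ihom X (Tgt F),
     fobj = (\<lambda>G \<in> Obj (ihom X (Src F)). F \<circ>\<^sub>F G),
     farr = (\<lambda>\<sigma> \<in> Arr (ihom X (Src F)). F *\<^sub>L \<sigma>),
     ften = restrict2 (Obj (ihom X (Src F))) (\<lambda>G H.
       \<lparr>nsrc = tensF (F \<circ>\<^sub>F G) (F \<circ>\<^sub>F H), ntgt = F \<circ>\<^sub>F tensF G H,
        ncomp = (\<lambda>x \<in> Obj X. ften F (fobj G x) (fobj H x))\<rparr>),
     funit = \<lparr>nsrc = unitF X (Tgt F), ntgt = F \<circ>\<^sub>F unitF X (Src F),
       ncomp = (\<lambda>x \<in> Obj X. funit F)\<rparr>\<rparr>"

definition hom_pre :: "('o, 'a, 'p, 'b) smf \<Rightarrow> ('q, 'c) spc \<Rightarrow>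
    (('p, 'b, 'q, 'c) smf, ('p, 'b, 'q, 'c) mnt, ('o, 'a, 'q, 'c) smf, ('o, 'a, 'q, 'c) mnt) smf"
  where
  "hom_pre F X = \<lparr>Src = ihom (Tgt F) X, Tgt = ihom (Src F) X,
     fobj = (\<lambda>G \<in> Obj (ihom (Tgt F) X). G \<circ>\<^sub>F F),
     farr = (\<lambda>\<sigma> \<in> Arr (ihom (Tgt F) X). \<sigma> *\<^sub>R F),
     ften = restrict2 (Obj (ihom (Tgt F) X)) (\<lambda>G H. id2 (tensF G H \<circ>\<^sub>F F)),
     funit = id2 (unitF (Src F) X)\<rparr>"

definition hom_post2 :: "('o, 'a) spc \<Rightarrow> ('p, 'b, 'q, 'c) mnt \<Rightarrow>
    (('o, 'a, 'p, 'b) smf, ('o, 'a, 'p, 'b) mnt, ('o, 'a, 'q, 'c) smf, ('o, 'a, 'q, 'c) mnt) mnt"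
  where
  "hom_post2 X \<sigma> = \<lparr>nsrc = hom_post X (nsrc \<sigma>), ntgt = hom_post X (ntgt \<sigma>),
     ncomp = (\<lambda>G \<in> Obj (ihom X (mnt_dom \<sigma>)). \<sigma> *\<^sub>R G)\<rparr>"

definition hom_pre2 :: "('o, 'a, 'p, 'b) mnt \<Rightarrow> ('q, 'c) spc \<Rightarrow>
    (('p, 'b, 'q, 'c) smf, ('p, 'b, 'q, 'c) mnt, ('o, 'a, 'q, 'c) smf, ('o, 'a, 'q, 'c) mnt) mnt"
  where
  "hom_pre2 \<sigma> X = \<lparr>nsrc = hom_pre (nsrc \<sigma>) X, ntgt = hom_pre (ntgt \<sigma>) X,
     ncomp = (\<lambda>G \<in> Obj (ihom (mnt_cod \<sigma>) X). G *\<^sub>L \<sigma>)\<rparr>"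

text \<open>\<open>hom_functor D B C\<close> is \<open>[D,-] : [B,C] \<rightarrow> [[D,B],[D,C]]\<close>; it is strictly compatible with
  the pointwise tensor and unit.\<close>

definition hom_functor :: "('o, 'a) spc \<Rightarrow> ('p, 'b) spc \<Rightarrow> ('q, 'c) spc \<Rightarrow>
    (('p, 'b, 'q, 'c) smf, ('p, 'b, 'q, 'c) mnt,
     (('o, 'a, 'p, 'b) smf, ('o, 'a, 'p, 'b) mnt, ('o, 'a, 'q, 'c) smf, ('o, 'a, 'q, 'c) mnt) smf,
     (('o, 'a, 'p, 'b) smf, ('o, 'a, 'p, 'b) mnt, ('o, 'a, 'q, 'c) smf, ('o, 'a, 'q, 'c) mnt) mnt)
    smf" where
  "hom_functor D B C = \<lparr>Src = ihom B C, Tgt = ihom (ihom D B) (ihom D C),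
     fobj = (\<lambda>F \<in> Obj (ihom B C). hom_post D F),
     farr = (\<lambda>\<sigma> \<in> Arr (ihom B C). hom_post2 D \<sigma>),
     ften = restrict2 (Obj (ihom B C)) (\<lambda>F G. id2 (hom_post D (tensF F G))),
     funit = id2 (unitF (ihom D B) (ihom D C))\<rparr>"

text \<open>\<open>dual C D F : C \<rightarrow> [B,D]\<close> is the dual of \<open>F : B \<rightarrow> [C,D]\<close>.\<close>

definition dual :: "('p, 'b) spc \<Rightarrow> ('q, 'c) spc \<Rightarrow>
    ('o, 'a, ('p, 'b, 'q, 'c) smf, ('p, 'b, 'q, 'c) mnt) smf \<Rightarrow>
    ('p, 'b, ('o, 'a, 'q, 'c) smf, ('o, 'a, 'q, 'c) mnt) smf" where
  "dual C D F = (let B = Src F;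
       Fs = (\<lambda>c. \<lparr>Src = B, Tgt = D,
         fobj = (\<lambda>b \<in> Obj B. fobj (fobj F b) c),
         farr = (\<lambda>f \<in> Arr B. farr F f \<diamondop> c),
         ften = restrict2 (Obj B) (\<lambda>b b'. ften F b b' \<diamondop> c),
         funit = funit F \<diamondop> c\<rparr>)
     in \<lparr>Src = C, Tgt = ihom B D,
       fobj = (\<lambda>c \<in> Obj C. Fs c),
       farr = (\<lambda>g \<in> Arr C. \<lparr>nsrc = Fs (Dom C g), ntgt = Fs (Cod C g),
         ncomp = (\<lambda>b \<in> Obj B. farr (fobj F b) g)\<rparr>),
       ften = restrict2 (Obj C) (\<lambda>c c'. \<lparr>nsrc = tensF (Fs c) (Fs c'), ntgt = Fs (c \<otimes>\<^bsub>C\<^esub> c'),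
         ncomp = (\<lambda>b \<in> Obj B. ften (fobj F b) c c')\<rparr>),
       funit = \<lparr>nsrc = unitF B D, ntgt = Fs \<one>\<^bsub>C\<^esub>,
         ncomp = (\<lambda>b \<in> Obj B. funit (fobj F b))\<rparr>\<rparr>)"

text \<open>Evaluation \<open>ev\<^sub>c : [C,D] \<rightarrow> D\<close> at an object \<open>c\<close>.\<close>

definition ev :: "('o, 'a) spc \<Rightarrow> ('p, 'b) spc \<Rightarrow> 'o \<Rightarrow>
    (('o, 'a, 'p, 'b) smf, ('o, 'a, 'p, 'b) mnt, 'p, 'b) smf" where
  "ev C D c = \<lparr>Src = ihom C D, Tgt = D,
     fobj = (\<lambda>F \<in> Obj (ihom C D). fobj F c),
     farr = (\<lambda>\<sigma> \<in> Arr (ihom C D). \<sigma> \<diamondop> c),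
     ften = restrict2 (Obj (ihom C D)) (\<lambda>F G. Id D (fobj F c \<otimes>\<^bsub>D\<^esub> fobj G c)),
     funit = Id D \<one>\<^bsub>D\<^esub>\<rparr>"


section \<open>Symmetric Picard categories given by generators and relations\<close>

datatype 'g pobj = PGen 'g | PUnit | PTens "'g pobj" "'g pobj" | PBul "'g pobj"

datatype ('g, 'e) parr =
    AGen 'e
  | AId "'g pobj"
  | AComp "('g, 'e) parr" "('g, 'e) parr"
  | ATens "('g, 'e) parr" "('g, 'e) parr"
  | AInv "('g, 'e) parr"
  | AAssoc "'g pobj" "'g pobj" "'g pobj"
  | ALunit "'g pobj"
  | ARunit "'g pobj"
  | ASymm "'g pobj" "'g pobj"
  | AJ "'g pobj"

record ('g, 'e) presentation =
  genO :: "'g set"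
  genA :: "'e set"
  gen_dom :: "'e \<Rightarrow> 'g pobj"
  gen_cod :: "'e \<Rightarrow> 'g pobj"
  rels :: "(('g, 'e) parr \<times> ('g, 'e) parr) set"

definition pobj_wf :: "('g, 'e) presentation \<Rightarrow> 'g pobj \<Rightarrow> bool" where
  "pobj_wf P a \<longleftrightarrow> set_pobj a \<subseteq> genO P"

fun pdom :: "('g, 'e) presentation \<Rightarrow> ('g, 'e) parr \<Rightarrow> 'g pobj"
  and pcod :: "('g, 'e) presentation \<Rightarrow> ('g, 'e) parr \<Rightarrow> 'g pobj" where
  "pdom P (AGen e) = gen_dom P e"
| "pdom P (AId a) = a"
| "pdom P (AComp t s) = pdom P s"
| "pdom P (ATens s t) = PTens (pdom P s) (pdom P t)"
| "pdom P (AInv t) = pcod P t"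
| "pdom P (AAssoc a b c) = PTens (PTens a b) c"
| "pdom P (ALunit a) = PTens PUnit a"
| "pdom P (ARunit a) = PTens a PUnit"
| "pdom P (ASymm a b) = PTens a b"
| "pdom P (AJ a) = PUnit"
| "pcod P (AGen e) = gen_cod P e"
| "pcod P (AId a) = a"
| "pcod P (AComp t s) = pcod P t"
| "pcod P (ATens s t) = PTens (pcod P s) (pcod P t)"
| "pcod P (AInv t) = pdom P t"
| "pcod P (AAssoc a b c) = PTens a (PTens b c)"
| "pcod P (ALunit a) = a"
| "pcod P (ARunit a) = a"
| "pcod P (ASymm a b) = PTens b a"
| "pcod P (AJ a) = PTens (PBul a) a"


fun parr_wf :: "('g, 'e) presentation \<Rightarrow> ('g, 'e) parr \<Rightarrow> bool" where
  "parr_wf P (AGen e) \<longleftrightarrow> e \<in> genA P"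
| "parr_wf P (AId a) \<longleftrightarrow> pobj_wf P a"
| "parr_wf P (AComp t s) \<longleftrightarrow> parr_wf P t \<and> parr_wf P s \<and> pcod P s = pdom P t"
| "parr_wf P (ATens s t) \<longleftrightarrow> parr_wf P s \<and> parr_wf P t"
| "parr_wf P (AInv t) \<longleftrightarrow> parr_wf P t"
| "parr_wf P (AAssoc a b c) \<longleftrightarrow> pobj_wf P a \<and> pobj_wf P b \<and> pobj_wf P c"
| "parr_wf P (ALunit a) \<longleftrightarrow> pobj_wf P a"
| "parr_wf P (ARunit a) \<longleftrightarrow> pobj_wf P a"
| "parr_wf P (ASymm a b) \<longleftrightarrow> pobj_wf P a \<and> pobj_wf P b"
| "parr_wf P (AJ a) \<longleftrightarrow> pobj_wf P a"

definition parallel :: "('g, 'e) presentation \<Rightarrow> ('g, 'e) parr \<Rightarrow> ('g, 'e) parr \<Rightarrow> bool" where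
  "parallel P s t \<longleftrightarrow> parr_wf P s \<and> parr_wf P t \<and> pdom P s = pdom P t \<and> pcod P s = pcod P t"

text \<open>The congruence on well-formed arrow expressions generated by the relations and the axioms
  of symmetric Picard categories.\<close>

inductive pcong :: "('g, 'e) presentation \<Rightarrow> ('g, 'e) parr \<Rightarrow> ('g, 'e) parr \<Rightarrow> bool"
  for P :: "('g, 'e) presentation" where
  pc_rel: "(s, t) \<in> rels P \<Longrightarrow> parallel P s t \<Longrightarrow> pcong P s t"
| pc_refl: "parr_wf P t \<Longrightarrow> pcong P t t"
| pc_sym: "pcong P s t \<Longrightarrow> pcong P t s"
| pc_trans: "pcong P s t \<Longrightarrow> pcong P t u \<Longrightarrow> pcong P s u"
| pc_cong_comp: "pcong P s s' \<Longrightarrow> pcong P t t' \<Longrightarrow> pcod P t = pdom P s \<Longrightarrow>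
    pcong P (AComp s t) (AComp s' t')"
| pc_cong_tens: "pcong P s s' \<Longrightarrow> pcong P t t' \<Longrightarrow> pcong P (ATens s t) (ATens s' t')"
| pc_cong_inv: "pcong P s s' \<Longrightarrow> pcong P (AInv s) (AInv s')"
| pc_id_left: "parr_wf P t \<Longrightarrow> pcong P (AComp (AId (pcod P t)) t) t"
| pc_id_right: "parr_wf P t \<Longrightarrow> pcong P (AComp t (AId (pdom P t))) t"
| pc_comp_assoc: "parr_wf P (AComp (AComp u t) s) \<Longrightarrow>
    pcong P (AComp (AComp u t) s) (AComp u (AComp t s))"
| pc_inv_left: "parr_wf P t \<Longrightarrow> pcong P (AComp (AInv t) t) (AId (pdom P t))"
| pc_inv_right: "parr_wf P t \<Longrightarrow> pcong P (AComp t (AInv t)) (AId (pcod P t))"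
| pc_tens_id: "pobj_wf P a \<Longrightarrow> pobj_wf P b \<Longrightarrow> pcong P (ATens (AId a) (AId b)) (AId (PTens a b))"
| pc_tens_comp: "parr_wf P (AComp t s) \<Longrightarrow> parr_wf P (AComp t' s') \<Longrightarrow>
    pcong P (ATens (AComp t s) (AComp t' s')) (AComp (ATens t t') (ATens s s'))"
| pc_assoc_nat: "parr_wf P s \<Longrightarrow> parr_wf P t \<Longrightarrow> parr_wf P u \<Longrightarrow>
    pcong P (AComp (AAssoc (pcod P s) (pcod P t) (pcod P u)) (ATens (ATens s t) u))
      (AComp (ATens s (ATens t u)) (AAssoc (pdom P s) (pdom P t) (pdom P u)))"
| pc_lunit_nat: "parr_wf P t \<Longrightarrow>
    pcong P (AComp (ALunit (pcod P t)) (ATens (AId PUnit) t)) (AComp t (ALunit (pdom P t)))"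
| pc_runit_nat: "parr_wf P t \<Longrightarrow>
    pcong P (AComp (ARunit (pcod P t)) (ATens t (AId PUnit))) (AComp t (ARunit (pdom P t)))"
| pc_symm_nat: "parr_wf P s \<Longrightarrow> parr_wf P t \<Longrightarrow>
    pcong P (AComp (ASymm (pcod P s) (pcod P t)) (ATens s t))
      (AComp (ATens t s) (ASymm (pdom P s) (pdom P t)))"
| pc_symm_symm: "pobj_wf P a \<Longrightarrow> pobj_wf P b \<Longrightarrow>
    pcong P (AComp (ASymm b a) (ASymm a b)) (AId (PTens a b))"
| pc_pentagon: "pobj_wf P a \<Longrightarrow> pobj_wf P b \<Longrightarrow> pobj_wf P c \<Longrightarrow> pobj_wf P d \<Longrightarrow>
    pcong P (AComp (AAssoc a b (PTens c d)) (AAssoc (PTens a b) c d))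
      (AComp (ATens (AId a) (AAssoc b c d))
        (AComp (AAssoc a (PTens b c) d) (ATens (AAssoc a b c) (AId d))))"
| pc_triangle: "pobj_wf P a \<Longrightarrow> pobj_wf P b \<Longrightarrow>
    pcong P (AComp (ATens (AId a) (ALunit b)) (AAssoc a PUnit b)) (ATens (ARunit a) (AId b))"
| pc_hexagon: "pobj_wf P a \<Longrightarrow> pobj_wf P b \<Longrightarrow> pobj_wf P c \<Longrightarrow>
    pcong P (AComp (AAssoc b c a) (AComp (ASymm a (PTens b c)) (AAssoc a b c)))
      (AComp (ATens (AId b) (ASymm a c)) (AComp (AAssoc b a c) (ATens (ASymm a b) (AId c))))"

definition pclass :: "('g, 'e) presentation \<Rightarrow> ('g, 'e) parr \<Rightarrow> ('g, 'e) parr set" where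
  "pclass P t = {s. pcong P t s}"

definition prep :: "('g, 'e) parr set \<Rightarrow> ('g, 'e) parr" where
  "prep X = (SOME t. t \<in> X)"

definition presented :: "('g, 'e) presentation \<Rightarrow> ('g pobj, ('g, 'e) parr set) spc" where
  "presented P = \<lparr>Obj = {a. pobj_wf P a}, Arr = pclass P ` {t. parr_wf P t},
     Dom = (\<lambda>X. pdom P (prep X)), Cod = (\<lambda>X. pcod P (prep X)),
     Id = (\<lambda>a. pclass P (AId a)), Comp = (\<lambda>X Y. pclass P (AComp (prep X) (prep Y))),
     tensO = PTens, tensA = (\<lambda>X Y. pclass P (ATens (prep X) (prep Y))), Unit = PUnit,
     assoc = (\<lambda>a b c. pclass P (AAssoc a b c)), lunit = (\<lambda>a. pclass P (ALunit a)),
     runit = (\<lambda>a. pclass P (ARunit a)), symm = (\<lambda>a b. pclass P (ASymm a b)),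
     bul = PBul, bulj = (\<lambda>a. pclass P (AJ a))\<rparr>"

lemma pobj_wf_dom_cod:
  assumes "\<And>e. e \<in> genA P \<Longrightarrow> pobj_wf P (gen_dom P e) \<and> pobj_wf P (gen_cod P e)"
  shows "parr_wf P t \<Longrightarrow> pobj_wf P (pdom P t) \<and> pobj_wf P (pcod P t)"
    by (induction t) (use assms in \<open>auto simp: pobj_wf_def\<close>)

lemma pcong_parallel:
  assumes "\<And>e. e \<in> genA P \<Longrightarrow> pobj_wf P (gen_dom P e) \<and> pobj_wf P (gen_cod P e)"
  shows "pcong P s t \<Longrightarrow> parallel P s t"
proof -
  have w: "parr_wf P t \<Longrightarrow> pobj_wf P (pdom P t) \<and> pobj_wf P (pcod P t)" for t using pobj_wf_dom_cod[of P t] assms by blast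
  have pw: "pobj_wf P (PTens a b) = (pobj_wf P a \<and> pobj_wf P b)" "pobj_wf P (PBul a) = pobj_wf P a" "pobj_wf P PUnit" for a b
    by (auto simp: pobj_wf_def)
  assume "pcong P s t" then show "parallel P s t"
    by (induction rule: pcong.induct) (use w in \<open>auto simp: parallel_def pw\<close>)
qed

theorem presented_spc:
  assumes "\<And>e. e \<in> genA P \<Longrightarrow> pobj_wf P (gen_dom P e) \<and> pobj_wf P (gen_cod P e)"
  shows "symmetric_picard_category (presented P)"
proof -
  have w: "parr_wf P t \<Longrightarrow> pobj_wf P (pdom P t) \<and> pobj_wf P (pcod P t)" for t using pobj_wf_dom_cod[of P t] assms by blast
  have par: "pcong P s t \<Longrightarrow> parallel P s t" for s t using pcong_parallel[of P s t] assms by blast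
  have pw: "pobj_wf P (PTens a b) = (pobj_wf P a \<and> pobj_wf P b)" "pobj_wf P (PBul a) = pobj_wf P a" "pobj_wf P PUnit" for a b
    by (auto simp: pobj_wf_def)
  define cl where "cl = pclass P"
  have cl_eq: "cl s = cl t" if "pcong P s t" for s t
    using that by (auto simp: cl_def pclass_def intro: pc_sym pc_trans)
  have rep: "pcong P t (prep (cl t))" if "parr_wf P t" for t
    unfolding prep_def cl_def pclass_def using someI[of "\<lambda>s. s \<in> {s. pcong P t s}" t] that pc_refl by auto
  have prep_p: "parallel P t (prep (cl t))" if "parr_wf P t" for t using par[OF rep[OF that]] .
  have D: "Dom (presented P) (cl t) = pdom P t" "Cod (presented P) (cl t) = pcod P t" if "parr_wf P t" for t
    using prep_p[OF that] by (auto simp: presented_def parallel_def)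
  have Co: "Comp (presented P) (cl s) (cl t) = cl (AComp s t)" if "parr_wf P s" "parr_wf P t" "pcod P t = pdom P s" for s t
    using cl_eq[OF pc_cong_comp[OF rep[OF that(1)] rep[OF that(2)] that(3)]] by (simp add: presented_def cl_def)
  have Te: "tensA (presented P) (cl s) (cl t) = cl (ATens s t)" if "parr_wf P s" "parr_wf P t" for s t
    using cl_eq[OF pc_cong_tens[OF rep[OF that(1)] rep[OF that(2)]]] by (simp add: presented_def cl_def)
  have homE: "\<exists>t. f = cl t \<and> parr_wf P t \<and> pdom P t = a \<and> pcod P t = b" if "f \<in> hom (presented P) a b" for f a b
  proof -
    from that obtain t where "f = cl t" "parr_wf P t" by (auto simp: hom_def presented_def cl_def)
    with that D show ?thesis by (auto simp: hom_def)
  qed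
  have homI: "cl t \<in> hom (presented P) a b" if "parr_wf P t" "pdom P t = a" "pcod P t = b" for t a b
    using that D[OF that(1)] by (auto simp: hom_def presented_def cl_def)
  have S: "Obj (presented P) = {a. pobj_wf P a}" "Id (presented P) a = cl (AId a)" "tensO (presented P) = PTens"
    "Unit (presented P) = PUnit" "assoc (presented P) a b c = cl (AAssoc a b c)" "lunit (presented P) a = cl (ALunit a)"
    "runit (presented P) a = cl (ARunit a)" "symm (presented P) a b = cl (ASymm a b)" "bul (presented P) = PBul"
    "bulj (presented P) a = cl (AJ a)" for a b c
    by (auto simp: presented_def cl_def)
  have iso: "is_iso (presented P) (cl t)" if "parr_wf P t" for t
    unfolding is_iso_def inverse_of_def
    apply (rule exI[of _ "cl (AInv t)"])
    using that homI[OF that refl refl] D[OF that] homI[of "AInv t", OF _ refl refl] D[of "AInv t"] by (auto simp: hom_def Co S intro!: cl_eq pc_inv_left pc_inv_right)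
  have AO: "f \<in> Arr (presented P) \<Longrightarrow> \<exists>t. f = cl t \<and> parr_wf P t" for f by (auto simp: presented_def cl_def)
  show ?thesis
    apply unfold_locales
    subgoal using AO D w by (fastforce simp: S)
    subgoal using AO D w by (fastforce simp: S)
    subgoal by (auto simp: S intro!: homI)
    subgoal by (auto dest!: homE simp: Co intro!: homI)
    subgoal by (auto dest!: homE simp: S Co w cl_eq[OF pc_id_left])
    subgoal by (auto dest!: homE simp: S Co w cl_eq[OF pc_id_right])
    subgoal by (auto dest!: homE simp: S Co w cl_eq[OF pc_comp_assoc])
    subgoal by (auto simp: S pw)
    subgoal by (auto simp: S pw)
    subgoal by (auto dest!: homE simp: Te S intro!: homI)
    subgoal by (auto simp: Te S cl_eq[OF pc_tens_id])
    subgoal by (auto dest!: homE simp: Te Co S cl_eq[OF pc_tens_comp])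
    subgoal by (auto simp: S intro!: homI)
    subgoal by (auto simp: S intro!: iso)
    subgoal by (auto dest!: homE simp: Te Co S w cl_eq[OF pc_assoc_nat])
    subgoal by (auto simp: S intro!: homI)
    subgoal by (auto simp: S intro!: iso)
    subgoal by (auto dest!: homE simp: Te Co S w pw cl_eq[OF pc_lunit_nat])
    subgoal by (auto simp: S intro!: homI)
    subgoal by (auto simp: S intro!: iso)
    subgoal by (auto dest!: homE simp: Te Co S w pw cl_eq[OF pc_runit_nat])
    subgoal by (auto simp: S intro!: homI)
    subgoal by (auto dest!: homE simp: Te Co S w pw cl_eq[OF pc_symm_nat])
    subgoal by (auto simp: Te Co S w pw cl_eq[OF pc_symm_symm])
    subgoal by (auto simp: Te Co S w pw cl_eq[OF pc_pentagon])
    subgoal by (auto simp: Te Co S w pw cl_eq[OF pc_triangle])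
    subgoal by (auto simp: Te Co S w pw cl_eq[OF pc_hexagon])
    subgoal by (auto dest!: AO intro!: iso)
    subgoal by (auto simp: S pw)
    subgoal by (auto simp: S intro!: homI)
    done
qed


section \<open>The free symmetric Picard category on one generator\<close>

definition freeP :: "(unit, unit) presentation" where
  "freeP = \<lparr>genO = UNIV, genA = {}, gen_dom = (\<lambda>_. PUnit), gen_cod = (\<lambda>_. PUnit), rels = {}\<rparr>"

type_synonym I_obj = "unit pobj"
type_synonym I_arr = "(unit, unit) parr set"

definition freeI :: "(I_obj, I_arr) spc"  ("\<I>") where
  "\<I> = presented freeP"

lemma freeI_spc: "symmetric_picard_category \<I>"
  unfolding freeI_def by (rule presented_spc) (simp add: freeP_def)

definition star :: "I_obj"  ("\<star>") where
  "\<star> = PGen ()"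


section \<open>The tensor product\<close>

text \<open>\<open>B \<otimes> C\<close> is presented by objects \<open>(b,c)\<close> together with exactly the arrows and relations that
  make \<open>b \<mapsto> (c \<mapsto> (b,c))\<close> an arrow \<open>\<eta> : B \<rightarrow> [C, B \<otimes> C]\<close> of \<open>SPC\<close>; hence it represents, with
  respect to strict arrows, the arrows \<open>B \<rightarrow> [C,D]\<close>.
  \<open>GL f c : (b,c) \<rightarrow> (b',c)\<close> and \<open>GR b g : (b,c) \<rightarrow> (b,c')\<close> are the actions on arrows,
  \<open>GM1 b b' c : (b,c) \<otimes> (b',c) \<rightarrow> (b \<otimes> b', c)\<close> and \<open>GU1 c : I \<rightarrow> (I,c)\<close> the monoidal structure
  of \<open>\<eta>\<close>, \<open>GM2 b c c' : (b,c) \<otimes> (b,c') \<rightarrow> (b, c \<otimes> c')\<close> and \<open>GU2 b : I \<rightarrow> (b,I)\<close> that of the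
  arrows \<open>\<eta>(b)\<close>.\<close>

datatype ('o, 'a, 'p, 'b) tgen =
    GL 'a 'p
  | GR 'o 'b
  | GM1 'o 'o 'p
  | GU1 'p
  | GM2 'o 'p 'p
  | GU2 'o

type_synonym ('o, 'a, 'p, 'b) tparr = "('o \<times> 'p, ('o, 'a, 'p, 'b) tgen) parr"
type_synonym ('o, 'p) t_obj = "('o \<times> 'p) pobj"
type_synonym ('o, 'a, 'p, 'b) t_arr = "('o, 'a, 'p, 'b) tparr set"

fun tgen_dom :: "('o, 'a) spc \<Rightarrow> ('p, 'b) spc \<Rightarrow> ('o, 'a, 'p, 'b) tgen \<Rightarrow> ('o, 'p) t_obj" where
  "tgen_dom B C (GL f c) = PGen (Dom B f, c)"
| "tgen_dom B C (GR b g) = PGen (b, Dom C g)"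
| "tgen_dom B C (GM1 b b' c) = PTens (PGen (b, c)) (PGen (b', c))"
| "tgen_dom B C (GU1 c) = PUnit"
| "tgen_dom B C (GM2 b c c') = PTens (PGen (b, c)) (PGen (b, c'))"
| "tgen_dom B C (GU2 b) = PUnit"

fun tgen_cod :: "('o, 'a) spc \<Rightarrow> ('p, 'b) spc \<Rightarrow> ('o, 'a, 'p, 'b) tgen \<Rightarrow> ('o, 'p) t_obj" where
  "tgen_cod B C (GL f c) = PGen (Cod B f, c)"
| "tgen_cod B C (GR b g) = PGen (b, Cod C g)"
| "tgen_cod B C (GM1 b b' c) = PGen (b \<otimes>\<^bsub>B\<^esub> b', c)"
| "tgen_cod B C (GU1 c) = PGen (\<one>\<^bsub>B\<^esub>, c)"
| "tgen_cod B C (GM2 b c c') = PGen (b, c \<otimes>\<^bsub>C\<^esub> c')"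
| "tgen_cod B C (GU2 b) = PGen (b, \<one>\<^bsub>C\<^esub>)"

fun tgen_wf :: "('o, 'a) spc \<Rightarrow> ('p, 'b) spc \<Rightarrow> ('o, 'a, 'p, 'b) tgen \<Rightarrow> bool" where
  "tgen_wf B C (GL f c) \<longleftrightarrow> f \<in> Arr B \<and> c \<in> Obj C"
| "tgen_wf B C (GR b g) \<longleftrightarrow> b \<in> Obj B \<and> g \<in> Arr C"
| "tgen_wf B C (GM1 b b' c) \<longleftrightarrow> b \<in> Obj B \<and> b' \<in> Obj B \<and> c \<in> Obj C"
| "tgen_wf B C (GU1 c) \<longleftrightarrow> c \<in> Obj C"
| "tgen_wf B C (GM2 b c c') \<longleftrightarrow> b \<in> Obj B \<and> c \<in> Obj C \<and> c' \<in> Obj C"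
| "tgen_wf B C (GU2 b) \<longleftrightarrow> b \<in> Obj B"

text \<open>The interchange \<open>(a \<otimes> b) \<otimes> (c \<otimes> d) \<rightarrow> (a \<otimes> c) \<otimes> (b \<otimes> d)\<close> as an expression.\<close>

definition AInterchange :: "'g pobj \<Rightarrow> 'g pobj \<Rightarrow> 'g pobj \<Rightarrow> 'g pobj \<Rightarrow> ('g, 'e) parr" where
  "AInterchange a b c d =
     AComp (AInv (AAssoc a c (PTens b d)))
      (AComp (ATens (AId a) (AAssoc c b d))
        (AComp (ATens (AId a) (ATens (ASymm b c) (AId d)))
          (AComp (ATens (AId a) (AInv (AAssoc b c d)))
            (AAssoc a b (PTens c d)))))"

abbreviation AL :: "'a \<Rightarrow> 'p \<Rightarrow> ('o, 'a, 'p, 'b) tparr" where "AL f c \<equiv> AGen (GL f c)"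
abbreviation AR :: "'o \<Rightarrow> 'b \<Rightarrow> ('o, 'a, 'p, 'b) tparr" where "AR b g \<equiv> AGen (GR b g)"
abbreviation AM1 :: "'o \<Rightarrow> 'o \<Rightarrow> 'p \<Rightarrow> ('o, 'a, 'p, 'b) tparr" where
  "AM1 b b' c \<equiv> AGen (GM1 b b' c)"
abbreviation AU1 :: "'p \<Rightarrow> ('o, 'a, 'p, 'b) tparr" where "AU1 c \<equiv> AGen (GU1 c)"
abbreviation AM2 :: "'o \<Rightarrow> 'p \<Rightarrow> 'p \<Rightarrow> ('o, 'a, 'p, 'b) tparr" where
  "AM2 b c c' \<equiv> AGen (GM2 b c c')"
abbreviation AU2 :: "'o \<Rightarrow> ('o, 'a, 'p, 'b) tparr" where "AU2 b \<equiv> AGen (GU2 b)"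
abbreviation AIdG :: "'o \<Rightarrow> 'p \<Rightarrow> ('o, 'a, 'p, 'b) tparr" where
  "AIdG b c \<equiv> AId (PGen (b, c))"

inductive trel :: "('o, 'a) spc \<Rightarrow> ('p, 'b) spc \<Rightarrow>
    ('o, 'a, 'p, 'b) tparr \<Rightarrow> ('o, 'a, 'p, 'b) tparr \<Rightarrow> bool"
  for B :: "('o, 'a) spc" and C :: "('p, 'b) spc" where
\<comment> \<open>each \<open>\<eta>(b)\<close> is a functor\<close>
  tr_R_Id: "b \<in> Obj B \<Longrightarrow> c \<in> Obj C \<Longrightarrow> trel B C (AR b (Id C c)) (AIdG b c)"
| tr_R_Comp: "b \<in> Obj B \<Longrightarrow> g \<in> hom C c c' \<Longrightarrow> g' \<in> hom C c' c'' \<Longrightarrow>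
    trel B C (AR b (g' \<cdot>\<^bsub>C\<^esub> g)) (AComp (AR b g') (AR b g))"
\<comment> \<open>each \<open>\<eta>(b)\<close> is symmetric monoidal\<close>
| tr_M2_nat: "b \<in> Obj B \<Longrightarrow> g \<in> hom C c d \<Longrightarrow> g' \<in> hom C c' d' \<Longrightarrow>
    trel B C (AComp (AR b (g \<boxtimes>\<^bsub>C\<^esub> g')) (AM2 b c c'))
      (AComp (AM2 b d d') (ATens (AR b g) (AR b g')))"
| tr_M2_assoc: "b \<in> Obj B \<Longrightarrow> c \<in> Obj C \<Longrightarrow> c' \<in> Obj C \<Longrightarrow> c'' \<in> Obj C \<Longrightarrow>
    trel B C
      (AComp (AR b (assoc C c c' c''))
        (AComp (AM2 b (c \<otimes>\<^bsub>C\<^esub> c') c'') (ATens (AM2 b c c') (AIdG b c''))))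
      (AComp (AM2 b c (c' \<otimes>\<^bsub>C\<^esub> c''))
        (AComp (ATens (AIdG b c) (AM2 b c' c''))
          (AAssoc (PGen (b, c)) (PGen (b, c')) (PGen (b, c'')))))"
| tr_M2_lunit: "b \<in> Obj B \<Longrightarrow> c \<in> Obj C \<Longrightarrow>
    trel B C
      (AComp (AR b (lunit C c)) (AComp (AM2 b \<one>\<^bsub>C\<^esub> c) (ATens (AU2 b) (AIdG b c))))
      (ALunit (PGen (b, c)))"
| tr_M2_runit: "b \<in> Obj B \<Longrightarrow> c \<in> Obj C \<Longrightarrow>
    trel B C
      (AComp (AR b (runit C c)) (AComp (AM2 b c \<one>\<^bsub>C\<^esub>) (ATens (AIdG b c) (AU2 b))))
      (ARunit (PGen (b, c)))"
| tr_M2_symm: "b \<in> Obj B \<Longrightarrow> c \<in> Obj C \<Longrightarrow> c' \<in> Obj C \<Longrightarrow>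
    trel B C (AComp (AR b (symm C c c')) (AM2 b c c'))
      (AComp (AM2 b c' c) (ASymm (PGen (b, c)) (PGen (b, c'))))"
\<comment> \<open>each \<open>\<eta>(f)\<close> is a monoidal natural transformation\<close>
| tr_L_nat: "f \<in> hom B b b' \<Longrightarrow> g \<in> hom C c c' \<Longrightarrow>
    trel B C (AComp (AL f c') (AR b g)) (AComp (AR b' g) (AL f c))"
| tr_L_M2: "f \<in> hom B b b' \<Longrightarrow> c \<in> Obj C \<Longrightarrow> c' \<in> Obj C \<Longrightarrow>
    trel B C (AComp (AL f (c \<otimes>\<^bsub>C\<^esub> c')) (AM2 b c c'))
      (AComp (AM2 b' c c') (ATens (AL f c) (AL f c')))"
| tr_L_U2: "f \<in> hom B b b' \<Longrightarrow> trel B C (AComp (AL f \<one>\<^bsub>C\<^esub>) (AU2 b)) (AU2 b')"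
\<comment> \<open>\<open>\<eta>\<close> is a functor\<close>
| tr_L_Id: "b \<in> Obj B \<Longrightarrow> c \<in> Obj C \<Longrightarrow> trel B C (AL (Id B b) c) (AIdG b c)"
| tr_L_Comp: "f \<in> hom B b b' \<Longrightarrow> f' \<in> hom B b' b'' \<Longrightarrow> c \<in> Obj C \<Longrightarrow>
    trel B C (AL (f' \<cdot>\<^bsub>B\<^esub> f) c) (AComp (AL f' c) (AL f c))"
\<comment> \<open>\<open>\<eta>(b) \<otimes> \<eta>(b') \<rightarrow> \<eta>(b \<otimes> b')\<close> is a monoidal natural transformation\<close>
| tr_M1_R: "b \<in> Obj B \<Longrightarrow> b' \<in> Obj B \<Longrightarrow> g \<in> hom C c c' \<Longrightarrow>
    trel B C (AComp (AM1 b b' c') (ATens (AR b g) (AR b' g)))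
      (AComp (AR (b \<otimes>\<^bsub>B\<^esub> b') g) (AM1 b b' c))"
| tr_M1_M2: "b \<in> Obj B \<Longrightarrow> b' \<in> Obj B \<Longrightarrow> c \<in> Obj C \<Longrightarrow> c' \<in> Obj C \<Longrightarrow>
    trel B C
      (AComp (AM1 b b' (c \<otimes>\<^bsub>C\<^esub> c'))
        (AComp (ATens (AM2 b c c') (AM2 b' c c'))
          (AInterchange (PGen (b, c)) (PGen (b', c)) (PGen (b, c')) (PGen (b', c')))))
      (AComp (AM2 (b \<otimes>\<^bsub>B\<^esub> b') c c') (ATens (AM1 b b' c) (AM1 b b' c')))"
| tr_M1_U2: "b \<in> Obj B \<Longrightarrow> b' \<in> Obj B \<Longrightarrow>
    trel B C
      (AComp (AM1 b b' \<one>\<^bsub>C\<^esub>) (AComp (ATens (AU2 b) (AU2 b')) (AInv (ALunit PUnit))))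
      (AU2 (b \<otimes>\<^bsub>B\<^esub> b'))"
\<comment> \<open>\<open>I \<rightarrow> \<eta>(I)\<close> is a monoidal natural transformation\<close>
| tr_U1_R: "g \<in> hom C c c' \<Longrightarrow> trel B C (AU1 c') (AComp (AR \<one>\<^bsub>B\<^esub> g) (AU1 c))"
| tr_U1_M2: "c \<in> Obj C \<Longrightarrow> c' \<in> Obj C \<Longrightarrow>
    trel B C (AComp (AU1 (c \<otimes>\<^bsub>C\<^esub> c')) (ALunit PUnit))
      (AComp (AM2 \<one>\<^bsub>B\<^esub> c c') (ATens (AU1 c) (AU1 c')))"
| tr_U1_U2: "trel B C (AU1 \<one>\<^bsub>C\<^esub>) (AU2 \<one>\<^bsub>B\<^esub>)"
\<comment> \<open>\<open>\<eta>\<close> is symmetric monoidal\<close>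
| tr_M1_nat: "f \<in> hom B b d \<Longrightarrow> f' \<in> hom B b' d' \<Longrightarrow> c \<in> Obj C \<Longrightarrow>
    trel B C (AComp (AL (f \<boxtimes>\<^bsub>B\<^esub> f') c) (AM1 b b' c))
      (AComp (AM1 d d' c) (ATens (AL f c) (AL f' c)))"
| tr_M1_assoc: "b \<in> Obj B \<Longrightarrow> b' \<in> Obj B \<Longrightarrow> b'' \<in> Obj B \<Longrightarrow> c \<in> Obj C \<Longrightarrow>
    trel B C
      (AComp (AL (assoc B b b' b'') c)
        (AComp (AM1 (b \<otimes>\<^bsub>B\<^esub> b') b'' c) (ATens (AM1 b b' c) (AIdG b'' c))))
      (AComp (AM1 b (b' \<otimes>\<^bsub>B\<^esub> b'') c)
        (AComp (ATens (AIdG b c) (AM1 b' b'' c))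
          (AAssoc (PGen (b, c)) (PGen (b', c)) (PGen (b'', c)))))"
| tr_M1_lunit: "b \<in> Obj B \<Longrightarrow> c \<in> Obj C \<Longrightarrow>
    trel B C
      (AComp (AL (lunit B b) c) (AComp (AM1 \<one>\<^bsub>B\<^esub> b c) (ATens (AU1 c) (AIdG b c))))
      (ALunit (PGen (b, c)))"
| tr_M1_runit: "b \<in> Obj B \<Longrightarrow> c \<in> Obj C \<Longrightarrow>
    trel B C
      (AComp (AL (runit B b) c) (AComp (AM1 b \<one>\<^bsub>B\<^esub> c) (ATens (AIdG b c) (AU1 c))))
      (ARunit (PGen (b, c)))"
| tr_M1_symm: "b \<in> Obj B \<Longrightarrow> b' \<in> Obj B \<Longrightarrow> c \<in> Obj C \<Longrightarrow>
    trel B C (AComp (AL (symm B b b') c) (AM1 b b' c))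
      (AComp (AM1 b' b c) (ASymm (PGen (b, c)) (PGen (b', c))))"

definition tensP :: "('o, 'a) spc \<Rightarrow> ('p, 'b) spc \<Rightarrow>
    ('o \<times> 'p, ('o, 'a, 'p, 'b) tgen) presentation" where
  "tensP B C = \<lparr>genO = Obj B \<times> Obj C, genA = {e. tgen_wf B C e},
     gen_dom = tgen_dom B C, gen_cod = tgen_cod B C, rels = {(s, t). trel B C s t}\<rparr>"

definition tens0 :: "('o, 'a) spc \<Rightarrow> ('p, 'b) spc \<Rightarrow>
    (('o, 'p) t_obj, ('o, 'a, 'p, 'b) t_arr) spc"  (infixr "\<otimes>\<^sub>0" 70) where
  "B \<otimes>\<^sub>0 C = presented (tensP B C)"

text \<open>The relations relate parallel well-formed expressions.\<close>

lemma trel_parallel: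
  assumes "symmetric_picard_category B" "symmetric_picard_category C" "trel B C s t"
  shows "parallel (tensP B C) s t"
proof -
  interpret B: symmetric_picard_category B by fact
  interpret C: symmetric_picard_category C by fact
  show ?thesis using assms(3)
    by cases (auto simp: hom_def parallel_def tensP_def pobj_wf_def AInterchange_def
        B.arr_typing B.tensO_closed B.Unit_closed B.Dom_closed B.Cod_closed
        C.arr_typing C.tensO_closed C.Unit_closed C.Dom_closed C.Cod_closed)
qed

lemma tens0_spc:
  assumes "symmetric_picard_category B" "symmetric_picard_category C"
  shows "symmetric_picard_category (B \<otimes>\<^sub>0 C)"
proof -
  interpret B: symmetric_picard_category B by fact
  interpret C: symmetric_picard_category C by fact
  have "pobj_wf (tensP B C) (gen_dom (tensP B C) e) \<and> pobj_wf (tensP B C) (gen_cod (tensP B C) e)"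
    if "e \<in> genA (tensP B C)" for e
    using that
    by (cases e) (auto simp: tensP_def pobj_wf_def B.tensO_closed B.Unit_closed B.Dom_closed
      B.Cod_closed C.tensO_closed C.Unit_closed C.Dom_closed C.Cod_closed)
  then show ?thesis
    unfolding tens0_def by (rule presented_spc)
qed

definition eta :: "('o, 'a) spc \<Rightarrow> ('p, 'b) spc \<Rightarrow>
    ('o, 'a, ('p, 'b, ('o, 'p) t_obj, ('o, 'a, 'p, 'b) t_arr) smf,
             ('p, 'b, ('o, 'p) t_obj, ('o, 'a, 'p, 'b) t_arr) mnt) smf" where
  "eta B C = (let cl = pclass (tensP B C);
       E = (\<lambda>b. \<lparr>Src = C, Tgt = B \<otimes>\<^sub>0 C,
         fobj = (\<lambda>c \<in> Obj C. PGen (b, c)),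
         farr = (\<lambda>g \<in> Arr C. cl (AR b g)),
         ften = restrict2 (Obj C) (\<lambda>c c'. cl (AM2 b c c')),
         funit = cl (AU2 b)\<rparr>)
     in \<lparr>Src = B, Tgt = ihom C (B \<otimes>\<^sub>0 C),
       fobj = (\<lambda>b \<in> Obj B. E b),
       farr = (\<lambda>f \<in> Arr B. \<lparr>nsrc = E (Dom B f), ntgt = E (Cod B f),
         ncomp = (\<lambda>c \<in> Obj C. cl (AL f c))\<rparr>),
       ften = restrict2 (Obj B) (\<lambda>b b'. \<lparr>nsrc = tensF (E b) (E b'), ntgt = E (b \<otimes>\<^bsub>B\<^esub> b'),
         ncomp = (\<lambda>c \<in> Obj C. cl (AM1 b b' c))\<rparr>),
       funit = \<lparr>nsrc = unitF C (B \<otimes>\<^sub>0 C), ntgt = E \<one>\<^bsub>B\<^esub>,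
         ncomp = (\<lambda>c \<in> Obj C. cl (AU1 c))\<rparr>\<rparr>)"

text \<open>\<open>Rn B C\<close> on arrows \<open>B \<otimes> C \<rightarrow> D\<close>, \<open>Rn2 B C\<close> on 2-cells, and \<open>En B C D\<close> on arrows
  \<open>B \<rightarrow> [C,D]\<close>.\<close>

definition Rn :: "('o, 'a) spc \<Rightarrow> ('p, 'b) spc \<Rightarrow>
    (('o, 'p) t_obj, ('o, 'a, 'p, 'b) t_arr, 'q, 'c) smf \<Rightarrow>
    ('o, 'a, ('p, 'b, 'q, 'c) smf, ('p, 'b, 'q, 'c) mnt) smf" where
  "Rn B C F = hom_post C F \<circ>\<^sub>F eta B C"

definition Rn2 :: "('o, 'a) spc \<Rightarrow> ('p, 'b) spc \<Rightarrow>
    (('o, 'p) t_obj, ('o, 'a, 'p, 'b) t_arr, 'q, 'c) mnt \<Rightarrow>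
    ('o, 'a, ('p, 'b, 'q, 'c) smf, ('p, 'b, 'q, 'c) mnt) mnt" where
  "Rn2 B C \<sigma> = hom_post2 C \<sigma> *\<^sub>R eta B C"

definition En :: "('o, 'a) spc \<Rightarrow> ('p, 'b) spc \<Rightarrow> ('q, 'c) spc \<Rightarrow>
    ('o, 'a, ('p, 'b, 'q, 'c) smf, ('p, 'b, 'q, 'c) mnt) smf \<Rightarrow>
    (('o, 'p) t_obj, ('o, 'a, 'p, 'b) t_arr, 'q, 'c) smf" where
  "En B C D G = (THE F. F \<in> strict_arrows (B \<otimes>\<^sub>0 C) D \<and> Rn B C F = G)"

definition tens1 ::
    "('o, 'a, 'o', 'a') smf \<Rightarrow> ('p, 'b, 'p', 'b') smf \<Rightarrow>
     (('o, 'p) t_obj, ('o, 'a, 'p, 'b) t_arr, ('o', 'p') t_obj, ('o', 'a', 'p', 'b') t_arr) smf"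
    (infixr "\<otimes>\<^sub>1" 70) where
  "F \<otimes>\<^sub>1 G = (let X = Tgt F \<otimes>\<^sub>0 Tgt G in
     En (Src F) (Src G) X (hom_pre G X \<circ>\<^sub>F eta (Tgt F) (Tgt G) \<circ>\<^sub>F F))"

text \<open>\<open>Rn\<close> sends \<open>\<sigma> \<otimes> \<tau>\<close> to the horizontal composite of \<open>\<sigma>\<close>, \<open>\<eta>\<close> and \<open>[\<tau>,1]\<close>.\<close>

definition tens2 ::
    "('o, 'a, 'o', 'a') mnt \<Rightarrow> ('p, 'b, 'p', 'b') mnt \<Rightarrow>
     (('o, 'p) t_obj, ('o, 'a, 'p, 'b) t_arr, ('o', 'p') t_obj, ('o', 'a', 'p', 'b') t_arr) mnt"
    (infixr "\<otimes>\<^sub>2" 70) where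
  "\<sigma> \<otimes>\<^sub>2 \<tau> = (let \<eta> = eta (mnt_cod \<sigma>) (mnt_cod \<tau>); X = mnt_cod \<sigma> \<otimes>\<^sub>0 mnt_cod \<tau> in
     (THE \<omega>. \<omega> \<in> cells (nsrc \<sigma> \<otimes>\<^sub>1 nsrc \<tau>) (ntgt \<sigma> \<otimes>\<^sub>1 ntgt \<tau>) \<and>
        Rn2 (mnt_dom \<sigma>) (mnt_dom \<tau>) \<omega>
          = hom_pre2 \<tau> X *\<^sub>R (\<eta> \<circ>\<^sub>F ntgt \<sigma>) \<cdot>\<^sub>V hom_pre (nsrc \<tau>) X *\<^sub>L \<eta> *\<^sub>L \<sigma>))"

text \<open>The canonical arrows \<open>L'\<close>, \<open>R'\<close>, \<open>A'\<close> and the 2-cell \<open>\<theta>\<close>.\<close>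

definition Lc :: "('p, 'b) spc \<Rightarrow>
    ('p, 'b, (I_obj, 'p) t_obj, (I_obj, I_arr, 'p, 'b) t_arr) smf" where
  "Lc B = ev \<I> (\<I> \<otimes>\<^sub>0 B) \<star> \<circ>\<^sub>F dual B (\<I> \<otimes>\<^sub>0 B) (eta \<I> B)"

definition Rc :: "('o, 'a) spc \<Rightarrow>
    ('o, 'a, ('o, I_obj) t_obj, ('o, 'a, I_obj, I_arr) t_arr) smf" where
  "Rc B = ev \<I> (B \<otimes>\<^sub>0 \<I>) \<star> \<circ>\<^sub>F eta B \<I>"

definition Ac where
  "Ac B C D = (let X = B \<otimes>\<^sub>0 (C \<otimes>\<^sub>0 D) in
     (THE F. F \<in> strict_arrows ((B \<otimes>\<^sub>0 C) \<otimes>\<^sub>0 D) X \<and> strict_smf (Rn (B \<otimes>\<^sub>0 C) D F) \<and>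
        Rn B C (Rn (B \<otimes>\<^sub>0 C) D F)
          = hom_pre (eta C D) (ihom D X) \<circ>\<^sub>F hom_functor D (C \<otimes>\<^sub>0 D) X \<circ>\<^sub>F eta B (C \<otimes>\<^sub>0 D)))"

definition theta where
  "theta A M = (THE \<omega>. \<omega> \<in> cells (Ac \<I> A M \<circ>\<^sub>F (Lc A \<otimes>\<^sub>1 idF M)) (Lc (A \<otimes>\<^sub>0 M)) \<and>
     Rn2 A M \<omega> = id2 (Rn A M (Lc (A \<otimes>\<^sub>0 M))))"


section \<open>2-rings\<close>

type_synonym ('o, 'a, 'p, 'b) bilin_map =
  "('o, 'a, ('p, 'b, 'p, 'b) smf, ('p, 'b, 'p, 'b) mnt) smf"
type_synonym ('o, 'a, 'p, 'b) bilin_cell =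
  "('o, 'a, ('p, 'b, 'p, 'b) smf, ('p, 'b, 'p, 'b) mnt) mnt"
type_synonym ('o, 'a, 'p, 'b) trilin_cell =
  "('o, 'a, ('o, 'a, 'p, 'b) bilin_map, ('o, 'a, 'p, 'b) bilin_cell) mnt"

text \<open>For bilinear maps \<open>\<mu> : A \<rightarrow> [A,A]\<close> and \<open>\<phi> : A \<rightarrow> [M,M]\<close>, the trilinear maps
  \<open>(a,b,m) \<mapsto> a.(b.m)\<close> and \<open>(a,b,m) \<mapsto> (a.b).m\<close>, as arrows \<open>A \<rightarrow> [A,[M,M]]\<close>.\<close>

definition act_act where
  "act_act M \<phi> = hom_pre \<phi> (ihom M M) \<circ>\<^sub>F hom_functor M M M \<circ>\<^sub>F \<phi>"

definition mul_act where
  "mul_act A \<mu> \<phi> = hom_post A \<phi> \<circ>\<^sub>F \<mu>"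

text \<open>The object \<open>a.x\<close>, and the arrows \<open>a.g\<close> and \<open>f.x\<close>, for a bilinear map \<open>\<phi>\<close>.\<close>

abbreviation actO where "actO \<phi> a x \<equiv> fobj (fobj \<phi> a) x"
abbreviation actR where "actR \<phi> a g \<equiv> farr (fobj \<phi> a) g"
abbreviation actL where "actL \<phi> f x \<equiv> farr \<phi> f \<diamondop> x"

record ('o, 'a) ring2 =
  rcat :: "('o, 'a) spc"
  rmul :: "('o, 'a, 'o, 'a) bilin_map"
  rone :: "'o"
  ralpha :: "('o, 'a, 'o, 'a) trilin_cell"
  rrho :: "('o, 'a, 'o, 'a) mnt"
  rlam :: "('o, 'a, 'o, 'a) mnt"

locale two_ring =
  fixes R :: "('o, 'a) ring2"
  assumes rcat_spc: "symmetric_picard_category (rcat R)"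
    and rmul_arrow: "rmul R \<in> arrows (rcat R) (ihom (rcat R) (rcat R))"
    and rone_closed: "rone R \<in> Obj (rcat R)"
    and ralpha_cell: "ralpha R \<in>
      cells (act_act (rcat R) (rmul R)) (mul_act (rcat R) (rmul R) (rmul R))"
    and rrho_cell: "rrho R \<in> cells (idF (rcat R)) (ev (rcat R) (rcat R) (rone R) \<circ>\<^sub>F rmul R)"
    and rlam_cell: "rlam R \<in> cells (idF (rcat R)) (fobj (rmul R) (rone R))"
    and ring_pentagon: "\<lbrakk>k \<in> Obj (rcat R); h \<in> Obj (rcat R); g \<in> Obj (rcat R); f \<in> Obj (rcat R)\<rbrakk> \<Longrightarrow>
      (ralpha R \<diamondop> actO (rmul R) k h \<diamondop> g \<diamondop> f) \<cdot>\<^bsub>rcat R\<^esub> (ralpha R \<diamondop> k \<diamondop> h \<diamondop> actO (rmul R) g f)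
      = actL (rmul R) (ralpha R \<diamondop> k \<diamondop> h \<diamondop> g) f \<cdot>\<^bsub>rcat R\<^esub> (ralpha R \<diamondop> k \<diamondop> actO (rmul R) h g \<diamondop> f)
          \<cdot>\<^bsub>rcat R\<^esub> actR (rmul R) k (ralpha R \<diamondop> h \<diamondop> g \<diamondop> f)"
    and ring_triangle: "\<lbrakk>g \<in> Obj (rcat R); f \<in> Obj (rcat R)\<rbrakk> \<Longrightarrow>
      (ralpha R \<diamondop> g \<diamondop> rone R \<diamondop> f) \<cdot>\<^bsub>rcat R\<^esub> actR (rmul R) g (rlam R \<diamondop> f)
      = actL (rmul R) (rrho R \<diamondop> g) f"

text \<open>The presentation of a 2-ring by strict arrows \<open>c : A \<otimes> A \<rightarrow> A\<close> and \<open>u : I \<rightarrow> A\<close> and a 2-cell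
  \<open>\<alpha> : c \<circ> (1 \<otimes> c) \<circ> A' \<Rightarrow> c \<circ> (c \<otimes> 1)\<close>; the 2-cells \<open>\<rho>\<close> and \<open>\<lambda>\<close> are \<open>rrho R\<close> and \<open>rlam R\<close>,
  since \<open>c \<circ> (1 \<otimes> u) \<circ> R' = (-).1\<close> and \<open>c \<circ> (u \<otimes> 1) \<circ> L' = 1.(-)\<close>.\<close>

definition ring_c where
  "ring_c R = En (rcat R) (rcat R) (rcat R) (rmul R)"

definition ring_u where
  "ring_u R = (THE F. F \<in> strict_arrows \<I> (rcat R) \<and> fobj F \<star> = rone R)"

definition ring_alpha where
  "ring_alpha R = (let A = rcat R; c = ring_c R in
     (THE \<omega>. \<omega> \<in> cells (c \<circ>\<^sub>F (idF A \<otimes>\<^sub>1 c) \<circ>\<^sub>F Ac A A A) (c \<circ>\<^sub>F (c \<otimes>\<^sub>1 idF A)) \<and>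
        Rn2 A A (Rn2 (A \<otimes>\<^sub>0 A) A \<omega>) = ralpha R))"


section \<open>Modules over a 2-ring\<close>

record ('o, 'a, 'p, 'b) amod =
  mcat :: "('p, 'b) spc"
  mact :: "('o, 'a, 'p, 'b) bilin_map"
  mbeta :: "('o, 'a, 'p, 'b) trilin_cell"
  mgamma :: "('p, 'b, 'p, 'b) mnt"

locale A_module =
  fixes R :: "('o, 'a) ring2" and X :: "('o, 'a, 'p, 'b) amod"
  assumes mcat_spc: "symmetric_picard_category (mcat X)"
    and mcat_normal: "spc_normal (mcat X)"
    and mact_arrow: "mact X \<in> arrows (rcat R) (ihom (mcat X) (mcat X))"
    and mbeta_cell: "mbeta X \<in>
      cells (act_act (mcat X) (mact X)) (mul_act (rcat R) (rmul R) (mact X))"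
    and mgamma_cell: "mgamma X \<in> cells (idF (mcat X)) (fobj (mact X) (rone R))"
    and module_pentagon: "\<lbrakk>a \<in> Obj (rcat R); b \<in> Obj (rcat R); c \<in> Obj (rcat R); m \<in> Obj (mcat X)\<rbrakk> \<Longrightarrow>
      (mbeta X \<diamondop> actO (rmul R) a b \<diamondop> c \<diamondop> m) \<cdot>\<^bsub>mcat X\<^esub> (mbeta X \<diamondop> a \<diamondop> b \<diamondop> actO (mact X) c m)
      = actL (mact X) (ralpha R \<diamondop> a \<diamondop> b \<diamondop> c) m \<cdot>\<^bsub>mcat X\<^esub> (mbeta X \<diamondop> a \<diamondop> actO (rmul R) b c \<diamondop> m)
          \<cdot>\<^bsub>mcat X\<^esub> actR (mact X) a (mbeta X \<diamondop> b \<diamondop> c \<diamondop> m)"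
    and module_triangle_rho: "\<lbrakk>a \<in> Obj (rcat R); m \<in> Obj (mcat X)\<rbrakk> \<Longrightarrow>
      (mbeta X \<diamondop> a \<diamondop> rone R \<diamondop> m) \<cdot>\<^bsub>mcat X\<^esub> actR (mact X) a (mgamma X \<diamondop> m)
      = actL (mact X) (rrho R \<diamondop> a) m"
    and module_triangle_lam: "\<lbrakk>a \<in> Obj (rcat R); m \<in> Obj (mcat X)\<rbrakk> \<Longrightarrow>
      (mbeta X \<diamondop> rone R \<diamondop> a \<diamondop> m) \<cdot>\<^bsub>mcat X\<^esub> (mgamma X \<diamondop> actO (mact X) a m)
      = actL (mact X) (rlam R \<diamondop> a) m"

record ('o, 'a, 'p, 'b) amod_mor =
  msrc :: "('o, 'a, 'p, 'b) amod"
  mtgt :: "('o, 'a, 'p, 'b) amod"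
  marr :: "('p, 'b, 'p, 'b) smf"
  mdelta :: "('o, 'a, 'p, 'b) bilin_cell"

locale A_module_morphism =
  X: A_module R "msrc f" + Y: A_module R "mtgt f"
  for R :: "('o, 'a) ring2" and f :: "('o, 'a, 'p, 'b) amod_mor" +
  assumes marr_arrow: "marr f \<in> arrows (mcat (msrc f)) (mcat (mtgt f))"
    and mdelta_cell: "mdelta f \<in>
      cells (hom_pre (marr f) (mcat (mtgt f)) \<circ>\<^sub>F mact (mtgt f))
            (hom_post (mcat (msrc f)) (marr f) \<circ>\<^sub>F mact (msrc f))"
    and mdelta_gamma: "m \<in> Obj (mcat (msrc f)) \<Longrightarrow>
      farr (marr f) (mgamma (msrc f) \<diamondop> m)
      = (mdelta f \<diamondop> rone R \<diamondop> m) \<cdot>\<^bsub>mcat (mtgt f)\<^esub> (mgamma (mtgt f) \<diamondop> fobj (marr f) m)"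
    and mdelta_beta: "\<lbrakk>a \<in> Obj (rcat R); b \<in> Obj (rcat R); m \<in> Obj (mcat (msrc f))\<rbrakk> \<Longrightarrow>
      (mdelta f \<diamondop> actO (rmul R) a b \<diamondop> m) \<cdot>\<^bsub>mcat (mtgt f)\<^esub> (mbeta (mtgt f) \<diamondop> a \<diamondop> b \<diamondop> fobj (marr f) m)
      = farr (marr f) (mbeta (msrc f) \<diamondop> a \<diamondop> b \<diamondop> m)
          \<cdot>\<^bsub>mcat (mtgt f)\<^esub> (mdelta f \<diamondop> a \<diamondop> actO (mact (msrc f)) b m)
          \<cdot>\<^bsub>mcat (mtgt f)\<^esub> actR (mact (mtgt f)) a (mdelta f \<diamondop> b \<diamondop> m)"

text \<open>The type variables \<open>'p\<close> and \<open>'b\<close> play the role of a universe: the underlying symmetric Picard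
  categories have objects in \<open>'p\<close> and arrows in \<open>'b\<close>.\<close>

definition A_Mod :: "('o, 'a) ring2 \<Rightarrow> (('o, 'a, 'p, 'b) amod, ('o, 'a, 'p, 'b) amod_mor) cat" where
  "A_Mod R = \<lparr>Obj = {X. A_module R X}, Arr = {f. A_module_morphism R f},
     Dom = msrc, Cod = mtgt,
     Id = (\<lambda>X. \<lparr>msrc = X, mtgt = X, marr = idF (mcat X), mdelta = id2 (mact X)\<rparr>),
     Comp = (\<lambda>g f. \<lparr>msrc = msrc f, mtgt = mtgt g, marr = marr g \<circ>\<^sub>F marr f,
       mdelta = hom_post (mcat (msrc f)) (marr g) *\<^sub>L mdelta f
         \<cdot>\<^sub>V hom_pre (marr f) (mcat (mtgt g)) *\<^sub>L mdelta g\<rparr>)\<rparr>"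


section \<open>Algebras for the doctrine \<open>A \<otimes> -\<close>\<close>

record ('o, 'a, 'p, 'b) talg =
  tcat :: "('p, 'b) spc"
  tact :: "(('o, 'p) t_obj, ('o, 'a, 'p, 'b) t_arr, 'p, 'b) smf"
  tbeta :: "((('o, 'o) t_obj, 'p) t_obj,
    (('o, 'o) t_obj, ('o, 'a, 'o, 'a) t_arr, 'p, 'b) t_arr, 'p, 'b) mnt"
  tgamma :: "('p, 'b, 'p, 'b) mnt"

definition T_algebra :: "('o, 'a) ring2 \<Rightarrow> ('o, 'a, 'p, 'b) talg \<Rightarrow> bool" where
  "T_algebra R X \<longleftrightarrow>
    (let A = rcat R; c = ring_c R; u = ring_u R; \<alpha> = ring_alpha R; r = rrho R; l = rlam R;
         M = tcat X; \<phi> = tact X; \<beta> = tbeta X; \<gamma> = tgamma X in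
     symmetric_picard_category M \<and> spc_normal M \<and>
     \<phi> \<in> strict_arrows (A \<otimes>\<^sub>0 M) M \<and>
     \<beta> \<in> cells (\<phi> \<circ>\<^sub>F (idF A \<otimes>\<^sub>1 \<phi>) \<circ>\<^sub>F Ac A A M) (\<phi> \<circ>\<^sub>F (c \<otimes>\<^sub>1 idF M)) \<and>
     \<gamma> \<in> cells (idF M) (\<phi> \<circ>\<^sub>F (u \<otimes>\<^sub>1 idF M) \<circ>\<^sub>F Lc M) \<and>
     (\<beta> *\<^sub>R ((c \<otimes>\<^sub>1 idF A) \<otimes>\<^sub>1 idF M))
       \<cdot>\<^sub>V (\<beta> *\<^sub>R ((idF (A \<otimes>\<^sub>0 A) \<otimes>\<^sub>1 \<phi>) \<circ>\<^sub>F Ac (A \<otimes>\<^sub>0 A) A M))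
     = (\<phi> *\<^sub>L (\<alpha> \<otimes>\<^sub>2 id2 (idF M)))
       \<cdot>\<^sub>V (\<beta> *\<^sub>R (((idF A \<otimes>\<^sub>1 c) \<otimes>\<^sub>1 idF M) \<circ>\<^sub>F (Ac A A A \<otimes>\<^sub>1 idF M)))
       \<cdot>\<^sub>V ((\<phi> *\<^sub>L (id2 (idF A) \<otimes>\<^sub>2 \<beta>)) *\<^sub>R (Ac A (A \<otimes>\<^sub>0 A) M \<circ>\<^sub>F (Ac A A A \<otimes>\<^sub>1 idF M))) \<and>
     \<phi> *\<^sub>L (r \<otimes>\<^sub>2 id2 (idF M))
     = (\<beta> *\<^sub>R (((idF A \<otimes>\<^sub>1 u) \<otimes>\<^sub>1 idF M) \<circ>\<^sub>F (Rc A \<otimes>\<^sub>1 idF M)))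
       \<cdot>\<^sub>V (\<phi> *\<^sub>L (id2 (idF A) \<otimes>\<^sub>2 \<gamma>)) \<and>
     \<phi> *\<^sub>L (l \<otimes>\<^sub>2 id2 (idF M))
     = (\<beta> *\<^sub>R (((u \<otimes>\<^sub>1 idF A) \<otimes>\<^sub>1 idF M) \<circ>\<^sub>F (Lc A \<otimes>\<^sub>1 idF M)))
       \<cdot>\<^sub>V inv2 ((\<phi> \<circ>\<^sub>F (idF A \<otimes>\<^sub>1 \<phi>) \<circ>\<^sub>F (u \<otimes>\<^sub>1 idF (A \<otimes>\<^sub>0 M))) *\<^sub>L theta A M)
       \<cdot>\<^sub>V (\<gamma> *\<^sub>R \<phi>))"

record ('o, 'a, 'p, 'b) talg_mor =
  tsrc :: "('o, 'a, 'p, 'b) talg"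
  ttgt :: "('o, 'a, 'p, 'b) talg"
  tarr :: "('p, 'b, 'p, 'b) smf"
  tdelta :: "(('o, 'p) t_obj, ('o, 'a, 'p, 'b) t_arr, 'p, 'b) mnt"

definition T_algebra_morphism :: "('o, 'a) ring2 \<Rightarrow> ('o, 'a, 'p, 'b) talg_mor \<Rightarrow> bool" where
  "T_algebra_morphism R f \<longleftrightarrow>
    (let A = rcat R; c = ring_c R; u = ring_u R;
         X = tsrc f; M = tcat X; \<phi> = tact X;
         Y = ttgt f; N = tcat Y; \<psi> = tact Y;
         H = tarr f; \<delta> = tdelta f in
     T_algebra R X \<and> T_algebra R Y \<and>
     H \<in> arrows M N \<and>
     \<delta> \<in> cells (\<psi> \<circ>\<^sub>F (idF A \<otimes>\<^sub>1 H)) (H \<circ>\<^sub>F \<phi>) \<and>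
     (\<delta> *\<^sub>R (c \<otimes>\<^sub>1 idF M)) \<cdot>\<^sub>V (tbeta Y *\<^sub>R (idF (A \<otimes>\<^sub>0 A) \<otimes>\<^sub>1 H))
     = (H *\<^sub>L tbeta X) \<cdot>\<^sub>V (\<delta> *\<^sub>R ((idF A \<otimes>\<^sub>1 \<phi>) \<circ>\<^sub>F Ac A A M))
       \<cdot>\<^sub>V ((\<psi> *\<^sub>L (id2 (idF A) \<otimes>\<^sub>2 \<delta>)) *\<^sub>R Ac A A M) \<and>
     H *\<^sub>L tgamma X = (\<delta> *\<^sub>R ((u \<otimes>\<^sub>1 idF M) \<circ>\<^sub>F Lc M)) \<cdot>\<^sub>V (tgamma Y *\<^sub>R H))"

definition T_Alg :: "('o, 'a) ring2 \<Rightarrow> (('o, 'a, 'p, 'b) talg, ('o, 'a, 'p, 'b) talg_mor) cat" where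
  "T_Alg R = \<lparr>Obj = {X. T_algebra R X}, Arr = {f. T_algebra_morphism R f},
     Dom = tsrc, Cod = ttgt,
     Id = (\<lambda>X. \<lparr>tsrc = X, ttgt = X, tarr = idF (tcat X), tdelta = id2 (tact X)\<rparr>),
     Comp = (\<lambda>g f. \<lparr>tsrc = tsrc f, ttgt = ttgt g, tarr = tarr g \<circ>\<^sub>F tarr f,
       tdelta = (tarr g *\<^sub>L tdelta f) \<cdot>\<^sub>V (tdelta g *\<^sub>R (idF (rcat R) \<otimes>\<^sub>1 tarr f))\<rparr>)\<rparr>"

end

theory Submission
  imports Defs
begin

text \<open>A 2-cell out of \<open>B \<otimes> C\<close> is determined by its components at the generators \<open>(b,c)\<close>, and \<open>Rn\<close> turns a strict
  arrow \<open>\<phi> : A \<otimes> M \<rightarrow> M\<close> into an action \<open>\<phi>' : A \<rightarrow> [M,M]\<close>, and \<open>\<beta>\<close>, \<open>\<delta>\<close> into multilinear transformations with the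
  same components.  The pentagon and the unit triangle for \<open>A'\<close>, together with the naturality of \<open>A'\<close> and \<open>L'\<close>, make
  the boundaries of the 2-cells in (T1)-(T3), (M1) and (M2) match, and \<open>\<theta>\<close> has identity components at generators.
  Hence each of these equations, read at the generators of the iterated tensor product, is the corresponding axiom
  for modules, and transposition is a bijection on objects and on morphisms.\<close>

section \<open>Calculus in a symmetric Picard category\<close>

text \<open>Transposition is injective on strict arrows, so an equation between arrows out of an
  iterated tensor product is reduced to multilinear maps only when the successive transposes are
  known to be strict as well. Hence strictness is tracked for \<open>[F,1]\<close>, for
  \<open>[1,F]\<close> with \<open>F\<close> strict, for evaluation and for \<open>[D,-]\<close>
  itself. As strict arrows must preserve the chosen inverses and the arrows \<open>j\<close>, the
  inverse structure of the hom categories has to be controlled too. All its coherence rests on one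
  fact: tensoring with an object is fully faithful, so an arrow \<open>g\<close> is determined by
  \<open>(g \<boxtimes> f) \<cdot> h\<close>. For 2-cells the situation is milder. Comparison arrows
  are invertible, so the components at generators determine a 2-cell between arbitrary arrows; and a
  2-cell with strict domain exists once naturality holds at the generating arrows. The category laws
  are verified for modules, where composition is computed in components, and are carried along the
  bijection to algebras, where they would be pasting identities over tensor products.\<close>

abbreviation "SPC \<equiv> symmetric_picard_category"
abbreviation "SMF \<equiv> symmetric_monoidal_functor"

context category
begin

lemma homI: "f \<in> Arr C ==> Dom C f = a ==> Cod C f = b ==> f \<in> hom C a b"
  by (simp add: hom_def)

lemma hom_iff: "f \<in> hom C a b \<longleftrightarrow> f \<in> Arr C \<and> Dom C f = a \<and> Cod C f = b"
  by (simp add: hom_def)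

lemma comp_arr [simp]:
  assumes "f \<in> Arr C" "g \<in> Arr C" "Cod C f = Dom C g"
  shows "g \<cdot> f \<in> Arr C" "Dom C (g \<cdot> f) = Dom C f" "Cod C (g \<cdot> f) = Cod C g"
  using Comp_hom[of f "Dom C f" "Cod C f" g "Cod C g"] assms by (auto simp: hom_def)

lemma id_arr [simp]:
  "a \<in> Obj C ==> Id C a \<in> Arr C" "a \<in> Obj C ==> Dom C (Id C a) = a" "a \<in> Obj C ==> Cod C (Id C a) = a"
  using Id_hom[of a] by (auto simp: hom_def)

lemma comp_assoc [simp]:
  "[|f \<in> Arr C; g \<in> Arr C; h \<in> Arr C; Cod C f = Dom C g; Cod C g = Dom C h|] ==>
    (h \<cdot> g) \<cdot> f = h \<cdot> (g \<cdot> f)"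
  using Comp_assoc[of f "Dom C f" "Cod C f" g "Cod C g" h "Cod C h"] by (auto simp: hom_def)

lemma comp_id [simp]:
  "f \<in> Arr C ==> Cod C f = b ==> Id C b \<cdot> f = f"
  "f \<in> Arr C ==> Dom C f = a ==> f \<cdot> Id C a = f"
  using Comp_Id_left[of f "Dom C f" b] Comp_Id_right[of f a "Cod C f"] by (auto simp: hom_def)

text \<open>The simp rule \<open>comp_assoc\<close> nests composites to the right, so an equation
  \<open>g \<cdot> f = k\<close> does not match once another arrow precedes \<open>f\<close>. This
  is the same equation with a tail; it is applied throughout to naturality and coherence
  laws.\<close>

lemma comp_reduce:
  "g \<cdot> f = k ==> f \<in> Arr C ==> g \<in> Arr C ==> Cod C f = Dom C g ==> h \<in> Arr C ==> Cod C h = Dom C f ==>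
    g \<cdot> (f \<cdot> h) = k \<cdot> h"
  using comp_assoc[of h f g] by simp

lemma comp_reduce3:
  "g' \<cdot> (g \<cdot> f) = k ==> f \<in> Arr C ==> g \<in> Arr C ==> g' \<in> Arr C ==> Cod C f = Dom C g ==> Cod C g = Dom C g' ==>
    h \<in> Arr C ==> Cod C h = Dom C f ==> g' \<cdot> (g \<cdot> (f \<cdot> h)) = k \<cdot> h"
  using comp_assoc[of h f g] comp_assoc[of h "g \<cdot> f" g'] by simp

lemma inverse_of_unique:
  assumes "inverse_of C f g" "inverse_of C f h" shows "g = h"
proof -
  have "g = (h \<cdot> f) \<cdot> g" using assms by (auto simp: inverse_of_def hom_def simp del: comp_assoc)
  also have "\<dots> = h \<cdot> (f \<cdot> g)" using assms by (intro comp_assoc) (auto simp: inverse_of_def hom_def)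
  also have "\<dots> = h" using assms by (auto simp: inverse_of_def hom_def)
  finally show ?thesis .
qed

lemma inv_arr_eq: "inverse_of C f g ==> inv_arr C f = g"
  unfolding inv_arr_def by (rule the_equality) (auto intro: inverse_of_unique)

end

section \<open>Cancellation in the groupoid and coherence of the unit\<close>

context symmetric_picard_category
begin

lemmas spc = symmetric_picard_category_axioms

declare Dom_closed [simp] Cod_closed [simp] tensO_closed [simp] Unit_closed [simp] bul_closed [simp]

lemma inverse_of_inv: "f \<in> Arr C ==> inverse_of C f (inv_arr C f)"
  using groupoid[of f] inv_arr_eq unfolding is_iso_def by auto

lemma inv_arr_arr [simp]:
  "f \<in> Arr C ==> inv_arr C f \<in> Arr C" "f \<in> Arr C ==> Dom C (inv_arr C f) = Cod C f"
  "f \<in> Arr C ==> Cod C (inv_arr C f) = Dom C f"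
  using inverse_of_inv[of f] by (auto simp: inverse_of_def hom_def)

lemma inv_comp [simp]:
  "f \<in> Arr C ==> inv_arr C f \<cdot> f = Id C (Dom C f)" "f \<in> Arr C ==> f \<cdot> inv_arr C f = Id C (Cod C f)"
  using inverse_of_inv[of f] by (auto simp: inverse_of_def)

lemma inv_comp' [simp]:
  "f \<in> Arr C ==> h \<in> Arr C ==> Cod C h = Dom C f ==> inv_arr C f \<cdot> (f \<cdot> h) = h"
  "f \<in> Arr C ==> h \<in> Arr C ==> Cod C h = Cod C f ==> f \<cdot> (inv_arr C f \<cdot> h) = h"
  using comp_reduce[OF inv_comp(1)[of f], of h] comp_reduce[OF inv_comp(2)[of f], of h] by auto

text \<open>In a groupoid a left inverse is already the inverse: compose it with
  \<open>f \<cdot> inv_arr C f\<close>.\<close>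

lemma inv_arrI: "f \<in> Arr C ==> g \<in> Arr C ==> Cod C f = Dom C g ==> Cod C g = Dom C f ==>
    g \<cdot> f = Id C (Dom C f) ==> inv_arr C f = g"
proof -
  assume a: "f \<in> Arr C" "g \<in> Arr C" "Cod C f = Dom C g" "Cod C g = Dom C f" "g \<cdot> f = Id C (Dom C f)"
  then have "g = (g \<cdot> f) \<cdot> inv_arr C f" by (subst comp_assoc) simp_all
  also have "\<dots> = inv_arr C f" using a by simp
  finally show ?thesis by simp
qed

lemma cancel_left:
  assumes "g \<cdot> f = g \<cdot> h" "f \<in> Arr C" "h \<in> Arr C" "g \<in> Arr C" "Cod C f = Dom C g" "Cod C h = Dom C g"
  shows "f = h"
  by (metis inv_comp'(1) assms)

lemma cancel_right:
  assumes "f \<cdot> g = h \<cdot> g" "f \<in> Arr C" "h \<in> Arr C" "g \<in> Arr C" "Dom C f = Cod C g" "Dom C h = Cod C g"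
  shows "f = h"
proof -
  have "f = (f \<cdot> g) \<cdot> inv_arr C g" using assms(2-) by (subst comp_assoc) simp_all
  also have "\<dots> = h" unfolding assms(1) using assms(2-) by (subst comp_assoc) simp_all
  finally show ?thesis .
qed

lemma move_left: "f \<in> Arr C ==> g \<in> Arr C ==> Cod C f = Dom C g ==> g \<cdot> f = k ==> f = inv_arr C g \<cdot> k"
  by auto

lemma inv_Id [simp]: "a \<in> Obj C ==> inv_arr C (Id C a) = Id C a"
  by (rule inv_arrI) auto

lemma tens_arr [simp]:
  "f \<in> Arr C ==> g \<in> Arr C ==> f \<boxtimes> g \<in> Arr C"
  "f \<in> Arr C ==> g \<in> Arr C ==> Dom C (f \<boxtimes> g) = Dom C f \<otimes> Dom C g"
  "f \<in> Arr C ==> g \<in> Arr C ==> Cod C (f \<boxtimes> g) = Cod C f \<otimes> Cod C g"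
  using arr_typing(3)[of f g] by auto

declare arr_typing(4-7) [simp] tens_Id [simp]

lemma bulj_arr [simp]:
  "a \<in> Obj C ==> bulj C a \<in> Arr C" "a \<in> Obj C ==> Dom C (bulj C a) = \<one>"
  "a \<in> Obj C ==> Cod C (bulj C a) = bul C a \<otimes> a"
  using bulj_hom[of a] by (auto simp: hom_def)

lemma tens_comp:
  "[|f \<in> Arr C; f' \<in> Arr C; g \<in> Arr C; g' \<in> Arr C; Cod C f = Dom C f'; Cod C g = Dom C g'|] ==>
    (f' \<cdot> f) \<boxtimes> (g' \<cdot> g) = (f' \<boxtimes> g') \<cdot> (f \<boxtimes> g)"
  using tens_Comp[of f _ _ f' _ g _ _ g' ] by (auto simp: hom_def)

lemma tens_merge:
  "[|f \<in> Arr C; f' \<in> Arr C; g \<in> Arr C; g' \<in> Arr C; Cod C f = Dom C f'; Cod C g = Dom C g'|] ==>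
    (f' \<boxtimes> g') \<cdot> (f \<boxtimes> g) = (f' \<cdot> f) \<boxtimes> (g' \<cdot> g)"
  by (simp add: tens_comp)

lemmas tens_merge' = comp_reduce[OF tens_merge]
lemmas tm = tens_merge tens_merge'

lemma tensL:
  "[|f \<in> Arr C; f' \<in> Arr C; a \<in> Obj C; Cod C f = Dom C f'|] ==> Id C a \<boxtimes> (f' \<cdot> f) = (Id C a \<boxtimes> f') \<cdot> (Id C a \<boxtimes> f)"
  using tens_comp[of "Id C a" "Id C a" f f'] by simp

lemma tensR:
  "[|f \<in> Arr C; f' \<in> Arr C; a \<in> Obj C; Cod C f = Dom C f'|] ==> (f' \<cdot> f) \<boxtimes> Id C a = (f' \<boxtimes> Id C a) \<cdot> (f \<boxtimes> Id C a)"
  using tens_comp[of f f' "Id C a" "Id C a"] by simp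

lemma tens_split:
  "f \<in> Arr C ==> g \<in> Arr C ==> f \<boxtimes> g = (f \<boxtimes> Id C (Cod C g)) \<cdot> (Id C (Dom C f) \<boxtimes> g)"
  "f \<in> Arr C ==> g \<in> Arr C ==> f \<boxtimes> g = (Id C (Cod C f) \<boxtimes> g) \<cdot> (f \<boxtimes> Id C (Dom C g))"
  by (simp_all add: tens_merge)

lemma inv_tens [simp]: "f \<in> Arr C ==> g \<in> Arr C ==> inv_arr C (f \<boxtimes> g) = inv_arr C f \<boxtimes> inv_arr C g"
  by (rule inv_arrI) (auto simp: tens_merge)

lemma assoc_natural:
  "[|f \<in> Arr C; g \<in> Arr C; h \<in> Arr C; Cod C f = a; Cod C g = b; Cod C h = c|] ==>
    assoc C a b c \<cdot> ((f \<boxtimes> g) \<boxtimes> h) = (f \<boxtimes> (g \<boxtimes> h)) \<cdot> assoc C (Dom C f) (Dom C g) (Dom C h)"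
  using assoc_nat[of f "Dom C f" a g "Dom C g" b h "Dom C h" c] by (auto simp: hom_def)

lemma symm_natural:
  "[|f \<in> Arr C; g \<in> Arr C; Cod C f = a; Cod C g = b|] ==>
    symm C a b \<cdot> (f \<boxtimes> g) = (g \<boxtimes> f) \<cdot> symm C (Dom C f) (Dom C g)"
  using symm_nat[of f "Dom C f" a g "Dom C g" b] by (auto simp: hom_def)

lemma lunit_natural:
  "[|f \<in> Arr C; Cod C f = b|] ==> lunit C b \<cdot> (Id C \<one> \<boxtimes> f) = f \<cdot> lunit C (Dom C f)"
  using lunit_nat[of f "Dom C f" b] by (auto simp: hom_def)

lemma runit_natural:
  "[|f \<in> Arr C; Cod C f = b|] ==> runit C b \<cdot> (f \<boxtimes> Id C \<one>) = f \<cdot> runit C (Dom C f)"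
  using runit_nat[of f "Dom C f" b] by (auto simp: hom_def)

text \<open>Naturality of the unitors, which are invertible, recovers an arrow from its tensor
  product with the identity of \<open>\<one>\<close>.\<close>

lemma tens_one_faithful:
  "f \<in> Arr C ==> g \<in> Arr C ==> Dom C f = Dom C g ==> Cod C f = Cod C g ==> Id C \<one> \<boxtimes> f = Id C \<one> \<boxtimes> g ==> f = g"
  "f \<in> Arr C ==> g \<in> Arr C ==> Dom C f = Dom C g ==> Cod C f = Cod C g ==> f \<boxtimes> Id C \<one> = g \<boxtimes> Id C \<one> ==> f = g"
proof -
  assume a: "f \<in> Arr C" "g \<in> Arr C" "Dom C f = Dom C g" "Cod C f = Cod C g"
  { assume "Id C \<one> \<boxtimes> f = Id C \<one> \<boxtimes> g"
    then have "f \<cdot> lunit C (Dom C f) = g \<cdot> lunit C (Dom C f)"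
      using lunit_natural[of f "Cod C f"] lunit_natural[of g "Cod C f"] a by simp
    then show "f = g" by (rule cancel_right) (use a in simp_all) }
  { assume "f \<boxtimes> Id C \<one> = g \<boxtimes> Id C \<one>"
    then have "f \<cdot> runit C (Dom C f) = g \<cdot> runit C (Dom C f)"
      using runit_natural[of f "Cod C f"] runit_natural[of g "Cod C f"] a by simp
    then show "f = g" by (rule cancel_right) (use a in simp_all) }
qed

lemmas pentagon' = comp_reduce[OF pentagon]
lemmas triangle' = comp_reduce[OF triangle]
lemmas assoc_natural' = comp_reduce[OF assoc_natural]
lemmas symm_natural' = comp_reduce[OF symm_natural]
lemmas lunit_natural' = comp_reduce[OF lunit_natural]
lemmas runit_natural' = comp_reduce[OF runit_natural]

lemma tens_merge_id:
  "[|f \<in> Arr C; g \<in> Arr C; a \<in> Obj C; Cod C f = Dom C g|] ==> (Id C a \<boxtimes> g) \<cdot> (Id C a \<boxtimes> f) = Id C a \<boxtimes> (g \<cdot> f)"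
  "[|f \<in> Arr C; g \<in> Arr C; a \<in> Obj C; Cod C f = Dom C g|] ==> (g \<boxtimes> Id C a) \<cdot> (f \<boxtimes> Id C a) = (g \<cdot> f) \<boxtimes> Id C a"
  by (simp_all add: tensL tensR)

lemma assoc_natural_id:
  "[|a \<in> Obj C; b \<in> Obj C; h \<in> Arr C; Cod C h = c|] ==>
    assoc C a b c \<cdot> (Id C (a \<otimes> b) \<boxtimes> h) = (Id C a \<boxtimes> (Id C b \<boxtimes> h)) \<cdot> assoc C a b (Dom C h)"
  "[|f \<in> Arr C; b \<in> Obj C; c \<in> Obj C; Cod C f = a|] ==>
    assoc C a b c \<cdot> ((f \<boxtimes> Id C b) \<boxtimes> Id C c) = (f \<boxtimes> Id C (b \<otimes> c)) \<cdot> assoc C (Dom C f) b c"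
  using assoc_natural[of "Id C a" "Id C b" h a b c] assoc_natural[of f "Id C b" "Id C c" a b c] by simp_all

text \<open>Kelly's argument. The equation is not among the axioms; it is proved after tensoring
  with \<open>\<one>\<close> on the left, where the pentagon and the triangle apply, and
  \<open>tens_one_faithful\<close> removes the extra factor.\<close>

lemma lunit_tens:
  assumes [simp]: "a \<in> Obj C" "b \<in> Obj C"
  shows "lunit C (a \<otimes> b) \<cdot> assoc C \<one> a b = lunit C a \<boxtimes> Id C b"
proof (rule tens_one_faithful(1))
  let ?n = "assoc C \<one> (\<one> \<otimes> a) b \<cdot> (assoc C \<one> \<one> a \<boxtimes> Id C b)"
  have "(Id C \<one> \<boxtimes> (lunit C (a \<otimes> b) \<cdot> assoc C \<one> a b)) \<cdot> ?n
      = (Id C \<one> \<boxtimes> lunit C (a \<otimes> b)) \<cdot> (assoc C \<one> \<one> (a \<otimes> b) \<cdot> assoc C (\<one> \<otimes> \<one>) a b)"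
    by (simp add: tensL pentagon)
  also have "\<dots> = (runit C \<one> \<boxtimes> Id C (a \<otimes> b)) \<cdot> assoc C (\<one> \<otimes> \<one>) a b"
    by (simp add: triangle')
  also have "\<dots> = assoc C \<one> a b \<cdot> ((runit C \<one> \<boxtimes> Id C a) \<boxtimes> Id C b)"
    by (simp add: assoc_natural_id)
  also have "\<dots> = assoc C \<one> a b \<cdot> ((Id C \<one> \<boxtimes> lunit C a) \<boxtimes> Id C b) \<cdot> (assoc C \<one> \<one> a \<boxtimes> Id C b)"
    by (simp add: triangle[symmetric] tensR)
  also have "\<dots> = (Id C \<one> \<boxtimes> (lunit C a \<boxtimes> Id C b)) \<cdot> ?n"
    by (simp add: assoc_natural')
  finally show "Id C \<one> \<boxtimes> (lunit C (a \<otimes> b) \<cdot> assoc C \<one> a b) = Id C \<one> \<boxtimes> (lunit C a \<boxtimes> Id C b)"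
    by (rule cancel_right) simp_all
qed simp_all

text \<open>Naturality of the left unitor at the arrow \<open>lunit C a\<close>, followed by
  cancellation of that arrow.\<close>

lemma lunit_unit_tens: "a \<in> Obj C ==> lunit C (\<one> \<otimes> a) = Id C \<one> \<boxtimes> lunit C a"
proof -
  assume [simp]: "a \<in> Obj C"
  have "lunit C a \<cdot> lunit C (\<one> \<otimes> a) = lunit C a \<cdot> (Id C \<one> \<boxtimes> lunit C a)" by (simp add: lunit_natural)
  then show ?thesis by (rule cancel_left) simp_all
qed

text \<open>Both unitors, tensored with the identity of \<open>\<one>\<close>, solve the same
  equation: one by \<open>lunit_tens\<close>, the other by the triangle.\<close>

lemma lunit_eq_runit: "lunit C \<one> = runit C \<one>"
proof (rule tens_one_faithful(2))
  show "lunit C \<one> \<boxtimes> Id C \<one> = runit C \<one> \<boxtimes> Id C \<one>"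
    using lunit_tens[of \<one> \<one>] triangle[of \<one> \<one>] by (simp add: lunit_unit_tens)
qed simp_all

lemma symm_symm' [simp]:
  "a \<in> Obj C ==> b \<in> Obj C ==> symm C b a \<cdot> symm C a b = Id C (a \<otimes> b)"
  "a \<in> Obj C ==> b \<in> Obj C ==> f \<in> Arr C ==> Cod C f = a \<otimes> b ==> symm C b a \<cdot> symm C a b \<cdot> f = f"
  using comp_reduce[OF symm_symm[of a b], of f] by (auto simp: symm_symm)

text \<open>The hexagon at \<open>a\<close>, \<open>\<one>\<close>, \<open>\<one>\<close>, with
  \<open>lunit_tens\<close> and the triangle absorbing the associators. Again the argument takes
  place after tensoring with \<open>\<one>\<close>.\<close>

lemma lunit_symm:
  assumes [simp]: "a \<in> Obj C"
  shows "lunit C a \<cdot> symm C a \<one> = runit C a" "runit C a \<cdot> symm C \<one> a = lunit C a"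
proof -
  have "(lunit C a \<cdot> symm C a \<one>) \<boxtimes> Id C \<one> = runit C a \<boxtimes> Id C \<one>"
  proof (rule cancel_left)
    have "symm C a \<one> \<cdot> ((lunit C a \<cdot> symm C a \<one>) \<boxtimes> Id C \<one>)
       = symm C a \<one> \<cdot> lunit C (a \<otimes> \<one>) \<cdot> assoc C \<one> a \<one> \<cdot> (symm C a \<one> \<boxtimes> Id C \<one>)"
      by (simp add: tensR lunit_tens[symmetric])
    also have "\<dots> = lunit C (\<one> \<otimes> a) \<cdot> (Id C \<one> \<boxtimes> symm C a \<one>) \<cdot> assoc C \<one> a \<one> \<cdot> (symm C a \<one> \<boxtimes> Id C \<one>)"
      by (simp add: lunit_natural')
    also have "\<dots> = lunit C (\<one> \<otimes> a) \<cdot> assoc C \<one> \<one> a \<cdot> symm C a (\<one> \<otimes> \<one>) \<cdot> assoc C a \<one> \<one>"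
      by (simp add: hexagon)
    also have "\<dots> = (lunit C \<one> \<boxtimes> Id C a) \<cdot> symm C a (\<one> \<otimes> \<one>) \<cdot> assoc C a \<one> \<one>"
      by (simp add: comp_reduce[OF lunit_tens])
    also have "\<dots> = symm C a \<one> \<cdot> (Id C a \<boxtimes> lunit C \<one>) \<cdot> assoc C a \<one> \<one>"
      by (simp add: symm_natural')
    also have "\<dots> = symm C a \<one> \<cdot> (runit C a \<boxtimes> Id C \<one>)"
      by (simp add: triangle)
    finally show "symm C a \<one> \<cdot> ((lunit C a \<cdot> symm C a \<one>) \<boxtimes> Id C \<one>) = symm C a \<one> \<cdot> (runit C a \<boxtimes> Id C \<one>)" .
  qed simp_all
  then show *: "lunit C a \<cdot> symm C a \<one> = runit C a" by (rule tens_one_faithful(2)[rotated -1]) simp_all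
  show "runit C a \<cdot> symm C \<one> a = lunit C a" by (simp add: *[symmetric])
qed

subsection \<open>The middle-four interchange\<close>

text \<open>All coherence diagrams for the interchange are reduced to the exchange
  \<open>b \<otimes> (c \<otimes> x) \<rightarrow> c \<otimes> (b \<otimes> x)\<close> of the first two factors of a right-nested product.\<close>

definition xch :: "'o \<Rightarrow> 'o \<Rightarrow> 'o \<Rightarrow> 'a" where
  "xch b c x = assoc C c b x \<cdot> (symm C b c \<boxtimes> Id C x) \<cdot> inv_arr C (assoc C b c x)"

lemma xch_arr [simp]:
  assumes "b \<in> Obj C" "c \<in> Obj C" "x \<in> Obj C"
  shows "xch b c x \<in> Arr C" "Dom C (xch b c x) = b \<otimes> (c \<otimes> x)" "Cod C (xch b c x) = c \<otimes> (b \<otimes> x)"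
  using assms by (simp_all add: xch_def)

lemma xch_assoc: "b \<in> Obj C ==> c \<in> Obj C ==> x \<in> Obj C ==>
    xch b c x \<cdot> assoc C b c x = assoc C c b x \<cdot> (symm C b c \<boxtimes> Id C x)"
  by (simp add: xch_def)

lemmas xch_assoc' = comp_reduce[OF xch_assoc]

lemma xch_xch: "b \<in> Obj C ==> c \<in> Obj C ==> x \<in> Obj C ==> xch c b x \<cdot> xch b c x = Id C (b \<otimes> (c \<otimes> x))"
  by (simp add: xch_def tm)

lemmas xch_xch' = comp_reduce[OF xch_xch]

lemma xch_natural:
  assumes [simp]: "f \<in> Arr C" "g \<in> Arr C" "h \<in> Arr C" and "Cod C f = b" "Cod C g = c" "Cod C h = x"
  shows "xch b c x \<cdot> (f \<boxtimes> (g \<boxtimes> h)) = (g \<boxtimes> (f \<boxtimes> h)) \<cdot> xch (Dom C f) (Dom C g) (Dom C h)"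
proof (rule cancel_right[of _ "assoc C (Dom C f) (Dom C g) (Dom C h)"])
  have [simp]: "b = Cod C f" "c = Cod C g" "x = Cod C h" using assms by auto
  show "(xch b c x \<cdot> (f \<boxtimes> (g \<boxtimes> h))) \<cdot> assoc C (Dom C f) (Dom C g) (Dom C h) =
    ((g \<boxtimes> (f \<boxtimes> h)) \<cdot> xch (Dom C f) (Dom C g) (Dom C h)) \<cdot> assoc C (Dom C f) (Dom C g) (Dom C h)"
    by (simp add: assoc_natural[symmetric] xch_assoc' xch_assoc comp_reduce[OF assoc_natural[symmetric]] tm)
       (simp add: symm_natural)
qed (use assms in auto)

text \<open>The hexagon with a trailing factor \<open>x\<close>. Precomposition with two associators
  brings both sides to a form in which the hexagon applies inside
  \<open>- \<boxtimes> Id C x\<close>; the pentagon takes care of the rest.\<close>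

lemma xch_hexagon:
  assumes [simp]: "b \<in> Obj C" "c \<in> Obj C" "d \<in> Obj C" "x \<in> Obj C"
  shows "assoc C c d (b \<otimes> x) \<cdot> xch b (c \<otimes> d) x
    = (Id C c \<boxtimes> xch b d x) \<cdot> xch b c (d \<otimes> x) \<cdot> (Id C b \<boxtimes> assoc C c d x)"
proof (rule cancel_right[of _ "assoc C b (c \<otimes> d) x \<cdot> (assoc C b c d \<boxtimes> Id C x)"])
  have "(assoc C c d (b \<otimes> x) \<cdot> xch b (c \<otimes> d) x) \<cdot> (assoc C b (c \<otimes> d) x \<cdot> (assoc C b c d \<boxtimes> Id C x))
     = assoc C c d (b \<otimes> x) \<cdot> assoc C (c \<otimes> d) b x \<cdot> (symm C b (c \<otimes> d) \<boxtimes> Id C x) \<cdot> (assoc C b c d \<boxtimes> Id C x)"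
    by (simp add: xch_assoc')
  also have "\<dots> = (Id C c \<boxtimes> assoc C d b x) \<cdot> assoc C c (d \<otimes> b) x \<cdot>
      ((assoc C c d b \<cdot> symm C b (c \<otimes> d) \<cdot> assoc C b c d) \<boxtimes> Id C x)"
    by (simp add: pentagon' tensR)
  also have "\<dots> = (Id C c \<boxtimes> assoc C d b x) \<cdot> (Id C c \<boxtimes> (symm C b d \<boxtimes> Id C x)) \<cdot> assoc C c (b \<otimes> d) x
      \<cdot> (assoc C c b d \<boxtimes> Id C x) \<cdot> ((symm C b c \<boxtimes> Id C d) \<boxtimes> Id C x)"
    by (simp add: hexagon tensR assoc_natural')
  also have "\<dots> = (Id C c \<boxtimes> xch b d x) \<cdot> (Id C c \<boxtimes> assoc C b d x) \<cdot> assoc C c (b \<otimes> d) x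
      \<cdot> (assoc C c b d \<boxtimes> Id C x) \<cdot> ((symm C b c \<boxtimes> Id C d) \<boxtimes> Id C x)"
    by (simp add: tm xch_assoc)
  also have "\<dots> = (Id C c \<boxtimes> xch b d x) \<cdot> assoc C c b (d \<otimes> x) \<cdot> assoc C (c \<otimes> b) d x \<cdot> ((symm C b c \<boxtimes> Id C d) \<boxtimes> Id C x)"
    by (simp add: pentagon')
  also have "\<dots> = (Id C c \<boxtimes> xch b d x) \<cdot> xch b c (d \<otimes> x) \<cdot> assoc C b c (d \<otimes> x) \<cdot> assoc C (b \<otimes> c) d x"
    by (simp add: assoc_natural_id xch_assoc')
  also have "\<dots> = ((Id C c \<boxtimes> xch b d x) \<cdot> xch b c (d \<otimes> x) \<cdot> (Id C b \<boxtimes> assoc C c d x)) \<cdot>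
      (assoc C b (c \<otimes> d) x \<cdot> (assoc C b c d \<boxtimes> Id C x))"
    by (simp add: pentagon)
  finally show "(assoc C c d (b \<otimes> x) \<cdot> xch b (c \<otimes> d) x) \<cdot> (assoc C b (c \<otimes> d) x \<cdot> (assoc C b c d \<boxtimes> Id C x)) = \<dots>" .
qed simp_all

text \<open>The inverse form of \<open>xch_hexagon\<close>: \<open>xch c b x\<close> undoes
  \<open>xch b c x\<close>, so cancelling against \<open>xch d (b \<otimes> c) x\<close> yields the
  law for a product in the first argument.\<close>

lemma xch_hexagon2:
  assumes [simp]: "b \<in> Obj C" "c \<in> Obj C" "d \<in> Obj C" "x \<in> Obj C"
  shows "(Id C d \<boxtimes> assoc C b c x) \<cdot> xch (b \<otimes> c) d x
    = xch b d (c \<otimes> x) \<cdot> (Id C b \<boxtimes> xch c d x) \<cdot> assoc C b c (d \<otimes> x)"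
proof (rule cancel_right[of _ "xch d (b \<otimes> c) x"])
  have "(xch b d (c \<otimes> x) \<cdot> (Id C b \<boxtimes> xch c d x) \<cdot> assoc C b c (d \<otimes> x)) \<cdot> xch d (b \<otimes> c) x
     = xch b d (c \<otimes> x) \<cdot> (Id C b \<boxtimes> (xch c d x \<cdot> xch d c x)) \<cdot> xch d b (c \<otimes> x) \<cdot> (Id C d \<boxtimes> assoc C b c x)"
    by (simp add: xch_hexagon tm)
  then show "((Id C d \<boxtimes> assoc C b c x) \<cdot> xch (b \<otimes> c) d x) \<cdot> xch d (b \<otimes> c) x
     = (xch b d (c \<otimes> x) \<cdot> (Id C b \<boxtimes> xch c d x) \<cdot> assoc C b c (d \<otimes> x)) \<cdot> xch d (b \<otimes> c) x"
    by (simp add: xch_xch xch_xch')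
qed simp_all

text \<open>The exchange is insensitive to the bracketing of what follows it. This is the pentagon
  on both sides of a natural symmetry.\<close>

lemma xch_tail:
  assumes [simp]: "b \<in> Obj C" "c \<in> Obj C" "x \<in> Obj C" "y \<in> Obj C"
  shows "(Id C c \<boxtimes> assoc C b x y) \<cdot> assoc C c (b \<otimes> x) y \<cdot> (xch b c x \<boxtimes> Id C y)
    = xch b c (x \<otimes> y) \<cdot> (Id C b \<boxtimes> assoc C c x y) \<cdot> assoc C b (c \<otimes> x) y"
proof (rule cancel_right[of _ "assoc C b c x \<boxtimes> Id C y"])
  have "((Id C c \<boxtimes> assoc C b x y) \<cdot> assoc C c (b \<otimes> x) y \<cdot> (xch b c x \<boxtimes> Id C y)) \<cdot> (assoc C b c x \<boxtimes> Id C y)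
     = (Id C c \<boxtimes> assoc C b x y) \<cdot> assoc C c (b \<otimes> x) y \<cdot> (assoc C c b x \<boxtimes> Id C y) \<cdot> ((symm C b c \<boxtimes> Id C x) \<boxtimes> Id C y)"
    by (simp add: tens_merge_id xch_assoc)
  also have "\<dots> = assoc C c b (x \<otimes> y) \<cdot> assoc C (c \<otimes> b) x y \<cdot> ((symm C b c \<boxtimes> Id C x) \<boxtimes> Id C y)"
    by (simp add: pentagon')
  also have "\<dots> = (xch b c (x \<otimes> y) \<cdot> (Id C b \<boxtimes> assoc C c x y) \<cdot> assoc C b (c \<otimes> x) y) \<cdot> (assoc C b c x \<boxtimes> Id C y)"
    by (simp add: assoc_natural_id pentagon[symmetric] xch_assoc')
  finally show "((Id C c \<boxtimes> assoc C b x y) \<cdot> assoc C c (b \<otimes> x) y \<cdot> (xch b c x \<boxtimes> Id C y)) \<cdot> (assoc C b c x \<boxtimes> Id C y) = \<dots>" .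
qed simp_all

lemma xch_unit:
  assumes [simp]: "c \<in> Obj C" "x \<in> Obj C"
  shows "(Id C c \<boxtimes> lunit C x) \<cdot> xch \<one> c x = lunit C (c \<otimes> x)"
proof (rule cancel_right[of _ "assoc C \<one> c x"])
  show "((Id C c \<boxtimes> lunit C x) \<cdot> xch \<one> c x) \<cdot> assoc C \<one> c x = lunit C (c \<otimes> x) \<cdot> assoc C \<one> c x"
    by (simp add: xch_assoc triangle' tens_merge_id lunit_symm lunit_tens)
qed simp_all

lemma interchange_arr [simp]:
  assumes "a \<in> Obj C" "b \<in> Obj C" "c \<in> Obj C" "d \<in> Obj C"
  shows "interchange C a b c d \<in> Arr C" "Dom C (interchange C a b c d) = (a \<otimes> b) \<otimes> (c \<otimes> d)"
    "Cod C (interchange C a b c d) = (a \<otimes> c) \<otimes> (b \<otimes> d)"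
  using assms by (simp_all add: interchange_def Let_def)

text \<open>Up to reassociation the interchange exchanges only the two middle factors. Through this
  equation the laws below are reduced to those of \<open>xch\<close>.\<close>

lemma assoc_interchange:
  assumes [simp]: "a \<in> Obj C" "b \<in> Obj C" "c \<in> Obj C" "d \<in> Obj C"
  shows "assoc C a c (b \<otimes> d) \<cdot> interchange C a b c d = (Id C a \<boxtimes> xch b c d) \<cdot> assoc C a b (c \<otimes> d)"
  by (simp add: interchange_def Let_def xch_def tensL)

lemmas assoc_interchange' = comp_reduce[OF assoc_interchange]

lemma interchange_interchange:
  assumes [simp]: "a \<in> Obj C" "b \<in> Obj C" "c \<in> Obj C" "d \<in> Obj C"
  shows "interchange C a c b d \<cdot> interchange C a b c d = Id C ((a \<otimes> b) \<otimes> (c \<otimes> d))"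
  by (rule cancel_left[of "assoc C a b (c \<otimes> d)"])
     (simp_all add: assoc_interchange' assoc_interchange tm xch_xch)

lemma interchange_natural:
  assumes [simp]: "f \<in> Arr C" "g \<in> Arr C" "h \<in> Arr C" "k \<in> Arr C"
    and "Cod C f = a" "Cod C g = b" "Cod C h = c" "Cod C k = d"
  shows "interchange C a b c d \<cdot> ((f \<boxtimes> g) \<boxtimes> (h \<boxtimes> k))
    = ((f \<boxtimes> h) \<boxtimes> (g \<boxtimes> k)) \<cdot> interchange C (Dom C f) (Dom C g) (Dom C h) (Dom C k)"
proof -
  have [simp]: "a = Cod C f" "b = Cod C g" "c = Cod C h" "d = Cod C k" using assms by auto
  show ?thesis
    by (rule cancel_left[of "assoc C a c (b \<otimes> d)"])
      (simp_all add: assoc_interchange' assoc_interchange assoc_natural assoc_natural' xch_natural tm)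
qed

lemmas interchange_natural' = comp_reduce[OF interchange_natural]

text \<open>Associativity coherence of the tensor product, seen as a monoidal functor of two
  variables. It yields the associativity axiom for the pointwise tensor
  \<open>tensF F G\<close>.\<close>

lemma interchange_assoc:
  assumes [simp]: "a \<in> Obj C" "b \<in> Obj C" "c \<in> Obj C" "d \<in> Obj C" "e \<in> Obj C" "f \<in> Obj C"
  shows "(assoc C a c e \<boxtimes> assoc C b d f) \<cdot> interchange C (a \<otimes> c) (b \<otimes> d) e f \<cdot> (interchange C a b c d \<boxtimes> Id C (e \<otimes> f))
    = interchange C a b (c \<otimes> e) (d \<otimes> f) \<cdot> (Id C (a \<otimes> b) \<boxtimes> interchange C c d e f) \<cdot> assoc C (a \<otimes> b) (c \<otimes> d) (e \<otimes> f)"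
    (is "?L = ?R")
\<comment> \<open>This composite moves all brackets to the right, so both sides end in \<open>a
  \<otimes> (c \<otimes> (e \<otimes> (b \<otimes> (d \<otimes> f))))\<close>. There each of them is
  \<open>?M\<close>, which moves \<open>b\<close> past \<open>c\<close>, followed by
  \<open>?K\<close>, which moves first \<open>d\<close> and then \<open>b\<close> past
  \<open>e\<close>.\<close>
proof (rule cancel_left[of "(Id C a \<boxtimes> assoc C c e (b \<otimes> (d \<otimes> f))) \<cdot> assoc C a (c \<otimes> e) (b \<otimes> (d \<otimes> f))"])
  let ?N = "(Id C a \<boxtimes> assoc C c e (b \<otimes> (d \<otimes> f))) \<cdot> assoc C a (c \<otimes> e) (b \<otimes> (d \<otimes> f))"
  let ?K = "(Id C a \<boxtimes> (Id C c \<boxtimes> (xch b e (d \<otimes> f) \<cdot> (Id C b \<boxtimes> xch d e f))))"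
  let ?M = "(Id C a \<boxtimes> xch b c (d \<otimes> (e \<otimes> f))) \<cdot> (Id C a \<boxtimes> (Id C b \<boxtimes> assoc C c d (e \<otimes> f)))
      \<cdot> assoc C a b ((c \<otimes> d) \<otimes> (e \<otimes> f)) \<cdot> assoc C (a \<otimes> b) (c \<otimes> d) (e \<otimes> f)"
  have n: "(Id C a \<boxtimes> xch b c (e \<otimes> (d \<otimes> f))) \<cdot> (Id C a \<boxtimes> (Id C b \<boxtimes> (Id C c \<boxtimes> xch d e f)))
      = (Id C a \<boxtimes> (Id C c \<boxtimes> (Id C b \<boxtimes> xch d e f))) \<cdot> (Id C a \<boxtimes> xch b c (d \<otimes> (e \<otimes> f)))"
    by (simp add: tens_merge_id xch_natural)
  have "?N \<cdot> ?R = (Id C a \<boxtimes> assoc C c e (b \<otimes> (d \<otimes> f))) \<cdot> (Id C a \<boxtimes> xch b (c \<otimes> e) (d \<otimes> f)) \<cdot>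
      (Id C a \<boxtimes> (Id C b \<boxtimes> interchange C c d e f)) \<cdot> assoc C a b ((c \<otimes> d) \<otimes> (e \<otimes> f)) \<cdot> assoc C (a \<otimes> b) (c \<otimes> d) (e \<otimes> f)"
    by (simp add: assoc_interchange' comp_reduce[OF assoc_natural_id(1)])
  also have "\<dots> = (Id C a \<boxtimes> ((Id C c \<boxtimes> xch b e (d \<otimes> f)) \<cdot> xch b c (e \<otimes> (d \<otimes> f)) \<cdot>
      (Id C b \<boxtimes> (assoc C c e (d \<otimes> f) \<cdot> interchange C c d e f)))) \<cdot> assoc C a b ((c \<otimes> d) \<otimes> (e \<otimes> f)) \<cdot> assoc C (a \<otimes> b) (c \<otimes> d) (e \<otimes> f)"
    by (simp add: comp_reduce[OF tens_merge_id(1)] tens_merge_id xch_hexagon comp_reduce[OF xch_hexagon])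
  also have "\<dots> = ?K \<cdot> ?M"
    by (simp add: assoc_interchange tensL comp_reduce[OF n])
  finally have R: "?N \<cdot> ?R = ?K \<cdot> ?M" .
  have "?N \<cdot> (assoc C a c e \<boxtimes> assoc C b d f)
     = ?N \<cdot> ((assoc C a c e \<boxtimes> Id C (b \<otimes> (d \<otimes> f))) \<cdot> (Id C ((a \<otimes> c) \<otimes> e) \<boxtimes> assoc C b d f))"
    using tens_split(1)[of "assoc C a c e" "assoc C b d f"] by simp
  also have "\<dots> = assoc C a c (e \<otimes> (b \<otimes> (d \<otimes> f))) \<cdot> assoc C (a \<otimes> c) e (b \<otimes> (d \<otimes> f)) \<cdot> (Id C ((a \<otimes> c) \<otimes> e) \<boxtimes> assoc C b d f)"
    by (simp add: pentagon')
  also have "\<dots> = assoc C a c (e \<otimes> (b \<otimes> (d \<otimes> f))) \<cdot> (Id C (a \<otimes> c) \<boxtimes> (Id C e \<boxtimes> assoc C b d f)) \<cdot> assoc C (a \<otimes> c) e ((b \<otimes> d) \<otimes> f)"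
    by (simp add: assoc_natural_id(1)[of "a \<otimes> c" e, simplified])
  finally have N: "?N \<cdot> (assoc C a c e \<boxtimes> assoc C b d f) = \<dots>" .
  have "?N \<cdot> ?L = (?N \<cdot> (assoc C a c e \<boxtimes> assoc C b d f)) \<cdot> interchange C (a \<otimes> c) (b \<otimes> d) e f \<cdot> (interchange C a b c d \<boxtimes> Id C (e \<otimes> f))"
    by simp
  also have "\<dots> = assoc C a c (e \<otimes> (b \<otimes> (d \<otimes> f))) \<cdot> (Id C (a \<otimes> c) \<boxtimes> ((Id C e \<boxtimes> assoc C b d f) \<cdot> xch (b \<otimes> d) e f))
      \<cdot> assoc C (a \<otimes> c) (b \<otimes> d) (e \<otimes> f) \<cdot> (interchange C a b c d \<boxtimes> Id C (e \<otimes> f))"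
    unfolding N by (simp add: assoc_interchange' tensL)
  also have "\<dots> = assoc C a c (e \<otimes> (b \<otimes> (d \<otimes> f))) \<cdot> (Id C (a \<otimes> c) \<boxtimes> ((xch b e (d \<otimes> f) \<cdot> (Id C b \<boxtimes> xch d e f)) \<cdot> assoc C b d (e \<otimes> f)))
      \<cdot> assoc C (a \<otimes> c) (b \<otimes> d) (e \<otimes> f) \<cdot> (interchange C a b c d \<boxtimes> Id C (e \<otimes> f))"
    by (simp add: xch_hexagon2)
  also have "\<dots> = ?K \<cdot> (Id C a \<boxtimes> (Id C c \<boxtimes> assoc C b d (e \<otimes> f))) \<cdot> assoc C a c ((b \<otimes> d) \<otimes> (e \<otimes> f))
      \<cdot> assoc C (a \<otimes> c) (b \<otimes> d) (e \<otimes> f) \<cdot> (interchange C a b c d \<boxtimes> Id C (e \<otimes> f))"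
    by (simp add: comp_reduce[OF assoc_natural_id(1)] tensL)
  also have "assoc C a c ((b \<otimes> d) \<otimes> (e \<otimes> f)) \<cdot> assoc C (a \<otimes> c) (b \<otimes> d) (e \<otimes> f) \<cdot> (interchange C a b c d \<boxtimes> Id C (e \<otimes> f))
     = (Id C a \<boxtimes> assoc C c (b \<otimes> d) (e \<otimes> f)) \<cdot> assoc C a (c \<otimes> (b \<otimes> d)) (e \<otimes> f) \<cdot>
       ((assoc C a c (b \<otimes> d) \<cdot> interchange C a b c d) \<boxtimes> Id C (e \<otimes> f))"
    by (simp add: pentagon' tensR)
  also have "\<dots> = (Id C a \<boxtimes> assoc C c (b \<otimes> d) (e \<otimes> f)) \<cdot> (Id C a \<boxtimes> (xch b c d \<boxtimes> Id C (e \<otimes> f))) \<cdot> assoc C a (b \<otimes> (c \<otimes> d)) (e \<otimes> f) \<cdot>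
       (assoc C a b (c \<otimes> d) \<boxtimes> Id C (e \<otimes> f))"
    by (simp add: assoc_interchange tensR assoc_natural')
  also have "(Id C a \<boxtimes> (Id C c \<boxtimes> assoc C b d (e \<otimes> f))) \<cdot> \<dots>
     = (Id C a \<boxtimes> ((Id C c \<boxtimes> assoc C b d (e \<otimes> f)) \<cdot> assoc C c (b \<otimes> d) (e \<otimes> f) \<cdot> (xch b c d \<boxtimes> Id C (e \<otimes> f))))
       \<cdot> assoc C a (b \<otimes> (c \<otimes> d)) (e \<otimes> f) \<cdot> (assoc C a b (c \<otimes> d) \<boxtimes> Id C (e \<otimes> f))"
    by (simp add: tensL)
  also have "\<dots> = ?M" by (simp add: xch_tail tensL pentagon)
  finally show "?N \<cdot> ?L = ?N \<cdot> ?R" unfolding R .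
qed simp_all

lemma interchange_symm:
  assumes [simp]: "a \<in> Obj C" "b \<in> Obj C" "c \<in> Obj C" "d \<in> Obj C"
  shows "(symm C a c \<boxtimes> symm C b d) \<cdot> interchange C a b c d = interchange C c d a b \<cdot> symm C (a \<otimes> b) (c \<otimes> d)"
    (is "?L = ?R")
proof -
  \<comment> \<open>The hexagon in terms of the exchange: bringing \<open>d\<close> to the front and
    then back past \<open>a\<close> amounts to moving it past \<open>b\<close> only.\<close>
  have h: "xch d a b \<cdot> symm C (a \<otimes> b) d = (Id C a \<boxtimes> symm C b d) \<cdot> assoc C a b d"
  proof (rule cancel_left[of "(symm C a d \<boxtimes> Id C b) \<cdot> inv_arr C (assoc C a d b)"])
    have "((symm C a d \<boxtimes> Id C b) \<cdot> inv_arr C (assoc C a d b)) \<cdot> (xch d a b \<cdot> symm C (a \<otimes> b) d)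
        = inv_arr C (assoc C d a b) \<cdot> symm C (a \<otimes> b) d"
      by (simp add: xch_def tm)
    also have "\<dots> = ((symm C a d \<boxtimes> Id C b) \<cdot> inv_arr C (assoc C a d b)) \<cdot> (Id C a \<boxtimes> symm C b d) \<cdot> assoc C a b d"
    proof (rule cancel_right[of _ "symm C d (a \<otimes> b) \<cdot> assoc C d a b"])
      have "((symm C a d \<boxtimes> Id C b) \<cdot> inv_arr C (assoc C a d b)) \<cdot> ((Id C a \<boxtimes> symm C b d) \<cdot> (assoc C a b d \<cdot> symm C d (a \<otimes> b) \<cdot> assoc C d a b))
         = ((symm C a d \<boxtimes> Id C b) \<cdot> inv_arr C (assoc C a d b)) \<cdot> ((Id C a \<boxtimes> (symm C b d \<cdot> symm C d b)) \<cdot> assoc C a d b \<cdot> (symm C d a \<boxtimes> Id C b))"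
        by (simp add: hexagon tm)
      then show "(inv_arr C (assoc C d a b) \<cdot> symm C (a \<otimes> b) d) \<cdot> (symm C d (a \<otimes> b) \<cdot> assoc C d a b)
        = (((symm C a d \<boxtimes> Id C b) \<cdot> inv_arr C (assoc C a d b)) \<cdot> (Id C a \<boxtimes> symm C b d) \<cdot> assoc C a b d) \<cdot> (symm C d (a \<otimes> b) \<cdot> assoc C d a b)"
        by (simp add: tm)
    qed simp_all
    finally show "((symm C a d \<boxtimes> Id C b) \<cdot> inv_arr C (assoc C a d b)) \<cdot> (xch d a b \<cdot> symm C (a \<otimes> b) d)
      = ((symm C a d \<boxtimes> Id C b) \<cdot> inv_arr C (assoc C a d b)) \<cdot> (Id C a \<boxtimes> symm C b d) \<cdot> assoc C a b d" .
  qed simp_all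
  have "assoc C c a (d \<otimes> b) \<cdot> ?R \<cdot> assoc C (a \<otimes> b) c d = (Id C c \<boxtimes> xch d a b) \<cdot> assoc C c d (a \<otimes> b) \<cdot> symm C (a \<otimes> b) (c \<otimes> d) \<cdot> assoc C (a \<otimes> b) c d"
    by (simp add: assoc_interchange')
  also have "\<dots> = (Id C c \<boxtimes> (xch d a b \<cdot> symm C (a \<otimes> b) d)) \<cdot> assoc C c (a \<otimes> b) d \<cdot> (symm C (a \<otimes> b) c \<boxtimes> Id C d)"
    by (simp add: hexagon tensL)
  also have "\<dots> = (Id C c \<boxtimes> (Id C a \<boxtimes> symm C b d)) \<cdot> (Id C c \<boxtimes> assoc C a b d) \<cdot> assoc C c (a \<otimes> b) d \<cdot> (symm C (a \<otimes> b) c \<boxtimes> Id C d)"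
    by (simp add: h tensL)
  finally have R: "assoc C c a (d \<otimes> b) \<cdot> ?R \<cdot> assoc C (a \<otimes> b) c d = \<dots>" .
  have "assoc C c a (d \<otimes> b) \<cdot> ?L \<cdot> assoc C (a \<otimes> b) c d
      = assoc C c a (d \<otimes> b) \<cdot> (Id C (c \<otimes> a) \<boxtimes> symm C b d) \<cdot> (symm C a c \<boxtimes> Id C (b \<otimes> d)) \<cdot> interchange C a b c d \<cdot> assoc C (a \<otimes> b) c d"
    using tens_split(2)[of "symm C a c" "symm C b d"] by simp
  also have "\<dots> = (Id C c \<boxtimes> (Id C a \<boxtimes> symm C b d)) \<cdot> xch a c (b \<otimes> d) \<cdot> assoc C a c (b \<otimes> d) \<cdot> interchange C a b c d \<cdot> assoc C (a \<otimes> b) c d"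
    by (simp add: comp_reduce[OF assoc_natural_id(1)] xch_assoc')
  also have "\<dots> = (Id C c \<boxtimes> (Id C a \<boxtimes> symm C b d)) \<cdot> (Id C c \<boxtimes> assoc C a b d) \<cdot> xch (a \<otimes> b) c d \<cdot> assoc C (a \<otimes> b) c d"
    by (simp add: assoc_interchange' comp_reduce[OF xch_hexagon2])
  also have "\<dots> = assoc C c a (d \<otimes> b) \<cdot> ?R \<cdot> assoc C (a \<otimes> b) c d" unfolding R by (simp add: xch_assoc)
  finally have "assoc C c a (d \<otimes> b) \<cdot> ?L \<cdot> assoc C (a \<otimes> b) c d = assoc C c a (d \<otimes> b) \<cdot> ?R \<cdot> assoc C (a \<otimes> b) c d" .
  then have "?L \<cdot> assoc C (a \<otimes> b) c d = ?R \<cdot> assoc C (a \<otimes> b) c d" by (rule cancel_left) simp_all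
  then show ?thesis by (rule cancel_right) simp_all
qed

lemma interchange_lunit:
  assumes [simp]: "a \<in> Obj C" "b \<in> Obj C"
  shows "(lunit C a \<boxtimes> lunit C b) \<cdot> interchange C \<one> \<one> a b = lunit C (a \<otimes> b) \<cdot> (lunit C \<one> \<boxtimes> Id C (a \<otimes> b))"
proof -
  have "(lunit C a \<boxtimes> lunit C b) \<cdot> interchange C \<one> \<one> a b
     = (Id C a \<boxtimes> lunit C b) \<cdot> (lunit C a \<boxtimes> Id C (\<one> \<otimes> b)) \<cdot> interchange C \<one> \<one> a b"
    using tens_split(2)[of "lunit C a" "lunit C b"] by simp
  also have "\<dots> = (Id C a \<boxtimes> lunit C b) \<cdot> lunit C (a \<otimes> (\<one> \<otimes> b)) \<cdot> (Id C \<one> \<boxtimes> xch \<one> a b) \<cdot> assoc C \<one> \<one> (a \<otimes> b)"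
    by (simp add: lunit_tens[symmetric] assoc_interchange)
  also have "\<dots> = lunit C (a \<otimes> b) \<cdot> lunit C (\<one> \<otimes> (a \<otimes> b)) \<cdot> assoc C \<one> \<one> (a \<otimes> b)"
    by (simp add: lunit_natural' comp_reduce[OF xch_unit])
  finally show ?thesis by (simp add: lunit_tens)
qed

text \<open>Reduced to the left unit by the symmetry, which interchanges the two unitors.\<close>

lemma interchange_runit:
  assumes [simp]: "a \<in> Obj C" "b \<in> Obj C"
  shows "(runit C a \<boxtimes> runit C b) \<cdot> interchange C a b \<one> \<one> = runit C (a \<otimes> b) \<cdot> (Id C (a \<otimes> b) \<boxtimes> lunit C \<one>)"
proof -
  have "(runit C a \<boxtimes> runit C b) \<cdot> interchange C a b \<one> \<one>
     = (lunit C a \<boxtimes> lunit C b) \<cdot> (symm C a \<one> \<boxtimes> symm C b \<one>) \<cdot> interchange C a b \<one> \<one>"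
    by (simp add: comp_reduce[OF tens_merge] lunit_symm)
  also have "\<dots> = (lunit C a \<boxtimes> lunit C b) \<cdot> interchange C \<one> \<one> a b \<cdot> symm C (a \<otimes> b) (\<one> \<otimes> \<one>)"
    by (simp add: interchange_symm)
  also have "\<dots> = lunit C (a \<otimes> b) \<cdot> symm C (a \<otimes> b) \<one> \<cdot> (Id C (a \<otimes> b) \<boxtimes> lunit C \<one>)"
    by (simp add: comp_reduce[OF interchange_lunit] symm_natural)
  finally show ?thesis by (simp add: comp_reduce[OF lunit_symm(1)])
qed

end

subsection \<open>Tensoring with an object is fully faithful\<close>

context symmetric_picard_category
begin

text \<open>The isomorphism that exhibits tensoring with \<open>bul C a\<close> as an inverse of
  tensoring with \<open>a\<close>. The symmetry is inserted because \<open>bulj\<close> has the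
  inverse on the left of \<open>a\<close>, whereas here it stands on the right.\<close>

definition cancel_bul :: "'o \<Rightarrow> 'o \<Rightarrow> 'a" where
  "cancel_bul x a = runit C x \<cdot> (Id C x \<boxtimes> (inv_arr C (bulj C a) \<cdot> symm C a (bul C a))) \<cdot> assoc C x a (bul C a)"

lemma cancel_bul_arr [simp]:
  assumes "x \<in> Obj C" "a \<in> Obj C"
  shows "cancel_bul x a \<in> Arr C" "Dom C (cancel_bul x a) = (x \<otimes> a) \<otimes> bul C a" "Cod C (cancel_bul x a) = x"
  using assms by (simp_all add: cancel_bul_def)

lemma cancel_bul_natural:
  assumes [simp]: "f \<in> Arr C" "a \<in> Obj C"
  shows "cancel_bul (Cod C f) a \<cdot> ((f \<boxtimes> Id C a) \<boxtimes> Id C (bul C a)) = f \<cdot> cancel_bul (Dom C f) a"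
proof -
  let ?e = "inv_arr C (bulj C a) \<cdot> symm C a (bul C a)"
  have n: "(Id C (Cod C f) \<boxtimes> ?e) \<cdot> (f \<boxtimes> Id C (a \<otimes> bul C a)) = (f \<boxtimes> Id C \<one>) \<cdot> (Id C (Dom C f) \<boxtimes> ?e)"
    by (simp add: tens_merge)
  show ?thesis
    unfolding cancel_bul_def by (simp add: assoc_natural_id comp_reduce[OF n] runit_natural' del: tens_Id)
qed

text \<open>Since \<open>k\<close> is invertible it can be replaced by the identity of its domain;
  \<open>cancel_bul\<close> then recovers an arrow from its tensor product with that
  identity.\<close>

lemma tens_faithful:
  assumes [simp]: "f \<in> Arr C" "g \<in> Arr C" "k \<in> Arr C" and "Dom C f = Dom C g" "Cod C f = Cod C g"
    and e: "f \<boxtimes> k = g \<boxtimes> k"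
  shows "f = g"
proof (rule cancel_right[of _ "cancel_bul (Dom C g) (Dom C k)"])
  have "f \<boxtimes> Id C (Dom C k) = (Id C (Cod C g) \<boxtimes> inv_arr C k) \<cdot> (f \<boxtimes> k)"
    using assms(4,5) by (simp add: tens_merge)
  also have "\<dots> = g \<boxtimes> Id C (Dom C k)"
    unfolding e using assms(4,5) by (simp add: tens_merge)
  finally have "f \<boxtimes> Id C (Dom C k) = g \<boxtimes> Id C (Dom C k)" .
  then show "f \<cdot> cancel_bul (Dom C g) (Dom C k) = g \<cdot> cancel_bul (Dom C g) (Dom C k)"
    using cancel_bul_natural[of f "Dom C k"] cancel_bul_natural[of g "Dom C k"] assms by simp
qed (use assms in auto)

text \<open>The candidate is \<open>h \<boxtimes> Id\<close> of the inverse of \<open>a\<close>,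
  conjugated by \<open>cancel_bul\<close>. Naturality shows that it has the right image after one
  further tensoring with that inverse, and faithfulness removes this factor.\<close>

lemma tens_full:
  assumes [simp]: "x \<in> Obj C" "y \<in> Obj C" "a \<in> Obj C" "h \<in> Arr C" "Dom C h = x \<otimes> a" "Cod C h = y \<otimes> a"
  obtains f where "f \<in> Arr C" "Dom C f = x" "Cod C f = y" "f \<boxtimes> Id C a = h"
proof -
  define f where "f = cancel_bul y a \<cdot> (h \<boxtimes> Id C (bul C a)) \<cdot> inv_arr C (cancel_bul x a)"
  have [simp]: "f \<in> Arr C" "Dom C f = x" "Cod C f = y" by (simp_all add: f_def)
  have "cancel_bul y a \<cdot> ((f \<boxtimes> Id C a) \<boxtimes> Id C (bul C a)) = cancel_bul y a \<cdot> (h \<boxtimes> Id C (bul C a))"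
    using cancel_bul_natural[of f a] by (simp add: f_def del: tens_Id)
  then have "(f \<boxtimes> Id C a) \<boxtimes> Id C (bul C a) = h \<boxtimes> Id C (bul C a)"
    by (rule cancel_left) simp_all
  then have "f \<boxtimes> Id C a = h" by (rule tens_faithful[rotated -1]) simp_all
  then show thesis by (intro that) simp_all
qed

text \<open>A pair of objects with an arrow \<open>h : I \<rightarrow> x \<otimes> a\<close> exhibits \<open>x\<close> as an inverse of \<open>a\<close>.  Every arrow
  \<open>f : a \<rightarrow> b\<close> lifts to a unique \<open>g : x \<rightarrow> y\<close> compatible with such pairs; the pairs are closed under
  the tensor \<open>jtens\<close>.  Hence all coherence for \<open>a \<mapsto> a\<^sup>\<bullet>\<close> follows from uniqueness.\<close>

lemma dual_unique:
  assumes "(g \<boxtimes> f) \<cdot> h = (g' \<boxtimes> f) \<cdot> h" "f \<in> Arr C" "g \<in> Arr C" "g' \<in> Arr C" "h \<in> Arr C"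
    "Dom C g = Dom C g'" "Cod C g = Cod C g'" "Cod C h = Dom C g \<otimes> Dom C f"
  shows "g = g'"
proof -
  have "g \<boxtimes> f = g' \<boxtimes> f" using assms(1) by (rule cancel_right) (use assms in simp_all)
  then show ?thesis by (rule tens_faithful[rotated -1]) (use assms in simp_all)
qed

text \<open>As \<open>f\<close> and \<open>h\<close> are invertible, the required equation
  prescribes \<open>g\<close> tensored with an identity; fullness supplies such a
  \<open>g\<close>.\<close>

lemma dual_exists:
  assumes [simp]: "f \<in> Arr C" "h \<in> Arr C" "k \<in> Arr C" "x \<in> Obj C" "y \<in> Obj C"
    "Dom C h = Dom C k" "Cod C h = x \<otimes> Dom C f" "Cod C k = y \<otimes> Cod C f"
  obtains g where "g \<in> Arr C" "Dom C g = x" "Cod C g = y" "(g \<boxtimes> f) \<cdot> h = k"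
proof -
  obtain g where [simp]: "g \<in> Arr C" "Dom C g = x" "Cod C g = y"
    and e: "g \<boxtimes> Id C (Dom C f) = (Id C y \<boxtimes> inv_arr C f) \<cdot> k \<cdot> inv_arr C h"
    by (rule tens_full[of x y "Dom C f" "(Id C y \<boxtimes> inv_arr C f) \<cdot> k \<cdot> inv_arr C h"]) auto
  have "(g \<boxtimes> f) = (Id C y \<boxtimes> f) \<cdot> (g \<boxtimes> Id C (Dom C f))" by (simp add: tens_merge)
  also have "\<dots> = k \<cdot> inv_arr C h" unfolding e by (simp add: tm)
  finally have "(g \<boxtimes> f) \<cdot> h = k" by simp
  then show thesis by (intro that) simp_all
qed

definition jtens :: "'o \<Rightarrow> 'o \<Rightarrow> 'o \<Rightarrow> 'o \<Rightarrow> 'a \<Rightarrow> 'a \<Rightarrow> 'a" where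
  "jtens x a y b h k = interchange C x a y b \<cdot> (h \<boxtimes> k) \<cdot> inv_arr C (lunit C \<one>)"

lemma jtens_arr [simp]:
  assumes "x \<in> Obj C" "a \<in> Obj C" "y \<in> Obj C" "b \<in> Obj C" "h \<in> Arr C" "k \<in> Arr C"
    "Dom C h = \<one>" "Dom C k = \<one>" "Cod C h = x \<otimes> a" "Cod C k = y \<otimes> b"
  shows "jtens x a y b h k \<in> Arr C" "Dom C (jtens x a y b h k) = \<one>" "Cod C (jtens x a y b h k) = (x \<otimes> y) \<otimes> (a \<otimes> b)"
  using assms by (simp_all add: jtens_def)

lemma jtens_natural:
  assumes [simp]: "g \<in> Arr C" "g' \<in> Arr C" "f \<in> Arr C" "f' \<in> Arr C" "h \<in> Arr C" "k \<in> Arr C"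
    "Dom C h = \<one>" "Dom C k = \<one>" "Cod C h = Dom C g \<otimes> Dom C f" "Cod C k = Dom C g' \<otimes> Dom C f'"
  shows "((g \<boxtimes> g') \<boxtimes> (f \<boxtimes> f')) \<cdot> jtens (Dom C g) (Dom C f) (Dom C g') (Dom C f') h k
    = jtens (Cod C g) (Cod C f) (Cod C g') (Cod C f') ((g \<boxtimes> f) \<cdot> h) ((g' \<boxtimes> f') \<cdot> k)"
  unfolding jtens_def by (simp add: comp_reduce[OF interchange_natural[symmetric]] tens_comp)

text \<open>Both facts express that the two unitors agree at \<open>\<one>\<close>. They dispose of
  the unitors that the definition of \<open>jtens\<close>, and the unit of a pointwise tensor
  product, leave behind.\<close>

lemma unit_coherence:
  "assoc C \<one> \<one> \<one> \<cdot> (inv_arr C (lunit C \<one>) \<boxtimes> Id C \<one>) = Id C \<one> \<boxtimes> inv_arr C (lunit C \<one>)"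
  "symm C \<one> \<one> = Id C (\<one> \<otimes> \<one>)"
proof -
  show "assoc C \<one> \<one> \<one> \<cdot> (inv_arr C (lunit C \<one>) \<boxtimes> Id C \<one>) = Id C \<one> \<boxtimes> inv_arr C (lunit C \<one>)"
    by (rule cancel_left[of "Id C \<one> \<boxtimes> lunit C \<one>"])
      (simp_all add: triangle' lunit_eq_runit[symmetric] tens_merge)
  show "symm C \<one> \<one> = Id C (\<one> \<otimes> \<one>)"
    by (rule cancel_left[of "lunit C \<one>"]) (simp_all add: lunit_symm lunit_eq_runit)
qed

text \<open>This is \<open>interchange_assoc\<close> applied to \<open>h\<close>, \<open>k\<close>
  and \<open>l\<close>; the remaining unitors cancel by \<open>unit_coherence\<close>.\<close>

lemma jtens_assoc:
  assumes [simp]: "x \<in> Obj C" "a \<in> Obj C" "y \<in> Obj C" "b \<in> Obj C" "z \<in> Obj C" "c \<in> Obj C"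
    "h \<in> Arr C" "k \<in> Arr C" "l \<in> Arr C" "Dom C h = \<one>" "Dom C k = \<one>" "Dom C l = \<one>"
    "Cod C h = x \<otimes> a" "Cod C k = y \<otimes> b" "Cod C l = z \<otimes> c"
  shows "(assoc C x y z \<boxtimes> assoc C a b c) \<cdot> jtens (x \<otimes> y) (a \<otimes> b) z c (jtens x a y b h k) l
    = jtens x a (y \<otimes> z) (b \<otimes> c) h (jtens y b z c k l)"
proof -
  let ?l = "inv_arr C (lunit C \<one>)"
  have "jtens (x \<otimes> y) (a \<otimes> b) z c (jtens x a y b h k) l =
    interchange C (x \<otimes> y) (a \<otimes> b) z c \<cdot> (interchange C x a y b \<boxtimes> Id C (z \<otimes> c)) \<cdot> ((h \<boxtimes> k) \<boxtimes> l) \<cdot> (?l \<boxtimes> Id C \<one>) \<cdot> ?l"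
    unfolding jtens_def by (simp add: tm)
  then have "(assoc C x y z \<boxtimes> assoc C a b c) \<cdot> jtens (x \<otimes> y) (a \<otimes> b) z c (jtens x a y b h k) l =
    interchange C x a (y \<otimes> z) (b \<otimes> c) \<cdot> (Id C (x \<otimes> a) \<boxtimes> interchange C y b z c) \<cdot> assoc C (x \<otimes> a) (y \<otimes> b) (z \<otimes> c) \<cdot>
      ((h \<boxtimes> k) \<boxtimes> l) \<cdot> (?l \<boxtimes> Id C \<one>) \<cdot> ?l"
    by (simp add: comp_reduce3[OF interchange_assoc])
  also have "\<dots> = interchange C x a (y \<otimes> z) (b \<otimes> c) \<cdot> (Id C (x \<otimes> a) \<boxtimes> interchange C y b z c) \<cdot>
      (h \<boxtimes> (k \<boxtimes> l)) \<cdot> assoc C \<one> \<one> \<one> \<cdot> (?l \<boxtimes> Id C \<one>) \<cdot> ?l"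
    by (simp add: assoc_natural')
  also have "\<dots> = interchange C x a (y \<otimes> z) (b \<otimes> c) \<cdot> (Id C (x \<otimes> a) \<boxtimes> interchange C y b z c) \<cdot>
      (h \<boxtimes> (k \<boxtimes> l)) \<cdot> (Id C \<one> \<boxtimes> ?l) \<cdot> ?l"
    by (simp add: comp_reduce[OF unit_coherence(1)])
  also have "\<dots> = jtens x a (y \<otimes> z) (b \<otimes> c) h (jtens y b z c k l)"
    unfolding jtens_def by (simp add: tm)
  finally show ?thesis .
qed

lemma jtens_symm:
  assumes [simp]: "x \<in> Obj C" "a \<in> Obj C" "y \<in> Obj C" "b \<in> Obj C"
    "h \<in> Arr C" "k \<in> Arr C" "Dom C h = \<one>" "Dom C k = \<one>" "Cod C h = x \<otimes> a" "Cod C k = y \<otimes> b"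
  shows "(symm C x y \<boxtimes> symm C a b) \<cdot> jtens x a y b h k = jtens y b x a k h"
  unfolding jtens_def by (simp add: comp_reduce[OF interchange_symm] symm_natural' unit_coherence)

lemma jtens_lunit:
  assumes [simp]: "x \<in> Obj C" "a \<in> Obj C" "h \<in> Arr C" "Dom C h = \<one>" "Cod C h = x \<otimes> a"
  shows "(lunit C x \<boxtimes> lunit C a) \<cdot> jtens \<one> \<one> x a (inv_arr C (lunit C \<one>)) h = h"
  unfolding jtens_def by (simp add: comp_reduce[OF interchange_lunit] tm lunit_natural')

lemma jtens_runit:
  assumes [simp]: "x \<in> Obj C" "a \<in> Obj C" "h \<in> Arr C" "Dom C h = \<one>" "Cod C h = x \<otimes> a"
  shows "(runit C x \<boxtimes> runit C a) \<cdot> jtens x a \<one> \<one> h (inv_arr C (lunit C \<one>)) = h"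
  unfolding jtens_def by (simp add: comp_reduce[OF interchange_runit] tm runit_natural' lunit_eq_runit)

section \<open>Coherence of the chosen inverses\<close>

lemma bul_arr_props:
  assumes f: "f \<in> Arr C"
  shows "bul_arr C f \<in> Arr C" "Dom C (bul_arr C f) = bul C (Dom C f)" "Cod C (bul_arr C f) = bul C (Cod C f)"
    "(bul_arr C f \<boxtimes> f) \<cdot> bulj C (Dom C f) = bulj C (Cod C f)"
proof -
  let ?P = "\<lambda>g. g \<in> hom C (bul C (Dom C f)) (bul C (Cod C f)) \<and> (g \<boxtimes> f) \<cdot> bulj C (Dom C f) = bulj C (Cod C f)"
  obtain g where "?P g"
    by (rule dual_exists[of f "bulj C (Dom C f)" "bulj C (Cod C f)" "bul C (Dom C f)" "bul C (Cod C f)"])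
      (use f in \<open>auto simp: hom_iff\<close>)
  moreover have "g' = g" if "?P g'" for g'
    by (rule dual_unique[of _ f "bulj C (Dom C f)"]) (use that \<open>?P g\<close> f in \<open>auto simp: hom_iff\<close>)
  ultimately have "?P (bul_arr C f)" unfolding bul_arr_def by (rule theI)
  then show "bul_arr C f \<in> Arr C" "Dom C (bul_arr C f) = bul C (Dom C f)" "Cod C (bul_arr C f) = bul C (Cod C f)"
    "(bul_arr C f \<boxtimes> f) \<cdot> bulj C (Dom C f) = bulj C (Cod C f)" by (auto simp: hom_iff)
qed

declare bul_arr_props(1-3) [simp]

lemma bul_arr_eqI:
  assumes "f \<in> Arr C" "g \<in> Arr C" "Dom C g = bul C (Dom C f)" "Cod C g = bul C (Cod C f)"
    "(g \<boxtimes> f) \<cdot> bulj C (Dom C f) = bulj C (Cod C f)"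
  shows "bul_arr C f = g"
  by (rule dual_unique[of _ f "bulj C (Dom C f)"]) (use assms bul_arr_props in auto)

lemma bul_tens_props:
  assumes [simp]: "a \<in> Obj C" "b \<in> Obj C"
  shows "bul_tens C a b \<in> Arr C" "Dom C (bul_tens C a b) = bul C a \<otimes> bul C b" "Cod C (bul_tens C a b) = bul C (a \<otimes> b)"
    "(bul_tens C a b \<boxtimes> Id C (a \<otimes> b)) \<cdot> jtens (bul C a) a (bul C b) b (bulj C a) (bulj C b) = bulj C (a \<otimes> b)"
proof -
  let ?j = "jtens (bul C a) a (bul C b) b (bulj C a) (bulj C b)"
  let ?P = "\<lambda>g. g \<in> hom C (bul C a \<otimes> bul C b) (bul C (a \<otimes> b)) \<and> (g \<boxtimes> Id C (a \<otimes> b)) \<cdot> ?j = bulj C (a \<otimes> b)"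
  obtain g where "?P g"
    by (rule dual_exists[of "Id C (a \<otimes> b)" ?j "bulj C (a \<otimes> b)" "bul C a \<otimes> bul C b" "bul C (a \<otimes> b)"])
      (auto simp: hom_iff)
  moreover have "g' = g" if "?P g'" for g'
    by (rule dual_unique[of _ "Id C (a \<otimes> b)" ?j]) (use that \<open>?P g\<close> in \<open>auto simp: hom_iff\<close>)
  \<comment> \<open>The definition of \<open>bul_tens\<close> writes out \<open>jtens\<close> of the
    two arrows \<open>bulj\<close>, so unfolding \<open>jtens_def\<close> makes the two conditions
    coincide.\<close>
  ultimately have "?P (bul_tens C a b)" unfolding bul_tens_def jtens_def by (rule theI)
  then show "bul_tens C a b \<in> Arr C" "Dom C (bul_tens C a b) = bul C a \<otimes> bul C b" "Cod C (bul_tens C a b) = bul C (a \<otimes> b)"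
    "(bul_tens C a b \<boxtimes> Id C (a \<otimes> b)) \<cdot> ?j = bulj C (a \<otimes> b)" by (auto simp: hom_iff)
qed

declare bul_tens_props(1-3) [simp]

lemma bul_unit_props:
  shows "bul_unit C \<in> Arr C" "Dom C (bul_unit C) = \<one>" "Cod C (bul_unit C) = bul C \<one>"
    "(bul_unit C \<boxtimes> Id C \<one>) \<cdot> inv_arr C (lunit C \<one>) = bulj C \<one>"
proof -
  let ?P = "\<lambda>g. g \<in> hom C \<one> (bul C \<one>) \<and> (g \<boxtimes> Id C \<one>) \<cdot> inv_arr C (lunit C \<one>) = bulj C \<one>"
  obtain g where "?P g"
    by (rule dual_exists[of "Id C \<one>" "inv_arr C (lunit C \<one>)" "bulj C \<one>" \<one> "bul C \<one>"]) (auto simp: hom_iff)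
  moreover have "g' = g" if "?P g'" for g'
    by (rule dual_unique[of _ "Id C \<one>" "inv_arr C (lunit C \<one>)"]) (use that \<open>?P g\<close> in \<open>auto simp: hom_iff\<close>)
  ultimately have "?P (bul_unit C)" unfolding bul_unit_def by (rule theI)
  then show "bul_unit C \<in> Arr C" "Dom C (bul_unit C) = \<one>" "Cod C (bul_unit C) = bul C \<one>"
    "(bul_unit C \<boxtimes> Id C \<one>) \<cdot> inv_arr C (lunit C \<one>) = bulj C \<one>" by (auto simp: hom_iff)
qed

declare bul_unit_props(1-3) [simp]

lemma bul_arr_Id [simp]: "a \<in> Obj C ==> bul_arr C (Id C a) = Id C (bul C a)"
  by (rule bul_arr_eqI) auto

lemma bul_arr_comp:
  "f \<in> Arr C ==> g \<in> Arr C ==> Cod C f = Dom C g ==> bul_arr C (g \<cdot> f) = bul_arr C g \<cdot> bul_arr C f"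
  using bul_arr_props(4)[of f] bul_arr_props(4)[of g]
  by (intro bul_arr_eqI) (auto simp: tens_comp)

lemma bul_tens_natural:
  assumes [simp]: "f \<in> Arr C" "g \<in> Arr C" and "Cod C f = a" "Cod C g = b"
  shows "bul_tens C a b \<cdot> (bul_arr C f \<boxtimes> bul_arr C g) = bul_arr C (f \<boxtimes> g) \<cdot> bul_tens C (Dom C f) (Dom C g)"
proof -
  have [simp]: "a = Cod C f" "b = Cod C g" using assms by auto
  let ?j = "jtens (bul C (Dom C f)) (Dom C f) (bul C (Dom C g)) (Dom C g) (bulj C (Dom C f)) (bulj C (Dom C g))"
  have "((bul_tens C a b \<cdot> (bul_arr C f \<boxtimes> bul_arr C g)) \<boxtimes> (f \<boxtimes> g)) \<cdot> ?j
      = (bul_tens C a b \<boxtimes> Id C (a \<otimes> b)) \<cdot> ((bul_arr C f \<boxtimes> bul_arr C g) \<boxtimes> (f \<boxtimes> g)) \<cdot> ?j"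
    by (simp add: tm)
  also have "\<dots> = bulj C (a \<otimes> b)"
    using jtens_natural[of "bul_arr C f" "bul_arr C g" f g "bulj C (Dom C f)" "bulj C (Dom C g)"]
    by (simp add: bul_arr_props(4) bul_tens_props(4))
  also have "\<dots> = (bul_arr C (f \<boxtimes> g) \<boxtimes> (f \<boxtimes> g)) \<cdot> (bul_tens C (Dom C f) (Dom C g) \<boxtimes> Id C (Dom C f \<otimes> Dom C g)) \<cdot> ?j"
    using bul_arr_props(4)[of "f \<boxtimes> g"] by (simp add: bul_tens_props(4))
  also have "\<dots> = ((bul_arr C (f \<boxtimes> g) \<cdot> bul_tens C (Dom C f) (Dom C g)) \<boxtimes> (f \<boxtimes> g)) \<cdot> ?j"
    by (simp add: tm)
  finally show ?thesis by (rule dual_unique) simp_all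
qed

text \<open>Tensored with the associator of \<open>a\<close>, \<open>b\<close>, \<open>c\<close>,
  both sides carry the threefold \<open>jtens\<close> of the arrows \<open>bulj\<close> to
  \<open>bulj C (a \<otimes> (b \<otimes> c))\<close>, and \<open>dual_unique\<close> applies. The
  unit and symmetry laws follow the same pattern.\<close>

lemma bul_tens_assoc:
  assumes [simp]: "a \<in> Obj C" "b \<in> Obj C" "c \<in> Obj C"
  shows "bul_arr C (assoc C a b c) \<cdot> bul_tens C (a \<otimes> b) c \<cdot> (bul_tens C a b \<boxtimes> Id C (bul C c))
    = bul_tens C a (b \<otimes> c) \<cdot> (Id C (bul C a) \<boxtimes> bul_tens C b c) \<cdot> assoc C (bul C a) (bul C b) (bul C c)"
proof -
  let ?jj = "jtens (bul C a \<otimes> bul C b) (a \<otimes> b) (bul C c) c (jtens (bul C a) a (bul C b) b (bulj C a) (bulj C b)) (bulj C c)"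
  have "((bul_arr C (assoc C a b c) \<cdot> bul_tens C (a \<otimes> b) c \<cdot> (bul_tens C a b \<boxtimes> Id C (bul C c))) \<boxtimes> assoc C a b c) \<cdot> ?jj
     = (bul_arr C (assoc C a b c) \<boxtimes> assoc C a b c) \<cdot> (bul_tens C (a \<otimes> b) c \<boxtimes> Id C ((a \<otimes> b) \<otimes> c)) \<cdot>
        ((bul_tens C a b \<boxtimes> Id C (bul C c)) \<boxtimes> (Id C (a \<otimes> b) \<boxtimes> Id C c)) \<cdot> ?jj"
    by (simp add: tm)
  also have "\<dots> = bulj C (a \<otimes> (b \<otimes> c))"
    using jtens_natural[of "bul_tens C a b" "Id C (bul C c)" "Id C (a \<otimes> b)" "Id C c" "jtens (bul C a) a (bul C b) b (bulj C a) (bulj C b)" "bulj C c"]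
      bul_arr_props(4)[of "assoc C a b c"]
    by (simp add: bul_tens_props(4))
  also have "\<dots> = (bul_tens C a (b \<otimes> c) \<boxtimes> Id C (a \<otimes> (b \<otimes> c))) \<cdot>
        ((Id C (bul C a) \<boxtimes> bul_tens C b c) \<boxtimes> (Id C a \<boxtimes> Id C (b \<otimes> c))) \<cdot>
        (assoc C (bul C a) (bul C b) (bul C c) \<boxtimes> assoc C a b c) \<cdot> ?jj"
    using jtens_natural[of "Id C (bul C a)" "bul_tens C b c" "Id C a" "Id C (b \<otimes> c)" "bulj C a" "jtens (bul C b) b (bul C c) c (bulj C b) (bulj C c)"]
    by (simp add: bul_tens_props(4) jtens_assoc)
  also have "\<dots> = ((bul_tens C a (b \<otimes> c) \<cdot> (Id C (bul C a) \<boxtimes> bul_tens C b c) \<cdot> assoc C (bul C a) (bul C b) (bul C c)) \<boxtimes> assoc C a b c) \<cdot> ?jj"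
    by (simp add: tm)
  finally show ?thesis by (rule dual_unique) simp_all
qed

lemma bul_tens_lunit:
  assumes [simp]: "a \<in> Obj C"
  shows "bul_arr C (lunit C a) \<cdot> bul_tens C \<one> a \<cdot> (bul_unit C \<boxtimes> Id C (bul C a)) = lunit C (bul C a)"
proof -
  let ?jj = "jtens \<one> \<one> (bul C a) a (inv_arr C (lunit C \<one>)) (bulj C a)"
  have "((bul_arr C (lunit C a) \<cdot> bul_tens C \<one> a \<cdot> (bul_unit C \<boxtimes> Id C (bul C a))) \<boxtimes> lunit C a) \<cdot> ?jj
     = (bul_arr C (lunit C a) \<boxtimes> lunit C a) \<cdot> (bul_tens C \<one> a \<boxtimes> Id C (\<one> \<otimes> a)) \<cdot> ((bul_unit C \<boxtimes> Id C (bul C a)) \<boxtimes> (Id C \<one> \<boxtimes> Id C a)) \<cdot> ?jj"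
    by (simp add: tm)
  also have "\<dots> = bulj C a"
    using jtens_natural[of "bul_unit C" "Id C (bul C a)" "Id C \<one>" "Id C a" "inv_arr C (lunit C \<one>)" "bulj C a"]
      bul_arr_props(4)[of "lunit C a"]
    by (simp add: bul_unit_props(4) bul_tens_props(4))
  also have "\<dots> = (lunit C (bul C a) \<boxtimes> lunit C a) \<cdot> ?jj" by (simp add: jtens_lunit)
  finally show ?thesis by (rule dual_unique) simp_all
qed

lemma bul_tens_runit:
  assumes [simp]: "a \<in> Obj C"
  shows "bul_arr C (runit C a) \<cdot> bul_tens C a \<one> \<cdot> (Id C (bul C a) \<boxtimes> bul_unit C) = runit C (bul C a)"
proof -
  let ?jj = "jtens (bul C a) a \<one> \<one> (bulj C a) (inv_arr C (lunit C \<one>))"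
  have "((bul_arr C (runit C a) \<cdot> bul_tens C a \<one> \<cdot> (Id C (bul C a) \<boxtimes> bul_unit C)) \<boxtimes> runit C a) \<cdot> ?jj
     = (bul_arr C (runit C a) \<boxtimes> runit C a) \<cdot> (bul_tens C a \<one> \<boxtimes> Id C (a \<otimes> \<one>)) \<cdot> ((Id C (bul C a) \<boxtimes> bul_unit C) \<boxtimes> (Id C a \<boxtimes> Id C \<one>)) \<cdot> ?jj"
    by (simp add: tm)
  also have "\<dots> = bulj C a"
    using jtens_natural[of "Id C (bul C a)" "bul_unit C" "Id C a" "Id C \<one>" "bulj C a" "inv_arr C (lunit C \<one>)"]
      bul_arr_props(4)[of "runit C a"]
    by (simp add: bul_unit_props(4) bul_tens_props(4))
  also have "\<dots> = (runit C (bul C a) \<boxtimes> runit C a) \<cdot> ?jj" by (simp add: jtens_runit)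
  finally show ?thesis by (rule dual_unique) simp_all
qed

lemma bul_tens_symm:
  assumes [simp]: "a \<in> Obj C" "b \<in> Obj C"
  shows "bul_arr C (symm C a b) \<cdot> bul_tens C a b = bul_tens C b a \<cdot> symm C (bul C a) (bul C b)"
proof -
  let ?jj = "jtens (bul C a) a (bul C b) b (bulj C a) (bulj C b)"
  have "((bul_arr C (symm C a b) \<cdot> bul_tens C a b) \<boxtimes> symm C a b) \<cdot> ?jj
     = (bul_arr C (symm C a b) \<boxtimes> symm C a b) \<cdot> (bul_tens C a b \<boxtimes> Id C (a \<otimes> b)) \<cdot> ?jj"
    by (simp add: tm)
  also have "\<dots> = bulj C (b \<otimes> a)" using bul_arr_props(4)[of "symm C a b"] by (simp add: bul_tens_props(4))
  also have "\<dots> = (bul_tens C b a \<boxtimes> Id C (b \<otimes> a)) \<cdot> (symm C (bul C a) (bul C b) \<boxtimes> symm C a b) \<cdot> ?jj"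
    by (simp add: jtens_symm bul_tens_props(4))
  also have "\<dots> = ((bul_tens C b a \<cdot> symm C (bul C a) (bul C b)) \<boxtimes> symm C a b) \<cdot> ?jj"
    by (simp add: tm)
  finally show ?thesis by (rule dual_unique) simp_all
qed

text \<open>\<open>interchange_assoc\<close> multiplied by inverse interchanges. The former serves
  the axioms of a single arrow \<open>tensF F G\<close>; this form and the three after it serve the
  monoidality of the pointwise associator, symmetry and unitors.\<close>

lemma interchange_assoc2:
  assumes [simp]: "a \<in> Obj C" "b \<in> Obj C" "c \<in> Obj C" "d \<in> Obj C" "e \<in> Obj C" "f \<in> Obj C"
  shows "assoc C (a \<otimes> b) (c \<otimes> d) (e \<otimes> f) \<cdot> (interchange C a c b d \<boxtimes> Id C (e \<otimes> f)) \<cdot> interchange C (a \<otimes> c) e (b \<otimes> d) f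
    = (Id C (a \<otimes> b) \<boxtimes> interchange C c e d f) \<cdot> interchange C a (c \<otimes> e) b (d \<otimes> f) \<cdot> (assoc C a c e \<boxtimes> assoc C b d f)"
proof (rule cancel_right[of _ "interchange C (a \<otimes> c) (b \<otimes> d) e f \<cdot> (interchange C a b c d \<boxtimes> Id C (e \<otimes> f))"])
  show "(assoc C (a \<otimes> b) (c \<otimes> d) (e \<otimes> f) \<cdot> (interchange C a c b d \<boxtimes> Id C (e \<otimes> f)) \<cdot> interchange C (a \<otimes> c) e (b \<otimes> d) f) \<cdot>
     (interchange C (a \<otimes> c) (b \<otimes> d) e f \<cdot> (interchange C a b c d \<boxtimes> Id C (e \<otimes> f))) =
    ((Id C (a \<otimes> b) \<boxtimes> interchange C c e d f) \<cdot> interchange C a (c \<otimes> e) b (d \<otimes> f) \<cdot> (assoc C a c e \<boxtimes> assoc C b d f)) \<cdot>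
     (interchange C (a \<otimes> c) (b \<otimes> d) e f \<cdot> (interchange C a b c d \<boxtimes> Id C (e \<otimes> f)))"
    by (simp add: interchange_assoc comp_reduce[OF interchange_interchange] interchange_interchange tm)
qed simp_all

lemma interchange_symm2:
  assumes [simp]: "a \<in> Obj C" "b \<in> Obj C" "c \<in> Obj C" "d \<in> Obj C"
  shows "interchange C b a d c \<cdot> (symm C a b \<boxtimes> symm C c d) = symm C (a \<otimes> c) (b \<otimes> d) \<cdot> interchange C a b c d"
proof (rule cancel_right[of _ "interchange C a c b d"])
  show "(interchange C b a d c \<cdot> (symm C a b \<boxtimes> symm C c d)) \<cdot> interchange C a c b d = (symm C (a \<otimes> c) (b \<otimes> d) \<cdot> interchange C a b c d) \<cdot> interchange C a c b d"
    by (simp add: interchange_symm comp_reduce[OF interchange_interchange] interchange_interchange)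
qed simp_all

lemma interchange_lunit2:
  assumes [simp]: "a \<in> Obj C" "b \<in> Obj C"
  shows "lunit C (a \<otimes> b) \<cdot> (lunit C \<one> \<boxtimes> Id C (a \<otimes> b)) \<cdot> interchange C \<one> a \<one> b = lunit C a \<boxtimes> lunit C b"
  by (simp add: comp_reduce[OF interchange_lunit[symmetric]] interchange_interchange)

lemma interchange_runit2:
  assumes [simp]: "a \<in> Obj C" "b \<in> Obj C"
  shows "runit C (a \<otimes> b) \<cdot> (Id C (a \<otimes> b) \<boxtimes> lunit C \<one>) \<cdot> interchange C a \<one> b \<one> = runit C a \<boxtimes> runit C b"
  by (simp add: comp_reduce[OF interchange_runit[symmetric]] interchange_interchange)

end

section \<open>Arrows and 2-cells\<close>

locale spc_arrow = B: symmetric_picard_category B + C: symmetric_picard_category C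
  for B :: "('o, 'a) spc" and C :: "('p, 'b) spc" and F :: "('o, 'a, 'p, 'b) smf" +
  assumes arrow: "F \<in> arrows B C"
begin

abbreviation compC (infixr "\<bullet>" 60) where "g \<bullet> f \<equiv> Comp C g f"
abbreviation tensC (infixr "\<odot>" 70) where "g \<odot> f \<equiv> tensA C g f"
abbreviation compB (infixr "\<bullet>\<^sub>B" 60) where "g \<bullet>\<^sub>B f \<equiv> Comp B g f"
abbreviation tensB (infixr "\<odot>\<^sub>B" 70) where "g \<odot>\<^sub>B f \<equiv> tensA B g f"
abbreviation tensCO (infixr "\<oplus>" 70) where "x \<oplus> y \<equiv> tensO C x y"
abbreviation tensBO (infixr "\<oplus>\<^sub>B" 70) where "x \<oplus>\<^sub>B y \<equiv> tensO B x y"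

lemma src_tgt [simp]: "Src F = B" "Tgt F = C"
  using arrow by (auto simp: arrows_def)

lemma smf: "SMF F"
  using arrow by (auto simp: arrows_def)

lemmas smf_rules = symmetric_monoidal_functor.fobj_closed[OF smf] symmetric_monoidal_functor.farr_hom[OF smf]
  symmetric_monoidal_functor.farr_Id[OF smf] symmetric_monoidal_functor.farr_Comp[OF smf]
  symmetric_monoidal_functor.ften_hom[OF smf] symmetric_monoidal_functor.funit_hom[OF smf]
  symmetric_monoidal_functor.ften_nat[OF smf] symmetric_monoidal_functor.ften_assoc[OF smf]
  symmetric_monoidal_functor.ften_lunit[OF smf] symmetric_monoidal_functor.ften_runit[OF smf]
  symmetric_monoidal_functor.ften_symm[OF smf]

lemma exts: "fobj F \<in> extensional (Obj B)" "farr F \<in> extensional (Arr B)" "restrict2 (Obj B) (ften F) = ften F"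
  using symmetric_monoidal_functor.fobj_ext[OF smf] symmetric_monoidal_functor.farr_ext[OF smf]
    symmetric_monoidal_functor.ften_ext[OF smf] by auto

lemma fobj_closed [simp]: "x \<in> Obj B ==> fobj F x \<in> Obj C"
  using smf_rules(1) by simp

lemma farr_arr [simp]:
  "f \<in> Arr B ==> farr F f \<in> Arr C" "f \<in> Arr B ==> Dom C (farr F f) = fobj F (Dom B f)"
  "f \<in> Arr B ==> Cod C (farr F f) = fobj F (Cod B f)"
  using smf_rules(2)[of f "Dom B f" "Cod B f"] by (auto simp: hom_def)

lemma farr_Id [simp]: "x \<in> Obj B ==> farr F (Id B x) = Id C (fobj F x)"
  using smf_rules(3) by simp

lemma farr_Comp: "f \<in> Arr B ==> g \<in> Arr B ==> Cod B f = Dom B g ==> farr F (g \<bullet>\<^sub>B f) = farr F g \<bullet> farr F f"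
  using smf_rules(4)[of f "Dom B f" "Dom B g" g "Cod B g"] by (auto simp: hom_def)

lemma farr_merge: "f \<in> Arr B ==> g \<in> Arr B ==> Cod B f = Dom B g ==> farr F g \<bullet> farr F f = farr F (g \<bullet>\<^sub>B f)"
  by (simp add: farr_Comp)

lemmas farr_merge' = C.comp_reduce[OF farr_merge]

lemma farr_inv: "f \<in> Arr B ==> farr F (inv_arr B f) = inv_arr C (farr F f)"
  by (rule C.inv_arrI[symmetric]) (auto simp: farr_merge)

lemma ften_arr [simp]:
  assumes "x \<in> Obj B" "y \<in> Obj B"
  shows "ften F x y \<in> Arr C" "Dom C (ften F x y) = fobj F x \<oplus> fobj F y" "Cod C (ften F x y) = fobj F (x \<oplus>\<^sub>B y)"
  using smf_rules(5)[of x y] assms by (auto simp: hom_def)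

lemma funit_arr [simp]:
  "funit F \<in> Arr C" "Dom C (funit F) = \<one>\<^bsub>C\<^esub>" "Cod C (funit F) = fobj F \<one>\<^bsub>B\<^esub>"
  using smf_rules(6) by (auto simp: hom_def)

lemma ften_natural:
  "f \<in> Arr B ==> g \<in> Arr B ==> farr F (f \<odot>\<^sub>B g) \<bullet> ften F (Dom B f) (Dom B g) = ften F (Cod B f) (Cod B g) \<bullet> (farr F f \<odot> farr F g)"
  using smf_rules(7)[of f "Dom B f" "Cod B f" g "Dom B g" "Cod B g"] by (auto simp: hom_def)

lemma ften_natural2:
  "f \<in> Arr B ==> g \<in> Arr B ==> Cod B f = b ==> Cod B g = d ==>
    ften F b d \<bullet> (farr F f \<odot> farr F g) = farr F (f \<odot>\<^sub>B g) \<bullet> ften F (Dom B f) (Dom B g)"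
  using ften_natural[of f g] by auto

lemma ften_natural_id:
  "f \<in> Arr B ==> x \<in> Obj B ==> Cod B f = b ==> ften F b x \<bullet> (farr F f \<odot> Id C (fobj F x)) = farr F (f \<odot>\<^sub>B Id B x) \<bullet> ften F (Dom B f) x"
  "f \<in> Arr B ==> x \<in> Obj B ==> Cod B f = b ==> ften F x b \<bullet> (Id C (fobj F x) \<odot> farr F f) = farr F (Id B x \<odot>\<^sub>B f) \<bullet> ften F x (Dom B f)"
  using ften_natural[of f "Id B x"] ften_natural[of "Id B x" f] by auto

lemma ften_assoc:
  "x \<in> Obj B ==> y \<in> Obj B ==> z \<in> Obj B ==>
    farr F (assoc B x y z) \<bullet> ften F (x \<oplus>\<^sub>B y) z \<bullet> (ften F x y \<odot> Id C (fobj F z))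
      = ften F x (y \<oplus>\<^sub>B z) \<bullet> (Id C (fobj F x) \<odot> ften F y z) \<bullet> assoc C (fobj F x) (fobj F y) (fobj F z)"
  using smf_rules(8)[of x y z] by simp

lemma ften_lunit:
  "x \<in> Obj B ==> farr F (lunit B x) \<bullet> ften F \<one>\<^bsub>B\<^esub> x \<bullet> (funit F \<odot> Id C (fobj F x)) = lunit C (fobj F x)"
  using smf_rules(9)[of x] by simp

lemma ften_runit:
  "x \<in> Obj B ==> farr F (runit B x) \<bullet> ften F x \<one>\<^bsub>B\<^esub> \<bullet> (Id C (fobj F x) \<odot> funit F) = runit C (fobj F x)"
  using smf_rules(10)[of x] by simp

lemma ften_symm:
  "x \<in> Obj B ==> y \<in> Obj B ==> farr F (symm B x y) \<bullet> ften F x y = ften F y x \<bullet> symm C (fobj F x) (fobj F y)"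
  using smf_rules(11)[of x y] by simp

text \<open>Preservation of the symmetry, conjugated by the associativity axiom on both
  sides.\<close>

lemma ften_xch:
  assumes [simp]: "b \<in> Obj B" "c \<in> Obj B" "x \<in> Obj B"
  shows "farr F (B.xch b c x) \<bullet> ften F b (c \<oplus>\<^sub>B x) \<bullet> (Id C (fobj F b) \<odot> ften F c x)
    = ften F c (b \<oplus>\<^sub>B x) \<bullet> (Id C (fobj F c) \<odot> ften F b x) \<bullet> C.xch (fobj F b) (fobj F c) (fobj F x)" (is "?L = ?R")
proof (rule C.cancel_right[of _ "assoc C (fobj F b) (fobj F c) (fobj F x)"])
  have "?L \<bullet> assoc C (fobj F b) (fobj F c) (fobj F x)
     = farr F (B.xch b c x) \<bullet> farr F (assoc B b c x) \<bullet> ften F (b \<oplus>\<^sub>B c) x \<bullet> (ften F b c \<odot> Id C (fobj F x))"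
    by (simp add: ften_assoc)
  also have "\<dots> = farr F (assoc B c b x) \<bullet> ften F (c \<oplus>\<^sub>B b) x \<bullet> (farr F (symm B b c) \<odot> Id C (fobj F x)) \<bullet> (ften F b c \<odot> Id C (fobj F x))"
    by (simp add: farr_merge' B.xch_assoc) (simp add: farr_Comp C.comp_reduce[OF ften_natural_id(1)])
  also have "\<dots> = farr F (assoc B c b x) \<bullet> ften F (c \<oplus>\<^sub>B b) x \<bullet> (ften F c b \<odot> Id C (fobj F x)) \<bullet> (symm C (fobj F b) (fobj F c) \<odot> Id C (fobj F x))"
    by (simp add: C.tens_merge ften_symm)
  also have "\<dots> = ften F c (b \<oplus>\<^sub>B x) \<bullet> (Id C (fobj F c) \<odot> ften F b x) \<bullet> assoc C (fobj F c) (fobj F b) (fobj F x)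
      \<bullet> (symm C (fobj F b) (fobj F c) \<odot> Id C (fobj F x))"
    by (simp add: C.comp_reduce3[OF ften_assoc])
  also have "\<dots> = ?R \<bullet> assoc C (fobj F b) (fobj F c) (fobj F x)"
    by (simp add: C.xch_assoc)
  finally show "?L \<bullet> assoc C (fobj F b) (fobj F c) (fobj F x) = ?R \<bullet> assoc C (fobj F b) (fobj F c) (fobj F x)" .
qed simp_all

text \<open>The point at which preservation of the symmetry matters for hom categories: it makes the
  family \<open>ften F (G x) (H x)\<close> a monoidal transformation in \<open>x\<close>, hence
  makes \<open>[1,F]\<close> an arrow. The proof reassociates so that the exchange of the middle
  factors can be treated by \<open>ften_xch\<close>.\<close>

lemma ften_interchange:
  assumes [simp]: "a \<in> Obj B" "b \<in> Obj B" "c \<in> Obj B" "d \<in> Obj B"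
  shows "farr F (interchange B a b c d) \<bullet> ften F (a \<oplus>\<^sub>B b) (c \<oplus>\<^sub>B d) \<bullet> (ften F a b \<odot> ften F c d)
    = ften F (a \<oplus>\<^sub>B c) (b \<oplus>\<^sub>B d) \<bullet> (ften F a c \<odot> ften F b d) \<bullet> interchange C (fobj F a) (fobj F b) (fobj F c) (fobj F d)"
    (is "?L = ?R")
proof (rule C.cancel_left[of "farr F (assoc B a c (b \<oplus>\<^sub>B d))"])
  let ?a = "fobj F a" and ?b = "fobj F b" and ?c = "fobj F c" and ?d = "fobj F d"
  have "farr F (assoc B a c (b \<oplus>\<^sub>B d)) \<bullet> ?L =
     farr F (assoc B a c (b \<oplus>\<^sub>B d) \<bullet>\<^sub>B interchange B a b c d) \<bullet> ften F (a \<oplus>\<^sub>B b) (c \<oplus>\<^sub>B d) \<bullet> (ften F a b \<odot> Id C (fobj F (c \<oplus>\<^sub>B d)))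
       \<bullet> (Id C (?a \<oplus> ?b) \<odot> ften F c d)"
    using C.tens_split(1)[of "ften F a b" "ften F c d"] by (simp add: farr_merge')
  also have "\<dots> = farr F (Id B a \<odot>\<^sub>B B.xch b c d) \<bullet> ften F a (b \<oplus>\<^sub>B (c \<oplus>\<^sub>B d)) \<bullet> (Id C ?a \<odot> ften F b (c \<oplus>\<^sub>B d)) \<bullet>
      assoc C ?a ?b (fobj F (c \<oplus>\<^sub>B d)) \<bullet> (Id C (?a \<oplus> ?b) \<odot> ften F c d)"
    by (simp add: B.assoc_interchange farr_Comp C.comp_reduce3[OF ften_assoc])
  also have "\<dots> = ften F a (c \<oplus>\<^sub>B (b \<oplus>\<^sub>B d)) \<bullet> (Id C ?a \<odot> farr F (B.xch b c d)) \<bullet> (Id C ?a \<odot> ften F b (c \<oplus>\<^sub>B d)) \<bullet>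
      (Id C ?a \<odot> (Id C ?b \<odot> ften F c d)) \<bullet> assoc C ?a ?b (?c \<oplus> ?d)"
    by (simp add: C.assoc_natural_id C.comp_reduce[OF ften_natural_id(2)])
  also have "\<dots> = ften F a (c \<oplus>\<^sub>B (b \<oplus>\<^sub>B d)) \<bullet> (Id C ?a \<odot> (farr F (B.xch b c d) \<bullet> ften F b (c \<oplus>\<^sub>B d) \<bullet>
      (Id C ?b \<odot> ften F c d))) \<bullet> assoc C ?a ?b (?c \<oplus> ?d)"
    by (simp add: C.tensL)
  also have "\<dots> = ften F a (c \<oplus>\<^sub>B (b \<oplus>\<^sub>B d)) \<bullet> (Id C ?a \<odot> ften F c (b \<oplus>\<^sub>B d)) \<bullet> (Id C ?a \<odot> (Id C ?c \<odot> ften F b d))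
      \<bullet> (Id C ?a \<odot> C.xch ?b ?c ?d) \<bullet> assoc C ?a ?b (?c \<oplus> ?d)"
    by (simp add: ften_xch C.tensL)
  also have "\<dots> = ften F a (c \<oplus>\<^sub>B (b \<oplus>\<^sub>B d)) \<bullet> (Id C ?a \<odot> ften F c (b \<oplus>\<^sub>B d)) \<bullet> assoc C ?a ?c (fobj F (b \<oplus>\<^sub>B d)) \<bullet>
      (Id C (?a \<oplus> ?c) \<odot> ften F b d) \<bullet> interchange C ?a ?b ?c ?d"
    by (simp add: C.assoc_interchange C.comp_reduce[OF C.assoc_natural_id(1)])
  also have "\<dots> = farr F (assoc B a c (b \<oplus>\<^sub>B d)) \<bullet> ften F (a \<oplus>\<^sub>B c) (b \<oplus>\<^sub>B d) \<bullet> (ften F a c \<odot> Id C (fobj F (b \<oplus>\<^sub>B d))) \<bullet>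
      (Id C (?a \<oplus> ?c) \<odot> ften F b d) \<bullet> interchange C ?a ?b ?c ?d"
    by (simp add: C.comp_reduce3[OF ften_assoc])
  also have "\<dots> = farr F (assoc B a c (b \<oplus>\<^sub>B d)) \<bullet> ?R"
    using C.tens_split(1)[of "ften F a c" "ften F b d"] by simp
  finally show "farr F (assoc B a c (b \<oplus>\<^sub>B d)) \<bullet> ?L = farr F (assoc B a c (b \<oplus>\<^sub>B d)) \<bullet> ?R" .
qed simp_all

end

lemma spc_arrow: "F \<in> arrows B C ==> spc_arrow B C F"
  by (auto simp: spc_arrow_def spc_arrow_axioms_def arrows_def symmetric_monoidal_functor_def)

lemma arrows_spc: "F \<in> arrows B C ==> SPC B" "F \<in> arrows B C ==> SPC C"
  by (auto simp: arrows_def symmetric_monoidal_functor_def)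

lemma arrows_src_tgt: "F \<in> arrows B C ==> Src F = B" "F \<in> arrows B C ==> Tgt F = C"
  by (auto simp: arrows_def)

lemma arrowsI:
  fixes B :: "('o, 'a) spc" (structure) and C :: "('p, 'b) spc"
  assumes B: "SPC B" and C: "SPC C"
    and st: "Src F = B" "Tgt F = C"
    and ext: "fobj F \<in> extensional (Obj B)" "farr F \<in> extensional (Arr B)" "restrict2 (Obj B) (ften F) = ften F"
    and o: "\<And>x. x \<in> Obj B ==> fobj F x \<in> Obj C"
    and a: "\<And>f. f \<in> Arr B ==> farr F f \<in> hom C (fobj F (Dom B f)) (fobj F (Cod B f))"
    and i: "\<And>x. x \<in> Obj B ==> farr F (Id B x) = Id C (fobj F x)"
    and c: "\<And>f g. f \<in> Arr B ==> g \<in> Arr B ==> Cod B f = Dom B g ==> farr F (Comp B g f) = Comp C (farr F g) (farr F f)"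
    and t: "\<And>x y. x \<in> Obj B ==> y \<in> Obj B ==> ften F x y \<in> hom C (tensO C (fobj F x) (fobj F y)) (fobj F (tensO B x y))"
    and u: "funit F \<in> hom C \<one>\<^bsub>C\<^esub> (fobj F \<one>)"
    and n: "\<And>f g. f \<in> Arr B ==> g \<in> Arr B ==>
      Comp C (farr F (tensA B f g)) (ften F (Dom B f) (Dom B g)) = Comp C (ften F (Cod B f) (Cod B g)) (tensA C (farr F f) (farr F g))"
    and as: "\<And>x y z. x \<in> Obj B ==> y \<in> Obj B ==> z \<in> Obj B ==>
      Comp C (farr F (assoc B x y z)) (Comp C (ften F (tensO B x y) z) (tensA C (ften F x y) (Id C (fobj F z))))
      = Comp C (ften F x (tensO B y z)) (Comp C (tensA C (Id C (fobj F x)) (ften F y z)) (assoc C (fobj F x) (fobj F y) (fobj F z)))"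
    and l: "\<And>x. x \<in> Obj B ==> Comp C (farr F (lunit B x)) (Comp C (ften F \<one> x) (tensA C (funit F) (Id C (fobj F x)))) = lunit C (fobj F x)"
    and r: "\<And>x. x \<in> Obj B ==> Comp C (farr F (runit B x)) (Comp C (ften F x \<one>) (tensA C (Id C (fobj F x)) (funit F))) = runit C (fobj F x)"
    and s: "\<And>x y. x \<in> Obj B ==> y \<in> Obj B ==> Comp C (farr F (symm B x y)) (ften F x y) = Comp C (ften F y x) (symm C (fobj F x) (fobj F y))"
  shows "F \<in> arrows B C"
proof -
  interpret B: symmetric_picard_category B by fact
  interpret C: symmetric_picard_category C by fact
  have "SMF F"
    unfolding symmetric_monoidal_functor_def symmetric_monoidal_functor_axioms_def st
    by (intro conjI allI impI) (use B C ext o a i c t u n as l r s in \<open>auto simp: hom_def\<close>)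
  then show ?thesis using st by (simp add: arrows_def)
qed

lemma smf_eqI:
  fixes F G :: "('o, 'a, 'p, 'b) smf"
  assumes "F \<in> arrows B C" "G \<in> arrows B C"
    and "\<And>x. x \<in> Obj B ==> fobj F x = fobj G x" "\<And>f. f \<in> Arr B ==> farr F f = farr G f"
    and "\<And>x y. x \<in> Obj B ==> y \<in> Obj B ==> ften F x y = ften G x y" "funit F = funit G"
  shows "F = G"
proof -
  interpret F: spc_arrow B C F using assms(1) by (rule spc_arrow)
  interpret G: spc_arrow B C G using assms(2) by (rule spc_arrow)
  have "fobj F = fobj G" using F.exts(1) G.exts(1) assms(3) by (rule extensionalityI)
  moreover have "farr F = farr G" using F.exts(2) G.exts(2) assms(4) by (rule extensionalityI)
  moreover have "ften F = ften G"
    by (subst F.exts(3)[symmetric], subst G.exts(3)[symmetric]) (auto simp: restrict2_def assms(5) fun_eq_iff)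
  ultimately show ?thesis using F.src_tgt G.src_tgt assms(6) by simp
qed

lemma restrict2_apply [simp]: "x \<in> A ==> y \<in> A ==> restrict2 A f x y = f x y"
  by (simp add: restrict2_def)

lemma restrict2_restrict2 [simp]: "restrict2 A (restrict2 A f) = restrict2 A f"
  by (simp add: restrict2_def fun_eq_iff)

locale spc_cell = F: spc_arrow B C F + G: spc_arrow B C G
  for B :: "('o, 'a) spc" and C :: "('p, 'b) spc" and F G :: "('o, 'a, 'p, 'b) smf" and \<sigma> :: "('o, 'a, 'p, 'b) mnt" +
  assumes cell: "\<sigma> \<in> cells F G"
begin

lemma mt: "monoidal_transformation \<sigma>" using cell by (simp add: cells_def)

lemma bounds [simp]: "nsrc \<sigma> = F" "ntgt \<sigma> = G" "mnt_dom \<sigma> = B" "mnt_cod \<sigma> = C"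
  using cell by (auto simp: cells_def mnt_dom_def mnt_cod_def)

lemma ncomp_ext: "ncomp \<sigma> \<in> extensional (Obj B)"
  using monoidal_transformation.ncomp_ext[OF mt] by simp

lemma ncomp_arr [simp]:
  assumes "x \<in> Obj B"
  shows "\<sigma> \<diamondop> x \<in> Arr C" "Dom C (\<sigma> \<diamondop> x) = fobj F x" "Cod C (\<sigma> \<diamondop> x) = fobj G x"
  using monoidal_transformation.ncomp_hom[OF mt, of x] assms by (auto simp: hom_def)

lemma natural: "f \<in> Arr B ==> Comp C (\<sigma> \<diamondop> (Cod B f)) (farr F f) = Comp C (farr G f) (\<sigma> \<diamondop> (Dom B f))"
  using monoidal_transformation.natural[OF mt, of f "Dom B f" "Cod B f"] by (auto simp: hom_def)

lemma natural2: "f \<in> Arr B ==> Cod B f = y ==> Comp C (\<sigma> \<diamondop> y) (farr F f) = Comp C (farr G f) (\<sigma> \<diamondop> (Dom B f))"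
  using natural by auto

lemma tens: "x \<in> Obj B ==> y \<in> Obj B ==>
    Comp C (\<sigma> \<diamondop> (tensO B x y)) (ften F x y) = Comp C (ften G x y) (tensA C (\<sigma> \<diamondop> x) (\<sigma> \<diamondop> y))"
  using monoidal_transformation.monoidal_tens[OF mt, of x y] by simp

lemma unit: "Comp C (\<sigma> \<diamondop> \<one>\<^bsub>B\<^esub>) (funit F) = funit G"
  using monoidal_transformation.monoidal_unit[OF mt] by simp

end

lemma cells_bounds: "\<sigma> \<in> cells F G ==> nsrc \<sigma> = F" "\<sigma> \<in> cells F G ==> ntgt \<sigma> = G"
  by (auto simp: cells_def)

lemma cells_arrows:
  assumes "\<sigma> \<in> cells F G" shows "F \<in> arrows (Src F) (Tgt F)" "G \<in> arrows (Src F) (Tgt F)"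
proof -
  have "monoidal_transformation \<sigma>" using assms by (simp add: cells_def)
  then interpret monoidal_transformation \<sigma> .
  show "F \<in> arrows (Src F) (Tgt F)" "G \<in> arrows (Src F) (Tgt F)"
    using F.symmetric_monoidal_functor_axioms G.symmetric_monoidal_functor_axioms same_Src same_Tgt assms
    by (auto simp: arrows_def cells_def mnt_dom_def mnt_cod_def)
qed

lemma spc_cell: "\<sigma> \<in> cells F G ==> F \<in> arrows B C ==> spc_cell B C F G \<sigma>"
  using cells_arrows[of \<sigma> F G] arrows_src_tgt[of F B C]
  by (auto simp: spc_cell_def spc_cell_axioms_def intro: spc_arrow)

lemma spc_cell2: "\<sigma> \<in> cells F G ==> G \<in> arrows B C ==> spc_cell B C F G \<sigma>"
  using cells_arrows[of \<sigma> F G] arrows_src_tgt[of G B C] arrows_src_tgt[of G "Src F" "Tgt F"] spc_cell[of \<sigma> F G B C]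
  by simp

lemma cellsI:
  fixes B :: "('o, 'a) spc" and C :: "('p, 'b) spc"
  assumes F: "F \<in> arrows B C" and G: "G \<in> arrows B C" and st: "nsrc \<sigma> = F" "ntgt \<sigma> = G"
    and ext: "ncomp \<sigma> \<in> extensional (Obj B)"
    and a: "\<And>x. x \<in> Obj B ==> \<sigma> \<diamondop> x \<in> hom C (fobj F x) (fobj G x)"
    and n: "\<And>f. f \<in> Arr B ==> Comp C (\<sigma> \<diamondop> (Cod B f)) (farr F f) = Comp C (farr G f) (\<sigma> \<diamondop> (Dom B f))"
    and t: "\<And>x y. x \<in> Obj B ==> y \<in> Obj B ==>
      Comp C (\<sigma> \<diamondop> (tensO B x y)) (ften F x y) = Comp C (ften G x y) (tensA C (\<sigma> \<diamondop> x) (\<sigma> \<diamondop> y))"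
    and u: "Comp C (\<sigma> \<diamondop> \<one>\<^bsub>B\<^esub>) (funit F) = funit G"
  shows "\<sigma> \<in> cells F G"
proof -
  interpret F: spc_arrow B C F using F by (rule spc_arrow)
  interpret G: spc_arrow B C G using G by (rule spc_arrow)
  have "monoidal_transformation \<sigma>"
    unfolding monoidal_transformation_def monoidal_transformation_axioms_def mnt_dom_def mnt_cod_def st
    by (intro conjI allI impI) (use F.smf G.smf ext a n t u in \<open>auto simp: hom_def\<close>)
  then show ?thesis using st by (simp add: cells_def)
qed

lemma mnt_eqI:
  assumes "\<sigma> \<in> cells F G" "\<tau> \<in> cells F G" "F \<in> arrows B C" "\<And>x. x \<in> Obj B ==> \<sigma> \<diamondop> x = \<tau> \<diamondop> x"
  shows "\<sigma> = \<tau>"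
proof -
  interpret s: spc_cell B C F G \<sigma> using assms(1,3) by (rule spc_cell)
  interpret t: spc_cell B C F G \<tau> using assms(2,3) by (rule spc_cell)
  have "ncomp \<sigma> = ncomp \<tau>" using s.ncomp_ext t.ncomp_ext assms(4) by (rule extensionalityI)
  then show ?thesis using s.bounds t.bounds by simp
qed

subsection \<open>The pointwise structure\<close>

lemma idF_arrow: "SPC C ==> idF C \<in> arrows C C"
proof -
  assume C: "SPC C"
  then interpret C: symmetric_picard_category C .
  show ?thesis
    by (rule arrowsI) (use C in \<open>auto simp: idF_def C.hom_iff\<close>)
qed

lemma compF_arrow:
  fixes D (structure)
  assumes F: "F \<in> arrows B C" and G: "G \<in> arrows C D" shows "G \<circ>\<^sub>F F \<in> arrows B D"
proof -
  interpret F: spc_arrow B C F using F by (rule spc_arrow)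
  interpret G: spc_arrow C D G using G by (rule spc_arrow)
  show ?thesis
  proof (rule arrowsI)
    fix x y z assume [simp]: "x \<in> Obj B" "y \<in> Obj B" "z \<in> Obj B"
    have "farr G (farr F (assoc B x y z)) \<cdot> farr G (ften F (x \<otimes>\<^bsub>B\<^esub> y) z) \<cdot> ften G (fobj F (x \<otimes>\<^bsub>B\<^esub> y)) (fobj F z) \<cdot>
        ((farr G (ften F x y) \<cdot> ften G (fobj F x) (fobj F y)) \<boxtimes> Id D (fobj G (fobj F z)))
      = farr G (farr F (assoc B x y z) \<cdot>\<^bsub>C\<^esub> ften F (x \<otimes>\<^bsub>B\<^esub> y) z \<cdot>\<^bsub>C\<^esub> (ften F x y \<boxtimes>\<^bsub>C\<^esub> Id C (fobj F z))) \<cdot>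
        ften G (fobj F x \<otimes>\<^bsub>C\<^esub> fobj F y) (fobj F z) \<cdot> (ften G (fobj F x) (fobj F y) \<boxtimes> Id D (fobj G (fobj F z)))"
      by (simp add: G.C.tensR G.farr_Comp G.C.comp_reduce[OF G.ften_natural_id(1)])
    also have "\<dots> = farr G (ften F x (y \<otimes>\<^bsub>B\<^esub> z)) \<cdot> ften G (fobj F x) (fobj F (y \<otimes>\<^bsub>B\<^esub> z)) \<cdot>
        (Id D (fobj G (fobj F x)) \<boxtimes> (farr G (ften F y z) \<cdot> ften G (fobj F y) (fobj F z))) \<cdot>
        assoc D (fobj G (fobj F x)) (fobj G (fobj F y)) (fobj G (fobj F z))"
      by (simp add: F.ften_assoc G.C.tensL G.farr_Comp G.C.comp_reduce[OF G.ften_natural_id(2)] G.ften_assoc)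
    finally show "farr (G \<circ>\<^sub>F F) (assoc B x y z) \<cdot> ften (G \<circ>\<^sub>F F) (x \<otimes>\<^bsub>B\<^esub> y) z \<cdot> (ften (G \<circ>\<^sub>F F) x y \<boxtimes> Id D (fobj (G \<circ>\<^sub>F F) z))
      = ften (G \<circ>\<^sub>F F) x (y \<otimes>\<^bsub>B\<^esub> z) \<cdot> (Id D (fobj (G \<circ>\<^sub>F F) x) \<boxtimes> ften (G \<circ>\<^sub>F F) y z) \<cdot>
        assoc D (fobj (G \<circ>\<^sub>F F) x) (fobj (G \<circ>\<^sub>F F) y) (fobj (G \<circ>\<^sub>F F) z)"
      by (simp add: compF_def)
  next
    fix x assume [simp]: "x \<in> Obj B"
    have "farr G (farr F (lunit B x)) \<cdot> farr G (ften F \<one>\<^bsub>B\<^esub> x) \<cdot> ften G (fobj F \<one>\<^bsub>B\<^esub>) (fobj F x) \<cdot>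
        ((farr G (funit F) \<cdot> funit G) \<boxtimes> Id D (fobj G (fobj F x)))
       = farr G (farr F (lunit B x) \<cdot>\<^bsub>C\<^esub> ften F \<one>\<^bsub>B\<^esub> x \<cdot>\<^bsub>C\<^esub> (funit F \<boxtimes>\<^bsub>C\<^esub> Id C (fobj F x))) \<cdot>
        ften G \<one>\<^bsub>C\<^esub> (fobj F x) \<cdot> (funit G \<boxtimes> Id D (fobj G (fobj F x)))"
      by (simp add: G.C.tensR G.farr_Comp G.C.comp_reduce[OF G.ften_natural_id(1)])
    also have "\<dots> = lunit D (fobj G (fobj F x))" by (simp add: F.ften_lunit G.ften_lunit)
    finally show "farr (G \<circ>\<^sub>F F) (lunit B x) \<cdot> ften (G \<circ>\<^sub>F F) \<one>\<^bsub>B\<^esub> x \<cdot> (funit (G \<circ>\<^sub>F F) \<boxtimes> Id D (fobj (G \<circ>\<^sub>F F) x)) = lunit D (fobj (G \<circ>\<^sub>F F) x)"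
      by (simp add: compF_def)
    have "farr G (farr F (runit B x)) \<cdot> farr G (ften F x \<one>\<^bsub>B\<^esub>) \<cdot> ften G (fobj F x) (fobj F \<one>\<^bsub>B\<^esub>) \<cdot>
        (Id D (fobj G (fobj F x)) \<boxtimes> (farr G (funit F) \<cdot> funit G))
       = farr G (farr F (runit B x) \<cdot>\<^bsub>C\<^esub> ften F x \<one>\<^bsub>B\<^esub> \<cdot>\<^bsub>C\<^esub> (Id C (fobj F x) \<boxtimes>\<^bsub>C\<^esub> funit F)) \<cdot>
        ften G (fobj F x) \<one>\<^bsub>C\<^esub> \<cdot> (Id D (fobj G (fobj F x)) \<boxtimes> funit G)"
      by (simp add: G.C.tensL G.farr_Comp G.C.comp_reduce[OF G.ften_natural_id(2)])
    also have "\<dots> = runit D (fobj G (fobj F x))" by (simp add: F.ften_runit G.ften_runit)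
    finally show "farr (G \<circ>\<^sub>F F) (runit B x) \<cdot> ften (G \<circ>\<^sub>F F) x \<one>\<^bsub>B\<^esub> \<cdot> (Id D (fobj (G \<circ>\<^sub>F F) x) \<boxtimes> funit (G \<circ>\<^sub>F F)) = runit D (fobj (G \<circ>\<^sub>F F) x)"
      by (simp add: compF_def)
  next
    fix x y assume [simp]: "x \<in> Obj B" "y \<in> Obj B"
    show "farr (G \<circ>\<^sub>F F) (symm B x y) \<cdot> ften (G \<circ>\<^sub>F F) x y = ften (G \<circ>\<^sub>F F) y x \<cdot> symm D (fobj (G \<circ>\<^sub>F F) x) (fobj (G \<circ>\<^sub>F F) y)"
      by (simp add: compF_def G.farr_merge' F.ften_symm) (simp add: G.farr_Comp G.ften_symm)
  next
    fix f g assume [simp]: "f \<in> Arr B" "g \<in> Arr B"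
    show "farr (G \<circ>\<^sub>F F) (f \<boxtimes>\<^bsub>B\<^esub> g) \<cdot> ften (G \<circ>\<^sub>F F) (Dom B f) (Dom B g) =
      ften (G \<circ>\<^sub>F F) (Cod B f) (Cod B g) \<cdot> (farr (G \<circ>\<^sub>F F) f \<boxtimes> farr (G \<circ>\<^sub>F F) g)"
      by (simp add: compF_def G.farr_merge' F.ften_natural) (simp add: G.farr_Comp G.ften_natural2)
  qed (auto simp: compF_def G.C.hom_iff F.farr_Comp G.farr_Comp F.B.spc G.C.spc)
qed

text \<open>Each axiom is the tensor product of the axioms for \<open>F\<close> and
  \<open>G\<close>: naturality carries the interchange past the comparison arrows, and the
  corresponding coherence law of the interchange finishes.\<close>

lemma tensF_arrow:
  fixes C (structure)
  assumes F: "F \<in> arrows B C" and G: "G \<in> arrows B C" shows "tensF F G \<in> arrows B C"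
proof -
  interpret F: spc_arrow B C F using F by (rule spc_arrow)
  interpret G: spc_arrow B C G using G by (rule spc_arrow)
  note red = F.C.comp_reduce
  note tm = F.C.tens_merge red[OF F.C.tens_merge]
  show ?thesis
  proof (rule arrowsI)
    fix x y z assume [simp]: "x \<in> Obj B" "y \<in> Obj B" "z \<in> Obj B"
    let ?Fx = "fobj F x" and ?Fy = "fobj F y" and ?Fz = "fobj F z" and ?Gx = "fobj G x" and ?Gy = "fobj G y" and ?Gz = "fobj G z"
    have "(farr F (assoc B x y z) \<boxtimes> farr G (assoc B x y z)) \<cdot>
      (ften F (x \<otimes>\<^bsub>B\<^esub> y) z \<boxtimes> ften G (x \<otimes>\<^bsub>B\<^esub> y) z) \<cdot> interchange C (fobj F (x \<otimes>\<^bsub>B\<^esub> y)) (fobj G (x \<otimes>\<^bsub>B\<^esub> y)) ?Fz ?Gz \<cdot>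
      (((ften F x y \<boxtimes> ften G x y) \<cdot> interchange C ?Fx ?Gx ?Fy ?Gy) \<boxtimes> (Id C (?Fz \<otimes> ?Gz)))
     = (farr F (assoc B x y z) \<boxtimes> farr G (assoc B x y z)) \<cdot>
      (ften F (x \<otimes>\<^bsub>B\<^esub> y) z \<boxtimes> ften G (x \<otimes>\<^bsub>B\<^esub> y) z) \<cdot> interchange C (fobj F (x \<otimes>\<^bsub>B\<^esub> y)) (fobj G (x \<otimes>\<^bsub>B\<^esub> y)) ?Fz ?Gz \<cdot>
      ((ften F x y \<boxtimes> ften G x y) \<boxtimes> (Id C ?Fz \<boxtimes> Id C ?Gz)) \<cdot> (interchange C ?Fx ?Gx ?Fy ?Gy \<boxtimes> Id C (?Fz \<otimes> ?Gz))"
      by (simp add: F.C.tensR)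
    also have "\<dots> = ((farr F (assoc B x y z) \<cdot> ften F (x \<otimes>\<^bsub>B\<^esub> y) z \<cdot> (ften F x y \<boxtimes> Id C ?Fz)) \<boxtimes>
       (farr G (assoc B x y z) \<cdot> ften G (x \<otimes>\<^bsub>B\<^esub> y) z \<cdot> (ften G x y \<boxtimes> Id C ?Gz))) \<cdot>
       interchange C (?Fx \<otimes> ?Fy) (?Gx \<otimes> ?Gy) ?Fz ?Gz \<cdot> (interchange C ?Fx ?Gx ?Fy ?Gy \<boxtimes> Id C (?Fz \<otimes> ?Gz))"
      by (simp add: F.C.interchange_natural' del: F.C.tens_Id) (simp add: tm)
    also have "\<dots> = ((ften F x (y \<otimes>\<^bsub>B\<^esub> z) \<cdot> (Id C ?Fx \<boxtimes> ften F y z)) \<boxtimes> (ften G x (y \<otimes>\<^bsub>B\<^esub> z) \<cdot> (Id C ?Gx \<boxtimes> ften G y z))) \<cdot>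
       (assoc C ?Fx ?Fy ?Fz \<boxtimes> assoc C ?Gx ?Gy ?Gz) \<cdot>
       interchange C (?Fx \<otimes> ?Fy) (?Gx \<otimes> ?Gy) ?Fz ?Gz \<cdot> (interchange C ?Fx ?Gx ?Fy ?Gy \<boxtimes> Id C (?Fz \<otimes> ?Gz))"
      by (simp add: F.ften_assoc G.ften_assoc tm)
    also have "\<dots> = (ften F x (y \<otimes>\<^bsub>B\<^esub> z) \<boxtimes> ften G x (y \<otimes>\<^bsub>B\<^esub> z)) \<cdot> ((Id C ?Fx \<boxtimes> ften F y z) \<boxtimes> (Id C ?Gx \<boxtimes> ften G y z)) \<cdot>
       interchange C ?Fx ?Gx (?Fy \<otimes> ?Fz) (?Gy \<otimes> ?Gz) \<cdot> (Id C (?Fx \<otimes> ?Gx) \<boxtimes> interchange C ?Fy ?Gy ?Fz ?Gz) \<cdot>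
       assoc C (?Fx \<otimes> ?Gx) (?Fy \<otimes> ?Gy) (?Fz \<otimes> ?Gz)"
      by (simp add: F.C.interchange_assoc F.C.tens_comp)
    also have "\<dots> = (ften F x (y \<otimes>\<^bsub>B\<^esub> z) \<boxtimes> ften G x (y \<otimes>\<^bsub>B\<^esub> z)) \<cdot> interchange C ?Fx ?Gx (fobj F (y \<otimes>\<^bsub>B\<^esub> z)) (fobj G (y \<otimes>\<^bsub>B\<^esub> z)) \<cdot>
       ((Id C ?Fx \<boxtimes> Id C ?Gx) \<boxtimes> (ften F y z \<boxtimes> ften G y z)) \<cdot> (Id C (?Fx \<otimes> ?Gx) \<boxtimes> interchange C ?Fy ?Gy ?Fz ?Gz) \<cdot>
       assoc C (?Fx \<otimes> ?Gx) (?Fy \<otimes> ?Gy) (?Fz \<otimes> ?Gz)"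
      by (simp add: F.C.interchange_natural' del: F.C.tens_Id)
    finally show "farr (tensF F G) (assoc B x y z) \<cdot> ften (tensF F G) (x \<otimes>\<^bsub>B\<^esub> y) z \<cdot> (ften (tensF F G) x y \<boxtimes> Id C (fobj (tensF F G) z))
      = ften (tensF F G) x (y \<otimes>\<^bsub>B\<^esub> z) \<cdot> (Id C (fobj (tensF F G) x) \<boxtimes> ften (tensF F G) y z) \<cdot>
        assoc C (fobj (tensF F G) x) (fobj (tensF F G) y) (fobj (tensF F G) z)"
      by (simp add: tensF_def F.C.tensL)
  next
    fix x assume [simp]: "x \<in> Obj B"
    let ?Fx = "fobj F x" and ?Gx = "fobj G x"
    have "(farr F (lunit B x) \<boxtimes> farr G (lunit B x)) \<cdot> (ften F \<one>\<^bsub>B\<^esub> x \<boxtimes> ften G \<one>\<^bsub>B\<^esub> x) \<cdot>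
       interchange C (fobj F \<one>\<^bsub>B\<^esub>) (fobj G \<one>\<^bsub>B\<^esub>) ?Fx ?Gx \<cdot>
       (((funit F \<boxtimes> funit G) \<cdot> inv_arr C (lunit C \<one>)) \<boxtimes> (Id C (?Fx \<otimes> ?Gx)))
      = (farr F (lunit B x) \<boxtimes> farr G (lunit B x)) \<cdot> (ften F \<one>\<^bsub>B\<^esub> x \<boxtimes> ften G \<one>\<^bsub>B\<^esub> x) \<cdot>
       interchange C (fobj F \<one>\<^bsub>B\<^esub>) (fobj G \<one>\<^bsub>B\<^esub>) ?Fx ?Gx \<cdot>
       ((funit F \<boxtimes> funit G) \<boxtimes> (Id C ?Fx \<boxtimes> Id C ?Gx)) \<cdot> (inv_arr C (lunit C \<one>) \<boxtimes> (Id C (?Fx \<otimes> ?Gx)))"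
      by (simp add: F.C.tensR)
    also have "\<dots> = ((farr F (lunit B x) \<cdot> ften F \<one>\<^bsub>B\<^esub> x \<cdot> (funit F \<boxtimes> Id C ?Fx)) \<boxtimes> (farr G (lunit B x) \<cdot> ften G \<one>\<^bsub>B\<^esub> x \<cdot> (funit G \<boxtimes> Id C ?Gx))) \<cdot>
        interchange C \<one> \<one> ?Fx ?Gx \<cdot> (inv_arr C (lunit C \<one>) \<boxtimes> (Id C (?Fx \<otimes> ?Gx)))"
      by (simp add: F.C.interchange_natural' del: F.C.tens_Id) (simp add: tm)
    also have "\<dots> = lunit C (?Fx \<otimes> ?Gx)"
      by (simp add: F.ften_lunit G.ften_lunit red[OF F.C.interchange_lunit] F.C.tens_merge)
    finally show "farr (tensF F G) (lunit B x) \<cdot> ften (tensF F G) \<one>\<^bsub>B\<^esub> x \<cdot> (funit (tensF F G) \<boxtimes> Id C (fobj (tensF F G) x)) = lunit C (fobj (tensF F G) x)"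
      by (simp add: tensF_def)
    have "(farr F (runit B x) \<boxtimes> farr G (runit B x)) \<cdot> (ften F x \<one>\<^bsub>B\<^esub> \<boxtimes> ften G x \<one>\<^bsub>B\<^esub>) \<cdot>
       interchange C ?Fx ?Gx (fobj F \<one>\<^bsub>B\<^esub>) (fobj G \<one>\<^bsub>B\<^esub>) \<cdot>
       ((Id C (?Fx \<otimes> ?Gx)) \<boxtimes> ((funit F \<boxtimes> funit G) \<cdot> inv_arr C (lunit C \<one>)))
      = (farr F (runit B x) \<boxtimes> farr G (runit B x)) \<cdot> (ften F x \<one>\<^bsub>B\<^esub> \<boxtimes> ften G x \<one>\<^bsub>B\<^esub>) \<cdot>
       interchange C ?Fx ?Gx (fobj F \<one>\<^bsub>B\<^esub>) (fobj G \<one>\<^bsub>B\<^esub>) \<cdot>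
       ((Id C ?Fx \<boxtimes> Id C ?Gx) \<boxtimes> (funit F \<boxtimes> funit G)) \<cdot> ((Id C (?Fx \<otimes> ?Gx)) \<boxtimes> inv_arr C (lunit C \<one>))"
      by (simp add: F.C.tensL)
    also have "\<dots> = ((farr F (runit B x) \<cdot> ften F x \<one>\<^bsub>B\<^esub> \<cdot> (Id C ?Fx \<boxtimes> funit F)) \<boxtimes> (farr G (runit B x) \<cdot> ften G x \<one>\<^bsub>B\<^esub> \<cdot> (Id C ?Gx \<boxtimes> funit G))) \<cdot>
        interchange C ?Fx ?Gx \<one> \<one> \<cdot> ((Id C (?Fx \<otimes> ?Gx)) \<boxtimes> inv_arr C (lunit C \<one>))"
      by (simp add: F.C.interchange_natural' del: F.C.tens_Id) (simp add: tm)
    also have "\<dots> = runit C (?Fx \<otimes> ?Gx)"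
      by (simp add: F.ften_runit G.ften_runit red[OF F.C.interchange_runit] F.C.tens_merge)
    finally show "farr (tensF F G) (runit B x) \<cdot> ften (tensF F G) x \<one>\<^bsub>B\<^esub> \<cdot> (Id C (fobj (tensF F G) x) \<boxtimes> funit (tensF F G)) = runit C (fobj (tensF F G) x)"
      by (simp add: tensF_def)
  next
    fix x y assume [simp]: "x \<in> Obj B" "y \<in> Obj B"
    show "farr (tensF F G) (symm B x y) \<cdot> ften (tensF F G) x y = ften (tensF F G) y x \<cdot> symm C (fobj (tensF F G) x) (fobj (tensF F G) y)"
      by (simp add: tensF_def F.C.interchange_symm[symmetric]) (simp add: tm F.ften_symm G.ften_symm)
  next
    fix f g assume [simp]: "f \<in> Arr B" "g \<in> Arr B"
    show "farr (tensF F G) (f \<boxtimes>\<^bsub>B\<^esub> g) \<cdot> ften (tensF F G) (Dom B f) (Dom B g) =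
      ften (tensF F G) (Cod B f) (Cod B g) \<cdot> (farr (tensF F G) f \<boxtimes> farr (tensF F G) g)"
      by (simp add: tensF_def F.C.interchange_natural) (simp add: tm F.ften_natural G.ften_natural)
  qed (auto simp: tensF_def F.C.hom_iff F.farr_Comp G.farr_Comp F.C.tens_comp F.B.spc F.C.spc)
qed

lemma unitF_arrow:
  assumes B: "SPC B" and C: "SPC C" shows "unitF B C \<in> arrows B C"
proof -
  interpret B: symmetric_picard_category B by fact
  interpret C: symmetric_picard_category C by fact
  show ?thesis
    by (rule arrowsI)
      (use B C C.unit_coherence C.triangle[of "\<one>\<^bsub>C\<^esub>" "\<one>\<^bsub>C\<^esub>"] in \<open>auto simp: unitF_def C.hom_iff C.lunit_eq_runit\<close>)
qed

text \<open>Each axiom is \<open>bul_arr\<close> applied to the axiom for \<open>F\<close>, followed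
  by the matching law for \<open>bul_tens\<close> and \<open>bul_unit\<close>.\<close>

lemma bulF_arrow:
  fixes C (structure)
  assumes F: "F \<in> arrows B C" shows "bulF F \<in> arrows B C"
proof -
  interpret F: spc_arrow B C F using F by (rule spc_arrow)
  note red = F.C.comp_reduce
  have bm: "bul_arr C g \<cdot> bul_arr C f = bul_arr C (g \<cdot> f)" if "f \<in> Arr C" "g \<in> Arr C" "Cod C f = Dom C g" for f g
    using that by (simp add: F.C.bul_arr_comp)
  have bi: "bul_tens C a b \<cdot> (bul_arr C f \<boxtimes> Id C (bul C b)) = bul_arr C (f \<boxtimes> Id C b) \<cdot> bul_tens C (Dom C f) b"
      "bul_tens C b a \<cdot> (Id C (bul C b) \<boxtimes> bul_arr C f) = bul_arr C (Id C b \<boxtimes> f) \<cdot> bul_tens C b (Dom C f)"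
    if "f \<in> Arr C" "b \<in> Obj C" "Cod C f = a" for f a b
    using F.C.bul_tens_natural[of f "Id C b" a b] F.C.bul_tens_natural[of "Id C b" f b a] that by simp_all
  show ?thesis
  proof (rule arrowsI)
    fix x y z assume [simp]: "x \<in> Obj B" "y \<in> Obj B" "z \<in> Obj B"
    let ?Fx = "fobj F x" and ?Fy = "fobj F y" and ?Fz = "fobj F z"
    have "bul_arr C (farr F (assoc B x y z)) \<cdot> bul_arr C (ften F (x \<otimes>\<^bsub>B\<^esub> y) z) \<cdot> bul_tens C (fobj F (x \<otimes>\<^bsub>B\<^esub> y)) ?Fz \<cdot>
       ((bul_arr C (ften F x y) \<cdot> bul_tens C ?Fx ?Fy) \<boxtimes> Id C (bul C ?Fz))
      = bul_arr C (farr F (assoc B x y z) \<cdot> ften F (x \<otimes>\<^bsub>B\<^esub> y) z \<cdot> (ften F x y \<boxtimes> Id C ?Fz)) \<cdot> bul_tens C (?Fx \<otimes> ?Fy) ?Fz \<cdot>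
       (bul_tens C ?Fx ?Fy \<boxtimes> Id C (bul C ?Fz))"
      by (simp add: F.C.tensR red[OF bi(1)] F.C.bul_arr_comp)
    also have "\<dots> = bul_arr C (ften F x (y \<otimes>\<^bsub>B\<^esub> z)) \<cdot> bul_tens C ?Fx (fobj F (y \<otimes>\<^bsub>B\<^esub> z)) \<cdot>
      (Id C (bul C ?Fx) \<boxtimes> (bul_arr C (ften F y z) \<cdot> bul_tens C ?Fy ?Fz)) \<cdot> assoc C (bul C ?Fx) (bul C ?Fy) (bul C ?Fz)"
      by (simp add: F.ften_assoc F.C.tensL red[OF bi(2)] F.C.bul_arr_comp F.C.bul_tens_assoc)
    finally show "farr (bulF F) (assoc B x y z) \<cdot> ften (bulF F) (x \<otimes>\<^bsub>B\<^esub> y) z \<cdot> (ften (bulF F) x y \<boxtimes> Id C (fobj (bulF F) z))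
      = ften (bulF F) x (y \<otimes>\<^bsub>B\<^esub> z) \<cdot> (Id C (fobj (bulF F) x) \<boxtimes> ften (bulF F) y z) \<cdot>
        assoc C (fobj (bulF F) x) (fobj (bulF F) y) (fobj (bulF F) z)"
      by (simp add: bulF_def)
  next
    fix x assume [simp]: "x \<in> Obj B"
    let ?Fx = "fobj F x"
    have "bul_arr C (farr F (lunit B x)) \<cdot> bul_arr C (ften F \<one>\<^bsub>B\<^esub> x) \<cdot> bul_tens C (fobj F \<one>\<^bsub>B\<^esub>) ?Fx \<cdot>
       ((bul_arr C (funit F) \<cdot> bul_unit C) \<boxtimes> Id C (bul C ?Fx))
      = bul_arr C (farr F (lunit B x) \<cdot> ften F \<one>\<^bsub>B\<^esub> x \<cdot> (funit F \<boxtimes> Id C ?Fx)) \<cdot> bul_tens C \<one> ?Fx \<cdot> (bul_unit C \<boxtimes> Id C (bul C ?Fx))"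
      by (simp add: F.C.tensR red[OF bi(1)] F.C.bul_arr_comp)
    also have "\<dots> = lunit C (bul C ?Fx)" by (simp add: F.ften_lunit F.C.bul_tens_lunit)
    finally show "farr (bulF F) (lunit B x) \<cdot> ften (bulF F) \<one>\<^bsub>B\<^esub> x \<cdot> (funit (bulF F) \<boxtimes> Id C (fobj (bulF F) x)) = lunit C (fobj (bulF F) x)"
      by (simp add: bulF_def)
    have "bul_arr C (farr F (runit B x)) \<cdot> bul_arr C (ften F x \<one>\<^bsub>B\<^esub>) \<cdot> bul_tens C ?Fx (fobj F \<one>\<^bsub>B\<^esub>) \<cdot>
       (Id C (bul C ?Fx) \<boxtimes> (bul_arr C (funit F) \<cdot> bul_unit C))
      = bul_arr C (farr F (runit B x) \<cdot> ften F x \<one>\<^bsub>B\<^esub> \<cdot> (Id C ?Fx \<boxtimes> funit F)) \<cdot> bul_tens C ?Fx \<one> \<cdot> (Id C (bul C ?Fx) \<boxtimes> bul_unit C)"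
      by (simp add: F.C.tensL red[OF bi(2)] F.C.bul_arr_comp)
    also have "\<dots> = runit C (bul C ?Fx)" by (simp add: F.ften_runit F.C.bul_tens_runit)
    finally show "farr (bulF F) (runit B x) \<cdot> ften (bulF F) x \<one>\<^bsub>B\<^esub> \<cdot> (Id C (fobj (bulF F) x) \<boxtimes> funit (bulF F)) = runit C (fobj (bulF F) x)"
      by (simp add: bulF_def)
  next
    fix x y assume [simp]: "x \<in> Obj B" "y \<in> Obj B"
    show "farr (bulF F) (symm B x y) \<cdot> ften (bulF F) x y = ften (bulF F) y x \<cdot> symm C (fobj (bulF F) x) (fobj (bulF F) y)"
      by (simp add: bulF_def red[OF bm] F.ften_symm) (simp add: F.C.bul_arr_comp F.C.bul_tens_symm)
  next
    fix f g assume [simp]: "f \<in> Arr B" "g \<in> Arr B"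
    show "farr (bulF F) (f \<boxtimes>\<^bsub>B\<^esub> g) \<cdot> ften (bulF F) (Dom B f) (Dom B g) =
      ften (bulF F) (Cod B f) (Cod B g) \<cdot> (farr (bulF F) f \<boxtimes> farr (bulF F) g)"
      by (simp add: bulF_def F.C.bul_tens_natural red[OF bm] F.ften_natural)
  qed (auto simp: bulF_def F.C.hom_iff F.farr_Comp F.C.bul_arr_comp F.B.spc F.C.spc)
qed

section \<open>The internal hom is a symmetric Picard category\<close>

lemma ihom_sel [simp]:
  "Obj (ihom B C) = arrows B C" "Dom (ihom B C) = nsrc" "Cod (ihom B C) = ntgt" "Id (ihom B C) = id2"
  "Comp (ihom B C) = vcomp" "tensO (ihom B C) = tensF" "Unit (ihom B C) = unitF B C" "bul (ihom B C) = bulF"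
  by (simp_all add: ihom_def)

lemma mnt_sel [simp]:
  "nsrc (\<tau> \<cdot>\<^sub>V \<sigma>) = nsrc \<sigma>" "ntgt (\<tau> \<cdot>\<^sub>V \<sigma>) = ntgt \<tau>" "nsrc (id2 F) = F" "ntgt (id2 F) = F"
  "nsrc (inv2 \<sigma>) = ntgt \<sigma>" "ntgt (inv2 \<sigma>) = nsrc \<sigma>"
  "nsrc (K *\<^sub>L \<sigma>) = K \<circ>\<^sub>F nsrc \<sigma>" "ntgt (K *\<^sub>L \<sigma>) = K \<circ>\<^sub>F ntgt \<sigma>"
  "nsrc (\<sigma> *\<^sub>R L) = nsrc \<sigma> \<circ>\<^sub>F L" "ntgt (\<sigma> *\<^sub>R L) = ntgt \<sigma> \<circ>\<^sub>F L"
  "nsrc (tensA (ihom B C) \<sigma> \<tau>) = tensF (nsrc \<sigma>) (nsrc \<tau>)" "ntgt (tensA (ihom B C) \<sigma> \<tau>) = tensF (ntgt \<sigma>) (ntgt \<tau>)"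
  "nsrc (assoc (ihom B C) F G H) = tensF (tensF F G) H" "ntgt (assoc (ihom B C) F G H) = tensF F (tensF G H)"
  "nsrc (lunit (ihom B C) F) = tensF (unitF B C) F" "ntgt (lunit (ihom B C) F) = F"
  "nsrc (runit (ihom B C) F) = tensF F (unitF B C)" "ntgt (runit (ihom B C) F) = F"
  "nsrc (symm (ihom B C) F G) = tensF F G" "ntgt (symm (ihom B C) F G) = tensF G F"
  "nsrc (bulj (ihom B C) F) = unitF B C" "ntgt (bulj (ihom B C) F) = tensF (bulF F) F"
  for F :: "('o, 'a, 'p, 'b) smf" and \<sigma> :: "('o, 'a, 'p, 'b) mnt"
  by (simp_all add: ihom_def vcomp_def id2_def inv2_def whiskL_def whiskR_def)

lemma ihom_app [simp]:
  assumes "x \<in> Obj B"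
  shows "tensA (ihom B C) \<sigma> \<tau> \<diamondop> x = \<sigma> \<diamondop> x \<boxtimes>\<^bsub>C\<^esub> \<tau> \<diamondop> x"
    "assoc (ihom B C) F G H \<diamondop> x = assoc C (fobj F x) (fobj G x) (fobj H x)"
    "lunit (ihom B C) F \<diamondop> x = lunit C (fobj F x)" "runit (ihom B C) F \<diamondop> x = runit C (fobj F x)"
    "symm (ihom B C) F G \<diamondop> x = symm C (fobj F x) (fobj G x)" "bulj (ihom B C) F \<diamondop> x = bulj C (fobj F x)"
  using assms by (simp_all add: ihom_def)

lemma ihom_ext [simp]:
  "ncomp (tensA (ihom B C) \<sigma> \<tau>) \<in> extensional (Obj B)" "ncomp (assoc (ihom B C) F G H) \<in> extensional (Obj B)"
  "ncomp (lunit (ihom B C) F) \<in> extensional (Obj B)" "ncomp (runit (ihom B C) F) \<in> extensional (Obj B)"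
  "ncomp (symm (ihom B C) F G) \<in> extensional (Obj B)" "ncomp (bulj (ihom B C) F) \<in> extensional (Obj B)"
  by (simp_all add: ihom_def)

lemma smf_sel [simp]:
  "Src (idF C) = C" "Tgt (idF C) = C" "Src (G \<circ>\<^sub>F F) = Src F" "Tgt (G \<circ>\<^sub>F F) = Tgt G"
  "Src (tensF F F') = Src F" "Tgt (tensF F F') = Tgt F" "Src (unitF B C) = B" "Tgt (unitF B C) = C"
  "Src (bulF F) = Src F" "Tgt (bulF F) = Tgt F"
  by (simp_all add: idF_def compF_def tensF_def unitF_def bulF_def)

lemma Arr_ihom: "\<sigma> \<in> Arr (ihom B C) \<longleftrightarrow> nsrc \<sigma> \<in> arrows B C \<and> \<sigma> \<in> cells (nsrc \<sigma>) (ntgt \<sigma>)"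
  using cells_arrows(1)[of \<sigma> "nsrc \<sigma>" "ntgt \<sigma>"]
  by (auto simp: ihom_def cells_def mnt_dom_def mnt_cod_def arrows_def)

lemma cells_Arr: "\<sigma> \<in> cells F G ==> F \<in> arrows B C ==> \<sigma> \<in> Arr (ihom B C)"
  using cells_bounds[of \<sigma> F G] by (simp add: Arr_ihom)

lemma cells_tgt_arrow: "\<sigma> \<in> cells F G ==> F \<in> arrows B C ==> G \<in> arrows B C"
  using cells_arrows[of \<sigma> F G] arrows_src_tgt[of F B C] by simp

lemma cells_src_arrow: "\<sigma> \<in> cells F G ==> G \<in> arrows B C ==> F \<in> arrows B C"
  using spc_cell2[of \<sigma> F G B C] spc_cell.axioms(1) spc_arrow.arrow by blast

lemma id2_app [simp]: "x \<in> Obj (Src F) ==> id2 F \<diamondop> x = Id (Tgt F) (fobj F x)"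
  by (simp add: id2_def)

lemma compF_app [simp]:
  "x \<in> Obj (Src F) ==> fobj (G \<circ>\<^sub>F F) x = fobj G (fobj F x)" "f \<in> Arr (Src F) ==> farr (G \<circ>\<^sub>F F) f = farr G (farr F f)"
  "x \<in> Obj (Src F) ==> y \<in> Obj (Src F) ==> ften (G \<circ>\<^sub>F F) x y = farr G (ften F x y) \<cdot>\<^bsub>Tgt G\<^esub> ften G (fobj F x) (fobj F y)"
  "funit (G \<circ>\<^sub>F F) = farr G (funit F) \<cdot>\<^bsub>Tgt G\<^esub> funit G"
  by (simp_all add: compF_def)

lemma idF_app [simp]:
  "x \<in> Obj C ==> fobj (idF C) x = x" "f \<in> Arr C ==> farr (idF C) f = f"
  "x \<in> Obj C ==> y \<in> Obj C ==> ften (idF C) x y = Id C (x \<otimes>\<^bsub>C\<^esub> y)" "funit (idF C) = Id C \<one>\<^bsub>C\<^esub>"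
  by (simp_all add: idF_def)

lemma tensF_app [simp]:
  "x \<in> Obj (Src F) ==> fobj (tensF F G) x = fobj F x \<otimes>\<^bsub>Tgt F\<^esub> fobj G x"
  "f \<in> Arr (Src F) ==> farr (tensF F G) f = farr F f \<boxtimes>\<^bsub>Tgt F\<^esub> farr G f"
  "x \<in> Obj (Src F) ==> y \<in> Obj (Src F) ==> ften (tensF F G) x y
    = (ften F x y \<boxtimes>\<^bsub>Tgt F\<^esub> ften G x y) \<cdot>\<^bsub>Tgt F\<^esub> interchange (Tgt F) (fobj F x) (fobj G x) (fobj F y) (fobj G y)"
  "funit (tensF F G) = (funit F \<boxtimes>\<^bsub>Tgt F\<^esub> funit G) \<cdot>\<^bsub>Tgt F\<^esub> inv_arr (Tgt F) (lunit (Tgt F) \<one>\<^bsub>Tgt F\<^esub>)"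
  by (simp_all add: tensF_def)

lemma unitF_app [simp]:
  "x \<in> Obj B ==> fobj (unitF B C) x = \<one>\<^bsub>C\<^esub>" "f \<in> Arr B ==> farr (unitF B C) f = Id C \<one>\<^bsub>C\<^esub>"
  "x \<in> Obj B ==> y \<in> Obj B ==> ften (unitF B C) x y = lunit C \<one>\<^bsub>C\<^esub>" "funit (unitF B C) = Id C \<one>\<^bsub>C\<^esub>"
  by (simp_all add: unitF_def)

lemma bulF_app [simp]:
  "x \<in> Obj (Src F) ==> fobj (bulF F) x = bul (Tgt F) (fobj F x)"
  "f \<in> Arr (Src F) ==> farr (bulF F) f = bul_arr (Tgt F) (farr F f)"
  "x \<in> Obj (Src F) ==> y \<in> Obj (Src F) ==> ften (bulF F) x y =
    bul_arr (Tgt F) (ften F x y) \<cdot>\<^bsub>Tgt F\<^esub> bul_tens (Tgt F) (fobj F x) (fobj F y)"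
  "funit (bulF F) = bul_arr (Tgt F) (funit F) \<cdot>\<^bsub>Tgt F\<^esub> bul_unit (Tgt F)"
  by (simp_all add: bulF_def)

locale spc_pair = B: symmetric_picard_category B + C: symmetric_picard_category C
  for B :: "('o, 'a) spc" and C :: "('p, 'b) spc" (structure)
begin

lemma arrows_sel [simp]: "F \<in> arrows B C ==> Src F = B" "F \<in> arrows B C ==> Tgt F = C"
  by (auto simp: arrows_def)

lemma fobj_in [simp]: "F \<in> arrows B C ==> x \<in> Obj B ==> fobj F x \<in> Obj C"
  by (rule spc_arrow.fobj_closed[OF spc_arrow])

lemma farr_in [simp]:
  "F \<in> arrows B C ==> f \<in> Arr B ==> farr F f \<in> Arr C" "F \<in> arrows B C ==> f \<in> Arr B ==> Dom C (farr F f) = fobj F (Dom B f)"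
  "F \<in> arrows B C ==> f \<in> Arr B ==> Cod C (farr F f) = fobj F (Cod B f)"
  by (rule spc_arrow.farr_arr[OF spc_arrow]; assumption)+

lemma ften_in [simp]:
  "F \<in> arrows B C ==> x \<in> Obj B ==> y \<in> Obj B ==> ften F x y \<in> Arr C"
  "F \<in> arrows B C ==> x \<in> Obj B ==> y \<in> Obj B ==> Dom C (ften F x y) = fobj F x \<otimes> fobj F y"
  "F \<in> arrows B C ==> x \<in> Obj B ==> y \<in> Obj B ==> Cod C (ften F x y) = fobj F (x \<otimes>\<^bsub>B\<^esub> y)"
  by (rule spc_arrow.ften_arr[OF spc_arrow]; assumption)+

lemma funit_in [simp]:
  "F \<in> arrows B C ==> funit F \<in> Arr C" "F \<in> arrows B C ==> Dom C (funit F) = \<one>"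
  "F \<in> arrows B C ==> Cod C (funit F) = fobj F \<one>\<^bsub>B\<^esub>"
  by (rule spc_arrow.funit_arr[OF spc_arrow]; assumption)+

lemma cell_of: "\<sigma> \<in> Arr (ihom B C) ==> spc_cell B C (nsrc \<sigma>) (ntgt \<sigma>) \<sigma>"
  by (auto simp: Arr_ihom intro: spc_cell)

lemma bounds_in [simp]: "\<sigma> \<in> Arr (ihom B C) ==> nsrc \<sigma> \<in> arrows B C" "\<sigma> \<in> Arr (ihom B C) ==> ntgt \<sigma> \<in> arrows B C"
  using cells_tgt_arrow by (auto simp: Arr_ihom)

lemma dom_in [simp]: "\<sigma> \<in> Arr (ihom B C) ==> mnt_dom \<sigma> = B" "\<sigma> \<in> Arr (ihom B C) ==> mnt_cod \<sigma> = C"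
  by (rule spc_cell.bounds[OF cell_of]; assumption)+

lemma ncomp_in [simp]:
  "\<sigma> \<in> Arr (ihom B C) ==> x \<in> Obj B ==> \<sigma> \<diamondop> x \<in> Arr C"
  "\<sigma> \<in> Arr (ihom B C) ==> x \<in> Obj B ==> Dom C (\<sigma> \<diamondop> x) = fobj (nsrc \<sigma>) x"
  "\<sigma> \<in> Arr (ihom B C) ==> x \<in> Obj B ==> Cod C (\<sigma> \<diamondop> x) = fobj (ntgt \<sigma>) x"
  by (rule spc_cell.ncomp_arr[OF cell_of]; assumption)+

lemma ihom_eqI:
  "\<sigma> \<in> Arr (ihom B C) ==> \<tau> \<in> Arr (ihom B C) ==> nsrc \<sigma> = nsrc \<tau> ==> ntgt \<sigma> = ntgt \<tau> ==>
    (\<And>x. x \<in> Obj B ==> \<sigma> \<diamondop> x = \<tau> \<diamondop> x) ==> \<sigma> = \<tau>"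
  by (rule mnt_eqI[of \<sigma> "nsrc \<sigma>" "ntgt \<sigma>" \<tau> B C]) (auto simp: Arr_ihom)

lemma tensF_in [simp]: "F \<in> arrows B C ==> G \<in> arrows B C ==> tensF F G \<in> arrows B C"
  by (rule tensF_arrow)

lemma unitF_in [simp]: "unitF B C \<in> arrows B C"
  by (rule unitF_arrow) (rule B.spc C.spc)+

lemma bulF_in [simp]: "F \<in> arrows B C ==> bulF F \<in> arrows B C"
  by (rule bulF_arrow)

lemma id2_in [simp]: "F \<in> arrows B C ==> id2 F \<in> Arr (ihom B C)"
proof -
  assume F: "F \<in> arrows B C"
  then interpret F: spc_arrow B C F by (rule spc_arrow)
  show ?thesis by (rule cells_Arr[of _ F F], rule cellsI[of _ B C]) (use F in \<open>auto simp: id2_def C.hom_iff\<close>)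
qed

lemma vcomp_app [simp]: "\<sigma> \<in> Arr (ihom B C) ==> x \<in> Obj B ==> (\<tau> \<cdot>\<^sub>V \<sigma>) \<diamondop> x = \<tau> \<diamondop> x \<cdot> \<sigma> \<diamondop> x"
  by (simp add: vcomp_def)

lemma vcomp_in [simp]:
  assumes s: "\<sigma> \<in> Arr (ihom B C)" and t: "\<tau> \<in> Arr (ihom B C)" and st: "ntgt \<sigma> = nsrc \<tau>"
  shows "\<tau> \<cdot>\<^sub>V \<sigma> \<in> Arr (ihom B C)"
proof -
  obtain F G H where F: "nsrc \<sigma> = F" and G: "ntgt \<sigma> = G" "nsrc \<tau> = G" and H: "ntgt \<tau> = H" using st by blast
  interpret s: spc_cell B C F G \<sigma> using cell_of[OF s] unfolding F G .
  interpret t: spc_cell B C G H \<tau> using cell_of[OF t] unfolding G H .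
  show ?thesis
  proof (rule cells_Arr[of _ F H], rule cellsI[of _ B C])
    fix f assume "f \<in> Arr B"
    then show "(\<tau> \<cdot>\<^sub>V \<sigma>) \<diamondop> Cod B f \<cdot> farr F f = farr H f \<cdot> (\<tau> \<cdot>\<^sub>V \<sigma>) \<diamondop> Dom B f"
      using s by (simp add: s.natural C.comp_reduce[OF t.natural])
  next
    fix x y assume "x \<in> Obj B" "y \<in> Obj B"
    then show "(\<tau> \<cdot>\<^sub>V \<sigma>) \<diamondop> (x \<otimes>\<^bsub>B\<^esub> y) \<cdot> ften F x y = ften H x y \<cdot> ((\<tau> \<cdot>\<^sub>V \<sigma>) \<diamondop> x \<boxtimes> (\<tau> \<cdot>\<^sub>V \<sigma>) \<diamondop> y)"
      using s by (simp add: s.tens C.comp_reduce[OF t.tens] C.tens_comp)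
  qed (use s t s.F.arrow t.G.arrow in \<open>auto simp: vcomp_def C.hom_iff s.unit t.unit\<close>)
qed

lemma inv2_app [simp]: "\<sigma> \<in> Arr (ihom B C) ==> x \<in> Obj B ==> inv2 \<sigma> \<diamondop> x = inv_arr C (\<sigma> \<diamondop> x)"
  by (simp add: inv2_def)

lemma inv2_in [simp]:
  assumes s: "\<sigma> \<in> Arr (ihom B C)" shows "inv2 \<sigma> \<in> Arr (ihom B C)"
proof -
  obtain F G where F: "nsrc \<sigma> = F" and G: "ntgt \<sigma> = G" by blast
  interpret s: spc_cell B C F G \<sigma> using cell_of[OF s] unfolding F G .
  show ?thesis
  proof (rule cells_Arr[of _ G F], rule cellsI[of _ B C])
    fix f assume [simp]: "f \<in> Arr B"
    have "\<sigma> \<diamondop> Cod B f \<cdot> (inv_arr C (\<sigma> \<diamondop> Cod B f) \<cdot> farr G f) = \<sigma> \<diamondop> Cod B f \<cdot> (farr F f \<cdot> inv_arr C (\<sigma> \<diamondop> Dom B f))"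
      using s by (simp add: C.comp_reduce[OF s.natural])
    then have "inv_arr C (\<sigma> \<diamondop> Cod B f) \<cdot> farr G f = farr F f \<cdot> inv_arr C (\<sigma> \<diamondop> Dom B f)"
      by (rule C.cancel_left) (use s in simp_all)
    then show "inv2 \<sigma> \<diamondop> Cod B f \<cdot> farr G f = farr F f \<cdot> inv2 \<sigma> \<diamondop> Dom B f"
      using s by simp
  next
    fix x y assume [simp]: "x \<in> Obj B" "y \<in> Obj B"
    let ?i = "\<lambda>x. inv_arr C (\<sigma> \<diamondop> x)"
    have "\<sigma> \<diamondop> (x \<otimes>\<^bsub>B\<^esub> y) \<cdot> (?i (x \<otimes>\<^bsub>B\<^esub> y) \<cdot> ften G x y) = \<sigma> \<diamondop> (x \<otimes>\<^bsub>B\<^esub> y) \<cdot> (ften F x y \<cdot> (?i x \<boxtimes> ?i y))"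
      using s by (simp add: C.comp_reduce[OF s.tens] C.tens_merge)
    then have "?i (x \<otimes>\<^bsub>B\<^esub> y) \<cdot> ften G x y = ften F x y \<cdot> (?i x \<boxtimes> ?i y)"
      by (rule C.cancel_left) (use s in simp_all)
    then show "inv2 \<sigma> \<diamondop> (x \<otimes>\<^bsub>B\<^esub> y) \<cdot> ften G x y = ften F x y \<cdot> (inv2 \<sigma> \<diamondop> x \<boxtimes> inv2 \<sigma> \<diamondop> y)"
      using s by simp
  next
    show "inv2 \<sigma> \<diamondop> \<one>\<^bsub>B\<^esub> \<cdot> funit G = funit F"
      using s s.unit[symmetric] by simp
  qed (use s s.F.arrow s.G.arrow in \<open>auto simp: inv2_def C.hom_iff\<close>)
qed

lemma tensA_in [simp]:
  assumes s: "\<sigma> \<in> Arr (ihom B C)" and t: "\<tau> \<in> Arr (ihom B C)"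
  shows "tensA (ihom B C) \<sigma> \<tau> \<in> Arr (ihom B C)"
proof -
  obtain F G F' G' where F: "nsrc \<sigma> = F" "nsrc \<tau> = F'" and G: "ntgt \<sigma> = G" "ntgt \<tau> = G'" by blast
  interpret s: spc_cell B C F G \<sigma> using cell_of[OF s] unfolding F G .
  interpret t: spc_cell B C F' G' \<tau> using cell_of[OF t] unfolding F G .
  note tm = C.tens_merge C.comp_reduce[OF C.tens_merge]
  show ?thesis
  proof (rule cells_Arr[of _ "tensF F F'" "tensF G G'"], rule cellsI[of _ B C])
    fix x y assume [simp]: "x \<in> Obj B" "y \<in> Obj B"
    show "tensA (ihom B C) \<sigma> \<tau> \<diamondop> (x \<otimes>\<^bsub>B\<^esub> y) \<cdot> ften (tensF F F') x y
      = ften (tensF G G') x y \<cdot> (tensA (ihom B C) \<sigma> \<tau> \<diamondop> x \<boxtimes> tensA (ihom B C) \<sigma> \<tau> \<diamondop> y)"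
      using s.F.arrow s.G.arrow t.F.arrow t.G.arrow by (simp add: C.interchange_natural) (simp add: tm s.tens t.tens)
  qed (use s t s.F.arrow s.G.arrow t.F.arrow t.G.arrow in \<open>auto simp: C.hom_iff tm s.natural t.natural s.unit t.unit\<close>)
qed

text \<open>Monoidality at a pair of objects is \<open>interchange_assoc2\<close>; at the unit it is
  \<open>unit_coherence\<close>.\<close>

lemma assoc_in [simp]:
  assumes F: "F \<in> arrows B C" and G: "G \<in> arrows B C" and H: "H \<in> arrows B C"
  shows "assoc (ihom B C) F G H \<in> Arr (ihom B C)"
proof -
  let ?i = "interchange C"
  note tm = C.tens_merge C.comp_reduce[OF C.tens_merge]
  show ?thesis
  proof (rule cells_Arr[of _ "tensF (tensF F G) H" "tensF F (tensF G H)"], rule cellsI[of _ B C])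
    fix x y assume [simp]: "x \<in> Obj B" "y \<in> Obj B"
    let ?Fx = "fobj F x" and ?Fy = "fobj F y" and ?Gx = "fobj G x" and ?Gy = "fobj G y" and ?Hx = "fobj H x" and ?Hy = "fobj H y"
    have "((((ften F x y \<boxtimes> ften G x y) \<cdot> ?i ?Fx ?Gx ?Fy ?Gy) \<boxtimes> ften H x y) \<cdot> ?i (?Fx \<otimes> ?Gx) ?Hx (?Fy \<otimes> ?Gy) ?Hy)
       = (((ften F x y \<boxtimes> ften G x y) \<boxtimes> ften H x y) \<cdot> (?i ?Fx ?Gx ?Fy ?Gy \<boxtimes> Id C (?Hx \<otimes> ?Hy)) \<cdot> ?i (?Fx \<otimes> ?Gx) ?Hx (?Fy \<otimes> ?Gy) ?Hy)"
      using F G H by (simp add: tm)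
    then have "assoc C (fobj F (x \<otimes>\<^bsub>B\<^esub> y)) (fobj G (x \<otimes>\<^bsub>B\<^esub> y)) (fobj H (x \<otimes>\<^bsub>B\<^esub> y)) \<cdot>
       ((((ften F x y \<boxtimes> ften G x y) \<cdot> ?i ?Fx ?Gx ?Fy ?Gy) \<boxtimes> ften H x y) \<cdot> ?i (?Fx \<otimes> ?Gx) ?Hx (?Fy \<otimes> ?Gy) ?Hy)
      = (ften F x y \<boxtimes> (ften G x y \<boxtimes> ften H x y)) \<cdot> assoc C (?Fx \<otimes> ?Fy) (?Gx \<otimes> ?Gy) (?Hx \<otimes> ?Hy) \<cdot>
        (?i ?Fx ?Gx ?Fy ?Gy \<boxtimes> Id C (?Hx \<otimes> ?Hy)) \<cdot> ?i (?Fx \<otimes> ?Gx) ?Hx (?Fy \<otimes> ?Gy) ?Hy"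
      using F G H by (simp add: C.assoc_natural')
    also have "\<dots> = (ften F x y \<boxtimes> (ften G x y \<boxtimes> ften H x y)) \<cdot> (Id C (?Fx \<otimes> ?Fy) \<boxtimes> ?i ?Gx ?Hx ?Gy ?Hy) \<cdot>
        ?i ?Fx (?Gx \<otimes> ?Hx) ?Fy (?Gy \<otimes> ?Hy) \<cdot> (assoc C ?Fx ?Gx ?Hx \<boxtimes> assoc C ?Fy ?Gy ?Hy)"
      using F G H by (simp add: C.interchange_assoc2)
    also have "\<dots> = (ften F x y \<boxtimes> ((ften G x y \<boxtimes> ften H x y) \<cdot> ?i ?Gx ?Hx ?Gy ?Hy)) \<cdot>
        ?i ?Fx (?Gx \<otimes> ?Hx) ?Fy (?Gy \<otimes> ?Hy) \<cdot> (assoc C ?Fx ?Gx ?Hx \<boxtimes> assoc C ?Fy ?Gy ?Hy)"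
      using F G H by (simp add: tm)
    finally show "assoc (ihom B C) F G H \<diamondop> (x \<otimes>\<^bsub>B\<^esub> y) \<cdot> ften (tensF (tensF F G) H) x y
      = ften (tensF F (tensF G H)) x y \<cdot> (assoc (ihom B C) F G H \<diamondop> x \<boxtimes> assoc (ihom B C) F G H \<diamondop> y)"
      using F G H by simp
  next
    let ?l = "inv_arr C (lunit C \<one>)"
    have "((funit F \<boxtimes> funit G) \<cdot> ?l) \<boxtimes> funit H = ((funit F \<boxtimes> funit G) \<boxtimes> funit H) \<cdot> (?l \<boxtimes> Id C \<one>)"
      "funit F \<boxtimes> ((funit G \<boxtimes> funit H) \<cdot> ?l) = (funit F \<boxtimes> (funit G \<boxtimes> funit H)) \<cdot> (Id C \<one> \<boxtimes> ?l)"
      using F G H by (simp_all add: C.tens_merge)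
    then show "assoc (ihom B C) F G H \<diamondop> \<one>\<^bsub>B\<^esub> \<cdot> funit (tensF (tensF F G) H) = funit (tensF F (tensF G H))"
      using F G H by (simp add: C.assoc_natural' C.comp_reduce[OF C.unit_coherence(1)])
  qed (use F G H in \<open>auto simp: C.hom_iff C.assoc_natural\<close>)
qed

lemma lunit_in [simp]:
  assumes F: "F \<in> arrows B C" shows "lunit (ihom B C) F \<in> Arr (ihom B C)"
proof (rule cells_Arr[of _ "tensF (unitF B C) F" F], rule cellsI[of _ B C])
  fix x y assume [simp]: "x \<in> Obj B" "y \<in> Obj B"
  \<comment> \<open>Pulls \<open>ften F x y\<close> out to the left of the unitor, which leaves
    exactly the composite in \<open>interchange_lunit2\<close>.\<close>
  have h: "lunit C (fobj F (x \<otimes>\<^bsub>B\<^esub> y)) \<cdot> (lunit C \<one> \<boxtimes> ften F x y) =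
     ften F x y \<cdot> lunit C (fobj F x \<otimes> fobj F y) \<cdot> (lunit C \<one> \<boxtimes> Id C (fobj F x \<otimes> fobj F y))"
    using F C.lunit_natural'[of "ften F x y" "fobj F (x \<otimes>\<^bsub>B\<^esub> y)" "lunit C \<one> \<boxtimes> Id C (fobj F x \<otimes> fobj F y)"]
    by (simp add: C.tens_merge)
  show "lunit (ihom B C) F \<diamondop> (x \<otimes>\<^bsub>B\<^esub> y) \<cdot> ften (tensF (unitF B C) F) x y = ften F x y \<cdot> (lunit (ihom B C) F \<diamondop> x \<boxtimes> lunit (ihom B C) F \<diamondop> y)"
    using F by (simp add: C.comp_reduce[OF h] C.interchange_lunit2)
next
  show "lunit (ihom B C) F \<diamondop> \<one>\<^bsub>B\<^esub> \<cdot> funit (tensF (unitF B C) F) = funit F"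
    using F by (simp add: C.lunit_natural')
qed (use F in \<open>auto simp: C.hom_iff C.lunit_natural\<close>)

lemma runit_in [simp]:
  assumes F: "F \<in> arrows B C" shows "runit (ihom B C) F \<in> Arr (ihom B C)"
proof (rule cells_Arr[of _ "tensF F (unitF B C)" F], rule cellsI[of _ B C])
  fix x y assume [simp]: "x \<in> Obj B" "y \<in> Obj B"
  have h: "runit C (fobj F (x \<otimes>\<^bsub>B\<^esub> y)) \<cdot> (ften F x y \<boxtimes> lunit C \<one>) =
     ften F x y \<cdot> runit C (fobj F x \<otimes> fobj F y) \<cdot> (Id C (fobj F x \<otimes> fobj F y) \<boxtimes> lunit C \<one>)"
    using F C.runit_natural'[of "ften F x y" "fobj F (x \<otimes>\<^bsub>B\<^esub> y)" "Id C (fobj F x \<otimes> fobj F y) \<boxtimes> lunit C \<one>"]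
    by (simp add: C.tens_merge)
  show "runit (ihom B C) F \<diamondop> (x \<otimes>\<^bsub>B\<^esub> y) \<cdot> ften (tensF F (unitF B C)) x y = ften F x y \<cdot> (runit (ihom B C) F \<diamondop> x \<boxtimes> runit (ihom B C) F \<diamondop> y)"
    using F by (simp add: C.comp_reduce[OF h] C.interchange_runit2)
next
  show "runit (ihom B C) F \<diamondop> \<one>\<^bsub>B\<^esub> \<cdot> funit (tensF F (unitF B C)) = funit F"
    using F by (simp add: C.runit_natural' C.lunit_eq_runit)
qed (use F in \<open>auto simp: C.hom_iff C.runit_natural\<close>)

lemma symm_in [simp]:
  assumes F: "F \<in> arrows B C" and G: "G \<in> arrows B C" shows "symm (ihom B C) F G \<in> Arr (ihom B C)"
proof (rule cells_Arr[of _ "tensF F G" "tensF G F"], rule cellsI[of _ B C])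
  fix x y assume [simp]: "x \<in> Obj B" "y \<in> Obj B"
  show "symm (ihom B C) F G \<diamondop> (x \<otimes>\<^bsub>B\<^esub> y) \<cdot> ften (tensF F G) x y = ften (tensF G F) x y \<cdot> (symm (ihom B C) F G \<diamondop> x \<boxtimes> symm (ihom B C) F G \<diamondop> y)"
    using F G by (simp add: C.symm_natural' C.interchange_symm2)
next
  show "symm (ihom B C) F G \<diamondop> \<one>\<^bsub>B\<^esub> \<cdot> funit (tensF F G) = funit (tensF G F)"
    using F G by (simp add: C.symm_natural' C.unit_coherence)
qed (use F G in \<open>auto simp: C.hom_iff C.symm_natural\<close>)

text \<open>The equations characterising \<open>bul_arr\<close>, \<open>bul_tens\<close> and
  \<open>bul_unit\<close> are precisely naturality and the two monoidality conditions for the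
  pointwise \<open>bulj\<close>.\<close>

lemma bulj_in [simp]:
  assumes F: "F \<in> arrows B C" shows "bulj (ihom B C) F \<in> Arr (ihom B C)"
proof (rule cells_Arr[of _ "unitF B C" "tensF (bulF F) F"], rule cellsI[of _ B C])
  fix x y assume [simp]: "x \<in> Obj B" "y \<in> Obj B"
  let ?Fx = "fobj F x" and ?Fy = "fobj F y"
  have "(((bul_arr C (ften F x y) \<cdot> bul_tens C ?Fx ?Fy) \<boxtimes> ften F x y) \<cdot> interchange C (bul C ?Fx) ?Fx (bul C ?Fy) ?Fy) \<cdot> (bulj C ?Fx \<boxtimes> bulj C ?Fy)
    = (bul_arr C (ften F x y) \<boxtimes> ften F x y) \<cdot> (bul_tens C ?Fx ?Fy \<boxtimes> Id C (?Fx \<otimes> ?Fy)) \<cdot> C.jtens (bul C ?Fx) ?Fx (bul C ?Fy) ?Fy (bulj C ?Fx) (bulj C ?Fy) \<cdot> lunit C \<one>"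
    using F unfolding C.jtens_def by (simp add: C.tens_merge C.comp_reduce[OF C.tens_merge])
  also have "\<dots> = bulj C (fobj F (x \<otimes>\<^bsub>B\<^esub> y)) \<cdot> lunit C \<one>"
    using F C.comp_reduce[OF C.bul_arr_props(4)[of "ften F x y"]] by (simp add: C.comp_reduce[OF C.bul_tens_props(4)])
  finally show "bulj (ihom B C) F \<diamondop> (x \<otimes>\<^bsub>B\<^esub> y) \<cdot> ften (unitF B C) x y
    = ften (tensF (bulF F) F) x y \<cdot> (bulj (ihom B C) F \<diamondop> x \<boxtimes> bulj (ihom B C) F \<diamondop> y)"
    using F by simp
next
  have "((bul_arr C (funit F) \<cdot> bul_unit C) \<boxtimes> funit F) \<cdot> inv_arr C (lunit C \<one>)
    = (bul_arr C (funit F) \<boxtimes> funit F) \<cdot> (bul_unit C \<boxtimes> Id C \<one>) \<cdot> inv_arr C (lunit C \<one>)"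
    using F by (simp add: C.comp_reduce[OF C.tens_merge])
  also have "\<dots> = bulj C (fobj F \<one>\<^bsub>B\<^esub>)"
    using F C.bul_arr_props(4)[of "funit F"] by (simp add: C.bul_unit_props(4))
  finally show "bulj (ihom B C) F \<diamondop> \<one>\<^bsub>B\<^esub> \<cdot> funit (unitF B C) = funit (tensF (bulF F) F)"
    using F by simp
next
  fix f assume "f \<in> Arr B"
  then show "bulj (ihom B C) F \<diamondop> Cod B f \<cdot> farr (unitF B C) f = farr (tensF (bulF F) F) f \<cdot> bulj (ihom B C) F \<diamondop> Dom B f"
    using F C.bul_arr_props(4)[of "farr F f"] by simp
qed (use F in \<open>auto simp: C.hom_iff\<close>)

lemma cells_inverse: "\<sigma> \<in> Arr (ihom B C) ==> is_iso (ihom B C) \<sigma>"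
  unfolding is_iso_def inverse_of_def
  by (rule exI[of _ "inv2 \<sigma>"]) (auto simp: hom_def intro!: ihom_eqI)

text \<open>An equation between 2-cells is an equation between components, so every axiom comes from
  the same axiom in \<open>C\<close>; inverses are taken componentwise by
  \<open>inv2\<close>.\<close>

theorem ihom_spc: "SPC (ihom B C)"
proof unfold_locales
  fix f g f' g' a b c a' b' c'
  assume "f \<in> hom (ihom B C) a b" "f' \<in> hom (ihom B C) b c" "g \<in> hom (ihom B C) a' b'" "g' \<in> hom (ihom B C) b' c'"
  then show "tensA (ihom B C) (f' \<cdot>\<^bsub>ihom B C\<^esub> f) (g' \<cdot>\<^bsub>ihom B C\<^esub> g) = tensA (ihom B C) f' g' \<cdot>\<^bsub>ihom B C\<^esub> tensA (ihom B C) f g"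
    by (auto simp: hom_def C.tens_comp intro!: ihom_eqI)
qed (auto simp: hom_def C.assoc_natural C.lunit_natural C.runit_natural C.symm_natural C.pentagon C.triangle C.hexagon cells_inverse
    intro!: ihom_eqI)

end

lemma spc_pair: "SPC B ==> SPC C ==> spc_pair B C"
  by (simp add: spc_pair_def)

lemma arrows_pair: "F \<in> arrows B C ==> spc_pair B C"
  using arrows_spc spc_pair by blast

lemma ihom_spc: "SPC B ==> SPC C ==> SPC (ihom B C)"
  using spc_pair spc_pair.ihom_spc by blast

section \<open>The 2-category \<open>SPC\<close>\<close>

lemma id2_cell: "F \<in> arrows B C ==> id2 F \<in> cells F F"
  using spc_pair.id2_in[OF arrows_pair] Arr_ihom[of "id2 F"] by fastforce

lemma vcomp_cell:
  assumes s: "\<sigma> \<in> cells F G" and t: "\<tau> \<in> cells G H" shows "\<tau> \<cdot>\<^sub>V \<sigma> \<in> cells F H"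
proof -
  obtain B C where BC: "Src F = B" "Tgt F = C" by blast
  have F: "F \<in> arrows B C" and G: "G \<in> arrows B C" using cells_arrows[OF s] unfolding BC by auto
  have "\<tau> \<cdot>\<^sub>V \<sigma> \<in> Arr (ihom B C)"
    by (rule spc_pair.vcomp_in[OF arrows_pair[OF F] cells_Arr[OF s F] cells_Arr[OF t G]])
      (simp add: cells_bounds[OF s] cells_bounds[OF t])
  then show ?thesis by (simp add: Arr_ihom cells_bounds[OF s] cells_bounds[OF t])
qed

lemma inv2_cell:
  assumes s: "\<sigma> \<in> cells F G" shows "inv2 \<sigma> \<in> cells G F"
proof -
  obtain B C where BC: "Src F = B" "Tgt F = C" by blast
  have F: "F \<in> arrows B C" using cells_arrows[OF s] unfolding BC by auto
  have "inv2 \<sigma> \<in> Arr (ihom B C)"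
    by (rule spc_pair.inv2_in[OF arrows_pair[OF F] cells_Arr[OF s F]])
  then show ?thesis by (simp add: Arr_ihom cells_bounds[OF s])
qed

lemma whiskL_app [simp]: "x \<in> Obj (mnt_dom \<sigma>) ==> (H *\<^sub>L \<sigma>) \<diamondop> x = farr H (\<sigma> \<diamondop> x)"
  by (simp add: whiskL_def)

lemma whiskR_app [simp]: "x \<in> Obj (Src F) ==> (\<sigma> *\<^sub>R F) \<diamondop> x = \<sigma> \<diamondop> fobj F x"
  by (simp add: whiskR_def)

lemma whiskL_cell:
  assumes s: "\<sigma> \<in> cells F G" and H: "H \<in> arrows (Tgt F) D"
  shows "H *\<^sub>L \<sigma> \<in> cells (H \<circ>\<^sub>F F) (H \<circ>\<^sub>F G)"
proof -
  obtain B C where BC: "Src F = B" "Tgt F = C" by blast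
  interpret s: spc_cell B C F G \<sigma> by (rule spc_cell[OF s cells_arrows(1)[OF s, unfolded BC]])
  interpret H: spc_arrow C D H by (rule spc_arrow[OF H[unfolded BC]])
  show ?thesis
  proof (rule cellsI[of _ B D])
    show "H \<circ>\<^sub>F F \<in> arrows B D" "H \<circ>\<^sub>F G \<in> arrows B D"
      using compF_arrow s.F.arrow s.G.arrow H.arrow by metis+
    fix x y assume [simp]: "x \<in> Obj B" "y \<in> Obj B"
    show "(H *\<^sub>L \<sigma>) \<diamondop> (x \<otimes>\<^bsub>B\<^esub> y) \<cdot>\<^bsub>D\<^esub> ften (H \<circ>\<^sub>F F) x y = ften (H \<circ>\<^sub>F G) x y \<cdot>\<^bsub>D\<^esub> ((H *\<^sub>L \<sigma>) \<diamondop> x \<boxtimes>\<^bsub>D\<^esub> (H *\<^sub>L \<sigma>) \<diamondop> y)"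
      by (simp add: H.farr_merge' s.tens) (simp add: H.farr_Comp H.ften_natural2)
  next
    show "ncomp (H *\<^sub>L \<sigma>) \<in> extensional (Obj B)" by (simp add: whiskL_def)
  qed (auto simp: H.C.hom_iff H.farr_merge s.natural H.farr_merge' s.unit)
qed

lemma whiskR_cell:
  assumes s: "\<sigma> \<in> cells G H" and F: "F \<in> arrows B (Src G)"
  shows "\<sigma> *\<^sub>R F \<in> cells (G \<circ>\<^sub>F F) (H \<circ>\<^sub>F F)"
proof -
  obtain C D where CD: "Src G = C" "Tgt G = D" by blast
  interpret s: spc_cell C D G H \<sigma> by (rule spc_cell[OF s cells_arrows(1)[OF s, unfolded CD]])
  interpret F: spc_arrow B C F by (rule spc_arrow[OF F[unfolded CD]])
  show ?thesis
  proof (rule cellsI[of _ B D])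
    show "G \<circ>\<^sub>F F \<in> arrows B D" "H \<circ>\<^sub>F F \<in> arrows B D"
      using compF_arrow s.F.arrow s.G.arrow F.arrow by metis+
    fix x y assume [simp]: "x \<in> Obj B" "y \<in> Obj B"
    show "(\<sigma> *\<^sub>R F) \<diamondop> (x \<otimes>\<^bsub>B\<^esub> y) \<cdot>\<^bsub>D\<^esub> ften (G \<circ>\<^sub>F F) x y = ften (H \<circ>\<^sub>F F) x y \<cdot>\<^bsub>D\<^esub> ((\<sigma> *\<^sub>R F) \<diamondop> x \<boxtimes>\<^bsub>D\<^esub> (\<sigma> *\<^sub>R F) \<diamondop> y)"
      by (simp add: s.F.C.comp_reduce[OF s.natural2] s.tens)
  next
    show "ncomp (\<sigma> *\<^sub>R F) \<in> extensional (Obj B)" by (simp add: whiskR_def)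
  qed (auto simp: s.F.C.hom_iff s.natural2 s.F.C.comp_reduce[OF s.natural2] s.unit)
qed

lemma compF_assoc:
  assumes F: "F \<in> arrows B C" and G: "G \<in> arrows C D" and H: "H \<in> arrows D E"
  shows "(H \<circ>\<^sub>F G) \<circ>\<^sub>F F = H \<circ>\<^sub>F (G \<circ>\<^sub>F F)"
proof -
  interpret F: spc_arrow B C F by (rule spc_arrow[OF F])
  interpret G: spc_arrow C D G by (rule spc_arrow[OF G])
  interpret H: spc_arrow D E H by (rule spc_arrow[OF H])
  show ?thesis
    by (rule smf_eqI[of _ B E]) (use F G H in \<open>auto intro!: compF_arrow simp: H.farr_Comp\<close>)
qed

lemma compF_idF:
  assumes F: "F \<in> arrows B C"
  shows "F \<circ>\<^sub>F idF B = F" "idF C \<circ>\<^sub>F F = F"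
proof -
  interpret F: spc_arrow B C F by (rule spc_arrow[OF F])
  have i: "idF B \<in> arrows B B" "idF C \<in> arrows C C"
    using idF_arrow F.B.spc F.C.spc by blast+
  show "F \<circ>\<^sub>F idF B = F" by (rule smf_eqI[of _ B C]) (use F i in \<open>auto intro: compF_arrow\<close>)
  show "idF C \<circ>\<^sub>F F = F" by (rule smf_eqI[of _ B C]) (use F i in \<open>auto intro: compF_arrow\<close>)
qed

subsection \<open>Pre- and post-composition\<close>

lemma whiskL_in: "\<sigma> \<in> Arr (ihom B C) ==> H \<in> arrows C D ==> H *\<^sub>L \<sigma> \<in> Arr (ihom B D)"
  using whiskL_cell[of \<sigma> "nsrc \<sigma>" "ntgt \<sigma>" H D] arrows_src_tgt[of "nsrc \<sigma>" B C] compF_arrow[of "nsrc \<sigma>" B C H D]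
  by (simp add: Arr_ihom)

lemma whiskR_in: "\<sigma> \<in> Arr (ihom C D) ==> F \<in> arrows B C ==> \<sigma> *\<^sub>R F \<in> Arr (ihom B D)"
  using whiskR_cell[of \<sigma> "nsrc \<sigma>" "ntgt \<sigma>" F B] arrows_src_tgt[of "nsrc \<sigma>" C D] compF_arrow[of F B C "nsrc \<sigma>" D]
  by (simp add: Arr_ihom)

lemma hom_app [simp]:
  "Src (hom_post X F) = ihom X (Src F)" "Tgt (hom_post X F) = ihom X (Tgt F)"
  "G \<in> arrows X (Src F) ==> fobj (hom_post X F) G = F \<circ>\<^sub>F G"
  "\<sigma> \<in> Arr (ihom X (Src F)) ==> farr (hom_post X F) \<sigma> = F *\<^sub>L \<sigma>"
  "G \<in> arrows X (Src F) ==> H \<in> arrows X (Src F) ==> nsrc (ften (hom_post X F) G H) = tensF (F \<circ>\<^sub>F G) (F \<circ>\<^sub>F H)"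
  "G \<in> arrows X (Src F) ==> H \<in> arrows X (Src F) ==> ntgt (ften (hom_post X F) G H) = F \<circ>\<^sub>F tensF G H"
  "G \<in> arrows X (Src F) ==> H \<in> arrows X (Src F) ==> x \<in> Obj X ==> ften (hom_post X F) G H \<diamondop> x = ften F (fobj G x) (fobj H x)"
  "nsrc (funit (hom_post X F)) = unitF X (Tgt F)" "ntgt (funit (hom_post X F)) = F \<circ>\<^sub>F unitF X (Src F)"
  "x \<in> Obj X ==> funit (hom_post X F) \<diamondop> x = funit F"
  "Src (hom_pre F' Y) = ihom (Tgt F') Y" "Tgt (hom_pre F' Y) = ihom (Src F') Y"
  "G' \<in> arrows (Tgt F') Y ==> fobj (hom_pre F' Y) G' = G' \<circ>\<^sub>F F'"
  "\<tau> \<in> Arr (ihom (Tgt F') Y) ==> farr (hom_pre F' Y) \<tau> = \<tau> *\<^sub>R F'"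
  "G' \<in> arrows (Tgt F') Y ==> H' \<in> arrows (Tgt F') Y ==> ften (hom_pre F' Y) G' H' = id2 (tensF G' H' \<circ>\<^sub>F F')"
  "funit (hom_pre F' Y) = id2 (unitF (Src F') Y)"
  by (simp_all add: hom_post_def hom_pre_def)

lemma hom_ext:
  "fobj (hom_post X F) \<in> extensional (arrows X (Src F))" "farr (hom_post X F) \<in> extensional (Arr (ihom X (Src F)))"
  "restrict2 (arrows X (Src F)) (ften (hom_post X F)) = ften (hom_post X F)"
  "fobj (hom_pre F' Y) \<in> extensional (arrows (Tgt F') Y)" "farr (hom_pre F' Y) \<in> extensional (Arr (ihom (Tgt F') Y))"
  "restrict2 (arrows (Tgt F') Y) (ften (hom_pre F' Y)) = ften (hom_pre F' Y)"
  by (simp_all add: hom_post_def hom_pre_def)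

lemma hom2_app [simp]:
  "nsrc (hom_post2 X \<sigma>) = hom_post X (nsrc \<sigma>)" "ntgt (hom_post2 X \<sigma>) = hom_post X (ntgt \<sigma>)"
  "G \<in> arrows X (mnt_dom \<sigma>) ==> hom_post2 X \<sigma> \<diamondop> G = \<sigma> *\<^sub>R G"
  "nsrc (hom_pre2 \<tau> Y) = hom_pre (nsrc \<tau>) Y" "ntgt (hom_pre2 \<tau> Y) = hom_pre (ntgt \<tau>) Y"
  "G' \<in> arrows (mnt_cod \<tau>) Y ==> hom_pre2 \<tau> Y \<diamondop> G' = G' *\<^sub>L \<tau>"
  by (simp_all add: hom_post2_def hom_pre2_def)

lemma hom2_ext:
  "ncomp (hom_post2 X \<sigma>) \<in> extensional (arrows X (mnt_dom \<sigma>))" "ncomp (hom_pre2 \<tau> Y) \<in> extensional (arrows (mnt_cod \<tau>) Y)"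
  by (simp_all add: hom_post2_def hom_pre2_def)

text \<open>The left unit axiom for \<open>F\<close> combined with naturality of the unitor. It is
  the monoidality of the constant family \<open>funit F\<close>, which is the unit comparison of
  \<open>[1,F]\<close>.\<close>

lemma (in spc_arrow) funit_lunit:
  "farr F (lunit B \<one>\<^bsub>B\<^esub>) \<bullet> ften F \<one>\<^bsub>B\<^esub> \<one>\<^bsub>B\<^esub> \<bullet> (funit F \<odot> funit F) = funit F \<bullet> lunit C \<one>\<^bsub>C\<^esub>"
proof -
  have "farr F (lunit B \<one>\<^bsub>B\<^esub>) \<bullet> ften F \<one>\<^bsub>B\<^esub> \<one>\<^bsub>B\<^esub> \<bullet> (funit F \<odot> funit F)
    = farr F (lunit B \<one>\<^bsub>B\<^esub>) \<bullet> ften F \<one>\<^bsub>B\<^esub> \<one>\<^bsub>B\<^esub> \<bullet> (funit F \<odot> Id C (fobj F \<one>\<^bsub>B\<^esub>)) \<bullet> (Id C \<one>\<^bsub>C\<^esub> \<odot> funit F)"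
    by (simp add: C.tens_merge)
  also have "\<dots> = funit F \<bullet> lunit C \<one>\<^bsub>C\<^esub>"
    by (simp add: C.comp_reduce3[OF ften_lunit] C.lunit_natural)
  finally show ?thesis .
qed

text \<open>Pointwise structure depends only on values, so precomposition preserves it on the nose.
  With the versions for unit and inverse below, this makes \<open>[F,1]\<close> strict for every
  arrow \<open>F\<close>.\<close>

lemma tensF_compF:
  assumes F: "F \<in> arrows B C" and G: "G \<in> arrows C D" and H: "H \<in> arrows C D"
  shows "tensF G H \<circ>\<^sub>F F = tensF (G \<circ>\<^sub>F F) (H \<circ>\<^sub>F F)"
proof -
  interpret F: spc_arrow B C F by (rule spc_arrow[OF F])
  interpret G: spc_arrow C D G by (rule spc_arrow[OF G])
  interpret H: spc_arrow C D H by (rule spc_arrow[OF H])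
  note tm = G.C.tens_merge G.C.comp_reduce[OF G.C.tens_merge]
  show ?thesis
    by (rule smf_eqI[of _ B D]) (use F G H in \<open>auto intro!: compF_arrow tensF_arrow simp: tm\<close>)
qed

lemma unitF_compF:
  assumes F: "F \<in> arrows B C" and D: "SPC D"
  shows "unitF C D \<circ>\<^sub>F F = unitF B D"
proof -
  interpret F: spc_arrow B C F by (rule spc_arrow[OF F])
  interpret D: symmetric_picard_category D by fact
  have U: "unitF C D \<in> arrows C D" "unitF B D \<in> arrows B D"
    using unitF_arrow D F.B.spc F.C.spc by blast+
  show ?thesis
    by (rule smf_eqI[of _ B D]) (use F U in \<open>auto intro!: compF_arrow\<close>)
qed

lemma bulF_compF:
  assumes F: "F \<in> arrows B C" and G: "G \<in> arrows C D"
  shows "bulF G \<circ>\<^sub>F F = bulF (G \<circ>\<^sub>F F)"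
proof -
  interpret F: spc_arrow B C F by (rule spc_arrow[OF F])
  interpret G: spc_arrow C D G by (rule spc_arrow[OF G])
  show ?thesis
    by (rule smf_eqI[of _ B D]) (use F G in \<open>auto intro!: compF_arrow bulF_arrow simp: G.C.bul_arr_comp\<close>)
qed

text \<open>The comparison arrows of \<open>[1,F]\<close> are those of \<open>F\<close> at values;
  that they are monoidal transformations is \<open>ften_interchange\<close> together with
  \<open>funit_lunit\<close>.\<close>

lemma hom_post_arrow:
  fixes C (structure)
  assumes X: "SPC X" and F: "F \<in> arrows B C"
  shows "hom_post X F \<in> arrows (ihom X B) (ihom X C)"
proof -
  interpret F: spc_arrow B C F by (rule spc_arrow[OF F])
  interpret P: spc_pair X B by (rule spc_pair[OF X F.B.spc])
  interpret Q: spc_pair X C by (rule spc_pair[OF X F.C.spc])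
  have [simp]: "F *\<^sub>L \<sigma> \<in> Arr (ihom X C)" if "\<sigma> \<in> Arr (ihom X B)" for \<sigma>
    using whiskL_in[OF that F] .
  have c [simp]: "F \<circ>\<^sub>F G \<in> arrows X C" if "G \<in> arrows X B" for G
    using compF_arrow[OF that F] .
  have t [simp]: "ften (hom_post X F) G H \<in> Arr (ihom X C)" if G: "G \<in> arrows X B" and H: "H \<in> arrows X B" for G H
  proof (rule cells_Arr[of _ "tensF (F \<circ>\<^sub>F G) (F \<circ>\<^sub>F H)" "F \<circ>\<^sub>F tensF G H"], rule cellsI[of _ X C])
    interpret G: spc_arrow X B G by (rule spc_arrow[OF G])
    interpret H: spc_arrow X B H by (rule spc_arrow[OF H])
    fix x y assume [simp]: "x \<in> Obj X" "y \<in> Obj X"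
    show "ften (hom_post X F) G H \<diamondop> (x \<otimes>\<^bsub>X\<^esub> y) \<cdot> ften (tensF (F \<circ>\<^sub>F G) (F \<circ>\<^sub>F H)) x y =
      ften (F \<circ>\<^sub>F tensF G H) x y \<cdot> (ften (hom_post X F) G H \<diamondop> x \<boxtimes> ften (hom_post X F) G H \<diamondop> y)"
      using G H by (simp add: F.C.tens_comp F.C.comp_reduce[OF F.ften_natural2] F.farr_Comp F.ften_interchange)
  next
    have h: "ften F \<one>\<^bsub>B\<^esub> \<one>\<^bsub>B\<^esub> \<cdot> (funit F \<boxtimes> funit F) = farr F (inv_arr B (lunit B \<one>\<^bsub>B\<^esub>)) \<cdot> funit F \<cdot> lunit C \<one>"
      by (subst F.farr_inv, simp, intro F.C.move_left) (simp_all add: F.funit_lunit)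
    show "ften (hom_post X F) G H \<diamondop> \<one>\<^bsub>X\<^esub> \<cdot> funit (tensF (F \<circ>\<^sub>F G) (F \<circ>\<^sub>F H)) = funit (F \<circ>\<^sub>F tensF G H)"
      using G H by (simp add: F.C.tens_comp F.farr_Comp F.C.comp_reduce[OF F.ften_natural2] F.C.comp_reduce[OF h])
  next
    show "ncomp (ften (hom_post X F) G H) \<in> extensional (Obj X)"
      using G H by (simp add: hom_post_def)
  qed (use G H in \<open>auto simp: F.C.hom_iff F.ften_natural2 intro!: tensF_arrow\<close>)
  have u [simp]: "funit (hom_post X F) \<in> Arr (ihom X C)"
  proof (rule cells_Arr[of _ "unitF X C" "F \<circ>\<^sub>F unitF X B"], rule cellsI[of _ X C])
    show "ncomp (funit (hom_post X F)) \<in> extensional (Obj X)"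
      by (simp add: hom_post_def)
    fix x y assume [simp]: "x \<in> Obj X" "y \<in> Obj X"
    show "funit (hom_post X F) \<diamondop> (x \<otimes>\<^bsub>X\<^esub> y) \<cdot> ften (unitF X C) x y =
      ften (F \<circ>\<^sub>F unitF X B) x y \<cdot> (funit (hom_post X F) \<diamondop> x \<boxtimes> funit (hom_post X F) \<diamondop> y)"
      by (simp add: F.funit_lunit)
  qed (auto simp: F.C.hom_iff)
  show ?thesis
  proof (rule arrowsI)
    fix \<sigma> \<tau> assume a: "\<sigma> \<in> Arr (ihom X B)" "\<tau> \<in> Arr (ihom X B)"
    show "farr (hom_post X F) (\<sigma> \<boxtimes>\<^bsub>ihom X B\<^esub> \<tau>) \<cdot>\<^bsub>ihom X C\<^esub> ften (hom_post X F) (Dom (ihom X B) \<sigma>) (Dom (ihom X B) \<tau>) =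
      ften (hom_post X F) (Cod (ihom X B) \<sigma>) (Cod (ihom X B) \<tau>) \<cdot>\<^bsub>ihom X C\<^esub> (farr (hom_post X F) \<sigma> \<boxtimes>\<^bsub>ihom X C\<^esub> farr (hom_post X F) \<tau>)"
      using a by (intro Q.ihom_eqI) (auto simp: F.ften_natural2)
  qed (use hom_ext(1-3)[of X F] in \<open>auto simp: hom_def P.ihom_spc Q.ihom_spc F.farr_Comp F.ften_assoc F.ften_lunit F.ften_runit F.ften_symm intro!: Q.ihom_eqI\<close>)
qed

lemma hom_pre_arrow:
  assumes F: "F \<in> arrows B C" and X: "SPC X"
  shows "hom_pre F X \<in> arrows (ihom C X) (ihom B X)"
proof -
  interpret F: spc_arrow B C F by (rule spc_arrow[OF F])
  interpret P: spc_pair C X by (rule spc_pair[OF F.C.spc X])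
  interpret Q: spc_pair B X by (rule spc_pair[OF F.B.spc X])
  have [simp]: "\<sigma> *\<^sub>R F \<in> Arr (ihom B X)" if "\<sigma> \<in> Arr (ihom C X)" for \<sigma>
    using whiskR_in[OF that F] .
  have c [simp]: "G \<circ>\<^sub>F F \<in> arrows B X" if "G \<in> arrows C X" for G
    using compF_arrow[OF F that] .
  note tc = tensF_compF[OF F, where D = X] unitF_compF[OF F X]
  show ?thesis
    by (rule arrowsI) (use hom_ext(4-6)[of F X] in \<open>auto simp: hom_def P.ihom_spc Q.ihom_spc tc intro!: Q.ihom_eqI\<close>)
qed

lemma hom_post2_in:
  assumes X: "SPC X" and s: "\<sigma> \<in> Arr (ihom B C)"
  shows "hom_post2 X \<sigma> \<in> Arr (ihom (ihom X B) (ihom X C))"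
proof -
  obtain F G where F: "nsrc \<sigma> = F" and G: "ntgt \<sigma> = G" by blast
  have FG: "\<sigma> \<in> cells F G" "F \<in> arrows B C" using s F G by (auto simp: Arr_ihom)
  interpret s: spc_cell B C F G \<sigma> using FG by (rule spc_cell)
  interpret P: spc_pair X B by (rule spc_pair[OF X s.F.B.spc])
  interpret Q: spc_pair X C by (rule spc_pair[OF X s.F.C.spc])
  have [simp]: "\<sigma> *\<^sub>R H \<in> Arr (ihom X C)" if "H \<in> arrows X B" for H
    using whiskR_in[OF s that] .
  have p: "hom_post X F \<in> arrows (ihom X B) (ihom X C)" "hom_post X G \<in> arrows (ihom X B) (ihom X C)"
    using hom_post_arrow[OF X s.F.arrow] hom_post_arrow[OF X s.G.arrow] .
  interpret PF: spc_arrow "ihom X B" "ihom X C" "hom_post X F" by (rule spc_arrow[OF p(1)])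
  interpret PG: spc_arrow "ihom X B" "ihom X C" "hom_post X G" by (rule spc_arrow[OF p(2)])
  have w [simp]: "F *\<^sub>L \<tau> \<in> Arr (ihom X C)" "G *\<^sub>L \<tau> \<in> Arr (ihom X C)" if "\<tau> \<in> Arr (ihom X B)" for \<tau>
    using that whiskL_in s.F.arrow s.G.arrow by blast+
  have [simp]: "ften (hom_post X F) H K \<in> Arr (ihom X C)" "ften (hom_post X G) H K \<in> Arr (ihom X C)"
    if "H \<in> arrows X B" "K \<in> arrows X B" for H K
    using that PF.ften_arr(1)[of H K] PG.ften_arr(1)[of H K] by simp_all
  show ?thesis
  proof (rule cells_Arr[of _ "hom_post X F" "hom_post X G"], rule cellsI[of _ "ihom X B" "ihom X C"])
  qed (use p hom2_ext(1)[of X \<sigma>] PF.funit_arr(1) PG.funit_arr(1) in \<open>auto simp: hom_def s.natural2 s.tens s.unit intro!: Q.ihom_eqI\<close>)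
qed

lemma hom_pre2_in:
  assumes s: "\<sigma> \<in> Arr (ihom B C)" and X: "SPC X"
  shows "hom_pre2 \<sigma> X \<in> Arr (ihom (ihom C X) (ihom B X))"
proof -
  obtain F G where F: "nsrc \<sigma> = F" and G: "ntgt \<sigma> = G" by blast
  have FG: "\<sigma> \<in> cells F G" "F \<in> arrows B C" using s F G by (auto simp: Arr_ihom)
  interpret s: spc_cell B C F G \<sigma> using FG by (rule spc_cell)
  interpret P: spc_pair C X by (rule spc_pair[OF s.F.C.spc X])
  interpret Q: spc_pair B X by (rule spc_pair[OF s.F.B.spc X])
  have [simp]: "H *\<^sub>L \<sigma> \<in> Arr (ihom B X)" if "H \<in> arrows C X" for H
    using whiskL_in[OF s that] .
  have p: "hom_pre F X \<in> arrows (ihom C X) (ihom B X)" "hom_pre G X \<in> arrows (ihom C X) (ihom B X)"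
    using hom_pre_arrow[OF s.F.arrow X] hom_pre_arrow[OF s.G.arrow X] .
  have w [simp]: "\<tau> *\<^sub>R F \<in> Arr (ihom B X)" "\<tau> *\<^sub>R G \<in> Arr (ihom B X)" if "\<tau> \<in> Arr (ihom C X)" for \<tau>
    using that whiskR_in s.F.arrow s.G.arrow by blast+
  have c [simp]: "H \<circ>\<^sub>F F \<in> arrows B X" "H \<circ>\<^sub>F G \<in> arrows B X" if "H \<in> arrows C X" for H
    using compF_arrow[OF s.F.arrow that] compF_arrow[OF s.G.arrow that] .
  note tc = tensF_compF[OF s.F.arrow, where D = X] unitF_compF[OF s.F.arrow X] tensF_compF[OF s.G.arrow, where D = X] unitF_compF[OF s.G.arrow X]
  \<comment> \<open>Naturality of \<open>\<tau>\<close> at a component of \<open>\<sigma>\<close>,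
    that is, the interchange law of the 2-category in components.\<close>
  have n: "Comp X (\<tau> \<diamondop> fobj G x) (farr (nsrc \<tau>) (\<sigma> \<diamondop> x)) = Comp X (farr (ntgt \<tau>) (\<sigma> \<diamondop> x)) (\<tau> \<diamondop> fobj F x)"
    if "\<tau> \<in> Arr (ihom C X)" "x \<in> Obj B" for \<tau> x
    using spc_cell.natural2[OF P.cell_of[OF that(1)], of "\<sigma> \<diamondop> x" "fobj G x"] that by simp
  show ?thesis
  proof (rule cells_Arr[of _ "hom_pre F X" "hom_pre G X"], rule cellsI[of _ "ihom C X" "ihom B X"])
  qed (use p hom2_ext(2)[of \<sigma> X] in \<open>auto simp: hom_def tc n intro!: Q.ihom_eqI\<close>)
qed

subsection \<open>Strict arrows\<close>

locale spc_strict = spc_arrow B C F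
  for B :: "('o, 'a) spc" and C :: "('p, 'b) spc" and F :: "('o, 'a, 'p, 'b) smf" +
  assumes strict: "strict_smf F"
begin

lemma str_obj [simp]:
  "x \<in> Obj B ==> y \<in> Obj B ==> fobj F (x \<oplus>\<^sub>B y) = fobj F x \<oplus> fobj F y"
  "x \<in> Obj B ==> y \<in> Obj B ==> ften F x y = Id C (fobj F x \<oplus> fobj F y)"
  "fobj F \<one>\<^bsub>B\<^esub> = \<one>\<^bsub>C\<^esub>" "funit F = Id C \<one>\<^bsub>C\<^esub>"
  "x \<in> Obj B ==> fobj F (bul B x) = bul C (fobj F x)"
  "x \<in> Obj B ==> farr F (bulj B x) = bulj C (fobj F x)"
  using strict by (auto simp: strict_smf_def)

lemma str_tens [simp]: "f \<in> Arr B ==> g \<in> Arr B ==> farr F (f \<odot>\<^sub>B g) = farr F f \<odot> farr F g"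
  using ften_natural[of f g] by simp

lemma str_struct [simp]:
  "x \<in> Obj B ==> y \<in> Obj B ==> z \<in> Obj B ==> farr F (assoc B x y z) = assoc C (fobj F x) (fobj F y) (fobj F z)"
  "x \<in> Obj B ==> farr F (lunit B x) = lunit C (fobj F x)"
  "x \<in> Obj B ==> farr F (runit B x) = runit C (fobj F x)"
  "x \<in> Obj B ==> y \<in> Obj B ==> farr F (symm B x y) = symm C (fobj F x) (fobj F y)"
  using ften_assoc[of x y z] ften_lunit[of x] ften_runit[of x] ften_symm[of x y] by simp_all

lemma str_interchange:
  "a \<in> Obj B ==> b \<in> Obj B ==> c \<in> Obj B ==> d \<in> Obj B ==>
    farr F (interchange B a b c d) = interchange C (fobj F a) (fobj F b) (fobj F c) (fobj F d)"
  using ften_interchange[of a b c d] by simp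

text \<open>A strict arrow preserves the equation that characterises \<open>bul_arr\<close>, and
  that equation has a single solution. The same reason applies to \<open>bul_tens\<close> and
  \<open>bul_unit\<close>.\<close>

lemma str_bul_arr [simp]: "f \<in> Arr B ==> farr F (bul_arr B f) = bul_arr C (farr F f)"
proof -
  assume [simp]: "f \<in> Arr B"
  have "farr F ((bul_arr B f \<odot>\<^sub>B f) \<bullet>\<^sub>B bulj B (Dom B f)) = farr F (bulj B (Cod B f))"
    by (simp add: B.bul_arr_props(4))
  then show ?thesis by (intro C.bul_arr_eqI[symmetric]) (simp_all add: farr_Comp)
qed

lemma str_bul_tens [simp]:
  assumes [simp]: "a \<in> Obj B" "b \<in> Obj B"
  shows "farr F (bul_tens B a b) = bul_tens C (fobj F a) (fobj F b)"
proof (rule C.dual_unique)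
  let ?j = "C.jtens (bul C (fobj F a)) (fobj F a) (bul C (fobj F b)) (fobj F b) (bulj C (fobj F a)) (bulj C (fobj F b))"
  have "farr F ((bul_tens B a b \<odot>\<^sub>B Id B (a \<oplus>\<^sub>B b)) \<bullet>\<^sub>B B.jtens (bul B a) a (bul B b) b (bulj B a) (bulj B b)) = bulj C (fobj F a \<oplus> fobj F b)"
    by (simp add: B.bul_tens_props(4))
  moreover have "farr F (B.jtens (bul B a) a (bul B b) b (bulj B a) (bulj B b)) = ?j"
    by (simp add: B.jtens_def C.jtens_def farr_Comp str_interchange farr_inv)
  ultimately show "(farr F (bul_tens B a b) \<odot> Id C (fobj F a \<oplus> fobj F b)) \<bullet> ?j = (bul_tens C (fobj F a) (fobj F b) \<odot> Id C (fobj F a \<oplus> fobj F b)) \<bullet> ?j"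
    by (simp add: C.bul_tens_props(4) farr_Comp)
qed simp_all

lemma str_bul_unit [simp]: "farr F (bul_unit B) = bul_unit C"
proof (rule C.dual_unique)
  have "farr F ((bul_unit B \<odot>\<^sub>B Id B \<one>\<^bsub>B\<^esub>) \<bullet>\<^sub>B inv_arr B (lunit B \<one>\<^bsub>B\<^esub>)) = bulj C \<one>\<^bsub>C\<^esub>"
    by (simp add: B.bul_unit_props(4))
  then show "(farr F (bul_unit B) \<odot> Id C \<one>\<^bsub>C\<^esub>) \<bullet> inv_arr C (lunit C \<one>\<^bsub>C\<^esub>) = (bul_unit C \<odot> Id C \<one>\<^bsub>C\<^esub>) \<bullet> inv_arr C (lunit C \<one>\<^bsub>C\<^esub>)"
    by (simp add: C.bul_unit_props(4) farr_Comp farr_inv)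
qed simp_all

end

lemma spc_strict: "F \<in> strict_arrows B C ==> spc_strict B C F"
  by (auto simp: spc_strict_def spc_strict_axioms_def strict_arrows_def intro: spc_arrow)

lemma strict_arrowsD: "F \<in> strict_arrows B C ==> F \<in> arrows B C"
  by (simp add: strict_arrows_def)

lemma strict_arrowsI:
  assumes "F \<in> arrows B C"
    "\<And>x y. x \<in> Obj B ==> y \<in> Obj B ==> fobj F (tensO B x y) = tensO C (fobj F x) (fobj F y)"
    "\<And>x y. x \<in> Obj B ==> y \<in> Obj B ==> ften F x y = Id C (tensO C (fobj F x) (fobj F y))"
    "fobj F \<one>\<^bsub>B\<^esub> = \<one>\<^bsub>C\<^esub>" "funit F = Id C \<one>\<^bsub>C\<^esub>"
    "\<And>x. x \<in> Obj B ==> fobj F (bul B x) = bul C (fobj F x)"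
    "\<And>x. x \<in> Obj B ==> farr F (bulj B x) = bulj C (fobj F x)"
  shows "F \<in> strict_arrows B C"
  using assms by (auto simp: strict_arrows_def strict_smf_def arrows_def)

lemma strict_compF:
  assumes F: "F \<in> strict_arrows B C" and G: "G \<in> strict_arrows C D"
  shows "G \<circ>\<^sub>F F \<in> strict_arrows B D"
proof -
  interpret F: spc_strict B C F by (rule spc_strict[OF F])
  interpret G: spc_strict C D G by (rule spc_strict[OF G])
  show ?thesis
    by (rule strict_arrowsI) (use compF_arrow[OF F.arrow G.arrow] in simp_all)
qed

lemma strict_idF: "SPC C ==> idF C \<in> strict_arrows C C"
proof -
  assume C: "SPC C"
  then interpret symmetric_picard_category C .
  show ?thesis by (rule strict_arrowsI) (use idF_arrow[OF C] in simp_all)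
qed

text \<open>Postcomposition with a strict arrow commutes with the pointwise operations because a
  strict arrow preserves every canonical arrow in their definitions: the interchange, the inverse
  unitor and the arrows attached to \<open>bul\<close>.\<close>

lemma hom_post_strict:
  assumes X: "SPC X" and F: "F \<in> strict_arrows B C"
  shows "hom_post X F \<in> strict_arrows (ihom X B) (ihom X C)"
proof -
  interpret F: spc_strict B C F by (rule spc_strict[OF F])
  interpret P: spc_pair X B by (rule spc_pair[OF X F.B.spc])
  interpret Q: spc_pair X C by (rule spc_pair[OF X F.C.spc])
  have p: "hom_post X F \<in> arrows (ihom X B) (ihom X C)" by (rule hom_post_arrow[OF X F.arrow])
  interpret PF: spc_arrow "ihom X B" "ihom X C" "hom_post X F" by (rule spc_arrow[OF p])
  have [simp]: "F *\<^sub>L \<sigma> \<in> Arr (ihom X C)" if "\<sigma> \<in> Arr (ihom X B)" for \<sigma>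
    using whiskL_in[OF that F.arrow] .
  have c [simp]: "F \<circ>\<^sub>F G \<in> arrows X C" if "G \<in> arrows X B" for G
    using compF_arrow[OF that F.arrow] .
  have t: "F \<circ>\<^sub>F tensF G H = tensF (F \<circ>\<^sub>F G) (F \<circ>\<^sub>F H)" if "G \<in> arrows X B" "H \<in> arrows X B" for G H
    by (rule smf_eqI[of _ X C]) (use that in \<open>auto simp: F.farr_Comp F.str_interchange F.farr_inv\<close>)
  have u: "F \<circ>\<^sub>F unitF X B = unitF X C"
    by (rule smf_eqI[of _ X C]) auto
  have b: "F \<circ>\<^sub>F bulF G = bulF (F \<circ>\<^sub>F G)" if "G \<in> arrows X B" for G
    by (rule smf_eqI[of _ X C]) (use that in \<open>auto simp: F.farr_Comp\<close>)
  show ?thesis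
  proof (rule strict_arrowsI)
    fix G H assume G: "G \<in> Obj (ihom X B)" "H \<in> Obj (ihom X B)"
    then show "ften (hom_post X F) G H = Id (ihom X C) (fobj (hom_post X F) G \<otimes>\<^bsub>ihom X C\<^esub> fobj (hom_post X F) H)"
      using PF.ften_arr(1)[of G H] t[of G H] by (intro Q.ihom_eqI) auto
  next
    show "funit (hom_post X F) = Id (ihom X C) \<one>\<^bsub>ihom X C\<^esub>"
      using PF.funit_arr(1) u by (intro Q.ihom_eqI) auto
  next
    fix G assume G: "G \<in> Obj (ihom X B)"
    then show "farr (hom_post X F) (bulj (ihom X B) G) = bulj (ihom X C) (fobj (hom_post X F) G)"
      using t[of "bulF G" G] b u by (intro Q.ihom_eqI) auto
  qed (use p t u b in auto)
qed

lemma hom_pre_strict: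
  assumes F: "F \<in> arrows B C" and X: "SPC X"
  shows "hom_pre F X \<in> strict_arrows (ihom C X) (ihom B X)"
proof -
  interpret F: spc_arrow B C F by (rule spc_arrow[OF F])
  interpret P: spc_pair C X by (rule spc_pair[OF F.C.spc X])
  interpret Q: spc_pair B X by (rule spc_pair[OF F.B.spc X])
  have [simp]: "\<sigma> *\<^sub>R F \<in> Arr (ihom B X)" if "\<sigma> \<in> Arr (ihom C X)" for \<sigma>
    using whiskR_in[OF that F] .
  have c [simp]: "G \<circ>\<^sub>F F \<in> arrows B X" if "G \<in> arrows C X" for G
    using compF_arrow[OF F that] .
  note tc = tensF_compF[OF F, where D = X] unitF_compF[OF F X] bulF_compF[OF F, where D = X]
  show ?thesis
    by (rule strict_arrowsI) (use hom_pre_arrow[OF F X] in \<open>auto simp: tc intro!: Q.ihom_eqI\<close>)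
qed

subsection \<open>The functor \<open>[D,-]\<close> and evaluation\<close>

lemma (in spc_pair) inv_arr_ihom: "\<sigma> \<in> Arr (ihom B C) ==> inv_arr (ihom B C) \<sigma> = inv2 \<sigma>"
  by (rule category.inv_arr_eq)
    (use ihom_spc in \<open>auto simp: symmetric_picard_category_def symmetric_monoidal_category_def inverse_of_def hom_def intro!: ihom_eqI\<close>)

lemma (in spc_pair) interchange_ihom:
  assumes [simp]: "F \<in> arrows B C" "G \<in> arrows B C" "H \<in> arrows B C" "K \<in> arrows B C"
  shows "x \<in> Obj B ==> interchange (ihom B C) F G H K \<diamondop> x = interchange C (fobj F x) (fobj G x) (fobj H x) (fobj K x)"
    "interchange (ihom B C) F G H K \<in> Arr (ihom B C)"
    "nsrc (interchange (ihom B C) F G H K) = tensF (tensF F G) (tensF H K)"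
    "ntgt (interchange (ihom B C) F G H K) = tensF (tensF F H) (tensF G K)"
  by (simp_all add: interchange_def Let_def inv_arr_ihom)

text \<open>Together with \<open>hom_post_unitF\<close> this is what allows
  \<open>hom_functor\<close> to have identities as comparison arrows.\<close>

lemma hom_post_tensF:
  assumes D: "SPC D" and F: "F \<in> arrows B C" and G: "G \<in> arrows B C"
  shows "hom_post D (tensF F G) = tensF (hom_post D F) (hom_post D G)"
proof -
  interpret F: spc_arrow B C F by (rule spc_arrow[OF F])
  interpret G: spc_arrow B C G by (rule spc_arrow[OF G])
  interpret P: spc_pair D B by (rule spc_pair[OF D F.B.spc])
  interpret Q: spc_pair D C by (rule spc_pair[OF D F.C.spc])
  have T: "tensF F G \<in> arrows B C" using F G by (rule tensF_arrow)
  note p = hom_post_arrow[OF D F] hom_post_arrow[OF D G] hom_post_arrow[OF D T]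
  interpret PF: spc_arrow "ihom D B" "ihom D C" "hom_post D F" by (rule spc_arrow[OF p(1)])
  interpret PG: spc_arrow "ihom D B" "ihom D C" "hom_post D G" by (rule spc_arrow[OF p(2)])
  interpret PT: spc_arrow "ihom D B" "ihom D C" "hom_post D (tensF F G)" by (rule spc_arrow[OF p(3)])
  have w [simp]: "F *\<^sub>L \<sigma> \<in> Arr (ihom D C)" "G *\<^sub>L \<sigma> \<in> Arr (ihom D C)" "tensF F G *\<^sub>L \<sigma> \<in> Arr (ihom D C)"
    if "\<sigma> \<in> Arr (ihom D B)" for \<sigma> using that whiskL_in F G T by blast+
  have c [simp]: "F \<circ>\<^sub>F H \<in> arrows D C" "G \<circ>\<^sub>F H \<in> arrows D C" if "H \<in> arrows D B" for H
    using compF_arrow[OF that F] compF_arrow[OF that G] .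
  have t [simp]: "ften (hom_post D F) H K \<in> Arr (ihom D C)" "ften (hom_post D G) H K \<in> Arr (ihom D C)"
      "ften (hom_post D (tensF F G)) H K \<in> Arr (ihom D C)"
    if "H \<in> arrows D B" "K \<in> arrows D B" for H K
    using that PF.ften_arr(1)[of H K] PG.ften_arr(1)[of H K] PT.ften_arr(1)[of H K] by simp_all
  have u [simp]: "funit (hom_post D F) \<in> Arr (ihom D C)" "funit (hom_post D G) \<in> Arr (ihom D C)"
      "funit (hom_post D (tensF F G)) \<in> Arr (ihom D C)"
    using PF.funit_arr(1) PG.funit_arr(1) PT.funit_arr(1) by simp_all
  have tc: "tensF F G \<circ>\<^sub>F H = tensF (F \<circ>\<^sub>F H) (G \<circ>\<^sub>F H)" if "H \<in> arrows D B" for H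
    using tensF_compF[OF that F G] .
  show ?thesis
    by (rule smf_eqI[of _ "ihom D B" "ihom D C"])
      (use p tensF_arrow[OF p(1,2)] in \<open>auto intro!: Q.ihom_eqI simp: tc Q.interchange_ihom Q.inv_arr_ihom\<close>)
qed

lemma hom_post_unitF:
  assumes D: "SPC D" and B: "SPC B" and C: "SPC C"
  shows "hom_post D (unitF B C) = unitF (ihom D B) (ihom D C)"
proof -
  have U: "unitF B C \<in> arrows B C" using B C by (rule unitF_arrow)
  interpret P: spc_pair D B by (rule spc_pair[OF D B])
  interpret Q: spc_pair D C by (rule spc_pair[OF D C])
  note p = hom_post_arrow[OF D U]
  interpret PU: spc_arrow "ihom D B" "ihom D C" "hom_post D (unitF B C)" by (rule spc_arrow[OF p])
  have w [simp]: "unitF B C *\<^sub>L \<sigma> \<in> Arr (ihom D C)" if "\<sigma> \<in> Arr (ihom D B)" for \<sigma>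
    using that whiskL_in U by blast
  have t [simp]: "ften (hom_post D (unitF B C)) H K \<in> Arr (ihom D C)" if "H \<in> arrows D B" "K \<in> arrows D B" for H K
    using that PU.ften_arr(1)[of H K] by simp
  have u [simp]: "funit (hom_post D (unitF B C)) \<in> Arr (ihom D C)" using PU.funit_arr(1) by simp
  have tc: "unitF B C \<circ>\<^sub>F H = unitF D C" if "H \<in> arrows D B" for H
    using unitF_compF[OF that C] .
  show ?thesis
    by (rule smf_eqI[of _ "ihom D B" "ihom D C"])
      (use p unitF_arrow[OF P.ihom_spc Q.ihom_spc] in \<open>auto intro!: Q.ihom_eqI simp: tc\<close>)
qed

lemma hom_functor_app [simp]:
  "Src (hom_functor D B C) = ihom B C" "Tgt (hom_functor D B C) = ihom (ihom D B) (ihom D C)"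
  "F \<in> arrows B C ==> fobj (hom_functor D B C) F = hom_post D F"
  "\<sigma> \<in> Arr (ihom B C) ==> farr (hom_functor D B C) \<sigma> = hom_post2 D \<sigma>"
  "F \<in> arrows B C ==> G \<in> arrows B C ==> ften (hom_functor D B C) F G = id2 (hom_post D (tensF F G))"
  "funit (hom_functor D B C) = id2 (unitF (ihom D B) (ihom D C))"
  by (simp_all add: hom_functor_def)

lemma hom_functor_arrow:
  assumes D: "SPC D" and B: "SPC B" and C: "SPC C"
  shows "hom_functor D B C \<in> arrows (ihom B C) (ihom (ihom D B) (ihom D C))"
proof -
  interpret S: spc_pair B C by (rule spc_pair[OF B C])
  interpret P: spc_pair D B by (rule spc_pair[OF D B])
  interpret Q: spc_pair D C by (rule spc_pair[OF D C])
  interpret PQ: spc_pair "ihom D B" "ihom D C" by (rule spc_pair[OF P.ihom_spc Q.ihom_spc])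
  note t = hom_post_tensF[OF D, of _ B C]
  note u = hom_post_unitF[OF D B C]
  have [simp]: "hom_post D F \<in> arrows (ihom D B) (ihom D C)" if "F \<in> arrows B C" for F
    using hom_post_arrow[OF D that] .
  have [simp]: "hom_post2 D \<sigma> \<in> Arr (ihom (ihom D B) (ihom D C))" if "\<sigma> \<in> Arr (ihom B C)" for \<sigma>
    using hom_post2_in[OF D that] .
  have w [simp]: "\<sigma> *\<^sub>R K \<in> Arr (ihom D C)" if "\<sigma> \<in> Arr (ihom B C)" "K \<in> arrows D B" for \<sigma> K
    using that whiskR_in by blast
  have c [simp]: "F \<circ>\<^sub>F K \<in> arrows D C" if "F \<in> arrows B C" "K \<in> arrows D B" for F K
    using compF_arrow that by blast
  have tc: "tensF F G \<circ>\<^sub>F H = tensF (F \<circ>\<^sub>F H) (G \<circ>\<^sub>F H)" if "F \<in> arrows B C" "G \<in> arrows B C" "H \<in> arrows D B" for F G H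
    using tensF_compF that by blast
  have uc: "unitF B C \<circ>\<^sub>F H = unitF D C" if "H \<in> arrows D B" for H
    using unitF_compF[OF that C] .
  show ?thesis
  proof (rule arrowsI)
    show "fobj (hom_functor D B C) \<in> extensional (Obj (ihom B C))" "farr (hom_functor D B C) \<in> extensional (Arr (ihom B C))"
      "restrict2 (Obj (ihom B C)) (ften (hom_functor D B C)) = ften (hom_functor D B C)"
      by (simp_all add: hom_functor_def)
  qed (auto simp: hom_def S.ihom_spc PQ.ihom_spc t u tc uc intro!: PQ.ihom_eqI Q.ihom_eqI)
qed

lemma ev_app [simp]:
  "Src (ev C D c) = ihom C D" "Tgt (ev C D c) = D"
  "F \<in> arrows C D ==> fobj (ev C D c) F = fobj F c"
  "\<sigma> \<in> Arr (ihom C D) ==> farr (ev C D c) \<sigma> = \<sigma> \<diamondop> c"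
  "F \<in> arrows C D ==> G \<in> arrows C D ==> ften (ev C D c) F G = Id D (fobj F c \<otimes>\<^bsub>D\<^esub> fobj G c)"
  "funit (ev C D c) = Id D \<one>\<^bsub>D\<^esub>"
  by (simp_all add: ev_def)

lemma ev_arrow:
  assumes C: "SPC C" and D: "SPC D" and c: "c \<in> Obj C"
  shows "ev C D c \<in> arrows (ihom C D) D"
proof -
  interpret S: spc_pair C D by (rule spc_pair[OF C D])
  show ?thesis
  proof (rule arrowsI)
    show "fobj (ev C D c) \<in> extensional (Obj (ihom C D))" "farr (ev C D c) \<in> extensional (Arr (ihom C D))"
      "restrict2 (Obj (ihom C D)) (ften (ev C D c)) = ften (ev C D c)"
      by (simp_all add: ev_def)
  qed (use c D S.ihom_spc in \<open>auto simp: hom_def\<close>)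
qed

section \<open>The universal property of presented categories\<close>

text \<open>The hypothesis of \<open>presented_spc\<close> as a predicate, so that it can be the
  assumption of a locale.\<close>

definition pres_wf :: "('g, 'e) presentation \<Rightarrow> bool" where
  "pres_wf P \<longleftrightarrow> (\<forall>e \<in> genA P. pobj_wf P (gen_dom P e) \<and> pobj_wf P (gen_cod P e))"

locale pres =
  fixes P :: "('g, 'e) presentation"
  assumes wf: "pres_wf P"
begin

abbreviation cl where "cl \<equiv> pclass P"
abbreviation PC where "PC \<equiv> presented P"

lemma gens: "e \<in> genA P ==> pobj_wf P (gen_dom P e) \<and> pobj_wf P (gen_cod P e)"
  using wf by (simp add: pres_wf_def)

lemma PC_spc: "SPC PC"
  by (rule presented_spc) (rule gens)

sublocale PC: symmetric_picard_category "presented P"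
  by (rule PC_spc)

lemma wf_dom_cod [simp]: "parr_wf P t ==> pobj_wf P (pdom P t)" "parr_wf P t ==> pobj_wf P (pcod P t)"
  using pobj_wf_dom_cod[of P t] gens by blast+

lemma wf_simps [simp]:
  "pobj_wf P (PTens a b) \<longleftrightarrow> pobj_wf P a \<and> pobj_wf P b" "pobj_wf P (PBul a) \<longleftrightarrow> pobj_wf P a"
  "pobj_wf P PUnit" "pobj_wf P (PGen g) \<longleftrightarrow> g \<in> genO P"
  by (auto simp: pobj_wf_def)

lemma parallelD: "pcong P s t ==> parallel P s t"
  using pcong_parallel[of P s t] gens by blast

lemma cl_eq: "pcong P s t ==> cl s = cl t"
  by (auto simp: pclass_def intro: pc_sym pc_trans)

lemma rep: "parr_wf P t ==> pcong P t (prep (cl t))"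
  unfolding prep_def pclass_def using someI[of "\<lambda>s. s \<in> {s. pcong P t s}" t] pc_refl by auto

lemma PC_Obj [simp]: "a \<in> Obj PC \<longleftrightarrow> pobj_wf P a"
  by (simp add: presented_def)

lemma cl_arr [simp]:
  assumes "parr_wf P t"
  shows "cl t \<in> Arr PC" "Dom PC (cl t) = pdom P t" "Cod PC (cl t) = pcod P t"
  using assms parallelD[OF rep[OF assms]] by (auto simp: presented_def parallel_def)

lemma PC_arrE: "f \<in> Arr PC ==> (\<And>t. f = cl t ==> parr_wf P t ==> thesis) ==> thesis"
  by (auto simp: presented_def)

lemma cl_struct:
  "cl (AId a) = Id PC a" "cl (AAssoc a b c) = assoc PC a b c" "cl (ALunit a) = lunit PC a" "cl (ARunit a) = runit PC a"
  "cl (ASymm a b) = symm PC a b" "cl (AJ a) = bulj PC a"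
  by (auto simp: presented_def)

lemma PC_obj: "PTens a b = tensO PC a b" "PUnit = Unit PC" "PBul a = bul PC a"
  by (auto simp: presented_def)

lemma cl_comp: "parr_wf P s ==> parr_wf P t ==> pcod P t = pdom P s ==> cl (AComp s t) = Comp PC (cl s) (cl t)"
  using cl_eq[OF pc_cong_comp[OF rep rep]] by (simp add: presented_def)

lemma cl_tens: "parr_wf P s ==> parr_wf P t ==> cl (ATens s t) = tensA PC (cl s) (cl t)"
  using cl_eq[OF pc_cong_tens[OF rep rep]] by (simp add: presented_def)

lemma cl_inv: "parr_wf P t ==> cl (AInv t) = inv_arr PC (cl t)"
proof -
  assume t: "parr_wf P t"
  have "Comp PC (cl (AInv t)) (cl t) = Id PC (pdom P t)"
    using t cl_comp[of "AInv t" t] cl_eq[OF pc_inv_left[OF t]] by (simp add: cl_struct)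
  then show ?thesis
    using t cl_arr[of "AInv t"] by (intro PC.inv_arrI[symmetric]) simp_all
qed

end

primrec evO :: "('p, 'b) spc \<Rightarrow> ('g \<Rightarrow> 'p) \<Rightarrow> 'g pobj \<Rightarrow> 'p" where
  "evO D go (PGen g) = go g"
| "evO D go PUnit = \<one>\<^bsub>D\<^esub>"
| "evO D go (PTens a b) = evO D go a \<otimes>\<^bsub>D\<^esub> evO D go b"
| "evO D go (PBul a) = bul D (evO D go a)"

primrec evA :: "('p, 'b) spc \<Rightarrow> ('g \<Rightarrow> 'p) \<Rightarrow> ('e \<Rightarrow> 'b) \<Rightarrow> ('g, 'e) parr \<Rightarrow> 'b" where
  "evA D go ga (AGen e) = ga e"
| "evA D go ga (AId a) = Id D (evO D go a)"
| "evA D go ga (AComp t s) = evA D go ga t \<cdot>\<^bsub>D\<^esub> evA D go ga s"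
| "evA D go ga (ATens s t) = evA D go ga s \<boxtimes>\<^bsub>D\<^esub> evA D go ga t"
| "evA D go ga (AInv t) = inv_arr D (evA D go ga t)"
| "evA D go ga (AAssoc a b c) = assoc D (evO D go a) (evO D go b) (evO D go c)"
| "evA D go ga (ALunit a) = lunit D (evO D go a)"
| "evA D go ga (ARunit a) = runit D (evO D go a)"
| "evA D go ga (ASymm a b) = symm D (evO D go a) (evO D go b)"
| "evA D go ga (AJ a) = bulj D (evO D go a)"

locale pres_model = pres P + D: symmetric_picard_category D
  for P :: "('g, 'e) presentation" and D :: "('p, 'b) spc" (structure) +
  fixes go :: "'g \<Rightarrow> 'p" and ga :: "'e \<Rightarrow> 'b"
  assumes go: "g \<in> genO P ==> go g \<in> Obj D"
    and ga: "e \<in> genA P ==> ga e \<in> hom D (evO D go (gen_dom P e)) (evO D go (gen_cod P e))"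
    and rels: "(s, t) \<in> rels P ==> parallel P s t ==> evA D go ga s = evA D go ga t"
begin

abbreviation eO where "eO \<equiv> evO D go"
abbreviation eA where "eA \<equiv> evA D go ga"

lemma eO_closed [simp]: "pobj_wf P a ==> eO a \<in> Obj D"
  by (induction a) (simp_all add: go)

lemma eA_arr [simp]:
  assumes "parr_wf P t"
  shows "eA t \<in> Arr D" "Dom D (eA t) = eO (pdom P t)" "Cod D (eA t) = eO (pcod P t)"
proof -
  have "eA t \<in> Arr D \<and> Dom D (eA t) = eO (pdom P t) \<and> Cod D (eA t) = eO (pcod P t)"
    using assms by (induction t) (use ga in \<open>auto simp: hom_def\<close>)
  then show "eA t \<in> Arr D" "Dom D (eA t) = eO (pdom P t)" "Cod D (eA t) = eO (pcod P t)" by auto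
qed

text \<open>Each rule of the congruence is an axiom that holds in \<open>D\<close>, except
  \<open>pc_rel\<close>, which is covered by the assumption on the relations.\<close>

lemma sound: "pcong P s t ==> eA s = eA t"
proof (induction rule: pcong.induct)
  case (pc_rel s t) then show ?case using rels by blast
next
  case (pc_tens_comp t s t' s') then show ?case by (simp add: D.tens_comp)
qed (simp_all add: D.assoc_natural D.lunit_natural D.runit_natural D.symm_natural D.pentagon D.triangle D.hexagon)

text \<open>An arrow is a class of expressions and \<open>prep\<close> picks an arbitrary member; by
  \<open>sound\<close> the value does not depend on the choice. The comparison arrows are
  identities, so the result is strict.\<close>

definition model :: "('g pobj, ('g, 'e) parr set, 'p, 'b) smf" where
  "model = \<lparr>Src = PC, Tgt = D, fobj = (\<lambda>a \<in> Obj PC. eO a), farr = (\<lambda>f \<in> Arr PC. eA (prep f)),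
     ften = restrict2 (Obj PC) (\<lambda>a b. Id D (eO a \<otimes> eO b)), funit = Id D \<one>\<rparr>"

lemma model_app [simp]:
  "pobj_wf P a ==> fobj model a = eO a" "parr_wf P t ==> farr model (cl t) = eA t"
  "pobj_wf P a ==> pobj_wf P b ==> ften model a b = Id D (eO a \<otimes> eO b)" "funit model = Id D \<one>"
  using sound[OF rep[of t]] by (simp_all add: model_def)

lemma model_strict: "model \<in> strict_arrows PC D"
proof -
  have ac [simp]: "farr model (Comp PC (cl s) (cl t)) = eA s \<cdot> eA t" if "parr_wf P s" "parr_wf P t" "pcod P t = pdom P s" for s t
    using that by (simp add: cl_comp[symmetric])
  have at [simp]: "farr model (tensA PC (cl s) (cl t)) = eA s \<boxtimes> eA t" if "parr_wf P s" "parr_wf P t" for s t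
    using that by (simp add: cl_tens[symmetric])
  note ob [simp] = PC_obj[symmetric]
  have st [simp]: "pobj_wf P a ==> farr model (Id PC a) = Id D (eO a)"
    "pobj_wf P a ==> pobj_wf P b ==> pobj_wf P c ==> farr model (assoc PC a b c) = assoc D (eO a) (eO b) (eO c)"
    "pobj_wf P a ==> farr model (lunit PC a) = lunit D (eO a)" "pobj_wf P a ==> farr model (runit PC a) = runit D (eO a)"
    "pobj_wf P a ==> pobj_wf P b ==> farr model (symm PC a b) = symm D (eO a) (eO b)"
    "pobj_wf P a ==> farr model (bulj PC a) = bulj D (eO a)" for a b c
    by (simp_all add: cl_struct[symmetric])
  have "model \<in> arrows PC D"
    by (rule arrowsI) (auto simp: D.spc PC_spc D.hom_iff elim!: PC_arrE, auto simp: model_def)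
  then show ?thesis by (rule strict_arrowsI) auto
qed

end

context pres
begin

text \<open>All expressions are built from generators by operations that strict arrows preserve, the
  chosen inverses and the arrows \<open>j\<close> included; hence two inductions.\<close>

lemma strict_unique:
  assumes F: "F \<in> strict_arrows PC D" and G: "G \<in> strict_arrows PC D"
    and o: "\<And>g. g \<in> genO P ==> fobj F (PGen g) = fobj G (PGen g)"
    and a: "\<And>e. e \<in> genA P ==> farr F (cl (AGen e)) = farr G (cl (AGen e))"
  shows "F = G"
proof -
  interpret F: spc_strict PC D F by (rule spc_strict[OF F])
  interpret G: spc_strict PC D G by (rule spc_strict[OF G])
  have O: "fobj F x = fobj G x" if "pobj_wf P x" for x
    using that
  proof (induction x)
    case PUnit show ?case unfolding PC_obj by simp
  next
    case (PTens x y) then show ?case using F.str_obj(1)[of x y] G.str_obj(1)[of x y] by (simp add: PC_obj(1)[symmetric])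
  next
    case (PBul x) then show ?case using F.str_obj(5)[of x] G.str_obj(5)[of x] by (simp add: PC_obj(3)[symmetric])
  qed (auto simp: o)
  have A: "farr F (cl t) = farr G (cl t)" if "parr_wf P t" for t
    using that by (induction t) (auto simp: a O cl_struct cl_comp cl_tens cl_inv F.farr_Comp G.farr_Comp F.farr_inv G.farr_inv)
  show ?thesis
    by (rule smf_eqI[OF F.arrow G.arrow]) (auto simp: O A elim!: PC_arrE)
qed

text \<open>No strictness is needed here: all the comparison arrows of \<open>F\<close> are invertible.\<close>

lemma cell_unique:
  fixes D (structure)
  assumes s: "\<sigma> \<in> cells F G" and t: "\<tau> \<in> cells F G" and F: "F \<in> arrows PC D"
    and g: "\<And>g. g \<in> genO P ==> \<sigma> \<diamondop> PGen g = \<tau> \<diamondop> PGen g"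
  shows "\<sigma> = \<tau>"
proof (rule mnt_eqI[OF s t F])
  interpret s: spc_cell PC D F G \<sigma> by (rule spc_cell[OF s F])
  interpret t: spc_cell PC D F G \<tau> by (rule spc_cell[OF t F])
  note C = s.F.C.cancel_right
  have u: "\<sigma> \<diamondop> PUnit = \<tau> \<diamondop> PUnit"
    by (rule C[of _ "funit F"]) (use s.unit t.unit in \<open>simp_all add: PC_obj[symmetric]\<close>)
  fix x assume "x \<in> Obj PC"
  then have "pobj_wf P x" by simp
  then show "\<sigma> \<diamondop> x = \<tau> \<diamondop> x"
  proof (induction x)
    case (PTens x y)
    show ?case
      by (rule C[of _ "ften F x y"]) (use PTens s.tens[of x y] t.tens[of x y] in \<open>simp_all add: PC_obj[symmetric]\<close>)
  next
    case (PBul x)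
    then have [simp]: "pobj_wf P x" and e: "\<sigma> \<diamondop> x = \<tau> \<diamondop> x" by simp_all
    \<comment> \<open>Naturality at \<open>bulj PC x\<close> and agreement at the unit determine the
      component at \<open>PTens (PBul x) x\<close>. Compatibility with the tensor product and
      \<open>tens_faithful\<close> then isolate the component at \<open>PBul x\<close>.\<close>
    have "\<sigma> \<diamondop> (PTens (PBul x) x) \<cdot> farr F (bulj PC x) = \<tau> \<diamondop> (PTens (PBul x) x) \<cdot> farr F (bulj PC x)"
      using s.natural[of "bulj PC x"] t.natural[of "bulj PC x"] u by (simp add: PC_obj[symmetric])
    then have "\<sigma> \<diamondop> (PTens (PBul x) x) = \<tau> \<diamondop> (PTens (PBul x) x)"
      by (rule C) (simp_all add: PC_obj[symmetric])
    then have "ften G (PBul x) x \<cdot> (\<sigma> \<diamondop> PBul x \<boxtimes> \<sigma> \<diamondop> x) = ften G (PBul x) x \<cdot> (\<tau> \<diamondop> PBul x \<boxtimes> \<sigma> \<diamondop> x)"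
      using s.tens[of "PBul x" x] t.tens[of "PBul x" x] by (simp add: PC_obj(1)[symmetric] e)
    then have "\<sigma> \<diamondop> PBul x \<boxtimes> \<sigma> \<diamondop> x = \<tau> \<diamondop> PBul x \<boxtimes> \<sigma> \<diamondop> x"
      by (rule s.F.C.cancel_left) (simp_all add: PC_obj[symmetric])
    then show ?case by (rule s.F.C.tens_faithful[rotated -1]) simp_all
  qed (auto simp: g u)
qed

end

text \<open>Extends components given at generators to all objects. The clauses for unit and tensor
  product are the monoidality conditions for a strict \<open>F\<close>. At \<open>PBul a\<close> no
  formula is available: the component is chosen as a solution of the naturality condition at
  \<open>AJ a\<close>, and \<open>cell_exists\<close> shows that there is one.\<close>

primrec sg :: "('p, 'b) spc \<Rightarrow> ('g, 'e) presentation \<Rightarrow> ('g pobj, ('g, 'e) parr set, 'p, 'b) smf \<Rightarrow>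
    ('g pobj, ('g, 'e) parr set, 'p, 'b) smf \<Rightarrow> ('g \<Rightarrow> 'b) \<Rightarrow> 'g pobj \<Rightarrow> 'b" where
  "sg D P F G \<tau> (PGen g) = \<tau> g"
| "sg D P F G \<tau> PUnit = funit G"
| "sg D P F G \<tau> (PTens a b) = ften G a b \<cdot>\<^bsub>D\<^esub> (sg D P F G \<tau> a \<boxtimes>\<^bsub>D\<^esub> sg D P F G \<tau> b)"
| "sg D P F G \<tau> (PBul a) = (SOME h. h \<in> hom D (fobj F (PBul a)) (fobj G (PBul a)) \<and>
     ften G (PBul a) a \<cdot>\<^bsub>D\<^esub> (h \<boxtimes>\<^bsub>D\<^esub> sg D P F G \<tau> a) \<cdot>\<^bsub>D\<^esub> farr F (pclass P (AJ a)) = farr G (pclass P (AJ a)) \<cdot>\<^bsub>D\<^esub> funit G)"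

declare sg.simps(4) [simp del]

context pres
begin

text \<open>Because \<open>F\<close> is strict, the recursively defined components have the right
  ends and are monoidal by construction. Naturality, assumed at generating arrows, spreads to all
  arrow expressions by induction.\<close>

lemma cell_exists:
  fixes D (structure)
  assumes F: "F \<in> strict_arrows PC D" and G: "G \<in> arrows PC D"
    and t: "\<And>g. g \<in> genO P ==> \<tau> g \<in> hom D (fobj F (PGen g)) (fobj G (PGen g))"
    and n: "\<And>e. e \<in> genA P ==> sg D P F G \<tau> (gen_cod P e) \<cdot> farr F (cl (AGen e)) = farr G (cl (AGen e)) \<cdot> sg D P F G \<tau> (gen_dom P e)"
  obtains \<sigma> where "\<sigma> \<in> cells F G" "\<And>g. g \<in> genO P ==> \<sigma> \<diamondop> PGen g = \<tau> g"
proof -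
  interpret F: spc_strict PC D F by (rule spc_strict[OF F])
  interpret G: spc_arrow PC D G by (rule spc_arrow[OF G])
  note D = F.C.spc
  let ?s = "sg D P F G \<tau>"
  note ob = PC_obj[symmetric]
  note tm = F.C.tens_merge F.C.comp_reduce[OF F.C.tens_merge]
  have Fo: "fobj F PUnit = \<one>" "pobj_wf P a ==> pobj_wf P b ==> fobj F (PTens a b) = fobj F a \<otimes> fobj F b"
    "pobj_wf P a ==> fobj F (PBul a) = bul D (fobj F a)" for a b
    unfolding PC_obj by simp_all
  \<comment> \<open>The last conjunct records the equation that the chosen component at
    \<open>PBul b\<close> satisfies; it becomes naturality at \<open>AJ b\<close>.\<close>
  have S: "?s a \<in> Arr D \<and> Dom D (?s a) = fobj F a \<and> Cod D (?s a) = fobj G a \<and>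
      (\<forall>b. a = PBul b \<longrightarrow> ften G a b \<cdot> (?s a \<boxtimes> ?s b) \<cdot> bulj D (fobj F b) = farr G (bulj PC b) \<cdot> funit G)"
    if "pobj_wf P a" for a
    using that
  proof (induction a)
    case (PGen g) then show ?case using t[of g] by (simp add: hom_def)
  next
    case PUnit show ?case using G.funit_arr by (simp add: Fo ob)
  next
    case (PTens a b) then show ?case using G.ften_arr[of a b] by (simp add: Fo ob)
  next
    case (PBul a)
    then have a [simp]: "pobj_wf P a" "?s a \<in> Arr D" "Dom D (?s a) = fobj F a" "Cod D (?s a) = fobj G a" by auto
    let ?Q = "\<lambda>h. h \<in> hom D (fobj F (PBul a)) (fobj G (PBul a)) \<and>
      ften G (PBul a) a \<cdot> (h \<boxtimes> ?s a) \<cdot> farr F (pclass P (AJ a)) = farr G (pclass P (AJ a)) \<cdot> funit G"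
    have fg [simp]: "ften G (PBul a) a \<in> Arr D" "Dom D (ften G (PBul a) a) = fobj G (PBul a) \<otimes> fobj G a"
        "Cod D (ften G (PBul a) a) = fobj G (PTens (PBul a) a)"
      "farr G (bulj PC a) \<in> Arr D" "Dom D (farr G (bulj PC a)) = fobj G PUnit" "Cod D (farr G (bulj PC a)) = fobj G (PTens (PBul a) a)"
      using G.ften_arr[of "PBul a" a] G.farr_arr[of "bulj PC a"] by (simp_all add: ob)
    have fu [simp]: "Cod D (funit G) = fobj G PUnit" by (simp add: ob)
    \<comment> \<open>The strict \<open>F\<close> sends \<open>bulj\<close> to \<open>bulj\<close>,
      an arrow out of the unit, so \<open>dual_exists\<close> solves the condition for
      \<open>h\<close>.\<close>
    obtain h where [simp]: "h \<in> Arr D" "Dom D h = bul D (fobj F a)" "Cod D h = fobj G (PBul a)"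
      and h: "(h \<boxtimes> ?s a) \<cdot> bulj D (fobj F a) = inv_arr D (ften G (PBul a) a) \<cdot> farr G (bulj PC a) \<cdot> funit G"
      by (rule F.C.dual_exists[of "?s a" "bulj D (fobj F a)" "inv_arr D (ften G (PBul a) a) \<cdot> farr G (bulj PC a) \<cdot> funit G"
          "bul D (fobj F a)" "fobj G (PBul a)"]) (auto simp: ob)
    have "?Q h" by (simp add: hom_def Fo cl_struct h ob)
    then have "?Q (?s (PBul a))" unfolding sg.simps(4) by (rule someI)
    then show ?case by (simp add: hom_def Fo cl_struct)
  qed
  then have Sa [simp]: "pobj_wf P a ==> ?s a \<in> Arr D" "pobj_wf P a ==> Dom D (?s a) = fobj F a" "pobj_wf P a ==> Cod D (?s a) = fobj G a"
    and Sb: "pobj_wf P b ==> ften G (PBul b) b \<cdot> (?s (PBul b) \<boxtimes> ?s b) \<cdot> bulj D (fobj F b) = farr G (bulj PC b) \<cdot> funit G"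
    for a b using S[of "PBul b"] by auto
  have Ga: "pobj_wf P a ==> pobj_wf P b ==> ften G a b \<in> Arr D" "pobj_wf P a ==> pobj_wf P b ==> Dom D (ften G a b) = fobj G a \<otimes> fobj G b"
     "pobj_wf P a ==> pobj_wf P b ==> Cod D (ften G a b) = fobj G (PTens a b)"
     "Cod D (funit G) = fobj G PUnit" for a b
    by (simp_all add: ob)
  note [simp] = Ga
  have N: "?s (pcod P e) \<cdot> farr F (cl e) = farr G (cl e) \<cdot> ?s (pdom P e)" if "parr_wf P e" for e
    using that
  proof (induction e)
    case (AGen e) then show ?case using n[of e] by simp
  next
    case (AId a) then show ?case by (simp add: cl_struct)
  next
    case (AComp s t)
    then have [simp]: "parr_wf P s" "parr_wf P t" and c: "pcod P t = pdom P s" by auto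
    have *: "Cod PC (cl t) = Dom PC (cl s)" using c by simp
    show ?case
      using AComp c F.C.comp_reduce[OF AComp.IH(1), of "farr F (cl t)"] by (simp add: cl_comp F.farr_Comp G.farr_Comp)
  next
    case (ATens s t)
    then have [simp]: "parr_wf P s" "parr_wf P t" by auto
    have "?s (PTens (pcod P s) (pcod P t)) \<cdot> (farr F (cl s) \<boxtimes> farr F (cl t))
       = ften G (pcod P s) (pcod P t) \<cdot> (farr G (cl s) \<boxtimes> farr G (cl t)) \<cdot> (?s (pdom P s) \<boxtimes> ?s (pdom P t))"
      using ATens by (simp add: tm)
    also have "\<dots> = farr G (tensA PC (cl s) (cl t)) \<cdot> ften G (pdom P s) (pdom P t) \<cdot> (?s (pdom P s) \<boxtimes> ?s (pdom P t))"
      by (simp add: F.C.comp_reduce[OF G.ften_natural2] ob)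
    finally show ?case by (simp add: cl_tens)
  next
    case (AInv t)
    then have [simp]: "parr_wf P t" and e: "?s (pcod P t) \<cdot> farr F (cl t) = farr G (cl t) \<cdot> ?s (pdom P t)" by auto
    have "farr G (cl t) \<cdot> (?s (pdom P t) \<cdot> inv_arr D (farr F (cl t))) = farr G (cl t) \<cdot> (inv_arr D (farr G (cl t)) \<cdot> ?s (pcod P t))"
      by (simp add: F.C.comp_reduce[OF e[symmetric]])
    then have "?s (pdom P t) \<cdot> inv_arr D (farr F (cl t)) = inv_arr D (farr G (cl t)) \<cdot> ?s (pcod P t)"
      by (rule F.C.cancel_left) simp_all
    then show ?case by (simp add: cl_inv F.farr_inv G.farr_inv)
  next
    case (AAssoc a b c)
    then have [simp]: "pobj_wf P a" "pobj_wf P b" "pobj_wf P c" by auto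
    have "farr G (assoc PC a b c) \<cdot> ?s (PTens (PTens a b) c)
      = farr G (assoc PC a b c) \<cdot> ften G (tensO PC a b) c \<cdot> (ften G a b \<boxtimes> Id D (fobj G c)) \<cdot> ((?s a \<boxtimes> ?s b) \<boxtimes> ?s c)"
      by (simp add: tm ob)
    also have "\<dots> = ften G a (tensO PC b c) \<cdot> (Id D (fobj G a) \<boxtimes> ften G b c) \<cdot> (?s a \<boxtimes> (?s b \<boxtimes> ?s c)) \<cdot> assoc D (fobj F a) (fobj F b) (fobj F c)"
      using F.C.comp_reduce3[OF G.ften_assoc[of a b c], of "(?s a \<boxtimes> ?s b) \<boxtimes> ?s c"] by (simp add: F.C.assoc_natural ob)
    also have "\<dots> = ?s (PTens a (PTens b c)) \<cdot> farr F (assoc PC a b c)"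
      by (simp add: tm ob)
    finally show ?case by (simp add: cl_struct)
  next
    case (ALunit a)
    then have [simp]: "pobj_wf P a" by auto
    have "farr G (lunit PC a) \<cdot> ?s (PTens PUnit a)
      = farr G (lunit PC a) \<cdot> ften G \<one>\<^bsub>PC\<^esub> a \<cdot> (funit G \<boxtimes> Id D (fobj G a)) \<cdot> (Id D \<one> \<boxtimes> ?s a)"
      by (simp add: tm ob)
    also have "\<dots> = ?s a \<cdot> farr F (lunit PC a)"
      using F.C.comp_reduce3[OF G.ften_lunit[of a], of "Id D \<one> \<boxtimes> ?s a"] by (simp add: F.C.lunit_natural ob)
    finally show ?case by (simp add: cl_struct)
  next
    case (ARunit a)
    then have [simp]: "pobj_wf P a" by auto
    have "farr G (runit PC a) \<cdot> ?s (PTens a PUnit)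
      = farr G (runit PC a) \<cdot> ften G a \<one>\<^bsub>PC\<^esub> \<cdot> (Id D (fobj G a) \<boxtimes> funit G) \<cdot> (?s a \<boxtimes> Id D \<one>)"
      by (simp add: tm ob)
    also have "\<dots> = ?s a \<cdot> farr F (runit PC a)"
      using F.C.comp_reduce3[OF G.ften_runit[of a], of "?s a \<boxtimes> Id D \<one>"] by (simp add: F.C.runit_natural ob)
    finally show ?case by (simp add: cl_struct)
  next
    case (ASymm a b)
    then have [simp]: "pobj_wf P a" "pobj_wf P b" by auto
    show ?case
      using F.C.comp_reduce[OF G.ften_symm[of a b], of "?s a \<boxtimes> ?s b"] by (simp add: cl_struct F.C.symm_natural ob)
  next
    case (AJ a)
    then show ?case using Sb[of a] F.str_obj(6)[of a] by (simp add: cl_struct Fo)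
  qed
  let ?c = "\<lparr>nsrc = F, ntgt = G, ncomp = (\<lambda>x \<in> Obj PC. ?s x)\<rparr>"
  have "?c \<in> cells F G"
    by (rule cellsI[OF F.arrow G]) (auto simp: F.C.hom_iff ob N elim!: PC_arrE)
  moreover have "?c \<diamondop> PGen g = \<tau> g" if "g \<in> genO P" for g using that by simp
  ultimately show thesis by (rule that)
qed

end

section \<open>The universal property of the tensor product\<close>

lemma tensP_sel [simp]:
  "genO (tensP B C) = Obj B \<times> Obj C" "genA (tensP B C) = {e. tgen_wf B C e}"
  "gen_dom (tensP B C) = tgen_dom B C" "gen_cod (tensP B C) = tgen_cod B C"
  "(s, t) \<in> rels (tensP B C) \<longleftrightarrow> trel B C s t"
  by (simp_all add: tensP_def)

lemma eta_app [simp]: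
  "Src (eta B C) = B" "Tgt (eta B C) = ihom C (B \<otimes>\<^sub>0 C)"
  "b \<in> Obj B ==> Src (fobj (eta B C) b) = C" "b \<in> Obj B ==> Tgt (fobj (eta B C) b) = B \<otimes>\<^sub>0 C"
  "b \<in> Obj B ==> c \<in> Obj C ==> fobj (fobj (eta B C) b) c = PGen (b, c)"
  "b \<in> Obj B ==> g \<in> Arr C ==> farr (fobj (eta B C) b) g = pclass (tensP B C) (AR b g)"
  "b \<in> Obj B ==> c \<in> Obj C ==> c' \<in> Obj C ==> ften (fobj (eta B C) b) c c' = pclass (tensP B C) (AM2 b c c')"
  "b \<in> Obj B ==> funit (fobj (eta B C) b) = pclass (tensP B C) (AU2 b)"
  "f \<in> Arr B ==> c \<in> Obj C ==> farr (eta B C) f \<diamondop> c = pclass (tensP B C) (AL f c)"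
  "b \<in> Obj B ==> b' \<in> Obj B ==> c \<in> Obj C ==> ften (eta B C) b b' \<diamondop> c = pclass (tensP B C) (AM1 b b' c)"
  "c \<in> Obj C ==> funit (eta B C) \<diamondop> c = pclass (tensP B C) (AU1 c)"
  by (simp_all add: eta_def Let_def)

locale tens = B: symmetric_picard_category B + C: symmetric_picard_category C
  for B :: "('o, 'a) spc" and C :: "('p, 'b) spc"
begin

lemma tensP_wf: "pres_wf (tensP B C)"
  unfolding pres_wf_def
proof
  fix e assume "e \<in> genA (tensP B C)"
  then show "pobj_wf (tensP B C) (gen_dom (tensP B C) e) \<and> pobj_wf (tensP B C) (gen_cod (tensP B C) e)"
    by (cases e) (auto simp: pobj_wf_def)
qed

sublocale P: pres "tensP B C"
  by unfold_locales (rule tensP_wf)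

abbreviation cl where "cl \<equiv> pclass (tensP B C)"

lemma X_spc: "SPC (B \<otimes>\<^sub>0 C)"
  unfolding tens0_def by (rule P.PC_spc)

lemma rel: "trel B C s t ==> cl s = cl t"
  using pc_rel[of s t "tensP B C"] trel_parallel[OF B.spc C.spc]
  by (intro P.cl_eq) auto

lemma cl_interchange:
  "pobj_wf (tensP B C) w ==> pobj_wf (tensP B C) x ==> pobj_wf (tensP B C) y ==> pobj_wf (tensP B C) z ==>
    parr_wf (tensP B C) (AInterchange w x y z) \<and> cl (AInterchange w x y z) = interchange P.PC w x y z
    \<and> pdom (tensP B C) (AInterchange w x y z) = PTens (PTens w x) (PTens y z)
    \<and> pcod (tensP B C) (AInterchange w x y z) = PTens (PTens w y) (PTens x z)"
  by (simp add: AInterchange_def interchange_def Let_def P.cl_comp P.cl_tens P.cl_inv P.cl_struct P.PC_obj[symmetric])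

lemmas cl_eqs = P.cl_comp P.cl_tens P.cl_inv P.cl_struct P.PC_obj[symmetric] cl_interchange

abbreviation E where "E \<equiv> fobj (eta B C)"

text \<open>Each axiom is one family of relations in \<open>trel\<close>, read in the quotient. The
  lemmas that follow treat the values of \<open>eta\<close> on arrows, its comparison arrows and
  finally \<open>eta\<close> itself in the same way.\<close>

lemma E_arrow:
  assumes b [simp]: "b \<in> Obj B" shows "E b \<in> arrows C (B \<otimes>\<^sub>0 C)"
proof (rule arrowsI)
  show "fobj (E b) \<in> extensional (Obj C)" "farr (E b) \<in> extensional (Arr C)" "restrict2 (Obj C) (ften (E b)) = ften (E b)"
    by (simp_all add: eta_def Let_def)
  fix f g assume fg [simp]: "f \<in> Arr C" "g \<in> Arr C"
  show "Cod C f = Dom C g ==> farr (E b) (g \<cdot>\<^bsub>C\<^esub> f) = farr (E b) g \<cdot>\<^bsub>B \<otimes>\<^sub>0 C\<^esub> farr (E b) f"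
    using rel[OF tr_R_Comp[OF b C.homI[OF fg(1) refl refl] C.homI[OF fg(2)]]] by (simp add: tens0_def cl_eqs)
  show "farr (E b) (f \<boxtimes>\<^bsub>C\<^esub> g) \<cdot>\<^bsub>B \<otimes>\<^sub>0 C\<^esub> ften (E b) (Dom C f) (Dom C g) =
      ften (E b) (Cod C f) (Cod C g) \<cdot>\<^bsub>B \<otimes>\<^sub>0 C\<^esub> (farr (E b) f \<boxtimes>\<^bsub>B \<otimes>\<^sub>0 C\<^esub> farr (E b) g)"
    using rel[OF tr_M2_nat[OF b C.homI[OF fg(1) refl refl] C.homI[OF fg(2) refl refl]]] by (simp add: tens0_def cl_eqs)
next
  fix x y z assume o [simp]: "x \<in> Obj C" "y \<in> Obj C" "z \<in> Obj C"
  show "farr (E b) (assoc C x y z) \<cdot>\<^bsub>B \<otimes>\<^sub>0 C\<^esub> ften (E b) (x \<otimes>\<^bsub>C\<^esub> y) z \<cdot>\<^bsub>B \<otimes>\<^sub>0 C\<^esub>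
       (ften (E b) x y \<boxtimes>\<^bsub>B \<otimes>\<^sub>0 C\<^esub> Id (B \<otimes>\<^sub>0 C) (fobj (E b) z)) =
       ften (E b) x (y \<otimes>\<^bsub>C\<^esub> z) \<cdot>\<^bsub>B \<otimes>\<^sub>0 C\<^esub> (Id (B \<otimes>\<^sub>0 C) (fobj (E b) x) \<boxtimes>\<^bsub>B \<otimes>\<^sub>0 C\<^esub> ften (E b) y z) \<cdot>\<^bsub>B \<otimes>\<^sub>0 C\<^esub>
       assoc (B \<otimes>\<^sub>0 C) (fobj (E b) x) (fobj (E b) y) (fobj (E b) z)"
    using rel[OF tr_M2_assoc[OF b o]] by (simp add: tens0_def cl_eqs)
next
  fix x assume o [simp]: "x \<in> Obj C"
  show "farr (E b) (lunit C x) \<cdot>\<^bsub>B \<otimes>\<^sub>0 C\<^esub> ften (E b) \<one>\<^bsub>C\<^esub> x \<cdot>\<^bsub>B \<otimes>\<^sub>0 C\<^esub> (funit (E b) \<boxtimes>\<^bsub>B \<otimes>\<^sub>0 C\<^esub> Id (B \<otimes>\<^sub>0 C) (fobj (E b) x)) = lunit (B \<otimes>\<^sub>0 C) (fobj (E b) x)"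
    using rel[OF tr_M2_lunit[OF b o]] by (simp add: tens0_def cl_eqs)
  show "farr (E b) (runit C x) \<cdot>\<^bsub>B \<otimes>\<^sub>0 C\<^esub> ften (E b) x \<one>\<^bsub>C\<^esub> \<cdot>\<^bsub>B \<otimes>\<^sub>0 C\<^esub> (Id (B \<otimes>\<^sub>0 C) (fobj (E b) x) \<boxtimes>\<^bsub>B \<otimes>\<^sub>0 C\<^esub> funit (E b)) = runit (B \<otimes>\<^sub>0 C) (fobj (E b) x)"
    using rel[OF tr_M2_runit[OF b o]] by (simp add: tens0_def cl_eqs)
  show "farr (E b) (Id C x) = Id (B \<otimes>\<^sub>0 C) (fobj (E b) x)"
    using rel[OF tr_R_Id[OF b o]] by (simp add: tens0_def cl_eqs)
next
  fix x y assume o [simp]: "x \<in> Obj C" "y \<in> Obj C"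
  show "farr (E b) (symm C x y) \<cdot>\<^bsub>B \<otimes>\<^sub>0 C\<^esub> ften (E b) x y = ften (E b) y x \<cdot>\<^bsub>B \<otimes>\<^sub>0 C\<^esub> symm (B \<otimes>\<^sub>0 C) (fobj (E b) x) (fobj (E b) y)"
    using rel[OF tr_M2_symm[OF b o]] by (simp add: tens0_def cl_eqs)
qed (auto simp: C.spc P.PC_spc tens0_def P.PC.hom_iff cl_eqs)

sublocale Q: spc_pair C "B \<otimes>\<^sub>0 C"
  by (rule spc_pair[OF C.spc X_spc])

lemma eta_bounds [simp]:
  "f \<in> Arr B ==> nsrc (farr (eta B C) f) = E (Dom B f)" "f \<in> Arr B ==> ntgt (farr (eta B C) f) = E (Cod B f)"
  "b \<in> Obj B ==> b' \<in> Obj B ==> nsrc (ften (eta B C) b b') = tensF (E b) (E b')"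
  "b \<in> Obj B ==> b' \<in> Obj B ==> ntgt (ften (eta B C) b b') = E (b \<otimes>\<^bsub>B\<^esub> b')"
  "nsrc (funit (eta B C)) = unitF C (B \<otimes>\<^sub>0 C)" "ntgt (funit (eta B C)) = E \<one>\<^bsub>B\<^esub>"
  by (simp_all add: eta_def Let_def)

lemma eta_arr_in [simp]:
  assumes f [simp]: "f \<in> Arr B" shows "farr (eta B C) f \<in> Arr (ihom C (B \<otimes>\<^sub>0 C))"
proof (rule cells_Arr[of _ "E (Dom B f)" "E (Cod B f)"], rule cellsI)
  note f' = B.homI[OF f refl refl]
  show "ncomp (farr (eta B C) f) \<in> extensional (Obj C)" by (simp add: eta_def Let_def)
  fix g assume g [simp]: "g \<in> Arr C"
  show "farr (eta B C) f \<diamondop> Cod C g \<cdot>\<^bsub>B \<otimes>\<^sub>0 C\<^esub> farr (E (Dom B f)) g = farr (E (Cod B f)) g \<cdot>\<^bsub>B \<otimes>\<^sub>0 C\<^esub> farr (eta B C) f \<diamondop> Dom C g"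
    using rel[OF tr_L_nat[OF f' C.homI[OF g refl refl]]] by (simp add: tens0_def cl_eqs)
next
  note f' = B.homI[OF f refl refl]
  fix x y assume o [simp]: "x \<in> Obj C" "y \<in> Obj C"
  show "farr (eta B C) f \<diamondop> (x \<otimes>\<^bsub>C\<^esub> y) \<cdot>\<^bsub>B \<otimes>\<^sub>0 C\<^esub> ften (E (Dom B f)) x y =
    ften (E (Cod B f)) x y \<cdot>\<^bsub>B \<otimes>\<^sub>0 C\<^esub> (farr (eta B C) f \<diamondop> x \<boxtimes>\<^bsub>B \<otimes>\<^sub>0 C\<^esub> farr (eta B C) f \<diamondop> y)"
    using rel[OF tr_L_M2[OF f' o]] by (simp add: tens0_def cl_eqs)
next
  show "farr (eta B C) f \<diamondop> \<one>\<^bsub>C\<^esub> \<cdot>\<^bsub>B \<otimes>\<^sub>0 C\<^esub> funit (E (Dom B f)) = funit (E (Cod B f))"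
    using rel[OF tr_L_U2[OF B.homI[OF f refl refl]]] by (simp add: tens0_def cl_eqs)
qed (auto simp: E_arrow, auto simp: tens0_def P.PC.hom_iff)

lemma eta_ten_in [simp]:
  assumes b [simp]: "b \<in> Obj B" "b' \<in> Obj B" shows "ften (eta B C) b b' \<in> Arr (ihom C (B \<otimes>\<^sub>0 C))"
proof (rule cells_Arr[of _ "tensF (E b) (E b')" "E (b \<otimes>\<^bsub>B\<^esub> b')"], rule cellsI)
  show "ncomp (ften (eta B C) b b') \<in> extensional (Obj C)" by (simp add: eta_def Let_def)
  fix g assume g [simp]: "g \<in> Arr C"
  show "ften (eta B C) b b' \<diamondop> Cod C g \<cdot>\<^bsub>B \<otimes>\<^sub>0 C\<^esub> farr (tensF (E b) (E b')) g = farr (E (b \<otimes>\<^bsub>B\<^esub> b')) g \<cdot>\<^bsub>B \<otimes>\<^sub>0 C\<^esub> ften (eta B C) b b' \<diamondop> Dom C g"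
    using rel[OF tr_M1_R[OF b C.homI[OF g refl refl]]] by (simp add: tens0_def cl_eqs)
next
  fix x y assume o [simp]: "x \<in> Obj C" "y \<in> Obj C"
  show "ften (eta B C) b b' \<diamondop> (x \<otimes>\<^bsub>C\<^esub> y) \<cdot>\<^bsub>B \<otimes>\<^sub>0 C\<^esub> ften (tensF (E b) (E b')) x y =
    ften (E (b \<otimes>\<^bsub>B\<^esub> b')) x y \<cdot>\<^bsub>B \<otimes>\<^sub>0 C\<^esub> (ften (eta B C) b b' \<diamondop> x \<boxtimes>\<^bsub>B \<otimes>\<^sub>0 C\<^esub> ften (eta B C) b b' \<diamondop> y)"
    using rel[OF tr_M1_M2[OF b o]] by (simp add: tens0_def cl_eqs)
next
  show "ften (eta B C) b b' \<diamondop> \<one>\<^bsub>C\<^esub> \<cdot>\<^bsub>B \<otimes>\<^sub>0 C\<^esub> funit (tensF (E b) (E b')) = funit (E (b \<otimes>\<^bsub>B\<^esub> b'))"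
    using rel[OF tr_M1_U2[OF b]] by (simp add: tens0_def cl_eqs)
qed (auto simp: E_arrow, auto simp: tens0_def P.PC.hom_iff cl_eqs)

lemma eta_unit_in [simp]: "funit (eta B C) \<in> Arr (ihom C (B \<otimes>\<^sub>0 C))"
proof (rule cells_Arr[of _ "unitF C (B \<otimes>\<^sub>0 C)" "E \<one>\<^bsub>B\<^esub>"], rule cellsI)
  show "ncomp (funit (eta B C)) \<in> extensional (Obj C)" by (simp add: eta_def Let_def)
  fix g assume g [simp]: "g \<in> Arr C"
  show "funit (eta B C) \<diamondop> Cod C g \<cdot>\<^bsub>B \<otimes>\<^sub>0 C\<^esub> farr (unitF C (B \<otimes>\<^sub>0 C)) g = farr (E \<one>\<^bsub>B\<^esub>) g \<cdot>\<^bsub>B \<otimes>\<^sub>0 C\<^esub> funit (eta B C) \<diamondop> Dom C g"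
    using rel[OF tr_U1_R[OF C.homI[OF g refl refl]]] by (simp add: tens0_def cl_eqs)
next
  fix x y assume o [simp]: "x \<in> Obj C" "y \<in> Obj C"
  show "funit (eta B C) \<diamondop> (x \<otimes>\<^bsub>C\<^esub> y) \<cdot>\<^bsub>B \<otimes>\<^sub>0 C\<^esub> ften (unitF C (B \<otimes>\<^sub>0 C)) x y =
    ften (E \<one>\<^bsub>B\<^esub>) x y \<cdot>\<^bsub>B \<otimes>\<^sub>0 C\<^esub> (funit (eta B C) \<diamondop> x \<boxtimes>\<^bsub>B \<otimes>\<^sub>0 C\<^esub> funit (eta B C) \<diamondop> y)"
    using rel[OF tr_U1_M2[OF o]] by (simp add: tens0_def cl_eqs)
next
  show "funit (eta B C) \<diamondop> \<one>\<^bsub>C\<^esub> \<cdot>\<^bsub>B \<otimes>\<^sub>0 C\<^esub> funit (unitF C (B \<otimes>\<^sub>0 C)) = funit (E \<one>\<^bsub>B\<^esub>)"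
    using rel[OF tr_U1_U2] by (simp add: tens0_def cl_eqs)
qed (auto simp: E_arrow, auto simp: tens0_def P.PC.hom_iff cl_eqs)

lemma E_in [simp]: "b \<in> Obj B ==> E b \<in> arrows C (B \<otimes>\<^sub>0 C)"
  by (rule E_arrow)

lemma eta_arrow: "eta B C \<in> arrows B (ihom C (B \<otimes>\<^sub>0 C))"
proof (rule arrowsI)
  show "fobj (eta B C) \<in> extensional (Obj B)" "farr (eta B C) \<in> extensional (Arr B)" "restrict2 (Obj B) (ften (eta B C)) = ften (eta B C)"
    by (simp_all add: eta_def Let_def)
  fix f g assume fg [simp]: "f \<in> Arr B" "g \<in> Arr B"
  show "farr (eta B C) (g \<cdot>\<^bsub>B\<^esub> f) = farr (eta B C) g \<cdot>\<^bsub>ihom C (B \<otimes>\<^sub>0 C)\<^esub> farr (eta B C) f" if a: "Cod B f = Dom B g"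
    using rel[OF tr_L_Comp[OF B.homI[OF fg(1) refl refl] B.homI[OF fg(2) a[symmetric] refl]]] a
    by (intro Q.ihom_eqI) (auto simp: tens0_def[symmetric], auto simp: tens0_def cl_eqs)
  show "farr (eta B C) (f \<boxtimes>\<^bsub>B\<^esub> g) \<cdot>\<^bsub>ihom C (B \<otimes>\<^sub>0 C)\<^esub> ften (eta B C) (Dom B f) (Dom B g) =
      ften (eta B C) (Cod B f) (Cod B g) \<cdot>\<^bsub>ihom C (B \<otimes>\<^sub>0 C)\<^esub> (farr (eta B C) f \<boxtimes>\<^bsub>ihom C (B \<otimes>\<^sub>0 C)\<^esub> farr (eta B C) g)"
    using rel[OF tr_M1_nat[OF B.homI[OF fg(1) refl refl] B.homI[OF fg(2) refl refl]]]
    by (intro Q.ihom_eqI) (auto, auto simp: tens0_def cl_eqs)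
next
  fix x y z assume o [simp]: "x \<in> Obj B" "y \<in> Obj B" "z \<in> Obj B"
  show "farr (eta B C) (assoc B x y z) \<cdot>\<^bsub>ihom C (B \<otimes>\<^sub>0 C)\<^esub> ften (eta B C) (x \<otimes>\<^bsub>B\<^esub> y) z \<cdot>\<^bsub>ihom C (B \<otimes>\<^sub>0 C)\<^esub>
       (ften (eta B C) x y \<boxtimes>\<^bsub>ihom C (B \<otimes>\<^sub>0 C)\<^esub> Id (ihom C (B \<otimes>\<^sub>0 C)) (E z)) =
       ften (eta B C) x (y \<otimes>\<^bsub>B\<^esub> z) \<cdot>\<^bsub>ihom C (B \<otimes>\<^sub>0 C)\<^esub> (Id (ihom C (B \<otimes>\<^sub>0 C)) (E x) \<boxtimes>\<^bsub>ihom C (B \<otimes>\<^sub>0 C)\<^esub> ften (eta B C) y z) \<cdot>\<^bsub>ihom C (B \<otimes>\<^sub>0 C)\<^esub>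
       assoc (ihom C (B \<otimes>\<^sub>0 C)) (E x) (E y) (E z)"
    using rel[OF tr_M1_assoc[OF o]] by (intro Q.ihom_eqI) (auto, auto simp: tens0_def cl_eqs)
next
  fix x assume o [simp]: "x \<in> Obj B"
  show "farr (eta B C) (lunit B x) \<cdot>\<^bsub>ihom C (B \<otimes>\<^sub>0 C)\<^esub> ften (eta B C) \<one>\<^bsub>B\<^esub> x \<cdot>\<^bsub>ihom C (B \<otimes>\<^sub>0 C)\<^esub>
       (funit (eta B C) \<boxtimes>\<^bsub>ihom C (B \<otimes>\<^sub>0 C)\<^esub> Id (ihom C (B \<otimes>\<^sub>0 C)) (E x)) = lunit (ihom C (B \<otimes>\<^sub>0 C)) (E x)"
    using rel[OF tr_M1_lunit[OF o]] by (intro Q.ihom_eqI) (auto, auto simp: tens0_def cl_eqs)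
  show "farr (eta B C) (runit B x) \<cdot>\<^bsub>ihom C (B \<otimes>\<^sub>0 C)\<^esub> ften (eta B C) x \<one>\<^bsub>B\<^esub> \<cdot>\<^bsub>ihom C (B \<otimes>\<^sub>0 C)\<^esub>
       (Id (ihom C (B \<otimes>\<^sub>0 C)) (E x) \<boxtimes>\<^bsub>ihom C (B \<otimes>\<^sub>0 C)\<^esub> funit (eta B C)) = runit (ihom C (B \<otimes>\<^sub>0 C)) (E x)"
    using rel[OF tr_M1_runit[OF o]] by (intro Q.ihom_eqI) (auto, auto simp: tens0_def cl_eqs)
  show "farr (eta B C) (Id B x) = Id (ihom C (B \<otimes>\<^sub>0 C)) (E x)"
    using rel[OF tr_L_Id[OF o]] by (intro Q.ihom_eqI) (auto, auto simp: tens0_def cl_eqs)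
next
  fix x y assume o [simp]: "x \<in> Obj B" "y \<in> Obj B"
  show "farr (eta B C) (symm B x y) \<cdot>\<^bsub>ihom C (B \<otimes>\<^sub>0 C)\<^esub> ften (eta B C) x y = ften (eta B C) y x \<cdot>\<^bsub>ihom C (B \<otimes>\<^sub>0 C)\<^esub> symm (ihom C (B \<otimes>\<^sub>0 C)) (E x) (E y)"
    using rel[OF tr_M1_symm[OF o]] by (intro Q.ihom_eqI) (auto, auto simp: tens0_def cl_eqs)
qed (auto simp: B.spc Q.ihom_spc hom_def)

end

section \<open>Bilinear maps as models of the presentation of the tensor product\<close>

locale bilin = C: symmetric_picard_category C + D: symmetric_picard_category D + G: spc_arrow B "ihom C D" G
  for B :: "('o, 'a) spc" and C :: "('p, 'b) spc" and D :: "('q, 'c) spc" (structure) and G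
begin

sublocale Q: spc_pair C D
  by (rule spc_pair[OF C.spc D.spc])

lemma G_in [simp]:
  "b \<in> Obj B ==> fobj G b \<in> arrows C D"
  "f \<in> Arr B ==> nsrc (farr G f) = fobj G (Dom B f)" "f \<in> Arr B ==> ntgt (farr G f) = fobj G (Cod B f)"
  "b \<in> Obj B ==> b' \<in> Obj B ==> nsrc (ften G b b') = tensF (fobj G b) (fobj G b')"
  "b \<in> Obj B ==> b' \<in> Obj B ==> ntgt (ften G b b') = fobj G (b \<otimes>\<^bsub>B\<^esub> b')"
  "nsrc (funit G) = unitF C D" "ntgt (funit G) = fobj G \<one>\<^bsub>B\<^esub>"
  "f \<in> Arr B ==> farr G f \<in> Arr (ihom C D)" "b \<in> Obj B ==> b' \<in> Obj B ==> ften G b b' \<in> Arr (ihom C D)"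
  "funit G \<in> Arr (ihom C D)"
  using G.fobj_closed[of b] G.farr_arr[of f] G.ften_arr[of b b'] G.funit_arr by simp_all

lemma Gb: "b \<in> Obj B ==> spc_arrow C D (fobj G b)"
  by (rule spc_arrow) simp

lemma Gf: "f \<in> Arr B ==> spc_cell C D (fobj G (Dom B f)) (fobj G (Cod B f)) (farr G f)"
  using Q.cell_of[of "farr G f"] by simp

lemma Gt: "b \<in> Obj B ==> b' \<in> Obj B ==> spc_cell C D (tensF (fobj G b) (fobj G b')) (fobj G (b \<otimes>\<^bsub>B\<^esub> b')) (ften G b b')"
  using Q.cell_of[of "ften G b b'"] by simp

lemma Gu: "spc_cell C D (unitF C D) (fobj G \<one>\<^bsub>B\<^esub>) (funit G)"
  using Q.cell_of[of "funit G"] by simp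

text \<open>The axioms for \<open>G\<close> are equations between 2-cells in \<open>[C,D]\<close>;
  evaluation at \<open>c\<close> brings them to the form in which the relations of the tensor
  product are written.\<close>

lemma point:
  "b \<in> Obj B ==> c \<in> Obj C ==> farr G (Id B b) \<diamondop> c = Id D (fobj (fobj G b) c)"
  "f \<in> Arr B ==> g \<in> Arr B ==> Cod B f = Dom B g ==> c \<in> Obj C ==>
    farr G (g \<cdot>\<^bsub>B\<^esub> f) \<diamondop> c = farr G g \<diamondop> c \<cdot> farr G f \<diamondop> c"
  "f \<in> Arr B ==> g \<in> Arr B ==> c \<in> Obj C ==>
    farr G (f \<boxtimes>\<^bsub>B\<^esub> g) \<diamondop> c \<cdot> ften G (Dom B f) (Dom B g) \<diamondop> c = ften G (Cod B f) (Cod B g) \<diamondop> c \<cdot> (farr G f \<diamondop> c \<boxtimes> farr G g \<diamondop> c)"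
  "x \<in> Obj B ==> y \<in> Obj B ==> z \<in> Obj B ==> c \<in> Obj C ==>
    farr G (assoc B x y z) \<diamondop> c \<cdot> ften G (x \<otimes>\<^bsub>B\<^esub> y) z \<diamondop> c \<cdot> (ften G x y \<diamondop> c \<boxtimes> Id D (fobj (fobj G z) c))
     = ften G x (y \<otimes>\<^bsub>B\<^esub> z) \<diamondop> c \<cdot> (Id D (fobj (fobj G x) c) \<boxtimes> ften G y z \<diamondop> c) \<cdot> assoc D (fobj (fobj G x) c) (fobj (fobj G y) c) (fobj (fobj G z) c)"
  "x \<in> Obj B ==> c \<in> Obj C ==>
    farr G (lunit B x) \<diamondop> c \<cdot> ften G \<one>\<^bsub>B\<^esub> x \<diamondop> c \<cdot> (funit G \<diamondop> c \<boxtimes> Id D (fobj (fobj G x) c)) = lunit D (fobj (fobj G x) c)"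
  "x \<in> Obj B ==> c \<in> Obj C ==>
    farr G (runit B x) \<diamondop> c \<cdot> ften G x \<one>\<^bsub>B\<^esub> \<diamondop> c \<cdot> (Id D (fobj (fobj G x) c) \<boxtimes> funit G \<diamondop> c) = runit D (fobj (fobj G x) c)"
  "x \<in> Obj B ==> y \<in> Obj B ==> c \<in> Obj C ==>
    farr G (symm B x y) \<diamondop> c \<cdot> ften G x y \<diamondop> c = ften G y x \<diamondop> c \<cdot> symm D (fobj (fobj G x) c) (fobj (fobj G y) c)"
  using arg_cong[OF G.farr_Id[of b], of "\<lambda>\<sigma>. \<sigma> \<diamondop> c"] arg_cong[OF G.farr_Comp[of f g], of "\<lambda>\<sigma>. \<sigma> \<diamondop> c"]
    arg_cong[OF G.ften_natural[of f g], of "\<lambda>\<sigma>. \<sigma> \<diamondop> c"] arg_cong[OF G.ften_assoc[of x y z], of "\<lambda>\<sigma>. \<sigma> \<diamondop> c"]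
    arg_cong[OF G.ften_lunit[of x], of "\<lambda>\<sigma>. \<sigma> \<diamondop> c"] arg_cong[OF G.ften_runit[of x], of "\<lambda>\<sigma>. \<sigma> \<diamondop> c"]
    arg_cong[OF G.ften_symm[of x y], of "\<lambda>\<sigma>. \<sigma> \<diamondop> c"] by simp_all

text \<open>Every generator names a piece of structure of the universal bilinear map
  \<open>eta\<close> and is sent to the same piece of structure of \<open>G\<close>.\<close>

primrec tga :: "('o, 'a, 'p, 'b) tgen \<Rightarrow> 'c" where
  "tga (GL f c) = farr G f \<diamondop> c"
| "tga (GR b g) = farr (fobj G b) g"
| "tga (GM1 b b' c) = ften G b b' \<diamondop> c"
| "tga (GU1 c) = funit G \<diamondop> c"
| "tga (GM2 b c c') = ften (fobj G b) c c'"
| "tga (GU2 b) = funit (fobj G b)"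

abbreviation tgo where "tgo \<equiv> \<lambda>p. fobj (fobj G (fst p)) (snd p)"

lemma ev_interchange:
  "evA D tgo tga (AInterchange w x y z) = interchange D (evO D tgo w) (evO D tgo x) (evO D tgo y) (evO D tgo z)"
  by (simp add: AInterchange_def interchange_def Let_def)

text \<open>Each relation is an axiom of \<open>G\<close>, of an arrow \<open>fobj G b\<close>, or
  of one of the 2-cells \<open>farr G f\<close>, \<open>ften G b b'\<close> and
  \<open>funit G\<close>, evaluated at objects.\<close>

lemma model_rel: "trel B C s t ==> evA D tgo tga s = evA D tgo tga t"
proof (induction rule: trel.induct)
  case (tr_R_Id b c) then show ?case using spc_arrow.farr_Id[OF Gb] by simp
next
  case (tr_R_Comp b g c c' g' c'') then show ?case using spc_arrow.farr_Comp[OF Gb, of b g g'] by (auto simp: hom_def)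
next
  case (tr_M2_nat b g c d g' c' d') then show ?case using spc_arrow.ften_natural[OF Gb, of b g g'] by (auto simp: hom_def)
next
  case (tr_M2_assoc b c c' c'') then show ?case using spc_arrow.ften_assoc[OF Gb, of b c c' c''] by simp
next
  case (tr_M2_lunit b c) then show ?case using spc_arrow.ften_lunit[OF Gb, of b c] by simp
next
  case (tr_M2_runit b c) then show ?case using spc_arrow.ften_runit[OF Gb, of b c] by simp
next
  case (tr_M2_symm b c c') then show ?case using spc_arrow.ften_symm[OF Gb, of b c c'] by simp
next
  case (tr_L_nat f b b' g c c') then show ?case using spc_cell.natural[OF Gf, of f g] by (auto simp: hom_def)
next
  case (tr_L_M2 f b b' c c') then show ?case using spc_cell.tens[OF Gf, of f c c'] by (auto simp: hom_def)
next
  case (tr_L_U2 f b b') then show ?case using spc_cell.unit[OF Gf, of f] by (auto simp: hom_def)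
next
  case (tr_L_Id b c) then show ?case by (simp add: point)
next
  case (tr_L_Comp f b b' f' b'' c) then show ?case by (auto simp: hom_def point)
next
  case (tr_M1_R b b' g c c') then show ?case using spc_cell.natural[OF Gt, of b b' g] by (auto simp: hom_def)
next
  case (tr_M1_M2 b b' c c') then show ?case using spc_cell.tens[OF Gt, of b b' c c'] by (simp add: ev_interchange)
next
  case (tr_M1_U2 b b') then show ?case using spc_cell.unit[OF Gt, of b b'] by simp
next
  case (tr_U1_R g c c') then show ?case using spc_cell.natural[OF Gu, of g] by (auto simp: hom_def)
next
  case (tr_U1_M2 c c') then show ?case using spc_cell.tens[OF Gu, of c c'] by simp
next
  case tr_U1_U2 then show ?case using spc_cell.unit[OF Gu] by simp
next
  case (tr_M1_nat f b d f' b' d' c) then show ?case using point(3)[of f f' c] by (auto simp: hom_def)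
next
  case (tr_M1_assoc b b' b'' c) then show ?case using point(4)[of b b' b'' c] by simp
next
  case (tr_M1_lunit b c) then show ?case using point(5)[of b c] by simp
next
  case (tr_M1_runit b c) then show ?case using point(6)[of b c] by simp
next
  case (tr_M1_symm b b' c) then show ?case using point(7)[of b b' c] by simp
qed

sublocale T: tens B C
  by (simp add: tens_def C.spc G.B.spc)

sublocale M: pres_model "tensP B C" D tgo tga
proof unfold_locales
  fix g assume "g \<in> genO (tensP B C)" then show "tgo g \<in> Obj D" by auto
next
  fix e assume "e \<in> genA (tensP B C)"
  then show "tga e \<in> hom D (evO D tgo (gen_dom (tensP B C) e)) (evO D tgo (gen_cod (tensP B C) e))"
    by (cases e) (auto simp: hom_def)
qed (use model_rel in auto)

end

lemma bilin: "G \<in> arrows B (ihom C D) ==> SPC C ==> SPC D ==> bilin B C D G"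
  by (simp add: bilin_def spc_arrow)

section \<open>Transposition of arrows and of 2-cells\<close>

context tens
begin

lemma post_E [simp]:
  assumes F: "F \<in> arrows (B \<otimes>\<^sub>0 C) D" and b: "b \<in> Obj B"
  shows "F \<circ>\<^sub>F E b \<in> arrows C D"
  by (rule compF_arrow[OF E_arrow[OF b] F])

lemma Rn_arrow: "F \<in> arrows (B \<otimes>\<^sub>0 C) D ==> Rn B C F \<in> arrows B (ihom C D)"
  unfolding Rn_def by (rule compF_arrow[OF eta_arrow hom_post_arrow[OF C.spc]])

lemma Rn_app [simp]:
  assumes F: "F \<in> arrows (B \<otimes>\<^sub>0 C) D"
  shows "Src (Rn B C F) = B" (is "PROP ?a1") "Tgt (Rn B C F) = ihom C D" (is "PROP ?a2")
    "b \<in> Obj B ==> fobj (Rn B C F) b = F \<circ>\<^sub>F E b" (is "PROP ?a3")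
    "f \<in> Arr B ==> farr (Rn B C F) f = F *\<^sub>L farr (eta B C) f" (is "PROP ?a4")
    "b \<in> Obj B ==> c \<in> Obj C ==> fobj (fobj (Rn B C F) b) c = fobj F (PGen (b, c))" (is "PROP ?a5")
    "b \<in> Obj B ==> g \<in> Arr C ==> farr (fobj (Rn B C F) b) g = farr F (cl (AR b g))" (is "PROP ?a6")
    "b \<in> Obj B ==> c \<in> Obj C ==> c' \<in> Obj C ==> ften (fobj (Rn B C F) b) c c' = farr F (cl (AM2 b c c')) \<cdot>\<^bsub>D\<^esub> ften F (PGen (b, c)) (PGen (b, c'))" (is "PROP ?a7")
    "b \<in> Obj B ==> funit (fobj (Rn B C F) b) = farr F (cl (AU2 b)) \<cdot>\<^bsub>D\<^esub> funit F" (is "PROP ?a8")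
    "f \<in> Arr B ==> c \<in> Obj C ==> farr (Rn B C F) f \<diamondop> c = farr F (cl (AL f c))" (is "PROP ?a9")
    "b \<in> Obj B ==> b' \<in> Obj B ==> c \<in> Obj C ==> ften (Rn B C F) b b' \<diamondop> c = farr F (cl (AM1 b b' c)) \<cdot>\<^bsub>D\<^esub> ften F (PGen (b, c)) (PGen (b', c))" (is "PROP ?a10")
    "c \<in> Obj C ==> funit (Rn B C F) \<diamondop> c = farr F (cl (AU1 c)) \<cdot>\<^bsub>D\<^esub> funit F" (is "PROP ?a11")
proof -
  interpret F: spc_arrow "B \<otimes>\<^sub>0 C" D F by (rule spc_arrow[OF F])
  interpret R: spc_arrow "ihom C (B \<otimes>\<^sub>0 C)" "ihom C D" "hom_post C F"
    by (rule spc_arrow[OF hom_post_arrow[OF C.spc F]])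
  interpret QD: spc_pair C D by (rule spc_pair[OF C.spc F.C.spc])
  have w [simp]: "F *\<^sub>L \<sigma> \<in> Arr (ihom C D)" if "\<sigma> \<in> Arr (ihom C (B \<otimes>\<^sub>0 C))" for \<sigma> using whiskL_in[OF that F] .
  have [simp]: "ften (hom_post C F) (E b) (E b') \<in> Arr (ihom C D)" if "b \<in> Obj B" "b' \<in> Obj B" for b b'
    using R.ften_arr(1)[of "E b" "E b'"] that by simp
  have [simp]: "funit (hom_post C F) \<in> Arr (ihom C D)" using R.funit_arr(1) .
  have c [simp]: "mnt_dom (farr (eta B C) f) = B'" if "f \<in> Arr B" "B' = C" for f B' using that by simp
  show "PROP ?a1" "PROP ?a2" "PROP ?a3" "PROP ?a4" "PROP ?a5" "PROP ?a6" "PROP ?a7" "PROP ?a8" "PROP ?a9" "PROP ?a10" "PROP ?a11"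
    by (simp_all add: Rn_def)
qed

text \<open>The required arrow is the model of the presentation given by \<open>G\<close>; its
  transpose reads off the values at the generators again.\<close>

lemma Rn_exists:
  assumes G: "G \<in> arrows B (ihom C D)" and D: "SPC D"
  obtains F where "F \<in> strict_arrows (B \<otimes>\<^sub>0 C) D" "Rn B C F = G"
proof -
  interpret G: bilin B C D G by (rule bilin[OF G C.spc D])
  let ?F = "G.M.model"
  have F: "?F \<in> strict_arrows (B \<otimes>\<^sub>0 C) D"
    using G.M.model_strict by (simp add: tens0_def)
  then have F': "?F \<in> arrows (B \<otimes>\<^sub>0 C) D" by (rule strict_arrowsD)
  have R: "Rn B C ?F \<in> arrows B (ihom C D)" by (rule Rn_arrow[OF F'])
  interpret R: bilin B C D "Rn B C ?F" by (rule bilin[OF R C.spc D])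
  \<comment> \<open>Rewriting the transpose into a composite with \<open>eta\<close> would hide its
    values at generators, and these are what is compared.\<close>
  note [simp del] = Rn_app(3,4)[OF F']
  note R.G_in(1) [simp] and Rn_app(5-)[OF F', simp]
  have o: "fobj (Rn B C ?F) b = fobj G b" if "b \<in> Obj B" for b
    by (rule smf_eqI[of _ C D]) (use that in simp_all)
  have "Rn B C ?F = G"
    by (rule smf_eqI[OF R G]) (auto intro!: G.Q.ihom_eqI simp: o)
  with F show thesis by (rule that)
qed

text \<open>For a strict arrow the comparison arrows in the transpose are identities, so the
  transpose records the value at every generating arrow, those of the forms \<open>GM1\<close>,
  \<open>GU1\<close>, \<open>GM2\<close>, \<open>GU2\<close> included.\<close>

lemma Rn_unique:
  assumes F: "F \<in> strict_arrows (B \<otimes>\<^sub>0 C) D" and G: "G \<in> strict_arrows (B \<otimes>\<^sub>0 C) D" and e: "Rn B C F = Rn B C G"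
  shows "F = G"
proof -
  interpret F: spc_strict "B \<otimes>\<^sub>0 C" D F by (rule spc_strict[OF F])
  interpret G: spc_strict "B \<otimes>\<^sub>0 C" D G by (rule spc_strict[OF G])
  note aF = Rn_app(5-)[OF F.arrow] and aG = Rn_app(5-)[OF G.arrow]
  have cX: "cl (AGen e) \<in> Arr (B \<otimes>\<^sub>0 C)" "Dom (B \<otimes>\<^sub>0 C) (cl (AGen e)) = tgen_dom B C e" if "tgen_wf B C e" for e
    using P.cl_arr[of "AGen e"] that by (simp_all add: tens0_def)
  have ob: "PGen (b, c) \<in> Obj (B \<otimes>\<^sub>0 C)" if "b \<in> Obj B" "c \<in> Obj C" for b c
    using that by (simp add: tens0_def)
  have te: "PTens x y = tensO (B \<otimes>\<^sub>0 C) x y" "PUnit = \<one>\<^bsub>B \<otimes>\<^sub>0 C\<^esub>" for x y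
    by (simp_all add: tens0_def P.PC_obj)
  have o: "fobj F (PGen (b, c)) = fobj G (PGen (b, c))" if "b \<in> Obj B" "c \<in> Obj C" for b c
    using aF(1)[OF that] aG(1)[OF that] e by simp
  show ?thesis
  proof (rule P.strict_unique[OF F[unfolded tens0_def] G[unfolded tens0_def]])
    fix e' assume "e' \<in> genA (tensP B C)"
    then have w: "tgen_wf B C e'" by simp
    show "farr F (cl (AGen e')) = farr G (cl (AGen e'))"
    proof (cases e')
      case (GL f c) then show ?thesis using aF(5)[of f c] aG(5)[of f c] e w by simp
    next
      case (GR b g) then show ?thesis using aF(2)[of b g] aG(2)[of b g] e w by simp
    next
      case (GM1 b b' c) then show ?thesis using aF(6)[of b b' c] aG(6)[of b b' c] e w cX[OF w] by (simp add: ob te o)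
    next
      case (GU1 c) then show ?thesis using aF(7)[of c] aG(7)[of c] e w cX[OF w] by (simp add: te)
    next
      case (GM2 b c c') then show ?thesis using aF(3)[of b c c'] aG(3)[of b c c'] e w cX[OF w] by (simp add: ob te o)
    next
      case (GU2 b) then show ?thesis using aF(4)[of b] aG(4)[of b] e w cX[OF w] by (simp add: te)
    qed
  qed (auto simp: o)
qed

lemma En_props:
  assumes G: "G \<in> arrows B (ihom C D)" and D: "SPC D"
  shows "En B C D G \<in> strict_arrows (B \<otimes>\<^sub>0 C) D" "Rn B C (En B C D G) = G"
proof -
  obtain F where F: "F \<in> strict_arrows (B \<otimes>\<^sub>0 C) D \<and> Rn B C F = G" using Rn_exists[OF G D] by blast
  have "En B C D G \<in> strict_arrows (B \<otimes>\<^sub>0 C) D \<and> Rn B C (En B C D G) = G"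
    unfolding En_def by (rule theI[of _ F]) (use F Rn_unique in blast)+
  then show "En B C D G \<in> strict_arrows (B \<otimes>\<^sub>0 C) D" "Rn B C (En B C D G) = G" by auto
qed

lemma Rn2_app:
  assumes s: "\<sigma> \<in> cells F G" and F: "F \<in> arrows (B \<otimes>\<^sub>0 C) D"
  shows "Rn2 B C \<sigma> \<in> cells (Rn B C F) (Rn B C G)"
    "b \<in> Obj B ==> Rn2 B C \<sigma> \<diamondop> b = \<sigma> *\<^sub>R E b"
    "b \<in> Obj B ==> c \<in> Obj C ==> Rn2 B C \<sigma> \<diamondop> b \<diamondop> c = \<sigma> \<diamondop> PGen (b, c)"
proof -
  interpret s: spc_cell "B \<otimes>\<^sub>0 C" D F G \<sigma> by (rule spc_cell[OF s F])
  have "hom_post2 C \<sigma> \<in> Arr (ihom (ihom C (B \<otimes>\<^sub>0 C)) (ihom C D))"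
    by (rule hom_post2_in[OF C.spc cells_Arr[OF s F]])
  then have "Rn2 B C \<sigma> \<in> Arr (ihom B (ihom C D))"
    unfolding Rn2_def by (rule whiskR_in[OF _ eta_arrow])
  then show "Rn2 B C \<sigma> \<in> cells (Rn B C F) (Rn B C G)"
    by (simp add: Arr_ihom) (simp add: Rn2_def Rn_def)
  show "b \<in> Obj B ==> Rn2 B C \<sigma> \<diamondop> b = \<sigma> *\<^sub>R E b"
    "b \<in> Obj B ==> c \<in> Obj C ==> Rn2 B C \<sigma> \<diamondop> b \<diamondop> c = \<sigma> \<diamondop> PGen (b, c)"
    by (simp_all add: Rn2_def)
qed

lemma cell_eqI:
  assumes "\<sigma> \<in> cells F G" "\<tau> \<in> cells F G" "F \<in> arrows (B \<otimes>\<^sub>0 C) D"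
    "\<And>b c. b \<in> Obj B ==> c \<in> Obj C ==> \<sigma> \<diamondop> PGen (b, c) = \<tau> \<diamondop> PGen (b, c)"
  shows "\<sigma> = \<tau>"
  by (rule P.cell_unique[OF assms(1,2), of D]) (use assms(3,4) in \<open>auto simp: tens0_def\<close>)

lemma Rn2_inj:
  assumes s: "\<sigma> \<in> cells F G" and t: "\<tau> \<in> cells F G" and F: "F \<in> arrows (B \<otimes>\<^sub>0 C) D" and e: "Rn2 B C \<sigma> = Rn2 B C \<tau>"
  shows "\<sigma> = \<tau>"
  by (rule cell_eqI[OF s t F]) (use Rn2_app(3)[OF s F] Rn2_app(3)[OF t F] e in metis)

text \<open>The components of \<open>\<tau>\<close> are prescribed at generators. The conditions at
  \<open>GL\<close>, \<open>GM1\<close> and \<open>GU1\<close> are naturality and monoidality of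
  \<open>\<tau>\<close>; those at \<open>GR\<close>, \<open>GM2\<close> and \<open>GU2\<close> are
  naturality and monoidality of its values. Strict domain and arbitrary codomain are as in the
  adjunction between \<open>En\<close> and \<open>Rn\<close>.\<close>

lemma Rn2_exists:
  assumes F: "F \<in> strict_arrows (B \<otimes>\<^sub>0 C) D" and G: "G \<in> arrows (B \<otimes>\<^sub>0 C) D" and t: "\<tau> \<in> cells (Rn B C F) (Rn B C G)"
  obtains \<sigma> where "\<sigma> \<in> cells F G" "Rn2 B C \<sigma> = \<tau>"
proof -
  interpret F: spc_strict "B \<otimes>\<^sub>0 C" D F by (rule spc_strict[OF F])
  interpret G: spc_arrow "B \<otimes>\<^sub>0 C" D G by (rule spc_arrow[OF G])
  have RF: "Rn B C F \<in> arrows B (ihom C D)" and RG: "Rn B C G \<in> arrows B (ihom C D)"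
    using Rn_arrow F.arrow G by blast+
  interpret RF: bilin B C D "Rn B C F" by (rule bilin[OF RF C.spc F.C.spc])
  interpret RG: bilin B C D "Rn B C G" by (rule bilin[OF RG C.spc F.C.spc])
  interpret t: spc_cell B "ihom C D" "Rn B C F" "Rn B C G" \<tau> by (rule spc_cell[OF t RF])
  note aF = Rn_app(5-)[OF F.arrow] and aG = Rn_app(5-)[OF G]
  note [simp del] = Rn_app(3,4)[OF F.arrow] Rn_app(3,4)[OF G]
  have tb [simp]: "\<tau> \<diamondop> b \<in> Arr (ihom C D)" "nsrc (\<tau> \<diamondop> b) = fobj (Rn B C F) b" "ntgt (\<tau> \<diamondop> b) = fobj (Rn B C G) b" if "b \<in> Obj B" for b
    using t.ncomp_arr[OF that] by simp_all
  have tc: "spc_cell C D (fobj (Rn B C F) b) (fobj (Rn B C G) b) (\<tau> \<diamondop> b)" if "b \<in> Obj B" for b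
    using RF.Q.cell_of[OF tb(1)[OF that]] that by simp
  note [simp] = aF aG
  have cX [simp]: "cl (AGen e) \<in> Arr (B \<otimes>\<^sub>0 C)" "Dom (B \<otimes>\<^sub>0 C) (cl (AGen e)) = tgen_dom B C e" "Cod (B \<otimes>\<^sub>0 C) (cl (AGen e)) = tgen_cod B C e"
    if "tgen_wf B C e" for e
    using P.cl_arr[of "AGen e"] that by (simp_all add: tens0_def)
  have ob [simp]: "PGen (b, c) \<in> Obj (B \<otimes>\<^sub>0 C)" if "b \<in> Obj B" "c \<in> Obj C" for b c
    using that by (simp add: tens0_def)
  have te: "PTens x y = tensO (B \<otimes>\<^sub>0 C) x y" "PUnit = \<one>\<^bsub>B \<otimes>\<^sub>0 C\<^esub>" for x y
    by (simp_all add: tens0_def P.PC_obj)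
  let ?t = "\<lambda>p. \<tau> \<diamondop> fst p \<diamondop> snd p"
  let ?s = "sg D (tensP B C) F G ?t"
  obtain \<sigma> where s: "\<sigma> \<in> cells F G" and sp: "\<And>g. g \<in> genO (tensP B C) ==> \<sigma> \<diamondop> PGen g = ?t g"
  proof (rule P.cell_exists[OF F[unfolded tens0_def] G[unfolded tens0_def], where \<tau> = ?t])
    fix g assume "g \<in> genO (tensP B C)"
    then show "?t g \<in> hom D (fobj F (PGen g)) (fobj G (PGen g))" by (auto simp: hom_def)
  next
    fix e assume "e \<in> genA (tensP B C)"
    then have w: "tgen_wf B C e" by simp
    have "?s (tgen_cod B C e) \<cdot>\<^bsub>D\<^esub> farr F (cl (AGen e)) = farr G (cl (AGen e)) \<cdot>\<^bsub>D\<^esub> ?s (tgen_dom B C e)"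
    proof (cases e)
      case (GL f c) then show ?thesis using arg_cong[OF t.natural[of f], of "\<lambda>\<sigma>. \<sigma> \<diamondop> c"] w by simp
    next
      case (GR b g) then show ?thesis using spc_cell.natural[OF tc, of b g] w by simp
    next
      case GM1: (GM1 b b' c)
      show ?thesis using arg_cong[OF t.tens[of b b'], of "\<lambda>\<sigma>. \<sigma> \<diamondop> c"] w[unfolded GM1] cX[OF w[unfolded GM1]]
        unfolding GM1 tgen_dom.simps tgen_cod.simps sg.simps by (simp add: te)
    next
      case GU1: (GU1 c)
      show ?thesis using arg_cong[OF t.unit, of "\<lambda>\<sigma>. \<sigma> \<diamondop> c"] w[unfolded GU1] cX[OF w[unfolded GU1]]
        unfolding GU1 tgen_dom.simps tgen_cod.simps sg.simps by (simp add: te)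
    next
      case GM2: (GM2 b c c')
      show ?thesis using spc_cell.tens[OF tc, of b c c'] w[unfolded GM2] cX[OF w[unfolded GM2]]
        unfolding GM2 tgen_dom.simps tgen_cod.simps sg.simps by (simp add: te)
    next
      case GU2: (GU2 b)
      show ?thesis using spc_cell.unit[OF tc, of b] w[unfolded GU2] cX[OF w[unfolded GU2]]
        unfolding GU2 tgen_dom.simps tgen_cod.simps sg.simps by (simp add: te)
    qed
    then show "?s (gen_cod (tensP B C) e) \<cdot>\<^bsub>D\<^esub> farr F (cl (AGen e)) = farr G (cl (AGen e)) \<cdot>\<^bsub>D\<^esub> ?s (gen_dom (tensP B C) e)" by simp
  next
    fix \<sigma> assume a: "\<sigma> \<in> cells F G" and b: "\<And>g. g \<in> genO (tensP B C) ==> \<sigma> \<diamondop> PGen g = ?t g"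
    show thesis by (rule that[OF a b])
  qed
  note R = Rn2_app[OF s F.arrow]
  interpret R: spc_cell B "ihom C D" "Rn B C F" "Rn B C G" "Rn2 B C \<sigma>" by (rule spc_cell[OF R(1) RF])
  have [simp]: "Rn2 B C \<sigma> \<diamondop> b \<in> Arr (ihom C D)" "nsrc (Rn2 B C \<sigma> \<diamondop> b) = fobj (Rn B C F) b" "ntgt (Rn2 B C \<sigma> \<diamondop> b) = fobj (Rn B C G) b"
    if "b \<in> Obj B" for b using R.ncomp_arr[OF that] by simp_all
  have "Rn2 B C \<sigma> = \<tau>"
    by (rule mnt_eqI[OF R(1) t RF], rule RF.Q.ihom_eqI) (auto simp: R(3) sp)
  with s show thesis by (rule that)
qed

end

lemma tens: "SPC B ==> SPC C ==> tens B C"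
  by (simp add: tens_def)

section \<open>Naturality of the closed structure\<close>

text \<open>For an arrow into a hom category, values on arrows are 2-cells and can be compared at
  objects. The versions for two and three nested homs repeat this, so identities about
  \<open>[D,-]\<close> become equations between components in the innermost category.\<close>

lemma smf_eqI2:
  assumes F: "F \<in> arrows A (ihom C D)" and G: "G \<in> arrows A (ihom C D)"
    and C: "SPC C" and D: "SPC D"
    and o: "\<And>a. a \<in> Obj A ==> fobj F a = fobj G a"
    and a: "\<And>f c. f \<in> Arr A ==> c \<in> Obj C ==> farr F f \<diamondop> c = farr G f \<diamondop> c"
    and t: "\<And>a b c. a \<in> Obj A ==> b \<in> Obj A ==> c \<in> Obj C ==> ften F a b \<diamondop> c = ften G a b \<diamondop> c"
    and u: "\<And>c. c \<in> Obj C ==> funit F \<diamondop> c = funit G \<diamondop> c"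
  shows "F = G"
proof -
  interpret F: bilin A C D F by (rule bilin[OF F C D])
  interpret G: bilin A C D G by (rule bilin[OF G C D])
  show ?thesis
    by (rule smf_eqI[OF F G]) (auto intro!: F.Q.ihom_eqI simp: o a t u)
qed

lemma smf_eqI3:
  assumes F: "F \<in> arrows A (ihom B (ihom C D))" and G: "G \<in> arrows A (ihom B (ihom C D))"
    and B: "SPC B" and C: "SPC C" and D: "SPC D"
    and o: "\<And>a b. a \<in> Obj A ==> b \<in> Obj B ==> fobj (fobj F a) b = fobj (fobj G a) b"
    and a: "\<And>a g c. a \<in> Obj A ==> g \<in> Arr B ==> c \<in> Obj C ==> farr (fobj F a) g \<diamondop> c = farr (fobj G a) g \<diamondop> c"
    and t: "\<And>a b b' c. a \<in> Obj A ==> b \<in> Obj B ==> b' \<in> Obj B ==> c \<in> Obj C ==> ften (fobj F a) b b' \<diamondop> c = ften (fobj G a) b b' \<diamondop> c"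
    and u: "\<And>a c. a \<in> Obj A ==> c \<in> Obj C ==> funit (fobj F a) \<diamondop> c = funit (fobj G a) \<diamondop> c"
    and a': "\<And>f b c. f \<in> Arr A ==> b \<in> Obj B ==> c \<in> Obj C ==> farr F f \<diamondop> b \<diamondop> c = farr G f \<diamondop> b \<diamondop> c"
    and t': "\<And>a a' b c. a \<in> Obj A ==> a' \<in> Obj A ==> b \<in> Obj B ==> c \<in> Obj C ==> ften F a a' \<diamondop> b \<diamondop> c = ften G a a' \<diamondop> b \<diamondop> c"
    and u': "\<And>b c. b \<in> Obj B ==> c \<in> Obj C ==> funit F \<diamondop> b \<diamondop> c = funit G \<diamondop> b \<diamondop> c"
  shows "F = G"
proof -
  have CD: "SPC (ihom C D)" by (rule ihom_spc[OF C D])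
  interpret F: bilin A B "ihom C D" F by (rule bilin[OF F B CD])
  interpret G: bilin A B "ihom C D" G by (rule bilin[OF G B CD])
  interpret CD: spc_pair C D by (rule spc_pair[OF C D])
  have O: "fobj F x = fobj G x" if "x \<in> Obj A" for x
    by (rule smf_eqI2[OF _ _ C D, where A = B]) (use that in \<open>auto simp: o a t u\<close>)
  have eq: "\<sigma> \<diamondop> b = \<tau> \<diamondop> b"
    if "\<sigma> \<in> Arr (ihom B (ihom C D))" "\<tau> \<in> Arr (ihom B (ihom C D))" "nsrc \<sigma> = nsrc \<tau>" "ntgt \<sigma> = ntgt \<tau>" "b \<in> Obj B"
      "\<And>c. c \<in> Obj C ==> \<sigma> \<diamondop> b \<diamondop> c = \<tau> \<diamondop> b \<diamondop> c" for \<sigma> \<tau> b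
    using F.Q.ncomp_in[OF that(1,5)] F.Q.ncomp_in[OF that(2,5)] that by (intro CD.ihom_eqI) simp_all
  show ?thesis
    by (rule smf_eqI2[OF F G B CD O]) (auto intro!: eq simp: a' t' u' O)
qed

lemma smf_eqI4:
  assumes F: "F \<in> arrows A (ihom B (ihom C (ihom D E)))" and G: "G \<in> arrows A (ihom B (ihom C (ihom D E)))"
    and B: "SPC B" and C: "SPC C"
    and D: "SPC D" and E: "SPC E"
    and o: "\<And>a b c. a \<in> Obj A ==> b \<in> Obj B ==> c \<in> Obj C ==> fobj (fobj (fobj F a) b) c = fobj (fobj (fobj G a) b) c"
    and a: "\<And>a b g d. a \<in> Obj A ==> b \<in> Obj B ==> g \<in> Arr C ==> d \<in> Obj D ==> farr (fobj (fobj F a) b) g \<diamondop> d = farr (fobj (fobj G a) b) g \<diamondop> d"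
    and t: "\<And>a b c c' d. a \<in> Obj A ==> b \<in> Obj B ==> c \<in> Obj C ==> c' \<in> Obj C ==> d \<in> Obj D ==>
      ften (fobj (fobj F a) b) c c' \<diamondop> d = ften (fobj (fobj G a) b) c c' \<diamondop> d"
    and u: "\<And>a b d. a \<in> Obj A ==> b \<in> Obj B ==> d \<in> Obj D ==> funit (fobj (fobj F a) b) \<diamondop> d = funit (fobj (fobj G a) b) \<diamondop> d"
    and a': "\<And>a g c d. a \<in> Obj A ==> g \<in> Arr B ==> c \<in> Obj C ==> d \<in> Obj D ==> farr (fobj F a) g \<diamondop> c \<diamondop> d = farr (fobj G a) g \<diamondop> c \<diamondop> d"
    and t': "\<And>a b b' c d. a \<in> Obj A ==> b \<in> Obj B ==> b' \<in> Obj B ==> c \<in> Obj C ==> d \<in> Obj D ==>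
      ften (fobj F a) b b' \<diamondop> c \<diamondop> d = ften (fobj G a) b b' \<diamondop> c \<diamondop> d"
    and u': "\<And>a c d. a \<in> Obj A ==> c \<in> Obj C ==> d \<in> Obj D ==> funit (fobj F a) \<diamondop> c \<diamondop> d = funit (fobj G a) \<diamondop> c \<diamondop> d"
    and a'': "\<And>f b c d. f \<in> Arr A ==> b \<in> Obj B ==> c \<in> Obj C ==> d \<in> Obj D ==> farr F f \<diamondop> b \<diamondop> c \<diamondop> d = farr G f \<diamondop> b \<diamondop> c \<diamondop> d"
    and t'': "\<And>a a' b c d. a \<in> Obj A ==> a' \<in> Obj A ==> b \<in> Obj B ==> c \<in> Obj C ==> d \<in> Obj D ==>
      ften F a a' \<diamondop> b \<diamondop> c \<diamondop> d = ften G a a' \<diamondop> b \<diamondop> c \<diamondop> d"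
    and u'': "\<And>b c d. b \<in> Obj B ==> c \<in> Obj C ==> d \<in> Obj D ==> funit F \<diamondop> b \<diamondop> c \<diamondop> d = funit G \<diamondop> b \<diamondop> c \<diamondop> d"
  shows "F = G"
proof -
  have DE: "SPC (ihom D E)" by (rule ihom_spc[OF D E])
  have CDE: "SPC (ihom C (ihom D E))" by (rule ihom_spc[OF C DE])
  interpret F: bilin A B "ihom C (ihom D E)" F by (rule bilin[OF F B CDE])
  interpret G: bilin A B "ihom C (ihom D E)" G by (rule bilin[OF G B CDE])
  interpret CDE: spc_pair C "ihom D E" by (rule spc_pair[OF C DE])
  interpret DE: spc_pair D E by (rule spc_pair[OF D E])
  have O: "fobj F x = fobj G x" if "x \<in> Obj A" for x
    by (rule smf_eqI3[OF _ _ C D E, where A = B]) (use that in \<open>auto simp: o a t u a' t' u'\<close>)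
  have eq: "\<sigma> \<diamondop> b = \<tau> \<diamondop> b"
    if s: "\<sigma> \<in> Arr (ihom B (ihom C (ihom D E)))" "\<tau> \<in> Arr (ihom B (ihom C (ihom D E)))" "nsrc \<sigma> = nsrc \<tau>" "ntgt \<sigma> = ntgt \<tau>" "b \<in> Obj B"
      "\<And>c d. c \<in> Obj C ==> d \<in> Obj D ==> \<sigma> \<diamondop> b \<diamondop> c \<diamondop> d = \<tau> \<diamondop> b \<diamondop> c \<diamondop> d" for \<sigma> \<tau> b
  proof (rule CDE.ihom_eqI)
    show *: "\<sigma> \<diamondop> b \<in> Arr (ihom C (ihom D E))" "\<tau> \<diamondop> b \<in> Arr (ihom C (ihom D E))"
        "nsrc (\<sigma> \<diamondop> b) = nsrc (\<tau> \<diamondop> b)" "ntgt (\<sigma> \<diamondop> b) = ntgt (\<tau> \<diamondop> b)"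
      using F.Q.ncomp_in[OF s(1,5)] F.Q.ncomp_in[OF s(2,5)] s(3,4) by simp_all
    fix c assume c: "c \<in> Obj C"
    show "\<sigma> \<diamondop> b \<diamondop> c = \<tau> \<diamondop> b \<diamondop> c"
      using CDE.ncomp_in[OF *(1) c] CDE.ncomp_in[OF *(2) c] s(6)[OF c] * by (intro DE.ihom_eqI) simp_all
  qed
  show ?thesis
    by (rule smf_eqI2[OF F G B CDE O]) (auto intro!: eq simp: a'' t'' u'' O)
qed

text \<open>In contrast to \<open>vcomp_app\<close>, the ends are read off from the 2-cell itself,
  so that components can be computed in nested hom categories.\<close>

lemma vcomp_app0: "x \<in> Obj (Src (nsrc \<sigma>)) ==> (\<tau> \<cdot>\<^sub>V \<sigma>) \<diamondop> x = \<tau> \<diamondop> x \<cdot>\<^bsub>Tgt (nsrc \<sigma>)\<^esub> \<sigma> \<diamondop> x"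
  by (simp add: vcomp_def mnt_dom_def mnt_cod_def)

lemmas pt = vcomp_app0 mnt_dom_def mnt_cod_def

lemma hom_post_in:
  assumes "X = X'" "SPC X" "F \<in> arrows B C"
  shows "G \<in> arrows X' B ==> H \<in> arrows X' B ==> ften (hom_post X F) G H \<in> Arr (ihom X' C)"
    "funit (hom_post X F) \<in> Arr (ihom X' C)"
  using spc_arrow.ften_arr(1)[OF spc_arrow[OF hom_post_arrow[OF assms(2,3)]]] spc_arrow.funit_arr(1)[OF spc_arrow[OF hom_post_arrow[OF assms(2,3)]]] assms(1)
  by simp_all

lemma hom_post_compF:
  assumes X: "SPC X" and F: "F \<in> arrows B C" and G: "G \<in> arrows C D"
  shows "hom_post X (G \<circ>\<^sub>F F) = hom_post X G \<circ>\<^sub>F hom_post X F"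
proof -
  interpret F: spc_arrow B C F by (rule spc_arrow[OF F])
  interpret G: spc_arrow C D G by (rule spc_arrow[OF G])
  note GF = compF_arrow[OF F G]
  interpret XB: spc_pair X B by (rule spc_pair[OF X F.B.spc])
  interpret XC: spc_pair X C by (rule spc_pair[OF X F.C.spc])
  note [simp] = hom_post_in[OF refl X F] whiskL_in[OF _ F] compF_arrow[OF _ F]
  show ?thesis
    by (rule smf_eqI2[of _ "ihom X B" X D])
      (use hom_post_arrow[OF X GF] compF_arrow[OF hom_post_arrow[OF X F] hom_post_arrow[OF X G]] X G.C.spc
       in \<open>auto simp: pt compF_assoc[OF _ F G]\<close>)
qed

lemma hom_pre_compF:
  assumes X: "SPC X" and F: "F \<in> arrows B C" and G: "G \<in> arrows C D"
  shows "hom_pre (G \<circ>\<^sub>F F) X = hom_pre F X \<circ>\<^sub>F hom_pre G X"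
proof -
  interpret F: spc_arrow B C F by (rule spc_arrow[OF F])
  interpret G: spc_arrow C D G by (rule spc_arrow[OF G])
  note GF = compF_arrow[OF F G]
  interpret DX: spc_pair D X by (rule spc_pair[OF G.C.spc X])
  interpret CX: spc_pair C X by (rule spc_pair[OF F.C.spc X])
  interpret BX: spc_pair B X by (rule spc_pair[OF F.B.spc X])
  note [simp] = compF_arrow[OF F] compF_arrow[OF G] whiskR_in[OF _ G]
  show ?thesis
    by (rule smf_eqI2[of _ "ihom D X" B X])
      (use hom_pre_arrow[OF GF X] compF_arrow[OF hom_pre_arrow[OF G X] hom_pre_arrow[OF F X]] X F.B.spc
       in \<open>auto simp: pt compF_assoc[OF F G, symmetric]\<close>)
qed

text \<open>Associativity of composition, internalised: the two sides send \<open>K\<close> to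
  \<open>G \<circ> (K \<circ> F)\<close> and to \<open>(G \<circ> K) \<circ> F\<close>.\<close>

lemma hom_post_pre:
  assumes F: "F \<in> arrows B C" and G: "G \<in> arrows X Y"
  shows "hom_post B G \<circ>\<^sub>F hom_pre F X = hom_pre F Y \<circ>\<^sub>F hom_post C G"
proof -
  interpret F: spc_arrow B C F by (rule spc_arrow[OF F])
  interpret G: spc_arrow X Y G by (rule spc_arrow[OF G])
  note B = F.B.spc and C = F.C.spc
  note X = G.B.spc and Y = G.C.spc
  interpret CX: spc_pair C X by (rule spc_pair[OF C X])
  interpret CY: spc_pair C Y by (rule spc_pair[OF C Y])
  interpret BX: spc_pair B X by (rule spc_pair[OF B X])
  note [simp] = compF_arrow[OF F] compF_arrow[OF _ G] whiskR_in[OF _ F] whiskL_in[OF _ G] hom_post_in[OF refl C G] unitF_compF[OF F X]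
  show ?thesis
    by (rule smf_eqI2[of _ "ihom C X" B Y])
      (use compF_arrow[OF hom_pre_arrow[OF F X] hom_post_arrow[OF B G]] compF_arrow[OF hom_post_arrow[OF C G] hom_pre_arrow[OF F Y]] B Y
       in \<open>auto simp: pt compF_assoc[OF F _ G]\<close>)
qed

lemma hom2_in:
  assumes "X = X'" "SPC X" "\<sigma> \<in> Arr (ihom B C)"
  shows "hom_post2 X \<sigma> \<in> Arr (ihom (ihom X' B) (ihom X' C))" "hom_pre2 \<sigma> X \<in> Arr (ihom (ihom C X') (ihom B X'))"
  using hom_post2_in hom_pre2_in assms by blast+

text \<open>Naturality of \<open>[D,-]\<close> in the codomain; on objects it is functoriality of
  \<open>[1,-]\<close>.\<close>

lemma hom_functor_post:
  assumes D: "SPC D" and B: "SPC B" and F: "F \<in> arrows C C'"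
  shows "hom_functor D B C' \<circ>\<^sub>F hom_post B F = hom_post (ihom D B) (hom_post D F) \<circ>\<^sub>F hom_functor D B C"
proof -
  interpret F: spc_arrow C C' F by (rule spc_arrow[OF F])
  note C = F.B.spc and C' = F.C.spc
  interpret BC: spc_pair B C by (rule spc_pair[OF B C])
  interpret BC': spc_pair B C' by (rule spc_pair[OF B C'])
  interpret DC: spc_pair D C by (rule spc_pair[OF D C])
  interpret DC': spc_pair D C' by (rule spc_pair[OF D C'])
  interpret DB: spc_pair D B by (rule spc_pair[OF D B])
  interpret DBDC: spc_pair "ihom D B" "ihom D C" by (rule spc_pair[OF DB.ihom_spc DC.ihom_spc])
  note pF = hom_post_arrow[OF D F]
  note [simp] = compF_arrow[OF _ F] compF_arrow[of _ D B _ C] hom_post_arrow[OF D, of _ B C] hom_post2_in[OF D, of _ B C] whiskL_in[of _ D B _ C]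
    whiskR_in[of _ B C _ D] hom_post_in[OF refl B F] hom_post_in[OF refl DB.ihom_spc pF] hom_post_in[OF refl D F] whiskL_in[OF _ F]
    hom_post_tensF[OF D, of _ B C] hom_post_unitF[OF D B C] hom_post_tensF[OF D, of _ B C']
  show ?thesis
  proof (rule smf_eqI3[of _ "ihom B C" "ihom D B" D C'])
    show "hom_functor D B C' \<circ>\<^sub>F hom_post B F \<in> arrows (ihom B C) (ihom (ihom D B) (ihom D C'))"
      by (rule compF_arrow[OF hom_post_arrow[OF B F] hom_functor_arrow[OF D B C']])
    show "hom_post (ihom D B) (hom_post D F) \<circ>\<^sub>F hom_functor D B C \<in> arrows (ihom B C) (ihom (ihom D B) (ihom D C'))"
      by (rule compF_arrow[OF hom_functor_arrow[OF D B C] hom_post_arrow[OF DB.ihom_spc pF]])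
  qed (use DB.ihom_spc D C' in \<open>auto simp: pt hom_post_compF[OF D _ F] compF_assoc[OF _ _ F] tensF_compF unitF_compF\<close>)
qed

lemma (in spc_pair) farr_Id_in [simp]: "F \<in> arrows B C ==> x \<in> Obj B ==> farr F (Id B x) = Id C (fobj F x)"
  by (rule spc_arrow.farr_Id[OF spc_arrow])

text \<open>Naturality of \<open>[D,-]\<close> in the domain. It accounts for a map in the second
  tensor factor of the target of \<open>A'\<close>.\<close>

lemma hom_functor_pre:
  assumes D: "SPC D" and C: "SPC C" and F: "F \<in> arrows B' B"
  shows "hom_functor D B' C \<circ>\<^sub>F hom_pre F C = hom_pre (hom_post D F) (ihom D C) \<circ>\<^sub>F hom_functor D B C"
proof -
  interpret F: spc_arrow B' B F by (rule spc_arrow[OF F])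
  note B = F.C.spc and B' = F.B.spc
  interpret BC: spc_pair B C by (rule spc_pair[OF B C])
  interpret BC': spc_pair B' C by (rule spc_pair[OF B' C])
  interpret DC: spc_pair D C by (rule spc_pair[OF D C])
  interpret DB: spc_pair D B by (rule spc_pair[OF D B])
  interpret DB': spc_pair D B' by (rule spc_pair[OF D B'])
  note pF = hom_post_arrow[OF D F]
  interpret P: spc_pair "ihom D B" "ihom D C" by (rule spc_pair[OF DB.ihom_spc DC.ihom_spc])
  interpret P': spc_pair "ihom D B'" "ihom D C" by (rule spc_pair[OF DB'.ihom_spc DC.ihom_spc])
  note [simp] = compF_arrow[OF F] compF_arrow[OF _ F] compF_arrow[of _ D B _ C] hom_post_arrow[OF D, of _ B C] hom_post_arrow[OF D, of _ B' C]
    hom_post2_in[OF D, of _ B C] hom_post_in[OF refl D F] whiskL_in[OF _ F] whiskR_in[OF _ F] unitF_compF[OF F C]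
  show ?thesis
  proof (rule smf_eqI3[of _ "ihom B C" "ihom D B'" D C])
    show "hom_functor D B' C \<circ>\<^sub>F hom_pre F C \<in> arrows (ihom B C) (ihom (ihom D B') (ihom D C))"
      by (rule compF_arrow[OF hom_pre_arrow[OF F C] hom_functor_arrow[OF D B' C]])
    show "hom_pre (hom_post D F) (ihom D C) \<circ>\<^sub>F hom_functor D B C \<in> arrows (ihom B C) (ihom (ihom D B') (ihom D C))"
      by (rule compF_arrow[OF hom_functor_arrow[OF D B C] hom_pre_arrow[OF pF DC.ihom_spc]])
  qed (use DB'.ihom_spc D C in \<open>auto simp: pt compF_assoc[OF _ F] hom_post_tensF[OF D, of _ B C] hom_post_unitF[OF D B C] hom_post_unitF[OF D B' C]\<close>)
qed

text \<open>Extranaturality of \<open>[D,-]\<close> in \<open>D\<close>. It gives naturality of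
  \<open>A'\<close> in the last variable and reappears in the pentagon.\<close>

lemma hom_functor_dom:
  assumes B: "SPC B" and C: "SPC C" and h: "h \<in> arrows D' D"
  shows "hom_pre (hom_pre h B) (ihom D' C) \<circ>\<^sub>F hom_functor D' B C = hom_post (ihom D B) (hom_pre h C) \<circ>\<^sub>F hom_functor D B C"
proof -
  interpret h: spc_arrow D' D h by (rule spc_arrow[OF h])
  note D = h.C.spc and D' = h.B.spc
  interpret BC: spc_pair B C by (rule spc_pair[OF B C])
  interpret DC: spc_pair D C by (rule spc_pair[OF D C])
  interpret DB: spc_pair D B by (rule spc_pair[OF D B])
  interpret DC': spc_pair D' C by (rule spc_pair[OF D' C])
  interpret DB': spc_pair D' B by (rule spc_pair[OF D' B])
  note pB = hom_pre_arrow[OF h B] and pC = hom_pre_arrow[OF h C]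
  interpret P: spc_pair "ihom D B" "ihom D C" by (rule spc_pair[OF DB.ihom_spc DC.ihom_spc])
  interpret P': spc_pair "ihom D' B" "ihom D' C" by (rule spc_pair[OF DB'.ihom_spc DC'.ihom_spc])
  note [simp] = compF_arrow[OF h] compF_arrow[of _ D B _ C] compF_arrow[of _ D' B _ C] hom_post_arrow[OF D, of _ B C] hom_post_arrow[OF D', of _ B C]
    hom_post2_in[OF D, of _ B C] hom_post2_in[OF D', of _ B C] whiskL_in[of _ D B _ C] whiskR_in[of _ B C _ D] hom_post_in[OF refl D, of _ B C]
    whiskR_in[OF _ h, of _ B] unitF_compF[OF h B] unitF_compF[OF h C]
  show ?thesis
  proof (rule smf_eqI3[of _ "ihom B C" "ihom D B" D' C])
    show "hom_pre (hom_pre h B) (ihom D' C) \<circ>\<^sub>F hom_functor D' B C \<in> arrows (ihom B C) (ihom (ihom D B) (ihom D' C))"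
      by (rule compF_arrow[OF hom_functor_arrow[OF D' B C] hom_pre_arrow[OF pB DC'.ihom_spc]])
    show "hom_post (ihom D B) (hom_pre h C) \<circ>\<^sub>F hom_functor D B C \<in> arrows (ihom B C) (ihom (ihom D B) (ihom D' C))"
      by (rule compF_arrow[OF hom_functor_arrow[OF D B C] hom_post_arrow[OF DB.ihom_spc pC]])
  qed (use DB.ihom_spc D' C in \<open>auto simp: pt compF_assoc[OF h] hom_post_tensF[OF D, of _ B C] hom_post_tensF[OF D', of _ B C]
     hom_post_unitF[OF D B C] hom_post_unitF[OF D' B C]\<close>)
qed

text \<open>\<open>[D,-]\<close> is compatible with composition \<open>(F,G,H) \<mapsto> F \<circ> (G \<circ> H)\<close>; this underlies the pentagon.\<close>

lemma hom_functor_functor: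
  assumes D: "SPC D" and E: "SPC E"
    and Y: "SPC Y" and W: "SPC W"
  shows "hom_post (ihom E Y) (hom_functor D E W) \<circ>\<^sub>F hom_functor E Y W
    = hom_pre (hom_functor D E Y) (ihom (ihom D E) (ihom D W)) \<circ>\<^sub>F hom_functor (ihom D E) (ihom D Y) (ihom D W) \<circ>\<^sub>F hom_functor D Y W"
proof -
  interpret YW: spc_pair Y W by (rule spc_pair[OF Y W])
  interpret EY: spc_pair E Y by (rule spc_pair[OF E Y])
  interpret EW: spc_pair E W by (rule spc_pair[OF E W])
  interpret DE: spc_pair D E by (rule spc_pair[OF D E])
  interpret DY: spc_pair D Y by (rule spc_pair[OF D Y])
  interpret DW: spc_pair D W by (rule spc_pair[OF D W])
  interpret P1: spc_pair "ihom D E" "ihom D W" by (rule spc_pair[OF DE.ihom_spc DW.ihom_spc])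
  interpret P2: spc_pair "ihom D E" "ihom D Y" by (rule spc_pair[OF DE.ihom_spc DY.ihom_spc])
  interpret P3: spc_pair "ihom D Y" "ihom D W" by (rule spc_pair[OF DY.ihom_spc DW.ihom_spc])
  interpret P4: spc_pair "ihom E Y" "ihom E W" by (rule spc_pair[OF EY.ihom_spc EW.ihom_spc])
  interpret P5: spc_pair "ihom (ihom D E) (ihom D Y)" "ihom (ihom D E) (ihom D W)" by (rule spc_pair[OF P2.ihom_spc P1.ihom_spc])
  note [simp] = compF_arrow[of _ D E _ Y] compF_arrow[of _ E Y _ W] compF_arrow[of _ D Y _ W] compF_arrow[of _ D E _ W]
    hom_post_arrow[OF D, of _ Y W] hom_post_arrow[OF D, of _ E Y] hom_post_arrow[OF D, of _ E W] hom_post_arrow[OF E, of _ Y W]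
    hom_post_arrow[OF DE.ihom_spc, of _ "ihom D Y" "ihom D W"]
    hom_post2_in[OF D, of _ Y W] hom_post2_in[OF E, of _ Y W] hom_post2_in[OF D, of _ E Y] hom_post2_in[OF D, of _ E W]
    hom_post2_in[OF DE.ihom_spc, of _ "ihom D Y" "ihom D W"]
    whiskL_in[of _ E Y _ W] whiskL_in[of _ D E _ Y] whiskR_in[of _ Y W _ E] whiskR_in[of _ E Y _ D]
    hom_post_in[OF refl E, of _ Y W] hom_post_in[OF refl D, of _ E Y]
  note tu = hom_post_tensF[OF D, of _ Y W] hom_post_tensF[OF D, of _ E Y] hom_post_tensF[OF D, of _ E W] hom_post_tensF[OF E, of _ Y W]
     hom_post_unitF[OF D Y W] hom_post_unitF[OF D E Y] hom_post_unitF[OF D E W] hom_post_unitF[OF E Y W]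
     hom_post_tensF[OF DE.ihom_spc, of _ "ihom D Y" "ihom D W"] hom_post_unitF[OF DE.ihom_spc DY.ihom_spc DW.ihom_spc]
     hom_post_compF[OF D, of _ E Y _ W]
  show ?thesis
  proof (rule smf_eqI4[of _ "ihom Y W" "ihom E Y" "ihom D E" D W])
    show "hom_post (ihom E Y) (hom_functor D E W) \<circ>\<^sub>F hom_functor E Y W \<in> arrows (ihom Y W) (ihom (ihom E Y) (ihom (ihom D E) (ihom D W)))"
      by (rule compF_arrow[OF hom_functor_arrow[OF E Y W] hom_post_arrow[OF EY.ihom_spc hom_functor_arrow[OF D E W]]])
    show "hom_pre (hom_functor D E Y) (ihom (ihom D E) (ihom D W)) \<circ>\<^sub>F hom_functor (ihom D E) (ihom D Y) (ihom D W) \<circ>\<^sub>F hom_functor D Y W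
        \<in> arrows (ihom Y W) (ihom (ihom E Y) (ihom (ihom D E) (ihom D W)))"
      by (rule compF_arrow[OF compF_arrow[OF hom_functor_arrow[OF D Y W] hom_functor_arrow[OF DE.ihom_spc DY.ihom_spc DW.ihom_spc]]
            hom_pre_arrow[OF hom_functor_arrow[OF D E Y] P1.ihom_spc]])
  qed (use EY.ihom_spc DE.ihom_spc D W in \<open>auto simp: pt tu compF_assoc[of _ D E _ Y _ W]\<close>)
qed

lemma hom_id:
  assumes B: "SPC B" and C: "SPC C"
  shows "hom_pre (idF B) C = idF (ihom B C)"
proof -
  interpret BC: spc_pair B C by (rule spc_pair[OF B C])
  show ?thesis
    by (rule smf_eqI2[of _ "ihom B C" B C])
      (use hom_pre_arrow[OF idF_arrow[OF B] C] idF_arrow[OF BC.ihom_spc] B C in \<open>auto simp: compF_idF\<close>)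
qed

section \<open>The canonical arrows\<close>

lemma Rn_arrow:
  "F \<in> arrows (B \<otimes>\<^sub>0 C) D ==> SPC B ==> SPC C ==> Rn B C F \<in> arrows B (ihom C D)"
  by (rule tens.Rn_arrow[OF tens])

lemma eta_arrow: "SPC B ==> SPC C ==> eta B C \<in> arrows B (ihom C (B \<otimes>\<^sub>0 C))"
  by (rule tens.eta_arrow[OF tens])

text \<open>Here and in the next lemmas the typing conditions are equations between
  \<open>Src\<close> and \<open>Tgt\<close>, which rewriting can decide; long composites can then be
  rebracketed without naming each intermediate category.\<close>

lemma compF_smf:
  "SMF F ==> SMF G ==> Tgt F = Src G ==> SMF (G \<circ>\<^sub>F F)"
  using compF_arrow[of F "Src F" "Tgt F" G "Tgt G"] by (simp add: arrows_def)

lemma compF_assoc_smf: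
  "SMF F ==> SMF G ==> SMF H ==>
    Tgt F = Src G ==> Tgt G = Src H ==> (H \<circ>\<^sub>F G) \<circ>\<^sub>F F = H \<circ>\<^sub>F (G \<circ>\<^sub>F F)"
  using compF_assoc[of F "Src F" "Tgt F" G "Tgt G" H "Tgt H"] by (simp add: arrows_def)

lemma compF_reduce:
  "K \<circ>\<^sub>F J = L ==> SMF J ==> SMF K ==> Tgt J = Src K ==>
    SMF Z ==> Tgt Z = Src J ==> K \<circ>\<^sub>F (J \<circ>\<^sub>F Z) = L \<circ>\<^sub>F Z"
  by (simp add: compF_assoc_smf[symmetric])

lemmas smf_calc = compF_smf compF_assoc_smf

lemma arrows_iff: "F \<in> arrows B C \<longleftrightarrow> SMF F \<and> Src F = B \<and> Tgt F = C"
  by (simp add: arrows_def)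

lemmas smf_of = arrows_iff[THEN iffD1]

lemma spc_closed:
  "SPC B ==> SPC C ==> SPC (ihom B C)" "SPC B ==> SPC C ==> SPC (B \<otimes>\<^sub>0 C)"
  by (rule ihom_spc tens0_spc; assumption)+

lemma eta_sel [simp]: "Src (eta B C) = B" "Tgt (eta B C) = ihom C (B \<otimes>\<^sub>0 C)"
  by (simp_all add: eta_def Let_def)

lemma smf_closed:
  "SPC B ==> SPC C ==> SMF (eta B C)" "SPC D ==> SPC B ==> SPC C ==> SMF (hom_functor D B C)"
  "SMF F ==> SPC X ==> SMF (hom_pre F X)" "SPC X ==> SMF F ==> SMF (hom_post X F)"
  using eta_arrow[of B C] hom_functor_arrow[of D B C] hom_pre_arrow[of F "Src F" "Tgt F" X] hom_post_arrow[of X F "Src F" "Tgt F"]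
  by (simp_all add: arrows_iff)

lemmas arr_calc = smf_calc smf_closed spc_closed

section \<open>Naturality of transposition and functoriality of the tensor product\<close>

lemma Rn_compF:
  assumes B: "SPC B" and C: "SPC C"
    and F: "F \<in> arrows (B \<otimes>\<^sub>0 C) D" and K: "K \<in> arrows D E"
  shows "Rn B C (K \<circ>\<^sub>F F) = hom_post C K \<circ>\<^sub>F Rn B C F"
  unfolding Rn_def hom_post_compF[OF C F K]
  by (rule compF_assoc[OF eta_arrow[OF B C] hom_post_arrow[OF C F] hom_post_arrow[OF C K]])

lemma tens1_props:
  assumes F: "F \<in> arrows B B'" and G: "G \<in> arrows C C'"
  shows "F \<otimes>\<^sub>1 G \<in> strict_arrows (B \<otimes>\<^sub>0 C) (B' \<otimes>\<^sub>0 C')"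
    "Rn B C (F \<otimes>\<^sub>1 G) = hom_pre G (B' \<otimes>\<^sub>0 C') \<circ>\<^sub>F eta B' C' \<circ>\<^sub>F F"
proof -
  note s = arrows_src_tgt[OF F] arrows_src_tgt[OF G] and c = arrows_spc[OF F] arrows_spc[OF G]
  have X: "SPC (B' \<otimes>\<^sub>0 C')" by (rule tens0_spc[OF c(2,4)])
  have H: "hom_pre G (B' \<otimes>\<^sub>0 C') \<circ>\<^sub>F eta B' C' \<circ>\<^sub>F F \<in> arrows B (ihom C (B' \<otimes>\<^sub>0 C'))"
    by (rule compF_arrow[OF compF_arrow[OF F eta_arrow[OF c(2,4)]] hom_pre_arrow[OF G X]])
  show "F \<otimes>\<^sub>1 G \<in> strict_arrows (B \<otimes>\<^sub>0 C) (B' \<otimes>\<^sub>0 C')"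
    "Rn B C (F \<otimes>\<^sub>1 G) = hom_pre G (B' \<otimes>\<^sub>0 C') \<circ>\<^sub>F eta B' C' \<circ>\<^sub>F F"
    using tens.En_props[OF tens[OF c(1,3)] H X] by (simp_all add: tens1_def s Let_def)
qed

lemma tens1_arrow: "F \<in> arrows B B' ==> G \<in> arrows C C' ==> F \<otimes>\<^sub>1 G \<in> arrows (B \<otimes>\<^sub>0 C) (B' \<otimes>\<^sub>0 C')"
  by (rule strict_arrowsD[OF tens1_props(1)])

text \<open>Naturality of transposition in both tensor factors. The arrow \<open>K\<close> is
  arbitrary: \<open>hom_post_pre\<close> moves \<open>[1,K]\<close> past \<open>[G,1]\<close>, after
  which it is absorbed in the transpose of \<open>K\<close>.\<close>

lemma Rn_tens1:
  assumes F: "F \<in> arrows B B'" and G: "G \<in> arrows C C'" and K: "K \<in> arrows (B' \<otimes>\<^sub>0 C') D"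
  shows "Rn B C (K \<circ>\<^sub>F (F \<otimes>\<^sub>1 G)) = hom_pre G D \<circ>\<^sub>F Rn B' C' K \<circ>\<^sub>F F"
proof -
  note c = arrows_spc[OF F] arrows_spc[OF G] arrows_spc[OF K]
  show ?thesis
    unfolding Rn_compF[OF c(1,3) tens1_arrow[OF F G] K] tens1_props(2)[OF F G] Rn_def[of B']
    by (simp add: arr_calc c smf_of[OF F] smf_of[OF G] smf_of[OF K] compF_reduce[OF hom_post_pre[OF G K]])
qed

lemma strict_eqI:
  assumes "F \<in> strict_arrows (B \<otimes>\<^sub>0 C) D" "G \<in> strict_arrows (B \<otimes>\<^sub>0 C) D" "Rn B C F = Rn B C G"
    "SPC B" "SPC C"
  shows "F = G"
  using tens.Rn_unique[OF tens] assms by blast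

lemma tens1_comp:
  assumes F: "F \<in> arrows B B'" and G: "G \<in> arrows C C'" and F': "F' \<in> arrows B' B''" and G': "G' \<in> arrows C' C''"
  shows "(F' \<otimes>\<^sub>1 G') \<circ>\<^sub>F (F \<otimes>\<^sub>1 G) = (F' \<circ>\<^sub>F F) \<otimes>\<^sub>1 (G' \<circ>\<^sub>F G)"
proof (rule strict_eqI[of _ B C])
  note c = arrows_spc[OF F] arrows_spc[OF G] arrows_spc[OF F'] arrows_spc[OF G']
  note FF = compF_arrow[OF F F'] and GG = compF_arrow[OF G G']
  have X: "SPC (B'' \<otimes>\<^sub>0 C'')" by (rule tens0_spc[OF c(6,8)])
  show "(F' \<otimes>\<^sub>1 G') \<circ>\<^sub>F (F \<otimes>\<^sub>1 G) \<in> strict_arrows (B \<otimes>\<^sub>0 C) (B'' \<otimes>\<^sub>0 C'')"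
    by (rule strict_compF[OF tens1_props(1)[OF F G] tens1_props(1)[OF F' G']])
  show "(F' \<circ>\<^sub>F F) \<otimes>\<^sub>1 (G' \<circ>\<^sub>F G) \<in> strict_arrows (B \<otimes>\<^sub>0 C) (B'' \<otimes>\<^sub>0 C'')"
    by (rule tens1_props(1)[OF FF GG])
  show "Rn B C ((F' \<otimes>\<^sub>1 G') \<circ>\<^sub>F (F \<otimes>\<^sub>1 G)) = Rn B C ((F' \<circ>\<^sub>F F) \<otimes>\<^sub>1 (G' \<circ>\<^sub>F G))"
    unfolding Rn_tens1[OF F G tens1_arrow[OF F' G']] tens1_props(2)[OF F' G'] tens1_props(2)[OF FF GG] hom_pre_compF[OF X G G']
    by (simp add: arr_calc c smf_of[OF F] smf_of[OF G] smf_of[OF F'] smf_of[OF G'])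
  show "SPC B" "SPC C" by (rule c)+
qed

lemma tens1_idF:
  assumes B: "SPC B" and C: "SPC C"
  shows "idF B \<otimes>\<^sub>1 idF C = idF (B \<otimes>\<^sub>0 C)"
proof (rule strict_eqI[OF _ _ _ B C])
  have X: "SPC (B \<otimes>\<^sub>0 C)" by (rule tens0_spc[OF B C])
  interpret CX: spc_pair C "B \<otimes>\<^sub>0 C" by (rule spc_pair[OF C X])
  note e = eta_arrow[OF B C]
  show "idF B \<otimes>\<^sub>1 idF C \<in> strict_arrows (B \<otimes>\<^sub>0 C) (B \<otimes>\<^sub>0 C)" by (rule tens1_props(1)[OF idF_arrow[OF B] idF_arrow[OF C]])
  show "idF (B \<otimes>\<^sub>0 C) \<in> strict_arrows (B \<otimes>\<^sub>0 C) (B \<otimes>\<^sub>0 C)" by (rule strict_idF[OF X])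
  have "hom_post C (idF (B \<otimes>\<^sub>0 C)) = idF (ihom C (B \<otimes>\<^sub>0 C))"
    by (rule smf_eqI2[of _ "ihom C (B \<otimes>\<^sub>0 C)" C "B \<otimes>\<^sub>0 C"])
      (use hom_post_arrow[OF C idF_arrow[OF X]] idF_arrow[OF CX.ihom_spc] C X in \<open>auto simp: compF_idF\<close>)
  then show "Rn B C (idF B \<otimes>\<^sub>1 idF C) = Rn B C (idF (B \<otimes>\<^sub>0 C))"
    unfolding tens1_props(2)[OF idF_arrow[OF B] idF_arrow[OF C]] by (simp add: Rn_def hom_id[OF C X] compF_idF[OF e])
qed

lemma tens1_app:
  assumes F: "F \<in> arrows B B'" and G: "G \<in> arrows C C'" and b: "b \<in> Obj B" and c: "c \<in> Obj C"
  shows "fobj (F \<otimes>\<^sub>1 G) (PGen (b, c)) = PGen (fobj F b, fobj G c)"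
proof -
  interpret F: spc_arrow B B' F by (rule spc_arrow[OF F])
  interpret G: spc_arrow C C' G by (rule spc_arrow[OF G])
  interpret T: tens B C by (rule tens[OF F.B.spc G.B.spc])
  interpret T': tens B' C' by (rule tens[OF F.C.spc G.C.spc])
  have "fobj (F \<otimes>\<^sub>1 G) (PGen (b, c)) = fobj (fobj (Rn B C (F \<otimes>\<^sub>1 G)) b) c"
    by (rule T.Rn_app(5)[OF tens1_arrow[OF F G] b c, symmetric])
  also have "\<dots> = PGen (fobj F b, fobj G c)" using b c by (simp add: tens1_props(2)[OF F G])
  finally show ?thesis .
qed

text \<open>For arrows out of an iterated tensor product, strictness of the transposed arrow is an additional
  condition; it holds for \<open>A'\<close> by construction.\<close>

lemma strict_eqI3:
  assumes "F \<in> strict_arrows ((B \<otimes>\<^sub>0 C) \<otimes>\<^sub>0 D) E" "G \<in> strict_arrows ((B \<otimes>\<^sub>0 C) \<otimes>\<^sub>0 D) E"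
    "Rn (B \<otimes>\<^sub>0 C) D F \<in> strict_arrows (B \<otimes>\<^sub>0 C) (ihom D E)" "Rn (B \<otimes>\<^sub>0 C) D G \<in> strict_arrows (B \<otimes>\<^sub>0 C) (ihom D E)"
    "Rn B C (Rn (B \<otimes>\<^sub>0 C) D F) = Rn B C (Rn (B \<otimes>\<^sub>0 C) D G)"
    and B: "SPC B" and C: "SPC C" and D: "SPC D"
  shows "F = G"
  by (rule strict_eqI[OF assms(1,2) strict_eqI[OF assms(3-5) B C] tens0_spc[OF B C] D])

text \<open>Applying \<open>En\<close> twice gives a strict arrow whose transpose is strict with the
  prescribed double transpose. By \<open>strict_eqI3\<close> it is the only one, so the definite
  description denotes it.\<close>

lemma Ac_props:
  assumes B: "SPC B" and C: "SPC C" and D: "SPC D"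
  shows "Ac B C D \<in> strict_arrows ((B \<otimes>\<^sub>0 C) \<otimes>\<^sub>0 D) (B \<otimes>\<^sub>0 (C \<otimes>\<^sub>0 D))"
    "Rn (B \<otimes>\<^sub>0 C) D (Ac B C D) \<in> strict_arrows (B \<otimes>\<^sub>0 C) (ihom D (B \<otimes>\<^sub>0 (C \<otimes>\<^sub>0 D)))"
    "Rn B C (Rn (B \<otimes>\<^sub>0 C) D (Ac B C D)) = hom_pre (eta C D) (ihom D (B \<otimes>\<^sub>0 (C \<otimes>\<^sub>0 D))) \<circ>\<^sub>F
       hom_functor D (C \<otimes>\<^sub>0 D) (B \<otimes>\<^sub>0 (C \<otimes>\<^sub>0 D)) \<circ>\<^sub>F eta B (C \<otimes>\<^sub>0 D)"
proof -
  note CD = tens0_spc[OF C D] and BC = tens0_spc[OF B C]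
  let ?X = "B \<otimes>\<^sub>0 (C \<otimes>\<^sub>0 D)"
  have X: "SPC ?X" by (rule tens0_spc[OF B CD])
  have DX: "SPC (ihom D ?X)" by (rule ihom_spc[OF D X])
  let ?K = "hom_pre (eta C D) (ihom D ?X) \<circ>\<^sub>F hom_functor D (C \<otimes>\<^sub>0 D) ?X \<circ>\<^sub>F eta B (C \<otimes>\<^sub>0 D)"
  have K: "?K \<in> arrows B (ihom C (ihom D ?X))"
    by (rule compF_arrow[OF compF_arrow[OF eta_arrow[OF B CD] hom_functor_arrow[OF D CD X]] hom_pre_arrow[OF eta_arrow[OF C D] DX]])
  let ?F = "En B C (ihom D ?X) ?K"
  have F: "?F \<in> strict_arrows (B \<otimes>\<^sub>0 C) (ihom D ?X)" "Rn B C ?F = ?K"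
    using tens.En_props[OF tens[OF B C] K DX] .
  let ?A = "En (B \<otimes>\<^sub>0 C) D ?X ?F"
  have A: "?A \<in> strict_arrows ((B \<otimes>\<^sub>0 C) \<otimes>\<^sub>0 D) ?X" "Rn (B \<otimes>\<^sub>0 C) D ?A = ?F"
    using tens.En_props[OF tens[OF BC D] strict_arrowsD[OF F(1)] X] .
  have st: "strict_smf G \<longleftrightarrow> G \<in> strict_arrows (B \<otimes>\<^sub>0 C) (ihom D ?X)" if "G \<in> arrows (B \<otimes>\<^sub>0 C) (ihom D ?X)" for G
    using that by (simp add: strict_arrows_def)
  have R: "Rn (B \<otimes>\<^sub>0 C) D G \<in> arrows (B \<otimes>\<^sub>0 C) (ihom D ?X)" if "G \<in> strict_arrows ((B \<otimes>\<^sub>0 C) \<otimes>\<^sub>0 D) ?X" for G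
    by (rule Rn_arrow[OF strict_arrowsD[OF that] BC D])
  have "Ac B C D = ?A"
    unfolding Ac_def Let_def
  proof (rule the_equality)
    show "?A \<in> strict_arrows ((B \<otimes>\<^sub>0 C) \<otimes>\<^sub>0 D) ?X \<and> strict_smf (Rn (B \<otimes>\<^sub>0 C) D ?A) \<and> Rn B C (Rn (B \<otimes>\<^sub>0 C) D ?A) = ?K"
      using A F st[OF R[OF A(1)]] by simp
    fix G assume "G \<in> strict_arrows ((B \<otimes>\<^sub>0 C) \<otimes>\<^sub>0 D) ?X \<and> strict_smf (Rn (B \<otimes>\<^sub>0 C) D G) \<and> Rn B C (Rn (B \<otimes>\<^sub>0 C) D G) = ?K"
    then show "G = ?A"
      using A F st R by (intro strict_eqI3[OF _ A(1) _ _ _ B C D]) auto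
  qed
  then show "Ac B C D \<in> strict_arrows ((B \<otimes>\<^sub>0 C) \<otimes>\<^sub>0 D) ?X"
    "Rn (B \<otimes>\<^sub>0 C) D (Ac B C D) \<in> strict_arrows (B \<otimes>\<^sub>0 C) (ihom D ?X)"
    "Rn B C (Rn (B \<otimes>\<^sub>0 C) D (Ac B C D)) = ?K" using A F by auto
qed

lemma Ac_arrow:
  "SPC B ==> SPC C ==> SPC D ==>
    Ac B C D \<in> arrows ((B \<otimes>\<^sub>0 C) \<otimes>\<^sub>0 D) (B \<otimes>\<^sub>0 (C \<otimes>\<^sub>0 D))"
  by (rule strict_arrowsD[OF Ac_props(1)])

text \<open>The composite characterising \<open>A'\<close>, carried along an arbitrary arrow
  \<open>F\<close> by naturality of \<open>[D,-]\<close>. All later computations with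
  \<open>A'\<close> under transposition start from here.\<close>

lemma Rn_Ac:
  assumes B: "SPC B" and C: "SPC C" and D: "SPC D"
    and F: "F \<in> arrows (B \<otimes>\<^sub>0 (C \<otimes>\<^sub>0 D)) E"
  shows "Rn B C (Rn (B \<otimes>\<^sub>0 C) D (F \<circ>\<^sub>F Ac B C D)) = hom_pre (eta C D) (ihom D E) \<circ>\<^sub>F hom_functor D (C \<otimes>\<^sub>0 D) E \<circ>\<^sub>F Rn B (C \<otimes>\<^sub>0 D) F"
proof -
  note s = spc_closed B C D and E = arrows_spc(2)[OF F] and pD = hom_post_arrow[OF D F]
  show ?thesis
    unfolding Rn_compF[OF s(2)[OF B C] D Ac_arrow[OF B C D] F] Rn_compF[OF B C strict_arrowsD[OF Ac_props(2)[OF B C D]] pD] Ac_props(3)[OF B C D]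
    unfolding Rn_def
    by (simp add: arr_calc s E smf_of[OF F] compF_reduce[OF hom_post_pre[OF eta_arrow[OF C D] pD]]
      compF_reduce[OF hom_functor_post[OF D _ F, symmetric]])
qed

text \<open>\<open>strict_eqI3\<close> requires strict transposes; this lemma and the next propagate
  that property through composites.\<close>

lemma Rn_strict_compF:
  assumes B: "SPC B" and C: "SPC C"
    and F: "F \<in> arrows (B \<otimes>\<^sub>0 C) D" "Rn B C F \<in> strict_arrows B (ihom C D)" and K: "K \<in> strict_arrows D E"
  shows "Rn B C (K \<circ>\<^sub>F F) \<in> strict_arrows B (ihom C E)"
  unfolding Rn_compF[OF B C F(1) strict_arrowsD[OF K]]
  by (rule strict_compF[OF F(2) hom_post_strict[OF C K]])

lemma Rn_strict_tens1:
  assumes F: "F \<in> strict_arrows B B'" and G: "G \<in> arrows C C'" and K: "K \<in> arrows (B' \<otimes>\<^sub>0 C') D"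
    and R: "Rn B' C' K \<in> strict_arrows B' (ihom C' D)"
  shows "Rn B C (K \<circ>\<^sub>F (F \<otimes>\<^sub>1 G)) \<in> strict_arrows B (ihom C D)"
  unfolding Rn_tens1[OF strict_arrowsD[OF F] G K]
  by (rule strict_compF[OF strict_compF[OF F R] hom_pre_strict[OF G arrows_spc(2)[OF K]]])

text \<open>Both double transposes are brought to the form \<open>?Z\<close>. On the left,
  commutation of pre- and postcomposition is enough; on the right, naturality of
  \<open>[D,-]\<close> in its domain and extranaturality at \<open>H\<close> are used.\<close>

lemma Ac_natural:
  assumes F: "F \<in> arrows B B'" and G: "G \<in> arrows C C'" and H: "H \<in> arrows D D'"
  shows "Ac B' C' D' \<circ>\<^sub>F ((F \<otimes>\<^sub>1 G) \<otimes>\<^sub>1 H) = (F \<otimes>\<^sub>1 (G \<otimes>\<^sub>1 H)) \<circ>\<^sub>F Ac B C D"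
proof (rule strict_eqI3[of _ B C D])
  note B = arrows_spc(1)[OF F] and B' = arrows_spc(2)[OF F] and C = arrows_spc(1)[OF G] and C' = arrows_spc(2)[OF G]
    and D = arrows_spc(1)[OF H] and D' = arrows_spc(2)[OF H]
  note FG = tens1_props[OF F G] and GH = tens1_props[OF G H]
  note FGa = tens1_arrow[OF F G] and GHa = tens1_arrow[OF G H]
  note FGH = tens1_props[OF FGa H] and FGH' = tens1_props[OF F GHa]
  note A = Ac_props[OF B C D] and A' = Ac_props[OF B' C' D']
  note Aa = Ac_arrow[OF B C D] and Aa' = Ac_arrow[OF B' C' D']
  note CD' = tens0_spc[OF C' D'] and CD = tens0_spc[OF C D] and BC = tens0_spc[OF B C]
  let ?X = "B' \<otimes>\<^sub>0 (C' \<otimes>\<^sub>0 D')"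
  have X: "SPC ?X" by (rule tens0_spc[OF B' CD'])
  show "Ac B' C' D' \<circ>\<^sub>F ((F \<otimes>\<^sub>1 G) \<otimes>\<^sub>1 H) \<in> strict_arrows ((B \<otimes>\<^sub>0 C) \<otimes>\<^sub>0 D) ?X"
    by (rule strict_compF[OF FGH(1) A'(1)])
  show "(F \<otimes>\<^sub>1 (G \<otimes>\<^sub>1 H)) \<circ>\<^sub>F Ac B C D \<in> strict_arrows ((B \<otimes>\<^sub>0 C) \<otimes>\<^sub>0 D) ?X"
    by (rule strict_compF[OF A(1) FGH'(1)])
  show "Rn (B \<otimes>\<^sub>0 C) D (Ac B' C' D' \<circ>\<^sub>F ((F \<otimes>\<^sub>1 G) \<otimes>\<^sub>1 H)) \<in> strict_arrows (B \<otimes>\<^sub>0 C) (ihom D ?X)"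
    by (rule Rn_strict_tens1[OF FG(1) H Aa' A'(2)])
  show "Rn (B \<otimes>\<^sub>0 C) D ((F \<otimes>\<^sub>1 (G \<otimes>\<^sub>1 H)) \<circ>\<^sub>F Ac B C D) \<in> strict_arrows (B \<otimes>\<^sub>0 C) (ihom D ?X)"
    by (rule Rn_strict_compF[OF BC D Aa A(2) FGH'(1)])
  note RA' = strict_arrowsD[OF A'(2)]
  note calc = arr_calc B B' C C' D D' smf_of[OF F] smf_of[OF G] smf_of[OF H]
  let ?Z = "hom_pre G (ihom D ?X) \<circ>\<^sub>F hom_pre (eta C' D') (ihom D ?X) \<circ>\<^sub>F
      hom_post (ihom D' (C' \<otimes>\<^sub>0 D')) (hom_pre H ?X) \<circ>\<^sub>F hom_functor D' (C' \<otimes>\<^sub>0 D') ?X \<circ>\<^sub>F eta B' (C' \<otimes>\<^sub>0 D') \<circ>\<^sub>F F"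
  note eC = eta_arrow[OF C' D'] and hD = hom_pre_arrow[OF H X] and hH = hom_pre_arrow[OF H CD'] and DX = ihom_spc[OF D X]
  have L: "Rn B C (Rn (B \<otimes>\<^sub>0 C) D (Ac B' C' D' \<circ>\<^sub>F ((F \<otimes>\<^sub>1 G) \<otimes>\<^sub>1 H))) = ?Z"
    unfolding Rn_tens1[OF FGa H Aa'] Rn_compF[OF B C compF_arrow[OF FGa RA'] hD] Rn_tens1[OF F G RA'] A'(3)
    by (simp add: calc compF_reduce[OF hom_post_pre[OF G hD]] compF_reduce[OF hom_post_pre[OF eC hD]])
  \<comment> \<open>The equation for the transpose of \<open>G \<otimes>\<^sub>1 H\<close>, with the
    contravariant operation \<open>hom_pre\<close> applied to both sides.\<close>
  have h: "hom_pre (eta C D) (ihom D ?X) \<circ>\<^sub>F hom_pre (hom_post D (G \<otimes>\<^sub>1 H)) (ihom D ?X)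
      = (hom_pre G (ihom D ?X) \<circ>\<^sub>F hom_pre (eta C' D') (ihom D ?X)) \<circ>\<^sub>F hom_pre (hom_pre H (C' \<otimes>\<^sub>0 D')) (ihom D ?X)"
    using arg_cong[OF GH(2), of "\<lambda>K. hom_pre K (ihom D ?X)"]
    unfolding Rn_def hom_pre_compF[OF DX eta_arrow[OF C D] hom_post_arrow[OF D GHa]] hom_pre_compF[OF DX compF_arrow[OF G eC] hH] hom_pre_compF[OF DX G eC] .
  have "Rn B C (Rn (B \<otimes>\<^sub>0 C) D ((F \<otimes>\<^sub>1 (G \<otimes>\<^sub>1 H)) \<circ>\<^sub>F Ac B C D)) = ?Z"
    unfolding Rn_Ac[OF B C D tens1_arrow[OF F GHa]] FGH'(2)
    by (simp add: calc smf_of[OF GHa] compF_reduce[OF hom_functor_pre[OF D X GHa]] compF_reduce[OF h] compF_reduce[OF hom_functor_dom[OF CD' X H]])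
  with L show "Rn B C (Rn (B \<otimes>\<^sub>0 C) D (Ac B' C' D' \<circ>\<^sub>F ((F \<otimes>\<^sub>1 G) \<otimes>\<^sub>1 H)))
     = Rn B C (Rn (B \<otimes>\<^sub>0 C) D ((F \<otimes>\<^sub>1 (G \<otimes>\<^sub>1 H)) \<circ>\<^sub>F Ac B C D))" by simp
  show "SPC B" "SPC C" "SPC D" by (rule B C D)+
qed

lemma Ac_app:
  assumes B: "SPC B" and C: "SPC C" and D: "SPC D"
    and b: "b \<in> Obj B" and c: "c \<in> Obj C" and d: "d \<in> Obj D"
  shows "fobj (Ac B C D) (PGen (PGen (b, c), d)) = PGen (b, PGen (c, d))"
proof -
  interpret BC: tens B C by (rule tens[OF B C])
  note CD = tens0_spc[OF C D] and BC = tens0_spc[OF B C]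
  interpret BCD: tens "B \<otimes>\<^sub>0 C" D by (rule tens[OF BC D])
  interpret CD: tens C D by (rule tens[OF C D])
  interpret X: tens B "C \<otimes>\<^sub>0 D" by (rule tens[OF B CD])
  have o: "PGen (b, c) \<in> Obj (B \<otimes>\<^sub>0 C)" "PGen (c, d) \<in> Obj (C \<otimes>\<^sub>0 D)" using b c d by (simp_all add: tens0_def)
  note A = Ac_props[OF B C D]
  have "fobj (Ac B C D) (PGen (PGen (b, c), d)) = fobj (fobj (fobj (Rn B C (Rn (B \<otimes>\<^sub>0 C) D (Ac B C D))) b) c) d"
    unfolding BC.Rn_app(5)[OF strict_arrowsD[OF A(2)] b c] BCD.Rn_app(5)[OF strict_arrowsD[OF A(1)] o(1) d] ..
  also have "\<dots> = PGen (b, PGen (c, d))"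
    unfolding A(3) using b c d o by (simp add: hom_post_arrow[OF D X.E_in])
  finally show ?thesis .
qed

section \<open>Strictness of evaluation and of \<open>[D,-]\<close>\<close>

lemma ev_strict:
  assumes C: "SPC C" and D: "SPC D" and c: "c \<in> Obj C"
  shows "ev C D c \<in> strict_arrows (ihom C D) D"
proof -
  interpret S: spc_pair C D by (rule spc_pair[OF C D])
  show ?thesis by (rule strict_arrowsI) (use c ev_arrow[OF C D c] in auto)
qed

text \<open>In \<open>[D,C]\<close> the arrows \<open>bul_arr\<close>, \<open>bul_tens\<close> and
  \<open>bul_unit\<close> are definite descriptions, so their components are not visible. Evaluation
  at \<open>d\<close> is strict, hence sends them to the corresponding arrows of \<open>C\<close>,
  and the comparison becomes pointwise.\<close>

lemma hom_post_bulF: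
  assumes D: "SPC D" and F: "F \<in> arrows B C"
  shows "hom_post D (bulF F) = bulF (hom_post D F)"
proof -
  note B = arrows_spc(1)[OF F] and C = arrows_spc(2)[OF F]
  interpret F: spc_arrow B C F by (rule spc_arrow[OF F])
  interpret P: spc_pair D B by (rule spc_pair[OF D B])
  interpret Q: spc_pair D C by (rule spc_pair[OF D C])
  interpret R: spc_pair B C by (rule spc_pair[OF B C])
  interpret PQ: spc_pair "ihom D B" "ihom D C" by (rule spc_pair[OF P.ihom_spc Q.ihom_spc])
  have FF: "bulF F \<in> arrows B C" using F by simp
  have e [simp]: "bul_arr (ihom D C) \<sigma> \<diamondop> d = bul_arr C (\<sigma> \<diamondop> d)" "bul_tens (ihom D C) G H \<diamondop> d = bul_tens C (fobj G d) (fobj H d)"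
    "bul_unit (ihom D C) \<diamondop> d = bul_unit C"
    if "d \<in> Obj D" "\<sigma> \<in> Arr (ihom D C)" "G \<in> arrows D C" "H \<in> arrows D C" for d \<sigma> G H
  proof -
    interpret E: spc_strict "ihom D C" C "ev D C d" by (rule spc_strict[OF ev_strict[OF D C that(1)]])
    show "bul_arr (ihom D C) \<sigma> \<diamondop> d = bul_arr C (\<sigma> \<diamondop> d)" "bul_tens (ihom D C) G H \<diamondop> d = bul_tens C (fobj G d) (fobj H d)"
      using E.str_bul_arr[of \<sigma>] E.str_bul_tens[of G H] that PQ.C.bul_arr_props(1)[of \<sigma>]
        PQ.C.bul_tens_props(1)[of G H] by simp_all
    show "bul_unit (ihom D C) \<diamondop> d = bul_unit C"
      using E.str_bul_unit unfolding ev_app(4)[OF PQ.C.bul_unit_props(1)] .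
  qed
  have [simp]: "F *\<^sub>L \<sigma> \<in> Arr (ihom D C)" if "\<sigma> \<in> Arr (ihom D B)" for \<sigma>
    using whiskL_in[OF that F] .
  have [simp]: "F \<circ>\<^sub>F G \<in> arrows D C" if "G \<in> arrows D B" for G
    using compF_arrow[OF that F] .
  have H: "hom_post D F \<in> arrows (ihom D B) (ihom D C)" by (rule hom_post_arrow[OF D F])
  interpret H: spc_arrow "ihom D B" "ihom D C" "hom_post D F" by (rule spc_arrow[OF H])
  note hi = hom_post_in[OF refl D F]
  have ua: "bul_unit (ihom D C) \<in> Arr (ihom D C)" "nsrc (bul_unit (ihom D C)) = unitF D C"
    using PQ.C.bul_unit_props by simp_all
  have ba: "bul_arr (ihom D C) \<sigma> \<in> Arr (ihom D C)" "nsrc (bul_arr (ihom D C) \<sigma>) = bulF (nsrc \<sigma>)" "ntgt (bul_arr (ihom D C) \<sigma>) = bulF (ntgt \<sigma>)"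
    if "\<sigma> \<in> Arr (ihom D C)" for \<sigma> using PQ.C.bul_arr_props[of \<sigma>] that by simp_all
  have ta: "bul_tens (ihom D C) G K \<in> Arr (ihom D C)"
    if "G \<in> arrows D C" "K \<in> arrows D C" for G K using PQ.C.bul_tens_props[of G K] that by simp_all
  have hs: "hom_post D (bulF F) \<in> arrows (ihom D B) (ihom D C)" by (rule hom_post_arrow[OF D FF])
  have bs: "bulF (hom_post D F) \<in> arrows (ihom D B) (ihom D C)" using H by simp
  show ?thesis
  proof (rule smf_eqI2[OF hs bs D C])
    fix a assume "a \<in> Obj (ihom D B)" then show "fobj (hom_post D (bulF F)) a = fobj (bulF (hom_post D F)) a"
      using bulF_compF[OF _ F] F by simp
  next
    fix d show "d \<in> Obj D ==> funit (hom_post D (bulF F)) \<diamondop> d = funit (bulF (hom_post D F)) \<diamondop> d"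
      using F FF hi ua ba by (simp add: e(1)[of _ _ "unitF D C" "unitF D C"] e(3)[of _ "funit (hom_post D F)" "unitF D C" "unitF D C"])
  next
    fix d s assume "s \<in> Arr (ihom D B)" "d \<in> Obj D"
    then show "farr (hom_post D (bulF F)) s \<diamondop> d = farr (bulF (hom_post D F)) s \<diamondop> d"
      using F FF by (simp add: e(1)[of _ _ "unitF D C" "unitF D C"])
  next
    fix G K d assume "G \<in> Obj (ihom D B)" "K \<in> Obj (ihom D B)" "d \<in> Obj D"
    then show "ften (hom_post D (bulF F)) G K \<diamondop> d = ften (bulF (hom_post D F)) G K \<diamondop> d"
      using F FF hi ta by (simp add: e(1)[of _ _ "unitF D C" "unitF D C"] e(2)[of _ "funit (hom_post D F)"])
  qed
qed

text \<open>Prepared for the pentagon: there a second transpose has \<open>[D,-]\<close> as a factor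
  and must be strict for a third transposition to be injective.\<close>

lemma hom_functor_strict:
  assumes D: "SPC D" and B: "SPC B" and C: "SPC C"
  shows "hom_functor D B C \<in> strict_arrows (ihom B C) (ihom (ihom D B) (ihom D C))"
proof -
  interpret S: spc_pair B C by (rule spc_pair[OF B C])
  interpret P: spc_pair D B by (rule spc_pair[OF D B])
  interpret Q: spc_pair D C by (rule spc_pair[OF D C])
  interpret PQ: spc_pair "ihom D B" "ihom D C" by (rule spc_pair[OF P.ihom_spc Q.ihom_spc])
  note t = hom_post_tensF[OF D, of _ B C] and u = hom_post_unitF[OF D B C] and b = hom_post_bulF[OF D, of _ B C]
  have [simp]: "hom_post D F \<in> arrows (ihom D B) (ihom D C)" if "F \<in> arrows B C" for F
    using hom_post_arrow[OF D that] .
  have [simp]: "hom_post2 D \<sigma> \<in> Arr (ihom (ihom D B) (ihom D C))" if "\<sigma> \<in> Arr (ihom B C)" for \<sigma>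
    using hom_post2_in[OF D that] .
  have w [simp]: "\<sigma> *\<^sub>R K \<in> Arr (ihom D C)" if "\<sigma> \<in> Arr (ihom B C)" "K \<in> arrows D B" for \<sigma> K
    using whiskR_in[OF that] .
  have c [simp]: "F \<circ>\<^sub>F K \<in> arrows D C" if "F \<in> arrows B C" "K \<in> arrows D B" for F K
    using compF_arrow[OF that(2,1)] .
  have tc: "tensF F G \<circ>\<^sub>F H = tensF (F \<circ>\<^sub>F H) (G \<circ>\<^sub>F H)" if "F \<in> arrows B C" "G \<in> arrows B C" "H \<in> arrows D B" for F G H
    using tensF_compF[OF that(3,1,2)] .
  have uc: "unitF B C \<circ>\<^sub>F H = unitF D C" if "H \<in> arrows D B" for H
    using unitF_compF[OF that C] .
  have bc: "bulF F \<circ>\<^sub>F H = bulF (F \<circ>\<^sub>F H)" if "F \<in> arrows B C" "H \<in> arrows D B" for F H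
    using bulF_compF[OF that(2,1)] .
  show ?thesis
  proof (rule strict_arrowsI)
    show "hom_functor D B C \<in> arrows (ihom B C) (ihom (ihom D B) (ihom D C))" by (rule hom_functor_arrow[OF D B C])
    fix F assume F: "F \<in> Obj (ihom B C)"
    have FF: "bulF F \<in> arrows B C" using F by simp
    show "farr (hom_functor D B C) (bulj (ihom B C) F) = bulj (ihom (ihom D B) (ihom D C)) (fobj (hom_functor D B C) F)"
    proof (rule PQ.ihom_eqI)
      fix K assume "K \<in> Obj (ihom D B)"
      then show "farr (hom_functor D B C) (bulj (ihom B C) F) \<diamondop> K = bulj (ihom (ihom D B) (ihom D C)) (fobj (hom_functor D B C) F) \<diamondop> K"
        using F FF S.bulj_in[of F] by (intro Q.ihom_eqI) (auto simp: tc uc bc)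
    qed (use F FF S.bulj_in[of F] in \<open>simp_all add: t u b\<close>)
  qed (simp_all add: t u b)
qed

text \<open>The sides are compared after three transpositions, with strictness checked at each
  stage. In fully transposed form the pentagon is \<open>hom_functor_functor\<close>, surrounded by
  naturality in \<open>eta\<close>.\<close>

lemma Ac_pentagon:
  assumes A: "SPC A" and B: "SPC B"
    and C: "SPC C" and D: "SPC D"
  shows "Ac A B (C \<otimes>\<^sub>0 D) \<circ>\<^sub>F Ac (A \<otimes>\<^sub>0 B) C D
    = (idF A \<otimes>\<^sub>1 Ac B C D) \<circ>\<^sub>F Ac A (B \<otimes>\<^sub>0 C) D \<circ>\<^sub>F (Ac A B C \<otimes>\<^sub>1 idF D)" (is "?L = ?R")
proof -
  note AB = tens0_spc[OF A B] and BC = tens0_spc[OF B C] and CD = tens0_spc[OF C D]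
  note ABC = tens0_spc[OF AB C] and A_BC = tens0_spc[OF A BC] and BC_D = tens0_spc[OF BC D] and B_CD = tens0_spc[OF B CD]
  let ?X = "A \<otimes>\<^sub>0 (B \<otimes>\<^sub>0 (C \<otimes>\<^sub>0 D))"
  note X = tens0_spc[OF A B_CD]
  note a1 = Ac_props[OF AB C D] and a2 = Ac_props[OF A B CD] and a3 = Ac_props[OF A B C] and a4 = Ac_props[OF A BC D] and a5 = Ac_props[OF B C D]
  note s = strict_arrowsD
  note iA = strict_idF[OF A] and iD = strict_idF[OF D]
  note t1 = tens1_props[OF s[OF iA] s[OF a5(1)]] and t2 = tens1_props[OF s[OF a3(1)] s[OF iD]]
  let ?Q = "(idF A \<otimes>\<^sub>1 Ac B C D) \<circ>\<^sub>F Ac A (B \<otimes>\<^sub>0 C) D"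
  have Q: "?Q \<in> strict_arrows ((A \<otimes>\<^sub>0 (B \<otimes>\<^sub>0 C)) \<otimes>\<^sub>0 D) ?X"
    by (rule strict_compF[OF a4(1) t1(1)])
  have RQ: "Rn (A \<otimes>\<^sub>0 (B \<otimes>\<^sub>0 C)) D ?Q \<in> strict_arrows (A \<otimes>\<^sub>0 (B \<otimes>\<^sub>0 C)) (ihom D ?X)"
    by (rule Rn_strict_compF[OF A_BC D s[OF a4(1)] a4(2) t1(1)])
  have asR: "?R = ?Q \<circ>\<^sub>F (Ac A B C \<otimes>\<^sub>1 idF D)"
    by (rule compF_assoc[OF s[OF t2(1)] s[OF a4(1)] s[OF t1(1)], symmetric])
  have L: "?L \<in> strict_arrows (((A \<otimes>\<^sub>0 B) \<otimes>\<^sub>0 C) \<otimes>\<^sub>0 D) ?X" by (rule strict_compF[OF a1(1) a2(1)])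
  have R: "?R \<in> strict_arrows (((A \<otimes>\<^sub>0 B) \<otimes>\<^sub>0 C) \<otimes>\<^sub>0 D) ?X"
    unfolding asR by (rule strict_compF[OF t2(1) Q])
  have RL: "Rn ((A \<otimes>\<^sub>0 B) \<otimes>\<^sub>0 C) D ?L \<in> strict_arrows ((A \<otimes>\<^sub>0 B) \<otimes>\<^sub>0 C) (ihom D ?X)"
    by (rule Rn_strict_compF[OF ABC D s[OF a1(1)] a1(2) a2(1)])
  have RR: "Rn ((A \<otimes>\<^sub>0 B) \<otimes>\<^sub>0 C) D ?R \<in> strict_arrows ((A \<otimes>\<^sub>0 B) \<otimes>\<^sub>0 C) (ihom D ?X)"
    unfolding asR by (rule Rn_strict_tens1[OF a3(1) s[OF iD] s[OF Q] RQ])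
  have eqR: "Rn ((A \<otimes>\<^sub>0 B) \<otimes>\<^sub>0 C) D ?R = Rn (A \<otimes>\<^sub>0 (B \<otimes>\<^sub>0 C)) D ?Q \<circ>\<^sub>F Ac A B C"
    unfolding asR Rn_tens1[OF s[OF a3(1)] s[OF iD] s[OF Q]] hom_id[OF D X]
    by (rule compF_idF(2)[OF s[OF strict_compF[OF a3(1) RQ]]])
  note eCD = eta_arrow[OF C D] and DX = ihom_spc[OF D X]
  note calc = arr_calc A B C D
  \<comment> \<open>Splits off the factor \<open>[eta,1] \<circ> [D,-]\<close>, whose strictness
    \<open>hL\<close> makes this second transpose strict.\<close>
  have eqL: "Rn (A \<otimes>\<^sub>0 B) C (Rn ((A \<otimes>\<^sub>0 B) \<otimes>\<^sub>0 C) D ?L)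
      = (hom_pre (eta C D) (ihom D ?X) \<circ>\<^sub>F hom_functor D (C \<otimes>\<^sub>0 D) ?X) \<circ>\<^sub>F Rn (A \<otimes>\<^sub>0 B) (C \<otimes>\<^sub>0 D) (Ac A B (C \<otimes>\<^sub>0 D))"
    unfolding Rn_Ac[OF AB C D s[OF a2(1)]]
    by (rule compF_assoc[OF Rn_arrow[OF s[OF a2(1)] AB CD] hom_functor_arrow[OF D CD X] hom_pre_arrow[OF eCD DX], symmetric])
  have hL: "hom_pre (eta C D) (ihom D ?X) \<circ>\<^sub>F hom_functor D (C \<otimes>\<^sub>0 D) ?X \<in> strict_arrows (ihom (C \<otimes>\<^sub>0 D) ?X) (ihom C (ihom D ?X))"
    by (rule strict_compF[OF hom_functor_strict[OF D CD X] hom_pre_strict[OF eCD DX]])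
  have RRL: "Rn (A \<otimes>\<^sub>0 B) C (Rn ((A \<otimes>\<^sub>0 B) \<otimes>\<^sub>0 C) D ?L) \<in> strict_arrows (A \<otimes>\<^sub>0 B) (ihom C (ihom D ?X))"
    unfolding eqL by (rule strict_compF[OF a2(2) hL])
  have RRR: "Rn (A \<otimes>\<^sub>0 B) C (Rn ((A \<otimes>\<^sub>0 B) \<otimes>\<^sub>0 C) D ?R) \<in> strict_arrows (A \<otimes>\<^sub>0 B) (ihom C (ihom D ?X))"
    unfolding eqR by (rule Rn_strict_compF[OF AB C s[OF a3(1)] a3(2) RQ])
  have RRRQ: "Rn A (B \<otimes>\<^sub>0 C) (Rn (A \<otimes>\<^sub>0 (B \<otimes>\<^sub>0 C)) D ?Q)
      = hom_pre (Rn (B \<otimes>\<^sub>0 C) D (Ac B C D)) (ihom D ?X) \<circ>\<^sub>F hom_functor D (B \<otimes>\<^sub>0 (C \<otimes>\<^sub>0 D)) ?X \<circ>\<^sub>F eta A (B \<otimes>\<^sub>0 (C \<otimes>\<^sub>0 D))"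
  proof -
    note e = eta_arrow[OF A B_CD] and e' = eta_arrow[OF BC D] and q = hom_post_arrow[OF D s[OF a5(1)]]
    show ?thesis
      unfolding Rn_Ac[OF A BC D s[OF t1(1)]] t1(2) compF_idF(1)[OF e] Rn_def[of "B \<otimes>\<^sub>0 C" D "Ac B C D"] hom_pre_compF[OF DX e' q]
      by (simp add: calc smf_of[OF s[OF a5(1)]] compF_reduce[OF hom_functor_pre[OF D X s[OF a5(1)]]])
  qed
  have "Rn A B (Rn (A \<otimes>\<^sub>0 B) C (Rn ((A \<otimes>\<^sub>0 B) \<otimes>\<^sub>0 C) D ?R)) = Rn A B (Rn (A \<otimes>\<^sub>0 B) C (Rn ((A \<otimes>\<^sub>0 B) \<otimes>\<^sub>0 C) D ?L))"
  proof -
    note CDX = ihom_spc[OF C DX]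
    note e' = eta_arrow[OF B C] and e'' = eta_arrow[OF B CD] and K = s[OF a5(2)]
    note DY = arrows_spc(2)[OF K] and cK = hom_post_arrow[OF C K] and h1 = hom_functor_arrow[OF D CD B_CD]
    have "Rn A B (Rn (A \<otimes>\<^sub>0 B) C (Rn ((A \<otimes>\<^sub>0 B) \<otimes>\<^sub>0 C) D ?R))
        = hom_pre (Rn B C (Rn (B \<otimes>\<^sub>0 C) D (Ac B C D))) (ihom C (ihom D ?X)) \<circ>\<^sub>F
          hom_functor C (ihom D (B \<otimes>\<^sub>0 (C \<otimes>\<^sub>0 D))) (ihom D ?X) \<circ>\<^sub>F hom_functor D (B \<otimes>\<^sub>0 (C \<otimes>\<^sub>0 D)) ?X \<circ>\<^sub>F eta A (B \<otimes>\<^sub>0 (C \<otimes>\<^sub>0 D))"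
      unfolding eqR Rn_Ac[OF A B C s[OF RQ]] RRRQ Rn_def[of B C "Rn (B \<otimes>\<^sub>0 C) D (Ac B C D)"] hom_pre_compF[OF CDX e' cK]
      by (simp add: calc smf_of[OF K] compF_reduce[OF hom_functor_pre[OF C DX K]])
    \<comment> \<open>Extranaturality at \<open>eta C D\<close> replaces precomposition with
      \<open>[eta,1]\<close> by postcomposition with it.\<close>
    also have "\<dots> = hom_pre (eta B (C \<otimes>\<^sub>0 D)) (ihom C (ihom D ?X)) \<circ>\<^sub>F hom_pre (hom_functor D (C \<otimes>\<^sub>0 D) (B \<otimes>\<^sub>0 (C \<otimes>\<^sub>0 D))) (ihom C (ihom D ?X)) \<circ>\<^sub>F
          hom_post (ihom (ihom D (C \<otimes>\<^sub>0 D)) (ihom D (B \<otimes>\<^sub>0 (C \<otimes>\<^sub>0 D)))) (hom_pre (eta C D) (ihom D ?X)) \<circ>\<^sub>F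
          hom_functor (ihom D (C \<otimes>\<^sub>0 D)) (ihom D (B \<otimes>\<^sub>0 (C \<otimes>\<^sub>0 D))) (ihom D ?X) \<circ>\<^sub>F hom_functor D (B \<otimes>\<^sub>0 (C \<otimes>\<^sub>0 D)) ?X \<circ>\<^sub>F eta A (B \<otimes>\<^sub>0 (C \<otimes>\<^sub>0 D))"
      unfolding a5(3) hom_pre_compF[OF CDX compF_arrow[OF e'' h1] hom_pre_arrow[OF eCD DY]] hom_pre_compF[OF CDX e'' h1]
      by (simp add: calc compF_reduce[OF hom_functor_dom[OF DY DX eCD]])
    also have "\<dots> = Rn A B (Rn (A \<otimes>\<^sub>0 B) C (Rn ((A \<otimes>\<^sub>0 B) \<otimes>\<^sub>0 C) D ?L))"
    proof -
      note G1 = hom_functor_arrow[OF D CD X] and G2 = hom_pre_arrow[OF eCD DX]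
      note n = hom_post_pre[OF e'' G1] hom_post_pre[OF e'' G2] hom_post_pre[OF h1 G2] hom_functor_functor[OF D CD B_CD X]
      show ?thesis
        unfolding eqL Rn_compF[OF A B s[OF a2(2)] s[OF hL]] a2(3) hom_post_compF[OF B G1 G2] by (simp add: calc n[THEN compF_reduce])
    qed
    finally show ?thesis .
  qed
  then have "Rn (A \<otimes>\<^sub>0 B) C (Rn ((A \<otimes>\<^sub>0 B) \<otimes>\<^sub>0 C) D ?L) = Rn (A \<otimes>\<^sub>0 B) C (Rn ((A \<otimes>\<^sub>0 B) \<otimes>\<^sub>0 C) D ?R)"
    by (intro strict_eqI[OF RRL RRR _ A B]) simp
  then show ?thesis by (intro strict_eqI3[OF L R RL RR _ AB C D])
qed

section \<open>Evaluation, duals and the unit arrows\<close>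

lemma ev_post:
  assumes C: "SPC C" and K: "K \<in> arrows D E" and c: "c \<in> Obj C"
  shows "K \<circ>\<^sub>F ev C D c = ev C E c \<circ>\<^sub>F hom_post C K"
proof -
  note DE = arrows_spc[OF K]
  interpret K: spc_arrow D E K by (rule spc_arrow[OF K])
  interpret P: spc_pair C D by (rule spc_pair[OF C DE(1)])
  interpret Q: spc_pair C E by (rule spc_pair[OF C DE(2)])
  note h = hom_post_in[OF refl C K]
  note [simp] = compF_arrow[OF _ K]
  show ?thesis
  proof (rule smf_eqI[OF compF_arrow[OF ev_arrow[OF C DE(1) c] K] compF_arrow[OF hom_post_arrow[OF C K] ev_arrow[OF C DE(2) c]]])
    fix s assume "s \<in> Arr (ihom C D)" then show "farr (K \<circ>\<^sub>F ev C D c) s = farr (ev C E c \<circ>\<^sub>F hom_post C K) s"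
      using c whiskL_in[of s C D K E] K by simp
  qed (use c h in auto)
qed

lemma ev_pre:
  assumes F: "F \<in> arrows B C" and X: "SPC X" and b: "b \<in> Obj B"
  shows "ev B X b \<circ>\<^sub>F hom_pre F X = ev C X (fobj F b)"
proof -
  note BC = arrows_spc[OF F]
  interpret F: spc_arrow B C F by (rule spc_arrow[OF F])
  interpret P: spc_pair B X by (rule spc_pair[OF BC(1) X])
  interpret Q: spc_pair C X by (rule spc_pair[OF BC(2) X])
  note [simp] = compF_arrow[OF F] whiskR_in[OF _ F]
  show ?thesis
    by (rule smf_eqI[OF compF_arrow[OF hom_pre_arrow[OF F X] ev_arrow[OF BC(1) X b]] ev_arrow[OF BC(2) X F.fobj_closed[OF b]]])
      (use b in auto)
qed

text \<open>In \<open>Ac_unit\<close> this turns the composite that defines \<open>A'\<close>, once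
  evaluated at the arrow \<open>L'\<close>, into precomposition with \<open>L'\<close>.\<close>

lemma ev_functor:
  assumes F: "F \<in> arrows D B" and C: "SPC C"
  shows "ev (ihom D B) (ihom D C) F \<circ>\<^sub>F hom_functor D B C = hom_pre F C"
proof -
  note D = arrows_spc(1)[OF F] and B = arrows_spc(2)[OF F]
  interpret P: spc_pair B C by (rule spc_pair[OF B C])
  interpret Q: spc_pair D C by (rule spc_pair[OF D C])
  note DB = ihom_spc[OF D B]
  interpret PQ: spc_pair "ihom D B" "ihom D C" by (rule spc_pair[OF DB Q.ihom_spc])
  interpret F: spc_arrow D B F by (rule spc_arrow[OF F])
  \<comment> \<open>The comparison arrows of the composite are products of two identities.\<close>
  have ii: "id2 G \<cdot>\<^sub>V id2 G = id2 G" if "G \<in> arrows D C" for G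
    using that by (intro Q.ihom_eqI) auto
  have FO: "F \<in> Obj (ihom D B)" using F by simp
  note [simp] = compF_arrow[OF F] hom_post_arrow[OF D, of _ B C] hom_post2_in[OF D, of _ B C]
  show ?thesis
    by (rule smf_eqI[OF compF_arrow[OF hom_functor_arrow[OF D B C] ev_arrow[OF DB Q.ihom_spc FO]] hom_pre_arrow[OF F C]])
      (use F FO tensF_compF[OF F, where D = C] unitF_compF[OF F C] ii in auto)
qed

text \<open>\<open>ev\<close> is undefined outside the hom category, so the work consists in showing
  that the values of the dual on arrows, its comparison arrows and its unit are 2-cells. These are
  the conditions on \<open>G\<close> with the two variables interchanged.\<close>

lemma (in bilin) ev_dual:
  assumes b: "b \<in> Obj B"
  shows "ev B D b \<circ>\<^sub>F dual C D G = fobj G b"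
proof -
  note B = G.B.spc
  interpret BD: spc_pair B D by (rule spc_pair[OF B D.spc])
  define Fs where "Fs = (\<lambda>c. \<lparr>Src = B, Tgt = D, fobj = (\<lambda>b \<in> Obj B. fobj (fobj G b) c),
     farr = (\<lambda>f \<in> Arr B. farr G f \<diamondop> c), ften = restrict2 (Obj B) (\<lambda>b b'. ften G b b' \<diamondop> c), funit = funit G \<diamondop> c\<rparr>)"
  have Fsel [simp]: "Src (Fs c) = B" "Tgt (Fs c) = D" "x \<in> Obj B ==> fobj (Fs c) x = fobj (fobj G x) c"
    "f \<in> Arr B ==> farr (Fs c) f = farr G f \<diamondop> c" "x \<in> Obj B ==> y \<in> Obj B ==> ften (Fs c) x y = ften G x y \<diamondop> c"
    "funit (Fs c) = funit G \<diamondop> c" for c x y f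
    by (simp_all add: Fs_def restrict2_def)
  have Fc [simp]: "Fs c \<in> arrows B D" if c: "c \<in> Obj C" for c
  proof -
    \<comment> \<open>As a composite of arrows, the value of the dual at \<open>c\<close> satisfies
      the axioms for an arrow without separate verification.\<close>
    have "Fs c = ev C D c \<circ>\<^sub>F G"
      using c by (auto simp: Fs_def compF_def restrict2_def fun_eq_iff restrict_def)
    then show ?thesis
      using compF_arrow[OF G.arrow ev_arrow[OF C.spc D.spc c]] by simp
  qed
  let ?a = "\<lambda>g. \<lparr>nsrc = Fs (Dom C g), ntgt = Fs (Cod C g), ncomp = (\<lambda>b \<in> Obj B. farr (fobj G b) g)\<rparr>"
  let ?t = "\<lambda>c c'. \<lparr>nsrc = tensF (Fs c) (Fs c'), ntgt = Fs (c \<otimes>\<^bsub>C\<^esub> c'), ncomp = (\<lambda>b \<in> Obj B. ften (fobj G b) c c')\<rparr>"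
  let ?u = "\<lparr>nsrc = unitF B D, ntgt = Fs \<one>\<^bsub>C\<^esub>, ncomp = (\<lambda>b \<in> Obj B. funit (fobj G b))\<rparr>"
  have a: "?a g \<in> Arr (ihom B D)" if g: "g \<in> Arr C" for g
  proof (rule cells_Arr, rule cellsI)
    show "Fs (Dom C g) \<in> arrows B D" "Fs (Cod C g) \<in> arrows B D" "Fs (Dom C g) \<in> arrows B D" using g by simp_all
    fix f assume f: "f \<in> Arr B"
    interpret f: spc_cell C D "fobj G (Dom B f)" "fobj G (Cod B f)" "farr G f" by (rule Gf[OF f])
    show "?a g \<diamondop> Cod B f \<cdot> farr (Fs (Dom C g)) f = farr (Fs (Cod C g)) f \<cdot> ?a g \<diamondop> Dom B f"
      using f.natural[OF g] f by simp
  next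
    fix x y assume x: "x \<in> Obj B" and y: "y \<in> Obj B"
    interpret t: spc_cell C D "tensF (fobj G x) (fobj G y)" "fobj G (x \<otimes>\<^bsub>B\<^esub> y)" "ften G x y" by (rule Gt[OF x y])
    show "?a g \<diamondop> (x \<otimes>\<^bsub>B\<^esub> y) \<cdot> ften (Fs (Dom C g)) x y = ften (Fs (Cod C g)) x y \<cdot> (?a g \<diamondop> x \<boxtimes> ?a g \<diamondop> y)"
      using t.natural[OF g] x y g by simp
  next
    interpret u: spc_cell C D "unitF C D" "fobj G \<one>\<^bsub>B\<^esub>" "funit G" by (rule Gu)
    show "?a g \<diamondop> \<one>\<^bsub>B\<^esub> \<cdot> funit (Fs (Dom C g)) = funit (Fs (Cod C g))"
      using u.natural[OF g] g by simp
  qed (use g in \<open>auto simp: D.hom_iff\<close>)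
  have t: "?t c c' \<in> Arr (ihom B D)" if c: "c \<in> Obj C" "c' \<in> Obj C" for c c'
  proof (rule cells_Arr, rule cellsI)
    show "tensF (Fs c) (Fs c') \<in> arrows B D" "Fs (c \<otimes>\<^bsub>C\<^esub> c') \<in> arrows B D" "tensF (Fs c) (Fs c') \<in> arrows B D" using c by simp_all
    fix f assume f: "f \<in> Arr B"
    interpret f: spc_cell C D "fobj G (Dom B f)" "fobj G (Cod B f)" "farr G f" by (rule Gf[OF f])
    show "?t c c' \<diamondop> Cod B f \<cdot> farr (tensF (Fs c) (Fs c')) f = farr (Fs (c \<otimes>\<^bsub>C\<^esub> c')) f \<cdot> ?t c c' \<diamondop> Dom B f"
      using f.tens[OF c] f by simp
  next
    fix x y assume x: "x \<in> Obj B" and y: "y \<in> Obj B"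
    interpret t: spc_cell C D "tensF (fobj G x) (fobj G y)" "fobj G (x \<otimes>\<^bsub>B\<^esub> y)" "ften G x y" by (rule Gt[OF x y])
    let ?i = "interchange D (fobj (fobj G x) c) (fobj (fobj G x) c') (fobj (fobj G y) c) (fobj (fobj G y) c')"
    \<comment> \<open>Two opposite interchanges cancel, which transfers the interchange from one
      side of the monoidality condition of \<open>ften G x y\<close> to the other.\<close>
    have "(ften (fobj G (x \<otimes>\<^bsub>B\<^esub> y)) c c' \<cdot> (ften G x y \<diamondop> c \<boxtimes> ften G x y \<diamondop> c')) \<cdot> ?i
       = ften G x y \<diamondop> (c \<otimes>\<^bsub>C\<^esub> c') \<cdot> (ften (fobj G x) c c' \<boxtimes> ften (fobj G y) c c')"
      unfolding t.tens[OF c, symmetric] using x y c by (simp add: D.interchange_interchange)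
    then show "?t c c' \<diamondop> (x \<otimes>\<^bsub>B\<^esub> y) \<cdot> ften (tensF (Fs c) (Fs c')) x y = ften (Fs (c \<otimes>\<^bsub>C\<^esub> c')) x y \<cdot> (?t c c' \<diamondop> x \<boxtimes> ?t c c' \<diamondop> y)"
      using x y c by simp
  next
    interpret u: spc_cell C D "unitF C D" "fobj G \<one>\<^bsub>B\<^esub>" "funit G" by (rule Gu)
    have "(ften (fobj G \<one>\<^bsub>B\<^esub>) c c' \<cdot> (funit G \<diamondop> c \<boxtimes> funit G \<diamondop> c')) \<cdot> inv_arr D (lunit D \<one>) = funit G \<diamondop> (c \<otimes>\<^bsub>C\<^esub> c')"
      unfolding u.tens[OF c, symmetric] using c by simp
    then show "?t c c' \<diamondop> \<one>\<^bsub>B\<^esub> \<cdot> funit (tensF (Fs c) (Fs c')) = funit (Fs (c \<otimes>\<^bsub>C\<^esub> c'))"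
      using c by simp
  qed (use c in \<open>auto simp: D.hom_iff\<close>)
  have u: "?u \<in> Arr (ihom B D)"
  proof (rule cells_Arr, rule cellsI)
    show "unitF B D \<in> arrows B D" "Fs \<one>\<^bsub>C\<^esub> \<in> arrows B D" "unitF B D \<in> arrows B D" by simp_all
    fix f assume f: "f \<in> Arr B"
    interpret f: spc_cell C D "fobj G (Dom B f)" "fobj G (Cod B f)" "farr G f" by (rule Gf[OF f])
    show "?u \<diamondop> Cod B f \<cdot> farr (unitF B D) f = farr (Fs \<one>\<^bsub>C\<^esub>) f \<cdot> ?u \<diamondop> Dom B f"
      using f.unit f by simp
  next
    fix x y assume x: "x \<in> Obj B" and y: "y \<in> Obj B"
    interpret t: spc_cell C D "tensF (fobj G x) (fobj G y)" "fobj G (x \<otimes>\<^bsub>B\<^esub> y)" "ften G x y" by (rule Gt[OF x y])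
    have "funit (fobj G (x \<otimes>\<^bsub>B\<^esub> y)) \<cdot> lunit D \<one> = ften G x y \<diamondop> \<one>\<^bsub>C\<^esub> \<cdot> (funit (fobj G x) \<boxtimes> funit (fobj G y))"
      unfolding t.unit[symmetric] using x y by simp
    then show "?u \<diamondop> (x \<otimes>\<^bsub>B\<^esub> y) \<cdot> ften (unitF B D) x y = ften (Fs \<one>\<^bsub>C\<^esub>) x y \<cdot> (?u \<diamondop> x \<boxtimes> ?u \<diamondop> y)"
      using x y by simp
  next
    interpret u: spc_cell C D "unitF C D" "fobj G \<one>\<^bsub>B\<^esub>" "funit G" by (rule Gu)
    show "?u \<diamondop> \<one>\<^bsub>B\<^esub> \<cdot> funit (unitF B D) = funit (Fs \<one>\<^bsub>C\<^esub>)"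
      using u.unit by simp
  qed (auto simp: D.hom_iff)
  have d: "dual C D G = \<lparr>Src = C, Tgt = ihom B D, fobj = (\<lambda>c \<in> Obj C. Fs c), farr = (\<lambda>g \<in> Arr C. ?a g),
      ften = restrict2 (Obj C) ?t, funit = ?u\<rparr>"
    by (simp add: dual_def Fs_def Let_def)
  interpret Gb: spc_arrow C D "fobj G b" by (rule Gb[OF b])
  \<comment> \<open>The dual itself has not been shown to be an arrow, so equality is checked field
    by field; outside the carriers both sides are \<open>undefined\<close>.\<close>
  have "fobj (ev B D b \<circ>\<^sub>F dual C D G) x = fobj (fobj G b) x" for x
    using b Gb.exts(1) unfolding d compF_def by (cases "x \<in> Obj C") (auto simp: extensional_def)
  moreover have "farr (ev B D b \<circ>\<^sub>F dual C D G) g = farr (fobj G b) g" for g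
    using b Gb.exts(2) a unfolding d compF_def by (cases "g \<in> Arr C") (auto simp: extensional_def)
  moreover have "ften (ev B D b \<circ>\<^sub>F dual C D G) x y = ften (fobj G b) x y" for x y
  proof (cases "x \<in> Obj C \<and> y \<in> Obj C")
    case True then show ?thesis using b t[of x y] unfolding d compF_def by (simp add: restrict2_def)
  next
    case False then have "restrict2 (Obj C) (ften (fobj G b)) x y = undefined" by (auto simp: restrict2_def)
    then have "ften (fobj G b) x y = undefined" unfolding Gb.exts(3) .
    then show ?thesis using False unfolding d compF_def by (auto simp: restrict2_def)
  qed
  moreover have "funit (ev B D b \<circ>\<^sub>F dual C D G) = funit (fobj G b)"
    using b u unfolding d compF_def by simp
  ultimately show ?thesis
    by (intro smf.equality ext) (simp_all add: d)
qed

lemma star_Obj [simp]: "\<star> \<in> Obj \<I>"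
  by (simp add: freeI_def star_def presented_def pobj_wf_def freeP_def)

lemma Lc_eq:
  assumes B: "SPC B" shows "Lc B = fobj (eta \<I> B) \<star>"
  unfolding Lc_def
  by (rule bilin.ev_dual[OF bilin[OF eta_arrow[OF freeI_spc B] B tens0_spc[OF freeI_spc B]] star_Obj])

lemma Lc_arrow: "SPC B ==> Lc B \<in> arrows B (\<I> \<otimes>\<^sub>0 B)"
  using tens.E_arrow[OF tens[OF freeI_spc] star_Obj] by (simp add: Lc_eq)

lemma Rc_arrow: "SPC B ==> Rc B \<in> arrows B (B \<otimes>\<^sub>0 \<I>)"
  unfolding Rc_def by (rule compF_arrow[OF eta_arrow[OF _ freeI_spc] ev_arrow[OF freeI_spc tens0_spc[OF _ freeI_spc] star_Obj]])

lemma PGen_Obj [simp]: "PGen (b, c) \<in> Obj (B \<otimes>\<^sub>0 C) \<longleftrightarrow> b \<in> Obj B \<and> c \<in> Obj C"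
  by (simp add: tens0_def presented_def pobj_wf_def)

lemma tens1_eta:
  assumes F: "F \<in> arrows B B'" and G: "G \<in> arrows C C'" and b: "b \<in> Obj B"
  shows "(F \<otimes>\<^sub>1 G) \<circ>\<^sub>F fobj (eta B C) b = fobj (eta B' C') (fobj F b) \<circ>\<^sub>F G"
proof -
  interpret F: spc_arrow B B' F by (rule spc_arrow[OF F])
  interpret G: spc_arrow C C' G by (rule spc_arrow[OF G])
  interpret T: tens B C by (rule tens[OF F.B.spc G.B.spc])
  interpret T': tens B' C' by (rule tens[OF F.C.spc G.C.spc])
  show ?thesis
    using T.Rn_app(3)[OF tens1_arrow[OF F G] b] b unfolding tens1_props(2)[OF F G] by simp
qed

lemma Lc_natural:
  assumes G: "G \<in> arrows B B'"
  shows "(idF \<I> \<otimes>\<^sub>1 G) \<circ>\<^sub>F Lc B = Lc B' \<circ>\<^sub>F G"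
  using tens1_eta[OF idF_arrow[OF freeI_spc] G star_Obj] by (simp add: Lc_eq[OF arrows_spc(1)[OF G]] Lc_eq[OF arrows_spc(2)[OF G]])

text \<open>\<open>R'\<close> is evaluation at \<open>\<star>\<close> after \<open>eta\<close>, so
  the transpose of the left side is the double transpose of \<open>A'\<close> evaluated at
  \<open>\<star>\<close>; \<open>ev_pre\<close> and \<open>ev_functor\<close> reduce it to
  \<open>[L',1] \<circ> eta\<close>.\<close>

lemma Ac_unit:
  assumes A: "SPC A" and M: "SPC M"
  shows "Ac A \<I> M \<circ>\<^sub>F (Rc A \<otimes>\<^sub>1 idF M) = idF A \<otimes>\<^sub>1 Lc M"
proof (rule strict_eqI[OF _ _ _ A M])
  note I = freeI_spc
  note IM = tens0_spc[OF I M] and AI = tens0_spc[OF A I]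
  let ?X = "A \<otimes>\<^sub>0 (\<I> \<otimes>\<^sub>0 M)"
  note X = tens0_spc[OF A IM] and MX = ihom_spc[OF M tens0_spc[OF A IM]]
  note a = Ac_props[OF A I M] and R = Rc_arrow[OF A] and L = Lc_arrow[OF M]
  note iA = idF_arrow[OF A] and iM = idF_arrow[OF M]
  show "Ac A \<I> M \<circ>\<^sub>F (Rc A \<otimes>\<^sub>1 idF M) \<in> strict_arrows (A \<otimes>\<^sub>0 M) ?X"
    by (rule strict_compF[OF tens1_props(1)[OF R iM] a(1)])
  show "idF A \<otimes>\<^sub>1 Lc M \<in> strict_arrows (A \<otimes>\<^sub>0 M) ?X" by (rule tens1_props(1)[OF iA L])
  note K = strict_arrowsD[OF a(2)]
  note calc = arr_calc A M I smf_of[OF ev_arrow[OF I AI star_Obj]] smf_of[OF ev_arrow[OF I MX star_Obj]]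
  note e = eta_arrow[OF A I] and e' = eta_arrow[OF I M] and e'' = eta_arrow[OF A IM]
  note h = hom_functor_arrow[OF M IM X]
  interpret IMt: tens \<I> M by (rule tens[OF I M])
  have s: "fobj (eta \<I> M) \<star> \<in> arrows M (\<I> \<otimes>\<^sub>0 M)" by simp
  have so: "fobj (eta \<I> M) \<star> \<in> Obj (ihom M (\<I> \<otimes>\<^sub>0 M))" by simp
  have "Rn A M (Ac A \<I> M \<circ>\<^sub>F (Rc A \<otimes>\<^sub>1 idF M)) = Rn (A \<otimes>\<^sub>0 \<I>) M (Ac A \<I> M) \<circ>\<^sub>F Rc A"
    by (simp add: Rn_tens1[OF R iM strict_arrowsD[OF a(1)]] hom_id[OF M X] compF_idF[OF compF_arrow[OF R K]])
  also have "\<dots> = ev \<I> (ihom M ?X) \<star> \<circ>\<^sub>F Rn A \<I> (Rn (A \<otimes>\<^sub>0 \<I>) M (Ac A \<I> M))"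
    unfolding Rc_def Rn_def[of A \<I>]
    by (simp add: calc smf_of[OF K] compF_reduce[OF ev_post[OF I K star_Obj]])
  also have "\<dots> = hom_pre (Lc M) ?X \<circ>\<^sub>F eta A (\<I> \<otimes>\<^sub>0 M)"
    unfolding a(3) Lc_eq[OF M] using e'' h s
    by (simp add: calc smf_of[OF s] smf_of[OF ev_arrow[OF ihom_spc[OF M IM] MX so]]
      compF_reduce[OF ev_pre[OF e' MX star_Obj]] compF_reduce[OF ev_functor[OF s X]])
  also have "\<dots> = Rn A M (idF A \<otimes>\<^sub>1 Lc M)" unfolding tens1_props(2)[OF iA L] by (simp add: compF_idF[OF e''])
  finally show "Rn A M (Ac A \<I> M \<circ>\<^sub>F (Rc A \<otimes>\<^sub>1 idF M)) = Rn A M (idF A \<otimes>\<^sub>1 Lc M)" .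
qed

text \<open>The transpose of \<open>theta\<close> is prescribed to be an identity, which is possible
  only if both ends have the same transpose.\<close>

lemma Rn_theta_dom:
  assumes A: "SPC A" and M: "SPC M"
  shows "Rn A M (Ac \<I> A M \<circ>\<^sub>F (Lc A \<otimes>\<^sub>1 idF M)) = Rn A M (Lc (A \<otimes>\<^sub>0 M))"
proof -
  note I = freeI_spc
  note IA = tens0_spc[OF I A] and AM = tens0_spc[OF A M]
  let ?X = "\<I> \<otimes>\<^sub>0 (A \<otimes>\<^sub>0 M)"
  note X = tens0_spc[OF I AM] and MX = ihom_spc[OF M tens0_spc[OF I AM]] and MAM = ihom_spc[OF M AM]
  note a = Ac_props[OF I A M] and L = Lc_arrow[OF A] and iM = idF_arrow[OF M]
  note K = strict_arrowsD[OF a(2)]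
  interpret IA: tens \<I> A by (rule tens[OF I A])
  interpret IAM: tens \<I> "A \<otimes>\<^sub>0 M" by (rule tens[OF I AM])
  have "Rn A M (Ac \<I> A M \<circ>\<^sub>F (Lc A \<otimes>\<^sub>1 idF M)) = Rn (\<I> \<otimes>\<^sub>0 A) M (Ac \<I> A M) \<circ>\<^sub>F Lc A"
    by (simp add: Rn_tens1[OF L iM strict_arrowsD[OF a(1)]] hom_id[OF M X] compF_idF[OF compF_arrow[OF L K]])
  also have "\<dots> = fobj (Rn \<I> A (Rn (\<I> \<otimes>\<^sub>0 A) M (Ac \<I> A M))) \<star>"
    by (simp add: IA.Rn_app(3)[OF K] Lc_eq[OF A])
  also have "\<dots> = hom_post M (fobj (eta \<I> (A \<otimes>\<^sub>0 M)) \<star>) \<circ>\<^sub>F eta A M"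
    unfolding a(3) using hom_post_arrow[OF M IAM.E_in[OF star_Obj]] eta_arrow[OF A M] by simp
  finally show ?thesis by (simp add: Lc_eq[OF AM] Rn_def)
qed

lemma theta_props:
  assumes A: "SPC A" and M: "SPC M"
  shows "theta A M \<in> cells (Ac \<I> A M \<circ>\<^sub>F (Lc A \<otimes>\<^sub>1 idF M)) (Lc (A \<otimes>\<^sub>0 M))"
    "a \<in> Obj A ==> m \<in> Obj M ==> theta A M \<diamondop> PGen (a, m) = Id (\<I> \<otimes>\<^sub>0 (A \<otimes>\<^sub>0 M)) (PGen (\<star>, PGen (a, m)))"
proof -
  note I = freeI_spc
  note AM = tens0_spc[OF A M]
  interpret AM: tens A M by (rule tens[OF A M])
  let ?F = "Ac \<I> A M \<circ>\<^sub>F (Lc A \<otimes>\<^sub>1 idF M)" and ?G = "Lc (A \<otimes>\<^sub>0 M)"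
  let ?P = "\<lambda>\<omega>. \<omega> \<in> cells ?F ?G \<and> Rn2 A M \<omega> = id2 (Rn A M ?G)"
  have F: "?F \<in> strict_arrows (A \<otimes>\<^sub>0 M) (\<I> \<otimes>\<^sub>0 (A \<otimes>\<^sub>0 M))"
    by (rule strict_compF[OF tens1_props(1)[OF Lc_arrow[OF A] idF_arrow[OF M]] Ac_props(1)[OF I A M]])
  note G = Lc_arrow[OF AM] note FF = strict_arrowsD[OF F]
  note RG = AM.Rn_arrow[OF G]
  have "id2 (Rn A M ?G) \<in> cells (Rn A M ?F) (Rn A M ?G)"
    unfolding Rn_theta_dom[OF A M] by (rule id2_cell[OF RG])
  then obtain w where w: "?P w" by (rule AM.Rn2_exists[OF F G]) simp
  then have "\<exists>!\<omega>. ?P \<omega>" by (intro ex1I[of ?P w]) (use w AM.Rn2_inj[OF _ _ FF] in metis)+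
  then have P: "?P (theta A M)" unfolding theta_def by (rule theI')
  then show c: "theta A M \<in> cells ?F ?G" by simp
  show "theta A M \<diamondop> PGen (a, m) = Id (\<I> \<otimes>\<^sub>0 (A \<otimes>\<^sub>0 M)) (PGen (\<star>, PGen (a, m)))" if a: "a \<in> Obj A" "m \<in> Obj M"
  proof -
    have [simp]: "PGen (a, m) \<in> Obj (A \<otimes>\<^sub>0 M)" using a by simp
    interpret T: tens \<I> "A \<otimes>\<^sub>0 M" by (rule tens[OF I AM.X_spc])
    have "theta A M \<diamondop> PGen (a, m) = Rn2 A M (theta A M) \<diamondop> a \<diamondop> m"
      by (rule AM.Rn2_app(3)[OF c FF a, symmetric])
    also have "\<dots> = id2 (Rn A M ?G) \<diamondop> a \<diamondop> m" using P by simp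
    also have "\<dots> = Id (\<I> \<otimes>\<^sub>0 (A \<otimes>\<^sub>0 M)) (PGen (\<star>, PGen (a, m)))"
      unfolding Lc_eq[OF AM] using a AM.post_E[OF T.E_in[OF star_Obj] a(1)] by (simp add: AM.Rn_app(1-3,5)[OF T.E_in[OF star_Obj]])
    finally show ?thesis .
  qed
qed

section \<open>Double transposes of the two ways of acting twice\<close>

lemma Rn_act_act:
  assumes A: "SPC A" and F: "\<phi> \<in> arrows (A \<otimes>\<^sub>0 M) M" and M: "SPC M"
  shows "Rn A A (Rn (A \<otimes>\<^sub>0 A) M (\<phi> \<circ>\<^sub>F (idF A \<otimes>\<^sub>1 \<phi>) \<circ>\<^sub>F Ac A A M)) = act_act M (Rn A M \<phi>)"
proof -
  note AM = tens0_spc[OF A M] and iA = idF_arrow[OF A]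
  note AAM = tens0_spc[OF A AM] and MM = ihom_spc[OF M M] and MAM = ihom_spc[OF M AM]
  note t = tens1_arrow[OF iA F] and a = Ac_arrow[OF A A M] and R = Rn_arrow[OF F A M]
  note e = eta_arrow[OF A M] and p = hom_post_arrow[OF M F] and q = hom_pre_arrow[OF F M]
  note h = hom_functor_arrow[OF M AM M] and h' = hom_functor_arrow[OF M M M]
  note pe = hom_pre_arrow[OF e MM] and pp = hom_pre_arrow[OF p MM]
  have "\<phi> \<circ>\<^sub>F (idF A \<otimes>\<^sub>1 \<phi>) \<circ>\<^sub>F Ac A A M = (\<phi> \<circ>\<^sub>F (idF A \<otimes>\<^sub>1 \<phi>)) \<circ>\<^sub>F Ac A A M"
    by (rule compF_assoc[OF a t F, symmetric])
  then show ?thesis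
    unfolding act_act_def
    by (simp only: Rn_Ac[OF A A M compF_arrow[OF t F]] Rn_tens1[OF iA F F] compF_idF(1)[OF R])
      (simp add: Rn_def[of A M] hom_pre_compF[OF MM e p] smf_calc smf_of[OF F] smf_of[OF R] smf_of[OF e] smf_of[OF p] smf_of[OF q] smf_of[OF h] smf_of[OF h']
        smf_of[OF pe] smf_of[OF pp] compF_reduce[OF hom_functor_pre[OF M M F]])
qed

lemma Rn_mul_act:
  assumes c: "c \<in> arrows (A \<otimes>\<^sub>0 A) A" and A: "SPC A" and F: "\<phi> \<in> arrows (A \<otimes>\<^sub>0 M) N" and M: "SPC M"
  shows "Rn A A (Rn (A \<otimes>\<^sub>0 A) M (\<phi> \<circ>\<^sub>F (c \<otimes>\<^sub>1 idF M))) = mul_act A (Rn A A c) (Rn A M \<phi>)"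
proof -
  note R = Rn_arrow[OF F A M]
  show ?thesis
    unfolding Rn_tens1[OF c idF_arrow[OF M] F] hom_id[OF M arrows_spc(2)[OF F]] compF_idF(2)[OF compF_arrow[OF c R]]
      Rn_compF[OF A A c R] mul_act_def ..
qed

text \<open>Two rounds of the test at generators: a transposed 2-cell has 2-cells as its components
  at the generators of the inner tensor product, and these are compared at objects of
  \<open>D\<close>.\<close>

lemma cell_eqI3:
  assumes s: "\<sigma> \<in> cells F G" and t: "\<tau> \<in> cells F G" and F: "F \<in> arrows ((B \<otimes>\<^sub>0 C) \<otimes>\<^sub>0 D) E"
    and B: "SPC B" and C: "SPC C" and D: "SPC D"
    and e: "\<And>b c d. b \<in> Obj B ==> c \<in> Obj C ==> d \<in> Obj D ==> \<sigma> \<diamondop> PGen (PGen (b, c), d) = \<tau> \<diamondop> PGen (PGen (b, c), d)"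
  shows "\<sigma> = \<tau>"
proof -
  interpret T: tens B C by (rule tens[OF B C])
  interpret T': tens "B \<otimes>\<^sub>0 C" D by (rule tens[OF T.X_spc D])
  interpret Q: spc_pair D E by (rule spc_pair[OF D arrows_spc(2)[OF F]])
  note R = T'.Rn_arrow[OF F]
  note s' = T'.Rn2_app(1)[OF s F] and t' = T'.Rn2_app(1)[OF t F]
  note G = cells_tgt_arrow[OF s F]
  interpret S: spc_cell "B \<otimes>\<^sub>0 C" "ihom D E" "Rn (B \<otimes>\<^sub>0 C) D F" "Rn (B \<otimes>\<^sub>0 C) D G" "Rn2 (B \<otimes>\<^sub>0 C) D \<sigma>" by (rule spc_cell[OF s' R])
  interpret S': spc_cell "B \<otimes>\<^sub>0 C" "ihom D E" "Rn (B \<otimes>\<^sub>0 C) D F" "Rn (B \<otimes>\<^sub>0 C) D G" "Rn2 (B \<otimes>\<^sub>0 C) D \<tau>" by (rule spc_cell[OF t' R])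
  have o: "PGen (b, c) \<in> Obj (B \<otimes>\<^sub>0 C)" if "b \<in> Obj B" "c \<in> Obj C" for b c using that by simp
  have "Rn2 (B \<otimes>\<^sub>0 C) D \<sigma> = Rn2 (B \<otimes>\<^sub>0 C) D \<tau>"
  proof (rule T.cell_eqI[OF s' t' R])
    fix b c assume b: "b \<in> Obj B" "c \<in> Obj C"
    show "Rn2 (B \<otimes>\<^sub>0 C) D \<sigma> \<diamondop> PGen (b, c) = Rn2 (B \<otimes>\<^sub>0 C) D \<tau> \<diamondop> PGen (b, c)"
      by (rule Q.ihom_eqI)
        (use S.ncomp_arr[OF o[OF b]] S'.ncomp_arr[OF o[OF b]] b o in \<open>simp_all add: T'.Rn2_app(3)[OF s F] T'.Rn2_app(3)[OF t F] e\<close>)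
  qed
  then show ?thesis by (rule T'.Rn2_inj[OF s t F])
qed

lemma cell_eqI4:
  assumes s: "\<sigma> \<in> cells F G" and t: "\<tau> \<in> cells F G" and F: "F \<in> arrows (((A \<otimes>\<^sub>0 B) \<otimes>\<^sub>0 C) \<otimes>\<^sub>0 D) E"
    and A: "SPC A" and B: "SPC B" and C: "SPC C" and D: "SPC D"
    and e: "\<And>a b c d. a \<in> Obj A ==> b \<in> Obj B ==> c \<in> Obj C ==> d \<in> Obj D ==>
      \<sigma> \<diamondop> PGen (PGen (PGen (a, b), c), d) = \<tau> \<diamondop> PGen (PGen (PGen (a, b), c), d)"
  shows "\<sigma> = \<tau>"
proof -
  note AB = tens0_spc[OF A B]
  note ABC = tens0_spc[OF AB C]
  interpret T': tens "(A \<otimes>\<^sub>0 B) \<otimes>\<^sub>0 C" D by (rule tens[OF ABC D])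
  interpret Q: spc_pair D E by (rule spc_pair[OF D arrows_spc(2)[OF F]])
  note R = T'.Rn_arrow[OF F]
  note s' = T'.Rn2_app(1)[OF s F] and t' = T'.Rn2_app(1)[OF t F]
  note G = cells_tgt_arrow[OF s F]
  interpret S: spc_cell "(A \<otimes>\<^sub>0 B) \<otimes>\<^sub>0 C" "ihom D E" "Rn ((A \<otimes>\<^sub>0 B) \<otimes>\<^sub>0 C) D F" "Rn ((A \<otimes>\<^sub>0 B) \<otimes>\<^sub>0 C) D G" "Rn2 ((A \<otimes>\<^sub>0 B) \<otimes>\<^sub>0 C) D \<sigma>" by (rule spc_cell[OF s' R])
  interpret S': spc_cell "(A \<otimes>\<^sub>0 B) \<otimes>\<^sub>0 C" "ihom D E" "Rn ((A \<otimes>\<^sub>0 B) \<otimes>\<^sub>0 C) D F" "Rn ((A \<otimes>\<^sub>0 B) \<otimes>\<^sub>0 C) D G" "Rn2 ((A \<otimes>\<^sub>0 B) \<otimes>\<^sub>0 C) D \<tau>" by (rule spc_cell[OF t' R])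
  have o: "PGen (PGen (a, b), c) \<in> Obj ((A \<otimes>\<^sub>0 B) \<otimes>\<^sub>0 C)" if "a \<in> Obj A" "b \<in> Obj B" "c \<in> Obj C" for a b c using that by simp
  have "Rn2 ((A \<otimes>\<^sub>0 B) \<otimes>\<^sub>0 C) D \<sigma> = Rn2 ((A \<otimes>\<^sub>0 B) \<otimes>\<^sub>0 C) D \<tau>"
  proof (rule cell_eqI3[OF s' t' R A B C])
    fix a b c assume b: "a \<in> Obj A" "b \<in> Obj B" "c \<in> Obj C"
    show "Rn2 ((A \<otimes>\<^sub>0 B) \<otimes>\<^sub>0 C) D \<sigma> \<diamondop> PGen (PGen (a, b), c) = Rn2 ((A \<otimes>\<^sub>0 B) \<otimes>\<^sub>0 C) D \<tau> \<diamondop> PGen (PGen (a, b), c)"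
      by (rule Q.ihom_eqI)
        (use S.ncomp_arr[OF o[OF b]] S'.ncomp_arr[OF o[OF b]] b o in \<open>simp_all add: T'.Rn2_app(3)[OF s F] T'.Rn2_app(3)[OF t F] e\<close>)
  qed
  then show ?thesis by (rule T'.Rn2_inj[OF s t F])
qed

section \<open>The tensor product of 2-cells\<close>

lemma tens2_props:
  assumes s: "\<sigma> \<in> cells F F'" and F: "F \<in> arrows B B'" and t: "\<tau> \<in> cells G G'" and G: "G \<in> arrows C C'"
  shows "\<sigma> \<otimes>\<^sub>2 \<tau> \<in> cells (F \<otimes>\<^sub>1 G) (F' \<otimes>\<^sub>1 G')"
    "b \<in> Obj B ==> c \<in> Obj C ==> (\<sigma> \<otimes>\<^sub>2 \<tau>) \<diamondop> PGen (b, c) =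
      pclass (tensP B' C') (AR (fobj F' b) (\<tau> \<diamondop> c)) \<cdot>\<^bsub>B' \<otimes>\<^sub>0 C'\<^esub> pclass (tensP B' C') (AL (\<sigma> \<diamondop> b) (fobj G c))"
proof -
  interpret s: spc_cell B B' F F' \<sigma> by (rule spc_cell[OF s F])
  interpret t: spc_cell C C' G G' \<tau> by (rule spc_cell[OF t G])
  note B = s.F.B.spc and C = t.F.B.spc
    and B' = s.F.C.spc and C' = t.F.C.spc
  interpret T: tens B C by (rule tens[OF B C])
  interpret T': tens B' C' by (rule tens[OF B' C'])
  let ?X = "B' \<otimes>\<^sub>0 C'"
  note X = T'.X_spc
  interpret CX: spc_pair C ?X by (rule spc_pair[OF C X])
  note F' = s.G.arrow and G' = t.G.arrow
  note FG = tens1_props[OF F G] and FG' = tens1_props[OF F' G']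
  note e = eta_arrow[OF B' C']
  let ?c = "hom_pre2 \<tau> ?X *\<^sub>R (eta B' C' \<circ>\<^sub>F F') \<cdot>\<^sub>V hom_pre G ?X *\<^sub>L eta B' C' *\<^sub>L \<sigma>"
  have tA: "\<tau> \<in> Arr (ihom C C')" by (rule cells_Arr[OF t G])
  have hp: "hom_pre2 \<tau> ?X \<in> cells (hom_pre G ?X) (hom_pre G' ?X)"
    using hom2_in(2)[OF refl X tA] by (simp add: Arr_ihom)
  have c1: "hom_pre G ?X *\<^sub>L eta B' C' *\<^sub>L \<sigma> \<in> cells (Rn B C (F \<otimes>\<^sub>1 G)) (hom_pre G ?X \<circ>\<^sub>F eta B' C' \<circ>\<^sub>F F')"
    unfolding FG(2) by (rule whiskL_cell whiskL_cell[OF s, of _ "ihom C' ?X"] | use e hom_pre_arrow[OF G X] in simp)+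
  have c2: "hom_pre2 \<tau> ?X *\<^sub>R (eta B' C' \<circ>\<^sub>F F') \<in> cells (hom_pre G ?X \<circ>\<^sub>F eta B' C' \<circ>\<^sub>F F') (Rn B C (F' \<otimes>\<^sub>1 G'))"
    unfolding FG'(2) by (rule whiskR_cell[OF hp]) (use compF_arrow[OF F' e] in simp)
  have c: "?c \<in> cells (Rn B C (F \<otimes>\<^sub>1 G)) (Rn B C (F' \<otimes>\<^sub>1 G'))" by (rule vcomp_cell[OF c1 c2])
  let ?P = "\<lambda>\<omega>. \<omega> \<in> cells (F \<otimes>\<^sub>1 G) (F' \<otimes>\<^sub>1 G') \<and> Rn2 B C \<omega> = ?c"
  note FGa = strict_arrowsD[OF FG(1)]
  obtain w where w: "?P w" by (rule T.Rn2_exists[OF FG(1) strict_arrowsD[OF FG'(1)] c]) simp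
  then have "\<exists>!\<omega>. ?P \<omega>" by (intro ex1I[of ?P w]) (use w T.Rn2_inj[OF _ _ FGa] in metis)+
  then have P: "?P (\<sigma> \<otimes>\<^sub>2 \<tau>)" unfolding tens2_def Let_def s.bounds t.bounds by (rule theI')
  then show c': "\<sigma> \<otimes>\<^sub>2 \<tau> \<in> cells (F \<otimes>\<^sub>1 G) (F' \<otimes>\<^sub>1 G')" by simp
  show "(\<sigma> \<otimes>\<^sub>2 \<tau>) \<diamondop> PGen (b, c) =
      pclass (tensP B' C') (AR (fobj F' b) (\<tau> \<diamondop> c)) \<cdot>\<^bsub>B' \<otimes>\<^sub>0 C'\<^esub> pclass (tensP B' C') (AL (\<sigma> \<diamondop> b) (fobj G c))"
    if b: "b \<in> Obj B" and c: "c \<in> Obj C"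
  proof -
    have w: "farr (eta B' C') (\<sigma> \<diamondop> b) *\<^sub>R G \<in> Arr (ihom C ?X)" using whiskR_in[OF T'.eta_arr_in G] b by simp
    have "(\<sigma> \<otimes>\<^sub>2 \<tau>) \<diamondop> PGen (b, c) = ?c \<diamondop> b \<diamondop> c"
      using T.Rn2_app(3)[OF c' FGa b c] P by simp
    also have "?c \<diamondop> b = (fobj (eta B' C') (fobj F' b) *\<^sub>L \<tau>) \<cdot>\<^sub>V (farr (eta B' C') (\<sigma> \<diamondop> b) *\<^sub>R G)"
      using b e by (simp add: pt)
    finally show ?thesis using b c w by simp
  qed
qed

section \<open>Algebras and modules\<close>

lemma tens1_smf:
  assumes "SMF F" "SMF G"
  shows "SMF (F \<otimes>\<^sub>1 G)" "Src (F \<otimes>\<^sub>1 G) = Src F \<otimes>\<^sub>0 Src G" "Tgt (F \<otimes>\<^sub>1 G) = Tgt F \<otimes>\<^sub>0 Tgt G"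
  using tens1_arrow[of F "Src F" "Tgt F" G "Src G" "Tgt G"] assms by (auto simp: arrows_def)

lemma tens1_merge:
  assumes "SMF F" "SMF G" "SMF F'" "SMF G'"
    "Tgt F = Src F'" "Tgt G = Src G'"
  shows "(F' \<otimes>\<^sub>1 G') \<circ>\<^sub>F (F \<otimes>\<^sub>1 G) = (F' \<circ>\<^sub>F F) \<otimes>\<^sub>1 (G' \<circ>\<^sub>F G)"
    "SMF Z ==> Tgt Z = Src F \<otimes>\<^sub>0 Src G ==> (F' \<otimes>\<^sub>1 G') \<circ>\<^sub>F ((F \<otimes>\<^sub>1 G) \<circ>\<^sub>F Z) = ((F' \<circ>\<^sub>F F) \<otimes>\<^sub>1 (G' \<circ>\<^sub>F G)) \<circ>\<^sub>F Z"
proof -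
  show e: "(F' \<otimes>\<^sub>1 G') \<circ>\<^sub>F (F \<otimes>\<^sub>1 G) = (F' \<circ>\<^sub>F F) \<otimes>\<^sub>1 (G' \<circ>\<^sub>F G)"
    by (rule tens1_comp) (use assms in \<open>auto simp: arrows_def\<close>)
  show "SMF Z ==> Tgt Z = Src F \<otimes>\<^sub>0 Src G ==> (F' \<otimes>\<^sub>1 G') \<circ>\<^sub>F ((F \<otimes>\<^sub>1 G) \<circ>\<^sub>F Z) = ((F' \<circ>\<^sub>F F) \<otimes>\<^sub>1 (G' \<circ>\<^sub>F G)) \<circ>\<^sub>F Z"
    by (rule compF_reduce[OF e]) (use assms in \<open>simp_all add: tens1_smf\<close>)
qed

lemma id_smf:
  "SPC B ==> SMF (idF B)"
  "SMF F ==> Src F = B' ==> F \<circ>\<^sub>F idF B' = F"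
  "SMF G ==> Tgt G = B'' ==> idF B'' \<circ>\<^sub>F G = G"
  using idF_arrow[of B] compF_idF(1)[of F "Src F" "Tgt F"] compF_idF(2)[of G "Src G" "Tgt G"] by (auto simp: arrows_def)

lemmas tens_calc = smf_calc tens1_smf tens1_merge id_smf tens1_idF

context two_ring
begin

abbreviation "A \<equiv> rcat R"
abbreviation "mu \<equiv> rmul R"
abbreviation "c \<equiv> ring_c R"
abbreviation "u \<equiv> ring_u R"

lemma c_props: "c \<in> strict_arrows (A \<otimes>\<^sub>0 A) A" "Rn A A c = mu"
  unfolding ring_c_def by (rule tens.En_props[OF tens[OF rcat_spc rcat_spc] rmul_arrow rcat_spc])+

lemma u_props: "u \<in> strict_arrows \<I> A" "fobj u \<star> = rone R"
proof -
  interpret A: symmetric_picard_category A by (rule rcat_spc)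
  interpret P: pres freeP by unfold_locales (simp add: pres_wf_def freeP_def)
  \<comment> \<open>The presentation \<open>freeP\<close> has no generating arrows, so any
    assignment on them will do.\<close>
  interpret M: pres_model freeP A "\<lambda>_. rone R" "\<lambda>_. undefined"
    by unfold_locales (auto simp: freeP_def rone_closed)
  have m: "M.model \<in> strict_arrows \<I> A \<and> fobj M.model \<star> = rone R"
  proof -
    have "() \<in> genO freeP" by (simp add: freeP_def)
    then have "fobj M.model (PGen ()) = rone R" by (simp add: M.model_def)
    then show ?thesis using M.model_strict by (simp add: freeI_def star_def)
  qed
  have "\<exists>!F. F \<in> strict_arrows \<I> A \<and> fobj F \<star> = rone R"
  proof (rule ex1I, rule m)
    fix F assume F: "F \<in> strict_arrows \<I> A \<and> fobj F \<star> = rone R"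
    show "F = M.model"
      by (rule P.strict_unique) (use F m in \<open>auto simp: freeI_def star_def freeP_def\<close>)
  qed
  then have "u \<in> strict_arrows \<I> A \<and> fobj u \<star> = rone R" unfolding ring_u_def by (rule theI')
  then show "u \<in> strict_arrows \<I> A" "fobj u \<star> = rone R" by simp_all
qed

lemmas c_arrow = strict_arrowsD[OF c_props(1)] and u_arrow = strict_arrowsD[OF u_props(1)]

end

section \<open>Strict actions and the transposes of their structure cells\<close>

locale strict_action = two_ring R for R :: "('o, 'a) ring2" +
  fixes M :: "('p, 'b) spc" and \<phi> :: "(('o, 'p) t_obj, ('o, 'a, 'p, 'b) t_arr, 'p, 'b) smf"
  assumes M_spc: "SPC M" and phi_strict: "\<phi> \<in> strict_arrows (rcat R \<otimes>\<^sub>0 M) M"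
begin

abbreviation "\<phi>' \<equiv> Rn A M \<phi>"
abbreviation "dm \<equiv> \<phi> \<circ>\<^sub>F (idF A \<otimes>\<^sub>1 \<phi>) \<circ>\<^sub>F Ac A A M"
abbreviation "cd \<equiv> \<phi> \<circ>\<^sub>F (c \<otimes>\<^sub>1 idF M)"
abbreviation "gd \<equiv> \<phi> \<circ>\<^sub>F (u \<otimes>\<^sub>1 idF M) \<circ>\<^sub>F Lc M"

sublocale A: symmetric_picard_category A by (rule rcat_spc)
sublocale M: symmetric_picard_category M by (rule M_spc)
sublocale AM: tens A M by (rule tens[OF rcat_spc M_spc])
sublocale AA: tens A A by (rule tens[OF rcat_spc rcat_spc])
sublocale MM: spc_pair M M by (rule spc_pair[OF M_spc M_spc])

lemma phi_arrow: "\<phi> \<in> arrows (A \<otimes>\<^sub>0 M) M" by (rule strict_arrowsD[OF phi_strict])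

lemma phi'_arrow: "\<phi>' \<in> arrows A (ihom M M)" by (rule Rn_arrow[OF phi_arrow rcat_spc M_spc])

lemma AAA_spc: "SPC (A \<otimes>\<^sub>0 A)" by (rule tens0_spc[OF rcat_spc rcat_spc])

text \<open>Both facts are needed for \<open>trans_surj\<close>, where a trilinear 2-cell is
  transposed back in two steps, each of which asks for a strict domain.\<close>

lemma dm_strict: "dm \<in> strict_arrows ((A \<otimes>\<^sub>0 A) \<otimes>\<^sub>0 M) M" "Rn (A \<otimes>\<^sub>0 A) M dm \<in> strict_arrows (A \<otimes>\<^sub>0 A) (ihom M M)"
proof -
  note t = tens1_props(1)[OF idF_arrow[OF rcat_spc] phi_arrow] and a = Ac_props[OF rcat_spc rcat_spc M_spc]
  have e: "dm = (\<phi> \<circ>\<^sub>F (idF A \<otimes>\<^sub>1 \<phi>)) \<circ>\<^sub>F Ac A A M"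
    by (rule compF_assoc[OF strict_arrowsD[OF a(1)] strict_arrowsD[OF t] phi_arrow, symmetric])
  show "dm \<in> strict_arrows ((A \<otimes>\<^sub>0 A) \<otimes>\<^sub>0 M) M" by (rule strict_compF[OF strict_compF[OF a(1) t] phi_strict])
  show "Rn (A \<otimes>\<^sub>0 A) M dm \<in> strict_arrows (A \<otimes>\<^sub>0 A) (ihom M M)"
    unfolding e by (rule Rn_strict_compF[OF AAA_spc M_spc strict_arrowsD[OF a(1)] a(2) strict_compF[OF t phi_strict]])
qed

lemmas dm_arrow = strict_arrowsD[OF dm_strict(1)]

lemma cd_arrow: "cd \<in> arrows ((A \<otimes>\<^sub>0 A) \<otimes>\<^sub>0 M) M"
  by (rule compF_arrow[OF tens1_arrow[OF c_arrow idF_arrow[OF M_spc]] phi_arrow])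

lemma Rn_dm: "Rn A A (Rn (A \<otimes>\<^sub>0 A) M dm) = act_act M \<phi>'"
  by (rule Rn_act_act[OF rcat_spc phi_arrow M_spc])

lemma Rn_cd: "Rn A A (Rn (A \<otimes>\<^sub>0 A) M cd) = mul_act A mu \<phi>'"
  unfolding c_props(2)[symmetric] by (rule Rn_mul_act[OF c_arrow rcat_spc phi_arrow M_spc])

text \<open>Since \<open>L'\<close> is \<open>eta\<close> at \<open>\<star>\<close>, the composite
  is the transpose of \<open>\<phi> \<circ> (u \<otimes> 1)\<close> at \<open>\<star>\<close>. Thus
  the cells \<open>\<gamma>\<close> of algebras and of modules have literally the same
  codomain.\<close>

lemma gd_eq: "gd = fobj \<phi>' (rone R)"
proof -
  interpret IM: tens \<I> M by (rule tens[OF freeI_spc M_spc])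
  note t = tens1_arrow[OF u_arrow idF_arrow[OF M_spc]] and L = Lc_arrow[OF M_spc]
  interpret u: spc_arrow \<I> A u by (rule spc_arrow[OF u_arrow])
  have "gd = (\<phi> \<circ>\<^sub>F (u \<otimes>\<^sub>1 idF M)) \<circ>\<^sub>F Lc M" by (rule compF_assoc[OF L t phi_arrow, symmetric])
  also have "\<dots> = fobj (Rn \<I> M (\<phi> \<circ>\<^sub>F (u \<otimes>\<^sub>1 idF M))) \<star>"
    using IM.Rn_app(3)[OF compF_arrow[OF t phi_arrow] star_Obj] by (simp add: Lc_eq[OF M_spc])
  also have "\<dots> = fobj \<phi>' (rone R)"
    unfolding Rn_tens1[OF u_arrow idF_arrow[OF M_spc] phi_arrow] hom_id[OF M_spc M_spc]
      compF_idF(2)[OF compF_arrow[OF u_arrow phi'_arrow]] using u_props(2) by simp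
  finally show ?thesis .
qed

definition trans where "trans \<beta> = Rn2 A A (Rn2 (A \<otimes>\<^sub>0 A) M \<beta>)"

lemma AAM: "tens (A \<otimes>\<^sub>0 A) M" by (rule tens[OF AAA_spc M_spc])

lemma trans_cell:
  assumes b: "\<beta> \<in> cells dm cd"
  shows "trans \<beta> \<in> cells (act_act M \<phi>') (mul_act A mu \<phi>')"
    "x \<in> Obj A ==> y \<in> Obj A ==> m \<in> Obj M ==> trans \<beta> \<diamondop> x \<diamondop> y \<diamondop> m = \<beta> \<diamondop> PGen (PGen (x, y), m)"
proof -
  interpret T: tens "A \<otimes>\<^sub>0 A" M by (rule AAM)
  note R = T.Rn_arrow[OF dm_arrow]
  note b' = T.Rn2_app(1)[OF b dm_arrow]
  show "trans \<beta> \<in> cells (act_act M \<phi>') (mul_act A mu \<phi>')"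
    using AA.Rn2_app(1)[OF b' R] unfolding trans_def Rn_dm Rn_cd .
  show "x \<in> Obj A ==> y \<in> Obj A ==> m \<in> Obj M ==> trans \<beta> \<diamondop> x \<diamondop> y \<diamondop> m = \<beta> \<diamondop> PGen (PGen (x, y), m)"
    unfolding trans_def using AA.Rn2_app(3)[OF b' R, of x y] T.Rn2_app(3)[OF b dm_arrow, of "PGen (x, y)" m] by simp
qed

lemma trans_inj:
  assumes b: "\<beta> \<in> cells dm cd" "\<beta>' \<in> cells dm cd" "trans \<beta> = trans \<beta>'"
  shows "\<beta> = \<beta>'"
proof (rule cell_eqI3[OF b(1,2) dm_arrow rcat_spc rcat_spc M_spc])
  fix x y m assume x: "x \<in> Obj A" "y \<in> Obj A" "m \<in> Obj M"
  show "\<beta> \<diamondop> PGen (PGen (x, y), m) = \<beta>' \<diamondop> PGen (PGen (x, y), m)"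
    using trans_cell(2)[OF b(1) x] trans_cell(2)[OF b(2) x] b(3) by simp
qed

lemma trans_surj:
  assumes t: "\<tau> \<in> cells (act_act M \<phi>') (mul_act A mu \<phi>')"
  obtains \<beta> where "\<beta> \<in> cells dm cd" "trans \<beta> = \<tau>"
proof -
  interpret T: tens "A \<otimes>\<^sub>0 A" M by (rule AAM)
  note R = T.Rn_arrow[OF cd_arrow]
  obtain b' where b': "b' \<in> cells (Rn (A \<otimes>\<^sub>0 A) M dm) (Rn (A \<otimes>\<^sub>0 A) M cd)" "Rn2 A A b' = \<tau>"
    by (rule AA.Rn2_exists[OF dm_strict(2) R]) (use t in \<open>auto simp: Rn_dm Rn_cd\<close>)
  obtain b where "b \<in> cells dm cd" "Rn2 (A \<otimes>\<^sub>0 A) M b = b'"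
    by (rule T.Rn2_exists[OF dm_strict(1) cd_arrow b'(1)])
  then show thesis using b'(2) by (intro that[of b]) (simp_all add: trans_def)
qed

end

lemma strict_action:
  "two_ring R ==> SPC M ==> \<phi> \<in> strict_arrows (rcat R \<otimes>\<^sub>0 M) M ==> strict_action R M \<phi>"
  by (simp add: strict_action_def strict_action_axioms_def)

context two_ring
begin

text \<open>The 2-ring acts strictly on itself through \<open>c\<close>; the bijectivity of
  \<open>trans\<close> for this action makes \<open>ring_alpha\<close> well defined.\<close>

sublocale self: strict_action R A c
  by (rule strict_action[OF two_ring_axioms rcat_spc c_props(1)])

lemma alpha_props:
  "ring_alpha R \<in> cells (c \<circ>\<^sub>F (idF A \<otimes>\<^sub>1 c) \<circ>\<^sub>F Ac A A A) (c \<circ>\<^sub>F (c \<otimes>\<^sub>1 idF A))"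
  "x \<in> Obj A ==> y \<in> Obj A ==> z \<in> Obj A ==> ring_alpha R \<diamondop> PGen (PGen (x, y), z) = ralpha R \<diamondop> x \<diamondop> y \<diamondop> z"
proof -
  let ?P = "\<lambda>\<omega>. \<omega> \<in> cells (c \<circ>\<^sub>F (idF A \<otimes>\<^sub>1 c) \<circ>\<^sub>F Ac A A A) (c \<circ>\<^sub>F (c \<otimes>\<^sub>1 idF A)) \<and> self.trans \<omega> = ralpha R"
  obtain w where w: "?P w" by (rule self.trans_surj[of "ralpha R"]) (use ralpha_cell in \<open>auto simp: c_props(2)\<close>)
  then have "\<exists>!\<omega>. ?P \<omega>" by (intro ex1I[of ?P w]) (use w self.trans_inj in metis)+
  then have P: "?P (ring_alpha R)" unfolding ring_alpha_def Let_def self.trans_def by (rule theI')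
  then show cl: "ring_alpha R \<in> cells (c \<circ>\<^sub>F (idF A \<otimes>\<^sub>1 c) \<circ>\<^sub>F Ac A A A) (c \<circ>\<^sub>F (c \<otimes>\<^sub>1 idF A))" by simp
  show "x \<in> Obj A ==> y \<in> Obj A ==> z \<in> Obj A ==> ring_alpha R \<diamondop> PGen (PGen (x, y), z) = ralpha R \<diamondop> x \<diamondop> y \<diamondop> z"
    using self.trans_cell(2)[OF cl, of x y z] P by simp
qed

text \<open>The record types \<open>rrho\<close> by means of evaluation at the unit object;
  naturality of evaluation identifies that codomain with the composite through
  \<open>R'\<close>.\<close>

lemma rho_cell: "rrho R \<in> cells (idF A) (c \<circ>\<^sub>F (idF A \<otimes>\<^sub>1 u) \<circ>\<^sub>F Rc A)"
proof -
  note iA = idF_arrow[OF rcat_spc] and I = freeI_spc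
  note t = tens1_arrow[OF iA u_arrow] and e = eta_arrow[OF rcat_spc I]
  note AI = tens0_spc[OF rcat_spc I] and AAm = ihom_spc[OF rcat_spc rcat_spc]
  note ct = compF_arrow[OF t c_arrow]
  interpret u: spc_arrow \<I> A u by (rule spc_arrow[OF u_arrow])
  have "c \<circ>\<^sub>F (idF A \<otimes>\<^sub>1 u) \<circ>\<^sub>F Rc A = ev \<I> A \<star> \<circ>\<^sub>F Rn A \<I> (c \<circ>\<^sub>F (idF A \<otimes>\<^sub>1 u))"
    unfolding compF_assoc[OF Rc_arrow[OF rcat_spc] t c_arrow, symmetric]
    unfolding Rc_def Rn_def compF_assoc[OF e ev_arrow[OF I AI star_Obj] ct, symmetric] ev_post[OF I ct star_Obj]
    by (rule compF_assoc[OF e hom_post_arrow[OF I ct] ev_arrow[OF I rcat_spc star_Obj]])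
  also have "\<dots> = ev A A (rone R) \<circ>\<^sub>F mu"
    unfolding Rn_tens1[OF iA u_arrow c_arrow] c_props(2) compF_idF(1)[OF rmul_arrow] u_props(2)[symmetric] ev_pre[OF u_arrow rcat_spc star_Obj, symmetric]
    by (rule compF_assoc[OF rmul_arrow hom_pre_arrow[OF u_arrow rcat_spc] ev_arrow[OF I rcat_spc star_Obj], symmetric])
  finally show ?thesis using rrho_cell by simp
qed

lemma lam_cell: "rlam R \<in> cells (idF A) (c \<circ>\<^sub>F (u \<otimes>\<^sub>1 idF A) \<circ>\<^sub>F Lc A)"
  using rlam_cell unfolding self.gd_eq c_props(2) .

end

text \<open>By the relations \<open>tr_R_Id\<close> and \<open>tr_L_Id\<close> one of the two
  factors in \<open>tens2_props\<close> is an identity.\<close>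

lemma tens2_id:
  assumes F: "F \<in> arrows B B'" and G: "G \<in> arrows C C'" and b: "b \<in> Obj B" and c: "c \<in> Obj C"
  shows "\<sigma> \<in> cells F F' ==> (\<sigma> \<otimes>\<^sub>2 id2 G) \<diamondop> PGen (b, c) = pclass (tensP B' C') (AL (\<sigma> \<diamondop> b) (fobj G c))"
    "\<tau> \<in> cells G G' ==> (id2 F \<otimes>\<^sub>2 \<tau>) \<diamondop> PGen (b, c) = pclass (tensP B' C') (AR (fobj F b) (\<tau> \<diamondop> c))"
proof -
  interpret F: spc_arrow B B' F by (rule spc_arrow[OF F])
  interpret G: spc_arrow C C' G by (rule spc_arrow[OF G])
  interpret T': tens B' C' by (rule tens[OF F.C.spc G.C.spc])
  interpret X: symmetric_picard_category "B' \<otimes>\<^sub>0 C'" by (rule T'.X_spc)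
  have i: "T'.cl (AR x (Id C' y)) = Id (B' \<otimes>\<^sub>0 C') (PGen (x, y))" "T'.cl (AL (Id B' x) y) = Id (B' \<otimes>\<^sub>0 C') (PGen (x, y))"
    if "x \<in> Obj B'" "y \<in> Obj C'" for x y
    using T'.rel[OF tr_R_Id[OF that]] T'.rel[OF tr_L_Id[OF that]] by (simp_all add: T'.P.cl_struct tens0_def)
  show "(\<sigma> \<otimes>\<^sub>2 id2 G) \<diamondop> PGen (b, c) = T'.cl (AL (\<sigma> \<diamondop> b) (fobj G c))" if s: "\<sigma> \<in> cells F F'"
  proof -
    interpret s: spc_cell B B' F F' \<sigma> by (rule spc_cell[OF s F])
    have "T'.cl (AL (\<sigma> \<diamondop> b) (fobj G c)) = farr (eta B' C') (\<sigma> \<diamondop> b) \<diamondop> fobj G c" using b c by simp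
    moreover have "\<dots> \<in> Arr (B' \<otimes>\<^sub>0 C')" "Cod (B' \<otimes>\<^sub>0 C') \<dots> = PGen (fobj F' b, fobj G c)"
      using b c T'.Q.ncomp_in[OF T'.eta_arr_in] by (simp_all del: eta_app(9))
    ultimately show ?thesis
      using tens2_props(2)[OF s F id2_cell[OF G] G b c] b c by (simp add: i)
  qed
  show "(id2 F \<otimes>\<^sub>2 \<tau>) \<diamondop> PGen (b, c) = T'.cl (AR (fobj F b) (\<tau> \<diamondop> c))" if t: "\<tau> \<in> cells G G'"
  proof -
    interpret t: spc_cell C C' G G' \<tau> by (rule spc_cell[OF t G])
    have "T'.cl (AR (fobj F b) (\<tau> \<diamondop> c)) = farr (fobj (eta B' C') (fobj F b)) (\<tau> \<diamondop> c)" using b c by simp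
    moreover have "\<dots> \<in> Arr (B' \<otimes>\<^sub>0 C')" "Dom (B' \<otimes>\<^sub>0 C') \<dots> = PGen (fobj F b, fobj G c)"
      using b c T'.Q.farr_in[OF T'.E_in] by (simp_all del: eta_app(6))
    ultimately show ?thesis
      using tens2_props(2)[OF id2_cell[OF F] F t G b c] b c by (simp add: i)
  qed
qed

lemma tens1_obj:
  "SMF F ==> SMF G ==> b \<in> Obj (Src F) ==> c \<in> Obj (Src G) ==>
    fobj (F \<otimes>\<^sub>1 G) (PGen (b, c)) = PGen (fobj F b, fobj G c)"
  using tens1_app[of F "Src F" "Tgt F" G "Src G" "Tgt G"] by (auto simp: arrows_def)

lemma Ac_smf:
  assumes "SPC B" "SPC C" "SPC D"
  shows "SMF (Ac B C D)" "Src (Ac B C D) = (B \<otimes>\<^sub>0 C) \<otimes>\<^sub>0 D" "Tgt (Ac B C D) = B \<otimes>\<^sub>0 (C \<otimes>\<^sub>0 D)"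
  using Ac_arrow[OF assms] by (auto simp: arrows_def)

lemma Lc_smf:
  assumes "SPC B"
  shows "SMF (Lc B)" "Src (Lc B) = B" "Tgt (Lc B) = \<I> \<otimes>\<^sub>0 B"
    "SMF (Rc B)" "Src (Rc B) = B" "Tgt (Rc B) = B \<otimes>\<^sub>0 \<I>"
    "b \<in> Obj B ==> fobj (Lc B) b = PGen (\<star>, b)" "b \<in> Obj B ==> fobj (Rc B) b = PGen (b, \<star>)"
proof -
  show "SMF (Lc B)" "Src (Lc B) = B" "Tgt (Lc B) = \<I> \<otimes>\<^sub>0 B"
    "SMF (Rc B)" "Src (Rc B) = B" "Tgt (Rc B) = B \<otimes>\<^sub>0 \<I>"
    using Lc_arrow[OF assms] Rc_arrow[OF assms] by (auto simp: arrows_def)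
  interpret T: tens B \<I> by (rule tens[OF assms freeI_spc])
  show "b \<in> Obj B ==> fobj (Lc B) b = PGen (\<star>, b)" "b \<in> Obj B ==> fobj (Rc B) b = PGen (b, \<star>)"
    by (simp_all add: Lc_eq[OF assms] Rc_def)
qed

section \<open>Boundaries of the 2-cells in (T1)-(T3)\<close>

context strict_action
begin

lemmas spcs = rcat_spc M_spc tens0_spc freeI_spc
lemmas smfs = smf_of[OF phi_arrow] smf_of[OF c_arrow] smf_of[OF u_arrow]
lemmas calc = tens_calc smfs spcs Ac_smf Lc_smf
lemmas iA = idF_arrow[OF rcat_spc] and iM = idF_arrow[OF M_spc]

lemma split_tens: "F \<in> arrows Y Z ==> G \<in> arrows X Y ==> (F \<circ>\<^sub>F G) \<otimes>\<^sub>1 idF M = (F \<otimes>\<^sub>1 idF M) \<circ>\<^sub>F (G \<otimes>\<^sub>1 idF M)"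
  using tens1_comp[OF _ iM _ iM, of G X Y F Z] by (simp add: calc)

lemma Ac_c: "Ac A A M \<circ>\<^sub>F ((c \<otimes>\<^sub>1 idF A) \<otimes>\<^sub>1 idF M) = (c \<otimes>\<^sub>1 idF (A \<otimes>\<^sub>0 M)) \<circ>\<^sub>F Ac (A \<otimes>\<^sub>0 A) A M"
  unfolding Ac_natural[OF c_arrow iA iM] by (simp add: calc)

text \<open>Naturality of \<open>A'\<close> at \<open>\<phi>\<close> in the last variable, and then
  the pentagon for \<open>A'\<close>.\<close>

lemma Ac_phi:
  "Ac A A M \<circ>\<^sub>F (idF (A \<otimes>\<^sub>0 A) \<otimes>\<^sub>1 \<phi>) \<circ>\<^sub>F Ac (A \<otimes>\<^sub>0 A) A M
     = (idF A \<otimes>\<^sub>1 ((idF A \<otimes>\<^sub>1 \<phi>) \<circ>\<^sub>F Ac A A M)) \<circ>\<^sub>F Ac A (A \<otimes>\<^sub>0 A) M \<circ>\<^sub>F (Ac A A A \<otimes>\<^sub>1 idF M)"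
proof -
  have "Ac A A M \<circ>\<^sub>F (idF (A \<otimes>\<^sub>0 A) \<otimes>\<^sub>1 \<phi>) \<circ>\<^sub>F Ac (A \<otimes>\<^sub>0 A) A M = (idF A \<otimes>\<^sub>1 (idF A \<otimes>\<^sub>1 \<phi>)) \<circ>\<^sub>F Ac A A (A \<otimes>\<^sub>0 M) \<circ>\<^sub>F Ac (A \<otimes>\<^sub>0 A) A M"
    using compF_reduce[OF Ac_natural[OF iA iA phi_arrow], of "Ac (A \<otimes>\<^sub>0 A) A M"] by (simp add: calc)
  then show ?thesis
    unfolding Ac_pentagon[OF rcat_spc rcat_spc rcat_spc M_spc] by (simp add: calc)
qed

lemma Ac_assoc:
  "Ac A A M \<circ>\<^sub>F (((idF A \<otimes>\<^sub>1 c) \<circ>\<^sub>F Ac A A A) \<otimes>\<^sub>1 idF M)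
     = (idF A \<otimes>\<^sub>1 (c \<otimes>\<^sub>1 idF M)) \<circ>\<^sub>F Ac A (A \<otimes>\<^sub>0 A) M \<circ>\<^sub>F (Ac A A A \<otimes>\<^sub>1 idF M)"
  unfolding split_tens[OF tens1_arrow[OF iA c_arrow] Ac_arrow[OF rcat_spc rcat_spc rcat_spc]]
  by (subst compF_reduce[OF Ac_natural[OF iA c_arrow iM]]) (simp_all add: calc del: tens1_merge)

lemma Ac_runit: "Ac A A M \<circ>\<^sub>F (((idF A \<otimes>\<^sub>1 u) \<circ>\<^sub>F Rc A) \<otimes>\<^sub>1 idF M) = idF A \<otimes>\<^sub>1 ((u \<otimes>\<^sub>1 idF M) \<circ>\<^sub>F Lc M)"
proof -
  have "Ac A A M \<circ>\<^sub>F (((idF A \<otimes>\<^sub>1 u) \<circ>\<^sub>F Rc A) \<otimes>\<^sub>1 idF M) = (idF A \<otimes>\<^sub>1 (u \<otimes>\<^sub>1 idF M)) \<circ>\<^sub>F Ac A \<I> M \<circ>\<^sub>F (Rc A \<otimes>\<^sub>1 idF M)"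
    unfolding split_tens[OF tens1_arrow[OF iA u_arrow] Rc_arrow[OF rcat_spc]]
    by (subst compF_reduce[OF Ac_natural[OF iA u_arrow iM]]) (simp_all add: calc del: tens1_merge)
  then show ?thesis unfolding Ac_unit[OF rcat_spc M_spc] by (simp add: calc)
qed

text \<open>The composite of \<open>A'\<close> with \<open>L' \<otimes> 1\<close> remains in the
  result: it is the domain of \<open>theta\<close>, by which (T3) passes to \<open>L'\<close> of the
  tensor product.\<close>

lemma Ac_lunit:
  "Ac A A M \<circ>\<^sub>F (((u \<otimes>\<^sub>1 idF A) \<circ>\<^sub>F Lc A) \<otimes>\<^sub>1 idF M) = (u \<otimes>\<^sub>1 idF (A \<otimes>\<^sub>0 M)) \<circ>\<^sub>F Ac \<I> A M \<circ>\<^sub>F (Lc A \<otimes>\<^sub>1 idF M)"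
  unfolding split_tens[OF tens1_arrow[OF u_arrow iA] Lc_arrow[OF rcat_spc]]
  by (subst compF_reduce[OF Ac_natural[OF u_arrow iA iM]]) (simp_all add: calc del: tens1_merge)

text \<open>Vertical composites are 2-cells only if the adjacent ends are equal as records. The
  first five equations are those needed for (T1), the next three those for (T2); the others,
  together with \<open>\<phi> \<circ> (1 \<otimes> 1) = \<phi>\<close>, are for (T3).\<close>

lemma boundaries:
  "cd \<circ>\<^sub>F ((idF (A \<otimes>\<^sub>0 A) \<otimes>\<^sub>1 \<phi>) \<circ>\<^sub>F Ac (A \<otimes>\<^sub>0 A) A M) = dm \<circ>\<^sub>F ((c \<otimes>\<^sub>1 idF A) \<otimes>\<^sub>1 idF M)"
  "(\<phi> \<circ>\<^sub>F (idF A \<otimes>\<^sub>1 dm)) \<circ>\<^sub>F Ac A (A \<otimes>\<^sub>0 A) M \<circ>\<^sub>F (Ac A A A \<otimes>\<^sub>1 idF M) = dm \<circ>\<^sub>F ((idF (A \<otimes>\<^sub>0 A) \<otimes>\<^sub>1 \<phi>) \<circ>\<^sub>F Ac (A \<otimes>\<^sub>0 A) A M)"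
  "(\<phi> \<circ>\<^sub>F (idF A \<otimes>\<^sub>1 cd)) \<circ>\<^sub>F Ac A (A \<otimes>\<^sub>0 A) M \<circ>\<^sub>F (Ac A A A \<otimes>\<^sub>1 idF M) = dm \<circ>\<^sub>F (((idF A \<otimes>\<^sub>1 c) \<otimes>\<^sub>1 idF M) \<circ>\<^sub>F (Ac A A A \<otimes>\<^sub>1 idF M))"
  "\<phi> \<circ>\<^sub>F ((c \<circ>\<^sub>F (idF A \<otimes>\<^sub>1 c) \<circ>\<^sub>F Ac A A A) \<otimes>\<^sub>1 idF M) = cd \<circ>\<^sub>F (((idF A \<otimes>\<^sub>1 c) \<otimes>\<^sub>1 idF M) \<circ>\<^sub>F (Ac A A A \<otimes>\<^sub>1 idF M))"
  "\<phi> \<circ>\<^sub>F ((c \<circ>\<^sub>F (c \<otimes>\<^sub>1 idF A)) \<otimes>\<^sub>1 idF M) = cd \<circ>\<^sub>F ((c \<otimes>\<^sub>1 idF A) \<otimes>\<^sub>1 idF M)"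
  "\<phi> \<circ>\<^sub>F (idF A \<otimes>\<^sub>1 gd) = dm \<circ>\<^sub>F (((idF A \<otimes>\<^sub>1 u) \<otimes>\<^sub>1 idF M) \<circ>\<^sub>F (Rc A \<otimes>\<^sub>1 idF M))"
  "\<phi> \<circ>\<^sub>F ((c \<circ>\<^sub>F (idF A \<otimes>\<^sub>1 u) \<circ>\<^sub>F Rc A) \<otimes>\<^sub>1 idF M) = cd \<circ>\<^sub>F (((idF A \<otimes>\<^sub>1 u) \<otimes>\<^sub>1 idF M) \<circ>\<^sub>F (Rc A \<otimes>\<^sub>1 idF M))"
  "\<phi> \<circ>\<^sub>F (idF A \<otimes>\<^sub>1 idF M) = \<phi>" "idF M \<circ>\<^sub>F \<phi> = \<phi>"
  "gd \<circ>\<^sub>F \<phi> = (\<phi> \<circ>\<^sub>F (idF A \<otimes>\<^sub>1 \<phi>) \<circ>\<^sub>F (u \<otimes>\<^sub>1 idF (A \<otimes>\<^sub>0 M))) \<circ>\<^sub>F Lc (A \<otimes>\<^sub>0 M)"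
  "(\<phi> \<circ>\<^sub>F (idF A \<otimes>\<^sub>1 \<phi>) \<circ>\<^sub>F (u \<otimes>\<^sub>1 idF (A \<otimes>\<^sub>0 M))) \<circ>\<^sub>F (Ac \<I> A M \<circ>\<^sub>F (Lc A \<otimes>\<^sub>1 idF M)) = dm \<circ>\<^sub>F (((u \<otimes>\<^sub>1 idF A) \<otimes>\<^sub>1 idF M) \<circ>\<^sub>F (Lc A \<otimes>\<^sub>1 idF M))"
  "\<phi> \<circ>\<^sub>F ((c \<circ>\<^sub>F (u \<otimes>\<^sub>1 idF A) \<circ>\<^sub>F Lc A) \<otimes>\<^sub>1 idF M) = cd \<circ>\<^sub>F (((u \<otimes>\<^sub>1 idF A) \<otimes>\<^sub>1 idF M) \<circ>\<^sub>F (Lc A \<otimes>\<^sub>1 idF M))"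
  by (simp_all add: calc Ac_c Ac_phi Ac_assoc Ac_runit Ac_lunit Lc_natural[OF phi_arrow, symmetric])
end

lemma vcomp_at:
  assumes s: "\<sigma> \<in> cells F G" and F: "F \<in> arrows B C" and x: "x \<in> Obj B"
  shows "(\<tau> \<cdot>\<^sub>V \<sigma>) \<diamondop> x = \<tau> \<diamondop> x \<cdot>\<^bsub>C\<^esub> \<sigma> \<diamondop> x"
  using vcomp_app0[of x \<sigma> \<tau>] cells_bounds[OF s] arrows_src_tgt[OF F] x by simp

lemma whiskL_at:
  assumes s: "\<sigma> \<in> cells F G" and F: "F \<in> arrows B C" and x: "x \<in> Obj B"
  shows "(H *\<^sub>L \<sigma>) \<diamondop> x = farr H (\<sigma> \<diamondop> x)"
  using cells_bounds[OF s] arrows_src_tgt[OF F] x by (simp add: mnt_dom_def)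

lemma whiskR_at: "K \<in> arrows B C ==> x \<in> Obj B ==> (\<sigma> *\<^sub>R K) \<diamondop> x = \<sigma> \<diamondop> fobj K x"
  by (rule whiskR_app) (simp add: arrows_src_tgt)

lemma whisk_arrows:
  "\<sigma> \<in> cells F G ==> F \<in> arrows B C ==> H \<in> arrows C D ==> H *\<^sub>L \<sigma> \<in> cells (H \<circ>\<^sub>F F) (H \<circ>\<^sub>F G)"
  "\<tau> \<in> cells F' G' ==> F' \<in> arrows B' C' ==> K \<in> arrows D' B' ==> \<tau> *\<^sub>R K \<in> cells (F' \<circ>\<^sub>F K) (G' \<circ>\<^sub>F K)"
  using whiskL_cell[of \<sigma> F G H D] whiskR_cell[of \<tau> F' G' K D'] by (simp_all add: arrows_def)

section \<open>The algebra axioms read at generators\<close>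

context strict_action
begin

lemma mu_app: "x \<in> Obj A ==> y \<in> Obj A ==> fobj (fobj mu x) y = fobj c (PGen (x, y))"
  using tens.Rn_app(5)[OF tens[OF rcat_spc rcat_spc] c_arrow] by (simp add: c_props(2))

lemmas phi_app = AM.Rn_app(5,6,9)[OF phi_arrow]

lemma phi_obj: "x \<in> Obj A ==> m \<in> Obj M ==> fobj \<phi> (PGen (x, m)) \<in> Obj M" "x \<in> Obj A ==> y \<in> Obj A ==> fobj c (PGen (x, y)) \<in> Obj A"
  using spc_arrow.fobj_closed[OF spc_arrow[OF phi_arrow]] spc_arrow.fobj_closed[OF spc_arrow[OF c_arrow]] by simp_all

lemmas obj_calc = calc tens1_obj Ac_app phi_app mu_app phi_obj u_props(2) rone_closed

lemma whisk_cells: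
  assumes b: "\<beta> \<in> cells dm cd"
  shows "F \<in> arrows X ((A \<otimes>\<^sub>0 A) \<otimes>\<^sub>0 M) ==> \<beta> *\<^sub>R F \<in> cells (dm \<circ>\<^sub>F F) (cd \<circ>\<^sub>F F)"
  by (rule whisk_arrows(2)[OF b dm_arrow])

lemma phi_tens2_cells:
  "F \<in> arrows X A ==> \<sigma> \<in> cells F F' ==> \<phi> *\<^sub>L (\<sigma> \<otimes>\<^sub>2 id2 (idF M)) \<in> cells (\<phi> \<circ>\<^sub>F (F \<otimes>\<^sub>1 idF M)) (\<phi> \<circ>\<^sub>F (F' \<otimes>\<^sub>1 idF M))"
  "G \<in> arrows Y M ==> \<tau> \<in> cells G G' ==> \<phi> *\<^sub>L (id2 (idF A) \<otimes>\<^sub>2 \<tau>) \<in> cells (\<phi> \<circ>\<^sub>F (idF A \<otimes>\<^sub>1 G)) (\<phi> \<circ>\<^sub>F (idF A \<otimes>\<^sub>1 G'))"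
  by (rule whisk_arrows(1)[OF tens2_props(1)[OF _ _ id2_cell[OF iM] iM] tens1_arrow[OF _ iM] phi_arrow]
    whisk_arrows(1)[OF tens2_props(1)[OF id2_cell[OF iA] iA] tens1_arrow[OF iA] phi_arrow]; assumption)+

lemma phi_tens2_at:
  "F \<in> arrows X A ==> \<sigma> \<in> cells F F' ==> x \<in> Obj X ==> m \<in> Obj M ==> (\<phi> *\<^sub>L (\<sigma> \<otimes>\<^sub>2 id2 (idF M))) \<diamondop> PGen (x, m) = actL \<phi>' (\<sigma> \<diamondop> x) m"
  "G \<in> arrows Y M ==> \<tau> \<in> cells G G' ==> a \<in> Obj A ==> y \<in> Obj Y ==> (\<phi> *\<^sub>L (id2 (idF A) \<otimes>\<^sub>2 \<tau>)) \<diamondop> PGen (a, y) = actR \<phi>' a (\<tau> \<diamondop> y)"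
proof -
  assume F: "F \<in> arrows X A" and s: "\<sigma> \<in> cells F F'" and x: "x \<in> Obj X" "m \<in> Obj M"
  interpret s: spc_cell X A F F' \<sigma> by (rule spc_cell[OF s F])
  show "(\<phi> *\<^sub>L (\<sigma> \<otimes>\<^sub>2 id2 (idF M))) \<diamondop> PGen (x, m) = actL \<phi>' (\<sigma> \<diamondop> x) m"
    using whiskL_at[OF tens2_props(1)[OF s F id2_cell[OF iM] iM] tens1_arrow[OF F iM], of "PGen (x, m)"] x
    by (simp add: tens2_id(1)[OF F iM x s] phi_app)
next
  assume G: "G \<in> arrows Y M" and t: "\<tau> \<in> cells G G'" and y: "a \<in> Obj A" "y \<in> Obj Y"
  interpret t: spc_cell Y M G G' \<tau> by (rule spc_cell[OF t G])
  show "(\<phi> *\<^sub>L (id2 (idF A) \<otimes>\<^sub>2 \<tau>)) \<diamondop> PGen (a, y) = actR \<phi>' a (\<tau> \<diamondop> y)"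
    using whiskL_at[OF tens2_props(1)[OF id2_cell[OF iA] iA t G] tens1_arrow[OF iA G], of "PGen (a, y)"] y
    by (simp add: tens2_id(2)[OF iA G y t] phi_app)
qed

lemma T1_iff:
  assumes b: "\<beta> \<in> cells dm cd"
  shows "(\<beta> *\<^sub>R ((c \<otimes>\<^sub>1 idF A) \<otimes>\<^sub>1 idF M))
       \<cdot>\<^sub>V (\<beta> *\<^sub>R ((idF (A \<otimes>\<^sub>0 A) \<otimes>\<^sub>1 \<phi>) \<circ>\<^sub>F Ac (A \<otimes>\<^sub>0 A) A M))
     = (\<phi> *\<^sub>L (ring_alpha R \<otimes>\<^sub>2 id2 (idF M)))
       \<cdot>\<^sub>V (\<beta> *\<^sub>R (((idF A \<otimes>\<^sub>1 c) \<otimes>\<^sub>1 idF M) \<circ>\<^sub>F (Ac A A A \<otimes>\<^sub>1 idF M)))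
       \<cdot>\<^sub>V ((\<phi> *\<^sub>L (id2 (idF A) \<otimes>\<^sub>2 \<beta>)) *\<^sub>R (Ac A (A \<otimes>\<^sub>0 A) M \<circ>\<^sub>F (Ac A A A \<otimes>\<^sub>1 idF M)))
    \<longleftrightarrow> (\<forall>x \<in> Obj A. \<forall>y \<in> Obj A. \<forall>z \<in> Obj A. \<forall>m \<in> Obj M.
      (trans \<beta> \<diamondop> actO mu x y \<diamondop> z \<diamondop> m) \<cdot>\<^bsub>M\<^esub> (trans \<beta> \<diamondop> x \<diamondop> y \<diamondop> actO \<phi>' z m)
      = actL \<phi>' (ralpha R \<diamondop> x \<diamondop> y \<diamondop> z) m \<cdot>\<^bsub>M\<^esub> (trans \<beta> \<diamondop> x \<diamondop> actO mu y z \<diamondop> m) \<cdot>\<^bsub>M\<^esub> actR \<phi>' x (trans \<beta> \<diamondop> y \<diamondop> z \<diamondop> m))"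
    (is "?L1 \<cdot>\<^sub>V ?L2 = ?R1 \<cdot>\<^sub>V ?R2 \<cdot>\<^sub>V ?R3 \<longleftrightarrow> ?rhs")
proof -
  let ?AAA = "(A \<otimes>\<^sub>0 A) \<otimes>\<^sub>0 A"
  let ?W = "?AAA \<otimes>\<^sub>0 M"
  note AA = AAA_spc and iAA = idF_arrow[OF AAA_spc]
  note al = alpha_props
  note Aa = Ac_arrow[OF rcat_spc rcat_spc rcat_spc]
  let ?K1 = "(c \<otimes>\<^sub>1 idF A) \<otimes>\<^sub>1 idF M" and ?K2 = "(idF (A \<otimes>\<^sub>0 A) \<otimes>\<^sub>1 \<phi>) \<circ>\<^sub>F Ac (A \<otimes>\<^sub>0 A) A M"
    and ?K3 = "((idF A \<otimes>\<^sub>1 c) \<otimes>\<^sub>1 idF M) \<circ>\<^sub>F (Ac A A A \<otimes>\<^sub>1 idF M)" and ?K4 = "Ac A (A \<otimes>\<^sub>0 A) M \<circ>\<^sub>F (Ac A A A \<otimes>\<^sub>1 idF M)"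
  note K1 = tens1_arrow[OF tens1_arrow[OF c_arrow iA] iM]
  note K2 = compF_arrow[OF Ac_arrow[OF AA rcat_spc M_spc] tens1_arrow[OF iAA phi_arrow]]
  note K3 = compF_arrow[OF tens1_arrow[OF Aa iM] tens1_arrow[OF tens1_arrow[OF iA c_arrow] iM]]
  note K4 = compF_arrow[OF tens1_arrow[OF Aa iM] Ac_arrow[OF rcat_spc AA M_spc]]
  note L1 = whisk_cells[OF b K1] and R2 = whisk_cells[OF b K3]
  have R1: "?R1 \<in> cells (cd \<circ>\<^sub>F ?K3) (cd \<circ>\<^sub>F ?K1)"
    using phi_tens2_cells(1)[OF self.dm_arrow al(1)] unfolding boundaries .
  note pb = phi_tens2_cells(2)[OF dm_arrow b]
  have R3: "?R3 \<in> cells (dm \<circ>\<^sub>F ?K2) (dm \<circ>\<^sub>F ?K3)"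
    using whisk_arrows(2)[OF pb compF_arrow[OF tens1_arrow[OF iA dm_arrow] phi_arrow] K4] unfolding boundaries .
  have L2': "?L2 \<in> cells (dm \<circ>\<^sub>F ?K2) (dm \<circ>\<^sub>F ?K1)" using whisk_cells[OF b K2] unfolding boundaries .
  note D = compF_arrow[OF K2 dm_arrow] and D3 = compF_arrow[OF K3 dm_arrow]
  note L = vcomp_cell[OF L2' L1] and R23 = vcomp_cell[OF R3 R2]
  note R = vcomp_cell[OF R23 R1]
  have at: "(?L1 \<cdot>\<^sub>V ?L2) \<diamondop> PGen (PGen (PGen (x, y), z), m) = (trans \<beta> \<diamondop> actO mu x y \<diamondop> z \<diamondop> m) \<cdot>\<^bsub>M\<^esub> (trans \<beta> \<diamondop> x \<diamondop> y \<diamondop> actO \<phi>' z m)"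
    "(?R1 \<cdot>\<^sub>V ?R2 \<cdot>\<^sub>V ?R3) \<diamondop> PGen (PGen (PGen (x, y), z), m) =
      actL \<phi>' (ralpha R \<diamondop> x \<diamondop> y \<diamondop> z) m \<cdot>\<^bsub>M\<^esub> (trans \<beta> \<diamondop> x \<diamondop> actO mu y z \<diamondop> m) \<cdot>\<^bsub>M\<^esub> actR \<phi>' x (trans \<beta> \<diamondop> y \<diamondop> z \<diamondop> m)"
    if x: "x \<in> Obj A" "y \<in> Obj A" "z \<in> Obj A" "m \<in> Obj M" for x y z m
  proof -
    let ?w = "PGen (PGen (PGen (x, y), z), m)"
    have w: "?w \<in> Obj ?W" using x by simp
    have o: "fobj ?K1 ?w = PGen (PGen (actO mu x y, z), m)" "fobj ?K2 ?w = PGen (PGen (x, y), actO \<phi>' z m)"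
      "fobj ?K3 ?w = PGen (PGen (x, actO mu y z), m)" "fobj ?K4 ?w = PGen (x, PGen (PGen (y, z), m))"
      using x by (simp_all add: obj_calc)
    have wr: "(\<sigma> *\<^sub>R K) \<diamondop> ?w = \<sigma> \<diamondop> fobj K ?w" if "K \<in> arrows ?W Z" for K Z and \<sigma> :: "('z1, 'z2, 'z3, 'z4) mnt"
      by (rule whiskR_at[OF that w])
    have t: "actO mu x y \<in> Obj A" "actO mu y z \<in> Obj A" "actO \<phi>' z m \<in> Obj M" using x by (simp_all add: obj_calc)
    show "(?L1 \<cdot>\<^sub>V ?L2) \<diamondop> ?w = (trans \<beta> \<diamondop> actO mu x y \<diamondop> z \<diamondop> m) \<cdot>\<^bsub>M\<^esub> (trans \<beta> \<diamondop> x \<diamondop> y \<diamondop> actO \<phi>' z m)"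
      unfolding vcomp_at[OF L2' D w] wr[OF K1] wr[OF K2] o using x t by (simp add: trans_cell(2)[OF b])
    show "(?R1 \<cdot>\<^sub>V ?R2 \<cdot>\<^sub>V ?R3) \<diamondop> ?w =
      actL \<phi>' (ralpha R \<diamondop> x \<diamondop> y \<diamondop> z) m \<cdot>\<^bsub>M\<^esub> (trans \<beta> \<diamondop> x \<diamondop> actO mu y z \<diamondop> m) \<cdot>\<^bsub>M\<^esub> actR \<phi>' x (trans \<beta> \<diamondop> y \<diamondop> z \<diamondop> m)"
      unfolding vcomp_at[OF R23 D w] vcomp_at[OF R3 D w] wr[OF K3] wr[OF K4] o
      using x t by (simp add: trans_cell(2)[OF b] phi_tens2_at(1)[OF self.dm_arrow al(1)] phi_tens2_at(2)[OF dm_arrow b] al(2))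
  qed
  show ?thesis
  proof
    assume e: "?L1 \<cdot>\<^sub>V ?L2 = ?R1 \<cdot>\<^sub>V ?R2 \<cdot>\<^sub>V ?R3"
    show ?rhs by (intro ballI) (use at e in simp)
  next
    assume ?rhs
    then show "?L1 \<cdot>\<^sub>V ?L2 = ?R1 \<cdot>\<^sub>V ?R2 \<cdot>\<^sub>V ?R3"
      by (intro cell_eqI4[OF L R D rcat_spc rcat_spc rcat_spc M_spc]) (simp add: at)
  qed
qed

lemma T2_iff:
  assumes b: "\<beta> \<in> cells dm cd" and g: "\<gamma> \<in> cells (idF M) gd"
  shows "\<phi> *\<^sub>L (rrho R \<otimes>\<^sub>2 id2 (idF M))
     = (\<beta> *\<^sub>R (((idF A \<otimes>\<^sub>1 u) \<otimes>\<^sub>1 idF M) \<circ>\<^sub>F (Rc A \<otimes>\<^sub>1 idF M))) \<cdot>\<^sub>V (\<phi> *\<^sub>L (id2 (idF A) \<otimes>\<^sub>2 \<gamma>))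
    \<longleftrightarrow> (\<forall>a \<in> Obj A. \<forall>m \<in> Obj M. (trans \<beta> \<diamondop> a \<diamondop> rone R \<diamondop> m) \<cdot>\<^bsub>M\<^esub> actR \<phi>' a (\<gamma> \<diamondop> m) = actL \<phi>' (rrho R \<diamondop> a) m)"
    (is "?L = ?R1 \<cdot>\<^sub>V ?R2 \<longleftrightarrow> ?rhs")
proof -
  let ?K = "((idF A \<otimes>\<^sub>1 u) \<otimes>\<^sub>1 idF M) \<circ>\<^sub>F (Rc A \<otimes>\<^sub>1 idF M)"
  note K = compF_arrow[OF tens1_arrow[OF Rc_arrow[OF rcat_spc] iM] tens1_arrow[OF tens1_arrow[OF iA u_arrow] iM]]
  have L: "?L \<in> cells \<phi> (cd \<circ>\<^sub>F ?K)" using phi_tens2_cells(1)[OF iA rho_cell] unfolding boundaries .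
  have R2: "?R2 \<in> cells \<phi> (dm \<circ>\<^sub>F ?K)" using phi_tens2_cells(2)[OF iM g] unfolding boundaries .
  note R = vcomp_cell[OF R2 whisk_cells[OF b K]]
  have at: "?L \<diamondop> PGen (a, m) = actL \<phi>' (rrho R \<diamondop> a) m"
    "(?R1 \<cdot>\<^sub>V ?R2) \<diamondop> PGen (a, m) = (trans \<beta> \<diamondop> a \<diamondop> rone R \<diamondop> m) \<cdot>\<^bsub>M\<^esub> actR \<phi>' a (\<gamma> \<diamondop> m)"
    if x: "a \<in> Obj A" "m \<in> Obj M" for a m
  proof -
    have w: "PGen (a, m) \<in> Obj (A \<otimes>\<^sub>0 M)" using x by simp
    have o: "fobj ?K (PGen (a, m)) = PGen (PGen (a, rone R), m)" using x by (simp add: obj_calc)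
    have wr: "?R1 \<diamondop> PGen (a, m) = \<beta> \<diamondop> fobj ?K (PGen (a, m))" by (rule whiskR_at[OF K w])
    show "?L \<diamondop> PGen (a, m) = actL \<phi>' (rrho R \<diamondop> a) m" by (rule phi_tens2_at(1)[OF iA rho_cell x])
    show "(?R1 \<cdot>\<^sub>V ?R2) \<diamondop> PGen (a, m) = (trans \<beta> \<diamondop> a \<diamondop> rone R \<diamondop> m) \<cdot>\<^bsub>M\<^esub> actR \<phi>' a (\<gamma> \<diamondop> m)"
      unfolding vcomp_at[OF R2 phi_arrow w] wr o phi_tens2_at(2)[OF iM g x] using x by (simp add: trans_cell(2)[OF b] rone_closed)
  qed
  show ?thesis
  proof
    assume e: "?L = ?R1 \<cdot>\<^sub>V ?R2"
    show ?rhs by (intro ballI) (use at e in metis)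
  next
    assume ?rhs
    then show "?L = ?R1 \<cdot>\<^sub>V ?R2"
      by (intro AM.cell_eqI[OF L R phi_arrow]) (simp add: at del: whiskL_app whiskR_app)
  qed
qed

lemma T3_iff:
  assumes b: "\<beta> \<in> cells dm cd" and g: "\<gamma> \<in> cells (idF M) gd"
  shows "\<phi> *\<^sub>L (rlam R \<otimes>\<^sub>2 id2 (idF M))
     = (\<beta> *\<^sub>R (((u \<otimes>\<^sub>1 idF A) \<otimes>\<^sub>1 idF M) \<circ>\<^sub>F (Lc A \<otimes>\<^sub>1 idF M)))
       \<cdot>\<^sub>V inv2 ((\<phi> \<circ>\<^sub>F (idF A \<otimes>\<^sub>1 \<phi>) \<circ>\<^sub>F (u \<otimes>\<^sub>1 idF (A \<otimes>\<^sub>0 M))) *\<^sub>L theta A M) \<cdot>\<^sub>V (\<gamma> *\<^sub>R \<phi>)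
    \<longleftrightarrow> (\<forall>a \<in> Obj A. \<forall>m \<in> Obj M. (trans \<beta> \<diamondop> rone R \<diamondop> a \<diamondop> m) \<cdot>\<^bsub>M\<^esub> (\<gamma> \<diamondop> actO \<phi>' a m) = actL \<phi>' (rlam R \<diamondop> a) m)"
    (is "?L = ?R1 \<cdot>\<^sub>V inv2 ?R2 \<cdot>\<^sub>V ?R3 \<longleftrightarrow> ?rhs")
proof -
  let ?K = "((u \<otimes>\<^sub>1 idF A) \<otimes>\<^sub>1 idF M) \<circ>\<^sub>F (Lc A \<otimes>\<^sub>1 idF M)"
  let ?Q = "\<phi> \<circ>\<^sub>F (idF A \<otimes>\<^sub>1 \<phi>) \<circ>\<^sub>F (u \<otimes>\<^sub>1 idF (A \<otimes>\<^sub>0 M))"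
  note K = compF_arrow[OF tens1_arrow[OF Lc_arrow[OF rcat_spc] iM] tens1_arrow[OF tens1_arrow[OF u_arrow iA] iM]]
  have Q: "?Q \<in> arrows (\<I> \<otimes>\<^sub>0 (A \<otimes>\<^sub>0 M)) M"
    by (rule compF_arrow[OF compF_arrow[OF tens1_arrow[OF u_arrow idF_arrow[OF AM.X_spc]] tens1_arrow[OF iA phi_arrow]] phi_arrow])
  note th = theta_props[OF rcat_spc M_spc]
  note LA = Lc_arrow[OF AM.X_spc]
  have L: "?L \<in> cells \<phi> (cd \<circ>\<^sub>F ?K)" using phi_tens2_cells(1)[OF iA lam_cell] unfolding boundaries .
  have R3: "?R3 \<in> cells \<phi> (?Q \<circ>\<^sub>F Lc (A \<otimes>\<^sub>0 M))" using whisk_arrows(2)[OF g iM phi_arrow] unfolding boundaries .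
  have R2: "?R2 \<in> cells (dm \<circ>\<^sub>F ?K) (?Q \<circ>\<^sub>F Lc (A \<otimes>\<^sub>0 M))"
    using whisk_arrows(1)[OF th(1) cells_src_arrow[OF th(1) LA] Q] unfolding boundaries .
  note D = compF_arrow[OF K dm_arrow]
  note R23 = vcomp_cell[OF R3 inv2_cell[OF R2]]
  note R = vcomp_cell[OF R23 whisk_cells[OF b K]]
  have at: "?L \<diamondop> PGen (a, m) = actL \<phi>' (rlam R \<diamondop> a) m"
    "(?R1 \<cdot>\<^sub>V inv2 ?R2 \<cdot>\<^sub>V ?R3) \<diamondop> PGen (a, m) = (trans \<beta> \<diamondop> rone R \<diamondop> a \<diamondop> m) \<cdot>\<^bsub>M\<^esub> (\<gamma> \<diamondop> actO \<phi>' a m)"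
    if x: "a \<in> Obj A" "m \<in> Obj M" for a m
  proof -
    interpret Q: spc_arrow "\<I> \<otimes>\<^sub>0 (A \<otimes>\<^sub>0 M)" M ?Q by (rule spc_arrow[OF Q])
    have w: "PGen (a, m) \<in> Obj (A \<otimes>\<^sub>0 M)" using x by simp
    have o: "fobj ?K (PGen (a, m)) = PGen (PGen (rone R, a), m)" using x by (simp add: obj_calc)
    have o': "fobj ?Q (PGen (\<star>, PGen (a, m))) = fobj \<phi> (PGen (rone R, actO \<phi>' a m))" using x by (simp add: obj_calc)
    have ro: "fobj \<phi> (PGen (rone R, actO \<phi>' a m)) \<in> Obj M" using x by (simp add: obj_calc)
    have wr: "?R1 \<diamondop> PGen (a, m) = \<beta> \<diamondop> fobj ?K (PGen (a, m))" by (rule whiskR_at[OF K w])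
    have wr': "?R3 \<diamondop> PGen (a, m) = \<gamma> \<diamondop> fobj \<phi> (PGen (a, m))" by (rule whiskR_at[OF phi_arrow w])
    \<comment> \<open>The arrow \<open>?Q\<close> preserves the identity component of
      \<open>theta\<close>; hence the inverted factor of (T3) is an identity at each generator and
      drops out of the composite.\<close>
    have "?R2 \<diamondop> PGen (a, m) = Id M (fobj \<phi> (PGen (rone R, actO \<phi>' a m)))"
      using whiskL_at[OF th(1) cells_src_arrow[OF th(1) LA] w, of ?Q] Q.farr_Id[of "PGen (\<star>, PGen (a, m))"] x unfolding th(2)[OF x] o' by simp
    moreover have "inv2 ?R2 \<diamondop> PGen (a, m) = inv_arr M (?R2 \<diamondop> PGen (a, m))"
    proof -
      interpret AMM: spc_pair "A \<otimes>\<^sub>0 M" M by (rule spc_pair[OF AM.X_spc M_spc])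
      show ?thesis by (rule AMM.inv2_app[OF cells_Arr[OF R2 D] w])
    qed
    ultimately have iv: "inv2 ?R2 \<diamondop> PGen (a, m) = Id M (fobj \<phi> (PGen (rone R, actO \<phi>' a m)))" using ro by simp
    interpret g: spc_cell M M "idF M" gd \<gamma> by (rule spc_cell[OF g iM])
    have "Cod M (\<gamma> \<diamondop> fobj \<phi> (PGen (a, m))) = fobj \<phi> (PGen (rone R, actO \<phi>' a m))" "\<gamma> \<diamondop> fobj \<phi> (PGen (a, m)) \<in> Arr M"
      using g.ncomp_arr[of "fobj \<phi> (PGen (a, m))"] x by (simp_all add: obj_calc)
    then have ic: "inv2 ?R2 \<diamondop> PGen (a, m) \<cdot>\<^bsub>M\<^esub> \<gamma> \<diamondop> fobj \<phi> (PGen (a, m)) = \<gamma> \<diamondop> fobj \<phi> (PGen (a, m))" unfolding iv by simp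
    show "?L \<diamondop> PGen (a, m) = actL \<phi>' (rlam R \<diamondop> a) m" by (rule phi_tens2_at(1)[OF iA lam_cell x])
    show "(?R1 \<cdot>\<^sub>V inv2 ?R2 \<cdot>\<^sub>V ?R3) \<diamondop> PGen (a, m) = (trans \<beta> \<diamondop> rone R \<diamondop> a \<diamondop> m) \<cdot>\<^bsub>M\<^esub> (\<gamma> \<diamondop> actO \<phi>' a m)"
      unfolding vcomp_at[OF R23 phi_arrow w] vcomp_at[OF R3 phi_arrow w] wr wr' ic o
      using x by (simp add: trans_cell(2)[OF b] rone_closed phi_app)
  qed
  show ?thesis
  proof
    assume e: "?L = ?R1 \<cdot>\<^sub>V inv2 ?R2 \<cdot>\<^sub>V ?R3"
    show ?rhs by (intro ballI) (use at e in metis)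
  next
    assume ?rhs
    then show "?L = ?R1 \<cdot>\<^sub>V inv2 ?R2 \<cdot>\<^sub>V ?R3"
      by (intro AM.cell_eqI[OF L R phi_arrow]) (simp add: at del: whiskL_app whiskR_app)
  qed
qed
end

section \<open>Morphisms between strict actions\<close>

locale action_pair = X: strict_action R M \<phi> + Y: strict_action R N \<psi>
  for R :: "('o, 'a) ring2" and M :: "('p, 'b) spc" and \<phi> and N :: "('q, 'c) spc" (structure) and \<psi> +
  fixes H :: "('p, 'b, 'q, 'c) smf"
  assumes H: "H \<in> arrows M N"
begin

abbreviation "A \<equiv> rcat R"
abbreviation "c \<equiv> ring_c R"
abbreviation "u \<equiv> ring_u R"
abbreviation "dd \<equiv> \<psi> \<circ>\<^sub>F (idF A \<otimes>\<^sub>1 H)"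
abbreviation "dc \<equiv> H \<circ>\<^sub>F \<phi>"

lemmas iA = X.iA and iM = X.iM
lemmas calc = X.calc Y.calc smf_of[OF H]

text \<open>A tensor product of arrows is strict even when its factors are not, so the domain of
  \<open>\<delta>\<close> is strict for arbitrary \<open>H\<close>. This makes transposition of
  \<open>\<delta>\<close> bijective.\<close>

lemma dd_strict: "dd \<in> strict_arrows (A \<otimes>\<^sub>0 M) N"
  by (rule strict_compF[OF tens1_props(1)[OF iA H] Y.phi_strict])

lemmas dd_arrow = strict_arrowsD[OF dd_strict]

lemma dc_arrow: "dc \<in> arrows (A \<otimes>\<^sub>0 M) N" by (rule compF_arrow[OF X.phi_arrow H])

lemma Rn_dd: "Rn A M dd = hom_pre H N \<circ>\<^sub>F Rn A N \<psi>"
  unfolding Rn_tens1[OF iA H Y.phi_arrow] by (simp add: compF_idF(1)[OF Y.phi'_arrow])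

lemma Rn_dc: "Rn A M dc = hom_post M H \<circ>\<^sub>F Rn A M \<phi>"
  by (rule Rn_compF[OF X.rcat_spc X.M_spc X.phi_arrow H])

lemma Ac_H: "Ac A A N \<circ>\<^sub>F (idF (A \<otimes>\<^sub>0 A) \<otimes>\<^sub>1 H) = (idF A \<otimes>\<^sub>1 (idF A \<otimes>\<^sub>1 H)) \<circ>\<^sub>F Ac A A M"
  using Ac_natural[OF iA iA H] by (simp add: calc)

text \<open>The first five equations match the ends in (M1), the last four those in (M2). The
  essential inputs are naturality of \<open>A'\<close> and of \<open>L'\<close> at
  \<open>H\<close>.\<close>

lemma delta_boundaries:
  "Y.cd \<circ>\<^sub>F (idF (A \<otimes>\<^sub>0 A) \<otimes>\<^sub>1 H) = dd \<circ>\<^sub>F (c \<otimes>\<^sub>1 idF M)"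
  "(\<psi> \<circ>\<^sub>F (idF A \<otimes>\<^sub>1 dd)) \<circ>\<^sub>F Ac A A M = Y.dm \<circ>\<^sub>F (idF (A \<otimes>\<^sub>0 A) \<otimes>\<^sub>1 H)"
  "(\<psi> \<circ>\<^sub>F (idF A \<otimes>\<^sub>1 dc)) \<circ>\<^sub>F Ac A A M = dd \<circ>\<^sub>F ((idF A \<otimes>\<^sub>1 \<phi>) \<circ>\<^sub>F Ac A A M)"
  "dc \<circ>\<^sub>F ((idF A \<otimes>\<^sub>1 \<phi>) \<circ>\<^sub>F Ac A A M) = H \<circ>\<^sub>F X.dm" "dc \<circ>\<^sub>F (c \<otimes>\<^sub>1 idF M) = H \<circ>\<^sub>F X.cd"
  "H \<circ>\<^sub>F idF M = H" "idF N \<circ>\<^sub>F H = H"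
  "Y.gd \<circ>\<^sub>F H = dd \<circ>\<^sub>F ((u \<otimes>\<^sub>1 idF M) \<circ>\<^sub>F Lc M)" "dc \<circ>\<^sub>F ((u \<otimes>\<^sub>1 idF M) \<circ>\<^sub>F Lc M) = H \<circ>\<^sub>F X.gd"
  by (simp_all add: calc Ac_H Lc_natural[OF H, symmetric])

context
  fixes \<delta> assumes d: "\<delta> \<in> cells dd dc"
begin

lemma Rn2_delta:
  "Rn2 A M \<delta> \<in> cells (hom_pre H N \<circ>\<^sub>F Rn A N \<psi>) (hom_post M H \<circ>\<^sub>F Rn A M \<phi>)"
  "a \<in> Obj A ==> m \<in> Obj M ==> Rn2 A M \<delta> \<diamondop> a \<diamondop> m = \<delta> \<diamondop> PGen (a, m)"
  using X.AM.Rn2_app(1,3)[OF d dd_arrow] by (simp_all add: Rn_dd Rn_dc)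

lemma M1_iff:
  assumes b: "\<beta> \<in> cells X.dm X.cd" and b': "\<beta>' \<in> cells Y.dm Y.cd"
  shows "(\<delta> *\<^sub>R (c \<otimes>\<^sub>1 idF M)) \<cdot>\<^sub>V (\<beta>' *\<^sub>R (idF (A \<otimes>\<^sub>0 A) \<otimes>\<^sub>1 H))
     = (H *\<^sub>L \<beta>) \<cdot>\<^sub>V (\<delta> *\<^sub>R ((idF A \<otimes>\<^sub>1 \<phi>) \<circ>\<^sub>F Ac A A M)) \<cdot>\<^sub>V ((\<psi> *\<^sub>L (id2 (idF A) \<otimes>\<^sub>2 \<delta>)) *\<^sub>R Ac A A M)
    \<longleftrightarrow> (\<forall>a \<in> Obj A. \<forall>b \<in> Obj A. \<forall>m \<in> Obj M.
      (Rn2 A M \<delta> \<diamondop> actO (rmul R) a b \<diamondop> m) \<cdot> (Y.trans \<beta>' \<diamondop> a \<diamondop> b \<diamondop> fobj H m)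
      = farr H (X.trans \<beta> \<diamondop> a \<diamondop> b \<diamondop> m) \<cdot> (Rn2 A M \<delta> \<diamondop> a \<diamondop> actO (Rn A M \<phi>) b m)
          \<cdot> actR (Rn A N \<psi>) a (Rn2 A M \<delta> \<diamondop> b \<diamondop> m))"
    (is "?L1 \<cdot>\<^sub>V ?L2 = ?R1 \<cdot>\<^sub>V ?R2 \<cdot>\<^sub>V ?R3 \<longleftrightarrow> ?rhs")
proof -
  note AA = X.AAA_spc
  let ?W = "(A \<otimes>\<^sub>0 A) \<otimes>\<^sub>0 M"
  let ?K1 = "c \<otimes>\<^sub>1 idF M" and ?K2 = "idF (A \<otimes>\<^sub>0 A) \<otimes>\<^sub>1 H" and ?K3 = "(idF A \<otimes>\<^sub>1 \<phi>) \<circ>\<^sub>F Ac A A M" and ?K4 = "Ac A A M"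
  note K1 = tens1_arrow[OF X.c_arrow iM] and K2 = tens1_arrow[OF idF_arrow[OF AA] H]
  note K4 = Ac_arrow[OF X.rcat_spc X.rcat_spc X.M_spc]
  note K3 = compF_arrow[OF K4 tens1_arrow[OF iA X.phi_arrow]]
  note L1 = whisk_arrows(2)[OF d dd_arrow K1]
  have L2: "?L2 \<in> cells (Y.dm \<circ>\<^sub>F ?K2) (dd \<circ>\<^sub>F ?K1)"
    using whisk_arrows(2)[OF b' Y.dm_arrow K2] unfolding delta_boundaries .
  note pd = Y.phi_tens2_cells(2)[OF dd_arrow d]
  have R3: "?R3 \<in> cells (Y.dm \<circ>\<^sub>F ?K2) (dd \<circ>\<^sub>F ?K3)"
    using whisk_arrows(2)[OF pd compF_arrow[OF tens1_arrow[OF iA dd_arrow] Y.phi_arrow] K4] unfolding delta_boundaries .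
  note R2 = whisk_arrows(2)[OF d dd_arrow K3]
  have R1: "?R1 \<in> cells (dc \<circ>\<^sub>F ?K3) (dc \<circ>\<^sub>F ?K1)"
    using whisk_arrows(1)[OF b X.dm_arrow H] unfolding delta_boundaries .
  note D = compF_arrow[OF K2 Y.dm_arrow]
  note L = vcomp_cell[OF L2 L1] and R23 = vcomp_cell[OF R3 R2]
  note R = vcomp_cell[OF R23 R1]
  have at: "(?L1 \<cdot>\<^sub>V ?L2) \<diamondop> PGen (PGen (x, y), m) = (Rn2 A M \<delta> \<diamondop> actO (rmul R) x y \<diamondop> m) \<cdot> (Y.trans \<beta>' \<diamondop> x \<diamondop> y \<diamondop> fobj H m)"
    "(?R1 \<cdot>\<^sub>V ?R2 \<cdot>\<^sub>V ?R3) \<diamondop> PGen (PGen (x, y), m) = farr H (X.trans \<beta> \<diamondop> x \<diamondop> y \<diamondop> m) \<cdot> (Rn2 A M \<delta> \<diamondop> x \<diamondop> actO (Rn A M \<phi>) y m)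
          \<cdot> actR (Rn A N \<psi>) x (Rn2 A M \<delta> \<diamondop> y \<diamondop> m)"
    if x: "x \<in> Obj A" "y \<in> Obj A" "m \<in> Obj M" for x y m
  proof -
    let ?w = "PGen (PGen (x, y), m)"
    interpret H: spc_arrow M N H by (rule spc_arrow[OF H])
    have w: "?w \<in> Obj ?W" using x by simp
    have o: "fobj ?K1 ?w = PGen (actO (rmul R) x y, m)" "fobj ?K2 ?w = PGen (PGen (x, y), fobj H m)"
      "fobj ?K3 ?w = PGen (x, actO (Rn A M \<phi>) y m)" "fobj ?K4 ?w = PGen (x, PGen (y, m))"
      using x by (simp_all add: X.obj_calc Y.obj_calc smf_of[OF H])
    have t: "actO (rmul R) x y \<in> Obj A" "actO (Rn A M \<phi>) y m \<in> Obj M" using x by (simp_all add: X.obj_calc)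
    show "(?L1 \<cdot>\<^sub>V ?L2) \<diamondop> ?w = (Rn2 A M \<delta> \<diamondop> actO (rmul R) x y \<diamondop> m) \<cdot> (Y.trans \<beta>' \<diamondop> x \<diamondop> y \<diamondop> fobj H m)"
      unfolding vcomp_at[OF L2 D w] whiskR_at[OF K1 w] whiskR_at[OF K2 w] o using x t by (simp add: Y.trans_cell(2)[OF b'] Rn2_delta(2))
    show "(?R1 \<cdot>\<^sub>V ?R2 \<cdot>\<^sub>V ?R3) \<diamondop> ?w = farr H (X.trans \<beta> \<diamondop> x \<diamondop> y \<diamondop> m) \<cdot> (Rn2 A M \<delta> \<diamondop> x \<diamondop> actO (Rn A M \<phi>) y m)
          \<cdot> actR (Rn A N \<psi>) x (Rn2 A M \<delta> \<diamondop> y \<diamondop> m)"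
      unfolding vcomp_at[OF R23 D w] vcomp_at[OF R3 D w] whiskR_at[OF K3 w] whiskR_at[OF K4 w] whiskL_at[OF b X.dm_arrow w] o
      using x t by (simp add: X.trans_cell(2)[OF b] Y.phi_tens2_at(2)[OF dd_arrow d] Rn2_delta(2))
  qed
  show ?thesis
  proof
    assume e: "?L1 \<cdot>\<^sub>V ?L2 = ?R1 \<cdot>\<^sub>V ?R2 \<cdot>\<^sub>V ?R3"
    show ?rhs by (intro ballI) (use at e in simp)
  next
    assume ?rhs
    then show "?L1 \<cdot>\<^sub>V ?L2 = ?R1 \<cdot>\<^sub>V ?R2 \<cdot>\<^sub>V ?R3"
      by (intro cell_eqI3[OF L R D X.rcat_spc X.rcat_spc X.M_spc]) (simp add: at)
  qed
qed

text \<open>These 2-cells start at \<open>M\<close> itself and not at a tensor product, so they are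
  compared at all objects of \<open>M\<close>.\<close>

lemma M2_iff:
  assumes g: "\<gamma> \<in> cells (idF M) X.gd" and g': "\<gamma>' \<in> cells (idF N) Y.gd"
  shows "H *\<^sub>L \<gamma> = (\<delta> *\<^sub>R ((u \<otimes>\<^sub>1 idF M) \<circ>\<^sub>F Lc M)) \<cdot>\<^sub>V (\<gamma>' *\<^sub>R H)
    \<longleftrightarrow> (\<forall>m \<in> Obj M. farr H (\<gamma> \<diamondop> m) = (Rn2 A M \<delta> \<diamondop> rone R \<diamondop> m) \<cdot> (\<gamma>' \<diamondop> fobj H m))"
    (is "?L = ?R1 \<cdot>\<^sub>V ?R2 \<longleftrightarrow> ?rhs")
proof -
  let ?K = "(u \<otimes>\<^sub>1 idF M) \<circ>\<^sub>F Lc M"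
  note K = compF_arrow[OF Lc_arrow[OF X.M_spc] tens1_arrow[OF X.u_arrow iM]]
  have L: "?L \<in> cells H (dc \<circ>\<^sub>F ?K)" using whisk_arrows(1)[OF g iM H] unfolding delta_boundaries .
  have R2: "?R2 \<in> cells H (dd \<circ>\<^sub>F ?K)" using whisk_arrows(2)[OF g' Y.iM H] unfolding delta_boundaries .
  note R = vcomp_cell[OF R2 whisk_arrows(2)[OF d dd_arrow K]]
  have at: "?L \<diamondop> m = farr H (\<gamma> \<diamondop> m)" "(?R1 \<cdot>\<^sub>V ?R2) \<diamondop> m = (Rn2 A M \<delta> \<diamondop> rone R \<diamondop> m) \<cdot> (\<gamma>' \<diamondop> fobj H m)"
    if m: "m \<in> Obj M" for m
  proof -
    have o: "fobj ?K m = PGen (rone R, m)" using m by (simp add: X.obj_calc)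
    show "?L \<diamondop> m = farr H (\<gamma> \<diamondop> m)" by (rule whiskL_at[OF g iM m])
    show "(?R1 \<cdot>\<^sub>V ?R2) \<diamondop> m = (Rn2 A M \<delta> \<diamondop> rone R \<diamondop> m) \<cdot> (\<gamma>' \<diamondop> fobj H m)"
      unfolding vcomp_at[OF R2 H m] whiskR_at[OF K m] whiskR_at[OF H m] o Rn2_delta(2)[OF X.rone_closed m] ..
  qed
  show ?thesis
  proof
    assume e: "?L = ?R1 \<cdot>\<^sub>V ?R2"
    show ?rhs by (intro ballI) (use at e in metis)
  next
    assume r: ?rhs
    show "?L = ?R1 \<cdot>\<^sub>V ?R2"
      by (rule mnt_eqI[OF L R H]) (simp only: at r[rule_format])
  qed
qed

end
end

section \<open>The two categories\<close>

lemma bilin_cell: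
  assumes s: "\<sigma> \<in> cells F G" and F: "F \<in> arrows A (ihom M N)" and M: "SPC M" and N: "SPC N"
    and a: "a \<in> Obj A"
  shows "spc_cell M N (fobj F a) (fobj G a) (\<sigma> \<diamondop> a)"
proof -
  interpret Q: spc_pair M N by (rule spc_pair[OF M N])
  interpret s: spc_cell A "ihom M N" F G \<sigma> by (rule spc_cell[OF s F])
  show ?thesis using Q.cell_of[OF s.ncomp_arr(1)[OF a]] s.ncomp_arr(2,3)[OF a] by simp
qed

lemma bilin_cell_eqI:
  assumes s: "\<sigma> \<in> cells F G" and t: "\<tau> \<in> cells F G" and F: "F \<in> arrows A (ihom M N)"
    and M: "SPC M" and N: "SPC N"
    and e: "\<And>a m. a \<in> Obj A ==> m \<in> Obj M ==> \<sigma> \<diamondop> a \<diamondop> m = \<tau> \<diamondop> a \<diamondop> m"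
  shows "\<sigma> = \<tau>"
proof (rule mnt_eqI[OF s t F])
  fix a assume a: "a \<in> Obj A"
  interpret s: spc_cell M N "fobj F a" "fobj G a" "\<sigma> \<diamondop> a" by (rule bilin_cell[OF s F M N a])
  interpret t: spc_cell M N "fobj F a" "fobj G a" "\<tau> \<diamondop> a" by (rule bilin_cell[OF t F M N a])
  show "\<sigma> \<diamondop> a = \<tau> \<diamondop> a" by (rule mnt_eqI[OF s.cell t.cell s.F.arrow e[OF a]])
qed

text \<open>The two whiskered cells can be pasted because \<open>[1,G]\<close> and
  \<open>[F,1]\<close> commute, which is \<open>hom_post_pre\<close>.\<close>

lemma comp_delta:
  assumes p: "\<phi> \<in> arrows A (ihom M M)" and q: "\<psi> \<in> arrows A (ihom N N)" and r: "\<chi> \<in> arrows A (ihom L L)"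
    and F: "F \<in> arrows M N" and G: "G \<in> arrows N L"
    and s: "\<sigma> \<in> cells (hom_pre F N \<circ>\<^sub>F \<psi>) (hom_post M F \<circ>\<^sub>F \<phi>)" and t: "\<tau> \<in> cells (hom_pre G L \<circ>\<^sub>F \<chi>) (hom_post N G \<circ>\<^sub>F \<psi>)"
  shows "hom_post M G *\<^sub>L \<sigma> \<cdot>\<^sub>V hom_pre F L *\<^sub>L \<tau> \<in> cells (hom_pre (G \<circ>\<^sub>F F) L \<circ>\<^sub>F \<chi>) (hom_post M (G \<circ>\<^sub>F F) \<circ>\<^sub>F \<phi>)"
    "a \<in> Obj A ==> m \<in> Obj M ==> (hom_post M G *\<^sub>L \<sigma> \<cdot>\<^sub>V hom_pre F L *\<^sub>L \<tau>) \<diamondop> a \<diamondop> m = farr G (\<sigma> \<diamondop> a \<diamondop> m) \<cdot>\<^bsub>L\<^esub> \<tau> \<diamondop> a \<diamondop> fobj F m"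
proof -
  note M = arrows_spc(1)[OF F] and N = arrows_spc(2)[OF F] and L = arrows_spc(2)[OF G]
  note pF = hom_pre_arrow[OF F L] and pF' = hom_pre_arrow[OF F N] and oF = hom_post_arrow[OF M F] and pG = hom_pre_arrow[OF G L]
    and oG = hom_post_arrow[OF N G] and oG' = hom_post_arrow[OF M G]
  note sa = compF_arrow[OF q pF'] and ta = compF_arrow[OF r pG]
  have t': "hom_pre F L *\<^sub>L \<tau> \<in> cells (hom_pre (G \<circ>\<^sub>F F) L \<circ>\<^sub>F \<chi>) (hom_pre F L \<circ>\<^sub>F hom_post N G \<circ>\<^sub>F \<psi>)"
    using whisk_arrows(1)[OF t ta pF] unfolding hom_pre_compF[OF L F G] compF_assoc[OF r pG pF] .
  have s': "hom_post M G *\<^sub>L \<sigma> \<in> cells (hom_pre F L \<circ>\<^sub>F hom_post N G \<circ>\<^sub>F \<psi>) (hom_post M (G \<circ>\<^sub>F F) \<circ>\<^sub>F \<phi>)"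
    using whisk_arrows(1)[OF s sa oG']
    unfolding hom_post_compF[OF M F G] compF_assoc[OF p oF oG'] compF_assoc[OF q pF' oG', symmetric] hom_post_pre[OF F G] compF_assoc[OF q oG pF] .
  show "hom_post M G *\<^sub>L \<sigma> \<cdot>\<^sub>V hom_pre F L *\<^sub>L \<tau> \<in> cells (hom_pre (G \<circ>\<^sub>F F) L \<circ>\<^sub>F \<chi>) (hom_post M (G \<circ>\<^sub>F F) \<circ>\<^sub>F \<phi>)"
    by (rule vcomp_cell[OF t' s'])
  show "(hom_post M G *\<^sub>L \<sigma> \<cdot>\<^sub>V hom_pre F L *\<^sub>L \<tau>) \<diamondop> a \<diamondop> m = farr G (\<sigma> \<diamondop> a \<diamondop> m) \<cdot>\<^bsub>L\<^esub> \<tau> \<diamondop> a \<diamondop> fobj F m"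
    if a: "a \<in> Obj A" and m: "m \<in> Obj M"
  proof -
    interpret s: spc_cell M N "fobj (hom_pre F N \<circ>\<^sub>F \<psi>) a" "fobj (hom_post M F \<circ>\<^sub>F \<phi>) a" "\<sigma> \<diamondop> a" by (rule bilin_cell[OF s sa M N a])
    interpret t: spc_cell N L "fobj (hom_pre G L \<circ>\<^sub>F \<chi>) a" "fobj (hom_post N G \<circ>\<^sub>F \<psi>) a" "\<tau> \<diamondop> a" by (rule bilin_cell[OF t ta N L a])
    interpret NL: spc_pair N L by (rule spc_pair[OF N L])
    interpret MN: spc_pair M N by (rule spc_pair[OF M N])
    have tA: "\<tau> \<diamondop> a \<in> Arr (ihom N L)" by (rule cells_Arr[OF t.cell t.F.arrow])
    have sA: "\<sigma> \<diamondop> a \<in> Arr (ihom M N)" by (rule cells_Arr[OF s.cell s.F.arrow])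
    have "(hom_post M G *\<^sub>L \<sigma> \<cdot>\<^sub>V hom_pre F L *\<^sub>L \<tau>) \<diamondop> a = (G *\<^sub>L (\<sigma> \<diamondop> a)) \<cdot>\<^sub>V ((\<tau> \<diamondop> a) *\<^sub>R F)"
      unfolding vcomp_at[OF t' compF_arrow[OF r hom_pre_arrow[OF compF_arrow[OF F G] L]] a] whiskL_at[OF s sa a] whiskL_at[OF t ta a]
      using F G tA sA by simp
    then show ?thesis
      using vcomp_at[OF whisk_arrows(2)[OF t.cell t.F.arrow F] compF_arrow[OF F t.F.arrow] m]
        whiskL_at[OF s.cell s.F.arrow m, of G] whiskR_at[OF F m, of "\<tau> \<diamondop> a"] by simp
  qed
qed

lemma id_delta:
  assumes p: "\<phi> \<in> arrows A (ihom M M)" and M: "SPC M"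
  shows "id2 \<phi> \<in> cells (hom_pre (idF M) M \<circ>\<^sub>F \<phi>) (hom_post M (idF M) \<circ>\<^sub>F \<phi>)"
    "a \<in> Obj A ==> m \<in> Obj M ==> id2 \<phi> \<diamondop> a \<diamondop> m = Id M (actO \<phi> a m)"
proof -
  interpret spc_pair M M by (rule spc_pair[OF M M])
  interpret p: spc_arrow A "ihom M M" \<phi> by (rule spc_arrow[OF p])
  have "hom_post M (idF M) = idF (ihom M M)"
    by (rule smf_eqI2[of _ "ihom M M" M M]) (use hom_post_arrow[OF M idF_arrow[OF M]] idF_arrow[OF ihom_spc] M in \<open>auto simp: compF_idF\<close>)
  then show "id2 \<phi> \<in> cells (hom_pre (idF M) M \<circ>\<^sub>F \<phi>) (hom_post M (idF M) \<circ>\<^sub>F \<phi>)"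
    using id2_cell[OF p] by (simp add: hom_id[OF M M] compF_idF[OF p])
  show "a \<in> Obj A ==> m \<in> Obj M ==> id2 \<phi> \<diamondop> a \<diamondop> m = Id M (actO \<phi> a m)"
    using p.fobj_closed[of a] by simp
qed

section \<open>The category of modules\<close>

context A_module
begin

lemma act_bilin: "bilin (rcat R) (mcat X) (mcat X) (mact X)"
  by (rule bilin[OF mact_arrow mcat_spc mcat_spc])

end

context A_module_morphism
begin

sublocale H: spc_arrow "mcat (msrc f)" "mcat (mtgt f)" "marr f" by (rule spc_arrow[OF marr_arrow])
sublocale bX: bilin "rcat R" "mcat (msrc f)" "mcat (msrc f)" "mact (msrc f)" by (rule X.act_bilin)
sublocale bY: bilin "rcat R" "mcat (mtgt f)" "mcat (mtgt f)" "mact (mtgt f)" by (rule Y.act_bilin)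

lemma delta_src: "hom_pre (marr f) (mcat (mtgt f)) \<circ>\<^sub>F mact (mtgt f) \<in> arrows (rcat R) (ihom (mcat (msrc f)) (mcat (mtgt f)))"
  by (rule compF_arrow[OF Y.mact_arrow hom_pre_arrow[OF marr_arrow Y.mcat_spc]])

lemma delta_cell:
  assumes a: "a \<in> Obj (rcat R)"
  shows "spc_cell (mcat (msrc f)) (mcat (mtgt f)) (fobj (mact (mtgt f)) a \<circ>\<^sub>F marr f) (marr f \<circ>\<^sub>F fobj (mact (msrc f)) a) (mdelta f \<diamondop> a)"
  using bilin_cell[OF mdelta_cell delta_src X.mcat_spc Y.mcat_spc a] a by simp

lemma delta_arr [simp]:
  assumes a: "a \<in> Obj (rcat R)" and m: "m \<in> Obj (mcat (msrc f))"
  shows "mdelta f \<diamondop> a \<diamondop> m \<in> Arr (mcat (mtgt f))" "Dom (mcat (mtgt f)) (mdelta f \<diamondop> a \<diamondop> m) = actO (mact (mtgt f)) a (fobj (marr f) m)"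
    "Cod (mcat (mtgt f)) (mdelta f \<diamondop> a \<diamondop> m) = fobj (marr f) (actO (mact (msrc f)) a m)"
  using spc_cell.ncomp_arr[OF delta_cell[OF a] m] a m by simp_all

lemma delta_natural:
  assumes a: "a \<in> Obj (rcat R)" and g: "g \<in> Arr (mcat (msrc f))"
  shows "mdelta f \<diamondop> a \<diamondop> Cod (mcat (msrc f)) g \<cdot>\<^bsub>mcat (mtgt f)\<^esub> actR (mact (mtgt f)) a (farr (marr f) g)
    = farr (marr f) (actR (mact (msrc f)) a g) \<cdot>\<^bsub>mcat (mtgt f)\<^esub> mdelta f \<diamondop> a \<diamondop> Dom (mcat (msrc f)) g"
  using spc_cell.natural[OF delta_cell[OF a] g] a g by simp

end

lemma A_Mod_sel [simp]:
  "X \<in> Obj (A_Mod R) \<longleftrightarrow> A_module R X" "f \<in> Arr (A_Mod R) \<longleftrightarrow> A_module_morphism R f" "Dom (A_Mod R) = msrc" "Cod (A_Mod R) = mtgt"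
  "Id (A_Mod R) X = \<lparr>msrc = X, mtgt = X, marr = idF (mcat X), mdelta = id2 (mact X)\<rparr>"
  "Comp (A_Mod R) g f = \<lparr>msrc = msrc f, mtgt = mtgt g, marr = marr g \<circ>\<^sub>F marr f,
       mdelta = hom_post (mcat (msrc f)) (marr g) *\<^sub>L mdelta f \<cdot>\<^sub>V hom_pre (marr f) (mcat (mtgt g)) *\<^sub>L mdelta g\<rparr>"
  by (simp_all add: A_Mod_def)

text \<open>The locale \<open>A_module\<close> does not include \<open>two_ring\<close>, hence the
  explicit condition on \<open>rmul R\<close>, which is used for the codomain of the components of
  \<open>mbeta\<close>.\<close>

lemma (in A_module) module_arrs:
  "m \<in> Obj (mcat X) ==> mgamma X \<diamondop> m \<in> Arr (mcat X) \<and> Dom (mcat X) (mgamma X \<diamondop> m) = m \<and> Cod (mcat X) (mgamma X \<diamondop> m) = actO (mact X) (rone R) m"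
  "a \<in> Obj (rcat R) ==> b \<in> Obj (rcat R) ==> m \<in> Obj (mcat X) ==> rmul R \<in> arrows (rcat R) (ihom (rcat R) (rcat R)) ==>
    mbeta X \<diamondop> a \<diamondop> b \<diamondop> m \<in> Arr (mcat X) \<and> Dom (mcat X) (mbeta X \<diamondop> a \<diamondop> b \<diamondop> m) = actO (mact X) a (actO (mact X) b m)
    \<and> Cod (mcat X) (mbeta X \<diamondop> a \<diamondop> b \<diamondop> m) = actO (mact X) (actO (rmul R) a b) m"
proof -
  interpret b: bilin "rcat R" "mcat X" "mcat X" "mact X" by (rule act_bilin)
  show "m \<in> Obj (mcat X) ==> mgamma X \<diamondop> m \<in> Arr (mcat X) \<and> Dom (mcat X) (mgamma X \<diamondop> m) = m \<and> Cod (mcat X) (mgamma X \<diamondop> m) = actO (mact X) (rone R) m"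
    using spc_cell.ncomp_arr[OF spc_cell[OF mgamma_cell idF_arrow[OF mcat_spc]], of m] by simp
  assume a: "a \<in> Obj (rcat R)" and b: "b \<in> Obj (rcat R)" and m: "m \<in> Obj (mcat X)" and r: "rmul R \<in> arrows (rcat R) (ihom (rcat R) (rcat R))"
  note A = b.G.B.spc and M = mcat_spc
  note MM = ihom_spc[OF M M]
  interpret r: bilin "rcat R" "rcat R" "rcat R" "rmul R" by (rule bilin[OF r A A])
  have f: "act_act (mcat X) (mact X) \<in> arrows (rcat R) (ihom (rcat R) (ihom (mcat X) (mcat X)))"
    unfolding act_act_def by (rule compF_arrow[OF compF_arrow[OF mact_arrow hom_functor_arrow[OF M M M]] hom_pre_arrow[OF mact_arrow MM]])
  have o: "fobj (fobj (act_act (mcat X) (mact X)) a) b = fobj (mact X) a \<circ>\<^sub>F fobj (mact X) b"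
    using a b hom_post_arrow[OF M b.G_in(1)[OF a]] by (simp add: act_act_def)
  have o': "fobj (fobj (mul_act (rcat R) (rmul R) (mact X)) a) b = fobj (mact X) (actO (rmul R) a b)"
    using a b mact_arrow by (simp add: mul_act_def)
  interpret c: spc_cell "rcat R" "ihom (mcat X) (mcat X)" "fobj (act_act (mcat X) (mact X)) a" "fobj (mul_act (rcat R) (rmul R) (mact X)) a" "mbeta X \<diamondop> a"
    by (rule bilin_cell[OF mbeta_cell f A MM a])
  interpret d: spc_cell "mcat X" "mcat X" "fobj (fobj (act_act (mcat X) (mact X)) a) b" "fobj (fobj (mul_act (rcat R) (rmul R) (mact X)) a) b" "mbeta X \<diamondop> a \<diamondop> b"
    by (rule bilin_cell[OF c.cell c.F.arrow M M b])
  show "mbeta X \<diamondop> a \<diamondop> b \<diamondop> m \<in> Arr (mcat X) \<and> Dom (mcat X) (mbeta X \<diamondop> a \<diamondop> b \<diamondop> m) = actO (mact X) a (actO (mact X) b m)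
    \<and> Cod (mcat X) (mbeta X \<diamondop> a \<diamondop> b \<diamondop> m) = actO (mact X) (actO (rmul R) a b) m"
    using d.ncomp_arr[OF m] a b m unfolding o o' by simp
qed

lemma module_morphism_eqI:
  assumes f: "A_module_morphism R f" and g: "A_module_morphism R g"
    and e: "msrc f = msrc g" "mtgt f = mtgt g" "marr f = marr g"
    "\<And>a m. a \<in> Obj (rcat R) ==> m \<in> Obj (mcat (msrc f)) ==> mdelta f \<diamondop> a \<diamondop> m = mdelta g \<diamondop> a \<diamondop> m"
  shows "f = g"
proof -
  interpret f: A_module_morphism R f by (rule f)
  interpret g: A_module_morphism R g by (rule g)
  have "mdelta f = mdelta g"
    by (rule bilin_cell_eqI[OF f.mdelta_cell _ f.delta_src f.X.mcat_spc f.Y.mcat_spc e(4)]) (use g.mdelta_cell in \<open>simp add: e\<close>)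
  then show ?thesis using e by simp
qed

lemma Comp_delta:
  assumes f: "A_module_morphism R f" and g: "A_module_morphism R g" and fg: "mtgt f = msrc g"
    and a: "a \<in> Obj (rcat R)" and x: "x \<in> Obj (mcat (msrc f))"
  shows "mdelta (Comp (A_Mod R) g f) \<diamondop> a \<diamondop> x = farr (marr g) (mdelta f \<diamondop> a \<diamondop> x) \<cdot>\<^bsub>mcat (mtgt g)\<^esub> mdelta g \<diamondop> a \<diamondop> fobj (marr f) x"
proof -
  interpret f: A_module_morphism R f by (rule f)
  interpret g: A_module_morphism R g by (rule g)
  show ?thesis
    using comp_delta(2)[OF f.X.mact_arrow f.Y.mact_arrow g.Y.mact_arrow f.marr_arrow _ f.mdelta_cell _ a x, of "marr g" "mdelta g"] g.marr_arrow g.mdelta_cell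
    by (simp add: fg)
qed

lemma (in two_ring) A_Mod_category: "category (A_Mod R :: (('o, 'a, 'p, 'b) amod, ('o, 'a, 'p, 'b) amod_mor) cat)"
proof -
  note r = rmul_arrow
  interpret r: bilin A A A "rmul R" by (rule bilin[OF r rcat_spc rcat_spc])
  have I: "A_module_morphism R \<lparr>msrc = X, mtgt = X, marr = idF (mcat X), mdelta = id2 (mact X)\<rparr>" if X: "A_module R X" for X :: "('o, 'a, 'p, 'b) amod"
  proof -
    interpret X: A_module R X by (rule X)
    interpret b: bilin A "mcat X" "mcat X" "mact X" by (rule X.act_bilin)
    note i = id_delta[OF X.mact_arrow X.mcat_spc]
    show ?thesis
    proof (intro A_module_morphism.intro A_module_morphism_axioms.intro, simp_all only: amod_mor.simps X)
      show "idF (mcat X) \<in> arrows (mcat X) (mcat X)" by (rule idF_arrow[OF X.mcat_spc])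
      show "id2 (mact X) \<in> cells (hom_pre (idF (mcat X)) (mcat X) \<circ>\<^sub>F mact X) (hom_post (mcat X) (idF (mcat X)) \<circ>\<^sub>F mact X)" by (rule i(1))
    qed (use i(2) X.module_arrs r rone_closed in auto)
  qed
  have C: "A_module_morphism R (Comp (A_Mod R) g f)"
    if f: "A_module_morphism R f" and g: "A_module_morphism R g" and fg: "mtgt f = msrc g" for f g :: "('o, 'a, 'p, 'b) amod_mor"
  proof -
    obtain X Y Z where m: "msrc f = X" "mtgt f = Y" "msrc g = Y" "mtgt g = Z" using fg by auto
    interpret f: A_module_morphism R f by (rule f)
    interpret g: A_module_morphism R g by (rule g)
    let ?X = "mcat X" and ?Y = "mcat Y" and ?Z = "mcat Z"
    note Hf = f.marr_arrow[unfolded m] and Hg = g.marr_arrow[unfolded m]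
    interpret H: spc_arrow ?X ?Y "marr f" by (rule spc_arrow[OF Hf])
    interpret K: spc_arrow ?Y ?Z "marr g" by (rule spc_arrow[OF Hg])
    interpret bX: bilin A ?X ?X "mact X" by (rule f.X.act_bilin[unfolded m])
    interpret bY: bilin A ?Y ?Y "mact Y" by (rule g.X.act_bilin[unfolded m])
    interpret bZ: bilin A ?Z ?Z "mact Z" by (rule g.Y.act_bilin[unfolded m])
    note d = comp_delta[OF bX.G.arrow bY.G.arrow bZ.G.arrow Hf Hg f.mdelta_cell[unfolded m] g.mdelta_cell[unfolded m]]
    note fd [simp] = f.delta_arr[unfolded m] and gd [simp] = g.delta_arr[unfolded m]
    note gX = f.X.module_arrs[unfolded m] and gY = g.X.module_arrs[unfolded m] and gZ = g.Y.module_arrs[unfolded m]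
    note [simp] = rone_closed m
    have KHo: "marr g \<circ>\<^sub>F marr f \<in> arrows ?X ?Z" by (rule compF_arrow[OF Hf Hg])
    show ?thesis
      unfolding A_Mod_sel m
    proof (intro A_module_morphism.intro A_module_morphism_axioms.intro, simp_all only: amod_mor.simps KHo d(1))
      show "A_module R X" "A_module R Z" using f.X.A_module_axioms g.Y.A_module_axioms by (simp_all add: m)
    next
      fix x assume x: "x \<in> Obj ?X"
      have "farr (marr g) (farr (marr f) (mgamma X \<diamondop> x)) = farr (marr g) (mdelta f \<diamondop> rone R \<diamondop> x \<cdot>\<^bsub>?Y\<^esub> mgamma Y \<diamondop> fobj (marr f) x)"
        using f.mdelta_gamma[unfolded m, OF x] by simp
      also have "\<dots> = farr (marr g) (mdelta f \<diamondop> rone R \<diamondop> x) \<cdot>\<^bsub>?Z\<^esub> mdelta g \<diamondop> rone R \<diamondop> fobj (marr f) x \<cdot>\<^bsub>?Z\<^esub> mgamma Z \<diamondop> fobj (marr g) (fobj (marr f) x)"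
        using g.mdelta_gamma[unfolded m, of "fobj (marr f) x"] x gY(1) by (simp add: K.farr_Comp)
      finally show "farr (marr g \<circ>\<^sub>F marr f) (mgamma X \<diamondop> x) = (hom_post ?X (marr g) *\<^sub>L mdelta f \<cdot>\<^sub>V hom_pre (marr f) ?Z *\<^sub>L mdelta g) \<diamondop> rone R \<diamondop> x
          \<cdot>\<^bsub>?Z\<^esub> mgamma Z \<diamondop> fobj (marr g \<circ>\<^sub>F marr f) x"
        using x gX(1) gZ(1)[of "fobj (marr g) (fobj (marr f) x)"] by (simp add: d(2) K.C.comp_assoc)
    next
      fix a b x assume a: "a \<in> Obj A" and b: "b \<in> Obj A" and x: "x \<in> Obj ?X"
      have ab: "actO mu a b \<in> Obj A" using a b by simp
      note gX' = gX(2)[OF a b x r] and gY' = gY(2)[OF a b H.fobj_closed[OF x] r] and gZ' = gZ(2)[OF a b K.fobj_closed[OF H.fobj_closed[OF x]] r]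
      let ?D = "hom_post ?X (marr g) *\<^sub>L mdelta f \<cdot>\<^sub>V hom_pre (marr f) ?Z *\<^sub>L mdelta g"
      let ?Hx = "fobj (marr f) x" and ?bx = "actO (mact X) b x"
      \<comment> \<open>Naturality of the second \<open>\<delta>\<close> at a component of the
        first. It exchanges the two middle factors, so that the compatibilities of both morphisms
        with \<open>\<beta>\<close> can be composed.\<close>
      have nat: "mdelta g \<diamondop> a \<diamondop> fobj (marr f) ?bx \<cdot>\<^bsub>?Z\<^esub> actR (mact Z) a (farr (marr g) (mdelta f \<diamondop> b \<diamondop> x))
         = farr (marr g) (actR (mact Y) a (mdelta f \<diamondop> b \<diamondop> x)) \<cdot>\<^bsub>?Z\<^esub> mdelta g \<diamondop> a \<diamondop> actO (mact Y) b ?Hx"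
        using g.delta_natural[unfolded m, OF a, of "mdelta f \<diamondop> b \<diamondop> x"] b x by simp
      have "?D \<diamondop> actO mu a b \<diamondop> x \<cdot>\<^bsub>?Z\<^esub> mbeta Z \<diamondop> a \<diamondop> b \<diamondop> fobj (marr g) ?Hx
        = farr (marr g) (mdelta f \<diamondop> actO mu a b \<diamondop> x) \<cdot>\<^bsub>?Z\<^esub> farr (marr g) (mbeta Y \<diamondop> a \<diamondop> b \<diamondop> ?Hx) \<cdot>\<^bsub>?Z\<^esub>
          mdelta g \<diamondop> a \<diamondop> actO (mact Y) b ?Hx \<cdot>\<^bsub>?Z\<^esub> actR (mact Z) a (mdelta g \<diamondop> b \<diamondop> ?Hx)"
        using g.mdelta_beta[unfolded m, OF a b, of ?Hx] a b x ab gZ' by (simp add: d(2) K.C.comp_assoc)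
      also have "\<dots> = farr (marr g) (mdelta f \<diamondop> actO mu a b \<diamondop> x \<cdot>\<^bsub>?Y\<^esub> mbeta Y \<diamondop> a \<diamondop> b \<diamondop> ?Hx) \<cdot>\<^bsub>?Z\<^esub>
          mdelta g \<diamondop> a \<diamondop> actO (mact Y) b ?Hx \<cdot>\<^bsub>?Z\<^esub> actR (mact Z) a (mdelta g \<diamondop> b \<diamondop> ?Hx)"
        using a b x ab gY' by (simp add: K.farr_Comp)
      also have "\<dots> = farr (marr g) (farr (marr f) (mbeta X \<diamondop> a \<diamondop> b \<diamondop> x)) \<cdot>\<^bsub>?Z\<^esub> farr (marr g) (mdelta f \<diamondop> a \<diamondop> ?bx) \<cdot>\<^bsub>?Z\<^esub>
          (farr (marr g) (actR (mact Y) a (mdelta f \<diamondop> b \<diamondop> x)) \<cdot>\<^bsub>?Z\<^esub> mdelta g \<diamondop> a \<diamondop> actO (mact Y) b ?Hx) \<cdot>\<^bsub>?Z\<^esub> actR (mact Z) a (mdelta g \<diamondop> b \<diamondop> ?Hx)"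
        using f.mdelta_beta[unfolded m, OF a b x] a b x gX' by (simp add: K.farr_Comp)
      also have "\<dots> = farr (marr g \<circ>\<^sub>F marr f) (mbeta X \<diamondop> a \<diamondop> b \<diamondop> x) \<cdot>\<^bsub>?Z\<^esub> ?D \<diamondop> a \<diamondop> ?bx \<cdot>\<^bsub>?Z\<^esub> actR (mact Z) a (?D \<diamondop> b \<diamondop> x)"
        unfolding nat[symmetric] using a b x gX' by (simp add: d(2) spc_arrow.farr_Comp[OF bZ.Gb[OF a]])
      finally show "?D \<diamondop> actO mu a b \<diamondop> x \<cdot>\<^bsub>?Z\<^esub> mbeta Z \<diamondop> a \<diamondop> b \<diamondop> fobj (marr g \<circ>\<^sub>F marr f) x
        = farr (marr g \<circ>\<^sub>F marr f) (mbeta X \<diamondop> a \<diamondop> b \<diamondop> x) \<cdot>\<^bsub>?Z\<^esub> ?D \<diamondop> a \<diamondop> ?bx \<cdot>\<^bsub>?Z\<^esub> actR (mact Z) a (?D \<diamondop> b \<diamondop> x)"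
        using x by simp
    qed
  qed
  have hom_iff: "f \<in> hom (A_Mod R) X Y \<longleftrightarrow> A_module_morphism R f \<and> msrc f = X \<and> mtgt f = Y" for f :: "('o, 'a, 'p, 'b) amod_mor" and X Y
    by (simp add: hom_def)
  have ob: "A_module R (msrc f)" "A_module R (mtgt f)" if "A_module_morphism R f" for f :: "('o, 'a, 'p, 'b) amod_mor"
    using that by (simp_all add: A_module_morphism_def)
  have Ia: "mdelta (Id (A_Mod R) X) \<diamondop> a \<diamondop> m = Id (mcat X) (actO (mact X) a m)"
    if "A_module R X" "a \<in> Obj A" "m \<in> Obj (mcat X)" for a m and X :: "('o, 'a, 'p, 'b) amod"
    using id_delta(2)[OF A_module.mact_arrow[OF that(1)] A_module.mcat_spc[OF that(1)] that(2,3)] by simp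
  show ?thesis
  proof
    fix f :: "('o, 'a, 'p, 'b) amod_mor" assume "f \<in> Arr (A_Mod R)"
    then show "Dom (A_Mod R) f \<in> Obj (A_Mod R)" "Cod (A_Mod R) f \<in> Obj (A_Mod R)" using ob by simp_all
  next
    fix X :: "('o, 'a, 'p, 'b) amod" assume "X \<in> Obj (A_Mod R)"
    then show "Id (A_Mod R) X \<in> hom (A_Mod R) X X" using I[of X] by (simp add: hom_iff)
  next
    fix f g :: "('o, 'a, 'p, 'b) amod_mor" and X Y Z assume "f \<in> hom (A_Mod R) X Y" "g \<in> hom (A_Mod R) Y Z"
    then show "Comp (A_Mod R) g f \<in> hom (A_Mod R) X Z" using C[of f g] by (simp add: hom_iff)
  next
    fix f :: "('o, 'a, 'p, 'b) amod_mor" and X Y assume fh: "f \<in> hom (A_Mod R) X Y"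
    then have f: "A_module_morphism R f" and m: "msrc f = X" "mtgt f = Y" by (simp_all add: hom_iff)
    interpret f: A_module_morphism R f by (rule f)
    note IX = I[OF f.X.A_module_axioms] and IY = I[OF f.Y.A_module_axioms]
    note ci = compF_idF[OF f.marr_arrow]
    show "Comp (A_Mod R) (Id (A_Mod R) Y) f = f"
    proof (rule module_morphism_eqI)
      show "A_module_morphism R (Comp (A_Mod R) (Id (A_Mod R) Y) f)" using C[OF f IY] by (simp add: m)
      show "A_module_morphism R f" by (rule f)
      fix a x assume a: "a \<in> Obj (rcat R)" and x: "x \<in> Obj (mcat (msrc (Comp (A_Mod R) (Id (A_Mod R) Y) f)))"
      then show "mdelta (Comp (A_Mod R) (Id (A_Mod R) Y) f) \<diamondop> a \<diamondop> x = mdelta f \<diamondop> a \<diamondop> x"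
        using Comp_delta[OF f IY _ a, of x] Ia[OF f.Y.A_module_axioms a, of "fobj (marr f) x"] f.delta_arr[OF a, of x] f.H.fobj_closed[of x] f.H.C.comp_id by (simp add: m)
    qed (use m ci in simp_all)
    show "Comp (A_Mod R) f (Id (A_Mod R) X) = f"
    proof (rule module_morphism_eqI)
      show "A_module_morphism R (Comp (A_Mod R) f (Id (A_Mod R) X))" using C[OF IX f] by (simp add: m)
      show "A_module_morphism R f" by (rule f)
      fix a x assume a: "a \<in> Obj (rcat R)" and x: "x \<in> Obj (mcat (msrc (Comp (A_Mod R) f (Id (A_Mod R) X))))"
      then show "mdelta (Comp (A_Mod R) f (Id (A_Mod R) X)) \<diamondop> a \<diamondop> x = mdelta f \<diamondop> a \<diamondop> x"
        using Comp_delta[OF IX f _ a, of x] Ia[OF f.X.A_module_axioms a, of x] f.delta_arr[OF a, of x]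
          f.H.farr_Id[of "actO (mact X) a x"] f.bX.Gb[OF a] spc_arrow.fobj_closed[OF f.bX.Gb[OF a], of x] f.H.C.comp_id by (simp add: m)
    qed (use m ci in simp_all)
  next
    fix f g h :: "('o, 'a, 'p, 'b) amod_mor" and W X Y Z
    assume "f \<in> hom (A_Mod R) W X" "g \<in> hom (A_Mod R) X Y" "h \<in> hom (A_Mod R) Y Z"
    then have f: "A_module_morphism R f" and g: "A_module_morphism R g" and h: "A_module_morphism R h"
      and m: "msrc f = W" "mtgt f = X" "msrc g = X" "mtgt g = Y" "msrc h = Y" "mtgt h = Z" by (simp_all add: hom_iff)
    interpret f: A_module_morphism R f by (rule f)
    interpret g: A_module_morphism R g by (rule g)
    interpret h: A_module_morphism R h by (rule h)
    let ?K = "Comp (A_Mod R)"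
    have gf: "A_module_morphism R (?K g f)" and hg: "A_module_morphism R (?K h g)" using C[OF f g] C[OF g h] by (simp_all add: m)
    note Ha = f.marr_arrow[unfolded m] g.marr_arrow[unfolded m] h.marr_arrow[unfolded m]
    interpret g': spc_arrow "mcat X" "mcat Y" "marr g" by (rule spc_arrow[OF Ha(2)])
    interpret h': spc_arrow "mcat Y" "mcat Z" "marr h" by (rule spc_arrow[OF Ha(3)])
    show "?K (?K h g) f = ?K h (?K g f)"
    proof (rule module_morphism_eqI)
      show "A_module_morphism R (?K (?K h g) f)" "A_module_morphism R (?K h (?K g f))"
        using C[OF f hg] C[OF gf h] by (simp_all add: m)
      fix a x assume a: "a \<in> Obj A" and x: "x \<in> Obj (mcat (msrc (?K (?K h g) f)))"
      have xW: "x \<in> Obj (mcat W)" using x by (simp add: m)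
      have o: "fobj (marr f) x \<in> Obj (mcat X)" "fobj (marr g) (fobj (marr f) x) \<in> Obj (mcat Y)"
        using xW f.H.fobj_closed[of x] g.H.fobj_closed[of "fobj (marr f) x"] by (simp_all add: m)
      have "mdelta (?K (?K h g) f) \<diamondop> a \<diamondop> x = farr (marr h) (farr (marr g) (mdelta f \<diamondop> a \<diamondop> x)) \<cdot>\<^bsub>mcat Z\<^esub>
          farr (marr h) (mdelta g \<diamondop> a \<diamondop> fobj (marr f) x) \<cdot>\<^bsub>mcat Z\<^esub> mdelta h \<diamondop> a \<diamondop> fobj (marr g) (fobj (marr f) x)"
        using Comp_delta[OF f hg _ a, of x] Comp_delta[OF g h _ a, of "fobj (marr f) x"] f.delta_arr[unfolded m, OF a xW] o xW
          arrows_src_tgt[OF Ha(2)] by (simp add: m del: A_Mod_sel(6)) (simp add: m)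
      also have "\<dots> = mdelta (?K h (?K g f)) \<diamondop> a \<diamondop> x"
        using Comp_delta[OF gf h _ a, of x] Comp_delta[OF f g _ a, of x] o xW arrows_src_tgt[OF Ha(1)]
          f.delta_arr[unfolded m, OF a xW] g.delta_arr[unfolded m, OF a o(1)] h.delta_arr[unfolded m, OF a o(2)]
        by (simp add: m h'.farr_Comp h'.C.comp_assoc)
      finally show "mdelta (?K (?K h g) f) \<diamondop> a \<diamondop> x = mdelta (?K h (?K g f)) \<diamondop> a \<diamondop> x" .
    qed (use m compF_assoc[OF Ha] in simp_all)
  qed
qed

text \<open>Along bijections compatible with ends, identities and composition, \<open>D\<close>
  inherits the category laws from \<open>C\<close>, and the inverse bijections form a functor. The
  laws for algebras are obtained in this way from those for modules.\<close>

lemma isomorphic_transport: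
  fixes C :: "('o, 'a, 'y) cat_scheme" and D :: "('p, 'b, 'z) cat_scheme"
  assumes C: "category C" and o: "bij_betw Go (Obj D) (Obj C)" and a: "bij_betw Ga (Arr D) (Arr C)"
    and d: "\<And>f. f \<in> Arr D ==> Dom D f \<in> Obj D \<and> Cod D f \<in> Obj D \<and> Dom C (Ga f) = Go (Dom D f) \<and> Cod C (Ga f) = Go (Cod D f)"
    and i: "\<And>X. X \<in> Obj D ==> Id D X \<in> Arr D \<and> Ga (Id D X) = Id C (Go X)"
    and c: "\<And>f g. f \<in> Arr D ==> g \<in> Arr D ==> Cod D f = Dom D g ==> Comp D g f \<in> Arr D \<and> Ga (Comp D g f) = Comp C (Ga g) (Ga f)"
  shows "isomorphic_categories C D"
proof -
  interpret C: category C by (rule C)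
  have oi: "X = Y" if "Go X = Go Y" "X \<in> Obj D" "Y \<in> Obj D" for X Y
    using that bij_betw_imp_inj_on[OF o] by (simp add: inj_on_def)
  have ai: "f = g" if "Ga f = Ga g" "f \<in> Arr D" "g \<in> Arr D" for f g
    using that bij_betw_imp_inj_on[OF a] by (simp add: inj_on_def)
  have oG: "Go X \<in> Obj C" if "X \<in> Obj D" for X using that bij_betw_imp_surj_on[OF o] by blast
  have aG: "Ga f \<in> Arr C" if "f \<in> Arr D" for f using that bij_betw_imp_surj_on[OF a] by blast
  have h: "Ga f \<in> hom C (Go X) (Go Y)" if "f \<in> hom D X Y" for f X Y
    using that d aG by (auto simp: hom_def)
  have hi: "f \<in> hom D X Y" if "f \<in> Arr D" "Ga f \<in> hom C (Go X) (Go Y)" "X \<in> Obj D" "Y \<in> Obj D" for f X Y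
    using that d oi by (auto simp: hom_def)
  have ho: "f \<in> Arr D" "X \<in> Obj D" "Y \<in> Obj D" "Dom D f = X" "Cod D f = Y" if "f \<in> hom D X Y" for f X Y
    using that d by (auto simp: hom_def)
  have ch: "Comp D g f \<in> hom D X Z" "Ga (Comp D g f) = Comp C (Ga g) (Ga f)" if f: "f \<in> hom D X Y" and g: "g \<in> hom D Y Z" for f g X Y Z
    using c[of f g] ho[OF f] ho[OF g] C.Comp_hom[OF h[OF f] h[OF g]] by (auto intro: hi)
  have ih: "Id D X \<in> hom D X X" "Ga (Id D X) = Id C (Go X)" if X: "X \<in> Obj D" for X
    using i[OF X] C.Id_hom[OF oG[OF X]] X by (auto intro: hi)
  have D: "category D"
  proof
    show "Comp D (Id D Y) f = f" if f: "f \<in> hom D X Y" for f X Y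
      by (rule ai) (use ch[OF f ih(1)[OF ho(3)[OF f]]] ih(2)[OF ho(3)[OF f]] C.Comp_Id_left[OF h[OF f]] ho[OF f] in \<open>auto dest: ho(1)\<close>)
    show "Comp D f (Id D X) = f" if f: "f \<in> hom D X Y" for f X Y
      by (rule ai) (use ch[OF ih(1)[OF ho(2)[OF f]] f] ih(2)[OF ho(2)[OF f]] C.Comp_Id_right[OF h[OF f]] ho[OF f] in \<open>auto dest: ho(1)\<close>)
    show "Comp D (Comp D k g) f = Comp D k (Comp D g f)" if f: "f \<in> hom D W X" and g: "g \<in> hom D X Y" and k: "k \<in> hom D Y Z" for f g k W X Y Z
      by (rule ai) (use ch[OF f ch(1)[OF g k]] ch[OF ch(1)[OF f g] k] ch(2)[OF f g] ch(2)[OF g k] C.Comp_assoc[OF h[OF f] h[OF g] h[OF k]] in \<open>auto dest: ho(1)\<close>)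
  qed (use d ch ih in auto)
  let ?Fo = "the_inv_into (Obj D) Go" and ?Fa = "the_inv_into (Arr D) Ga"
  have Fo: "?Fo Y \<in> Obj D" "Go (?Fo Y) = Y" if "Y \<in> Obj C" for Y
    using that o f_the_inv_into_f_bij_betw[OF o] the_inv_into_into[OF bij_betw_imp_inj_on[OF o], of Y "Obj D"] by (auto simp: bij_betw_def)
  have Fa: "?Fa f \<in> Arr D" "Ga (?Fa f) = f" if "f \<in> Arr C" for f
    using that a f_the_inv_into_f_bij_betw[OF a] the_inv_into_into[OF bij_betw_imp_inj_on[OF a], of f "Arr D"] by (auto simp: bij_betw_def)
  have Fh: "?Fa f \<in> hom D (?Fo (Dom C f)) (?Fo (Cod C f))" if f: "f \<in> Arr C" for f
    using Fa[OF f] Fo[OF C.Dom_closed[OF f]] Fo[OF C.Cod_closed[OF f]] f by (intro hi) (auto simp: hom_def)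
  show ?thesis
    unfolding isomorphic_categories_def
  proof (intro conjI exI)
    show "category C" "category D" by fact+
    show "is_functor C D ?Fo ?Fa"
      unfolding is_functor_def
    proof (intro conjI ballI impI)
      fix X assume X: "X \<in> Obj C"
      show "?Fo X \<in> Obj D" by (rule Fo(1)[OF X])
      have Ia: "Id C X \<in> Arr C" using C.Id_hom[OF X] by (simp add: hom_def)
      show "?Fa (Id C X) = Id D (?Fo X)"
        by (rule ai) (use Fa[OF Ia] ih[OF Fo(1)[OF X]] Fo(2)[OF X] in \<open>auto dest: ho(1)\<close>)
    next
      fix f assume f: "f \<in> Arr C"
      then show "?Fa f \<in> hom D (?Fo (Dom C f)) (?Fo (Cod C f))" by (rule Fh)
      fix g assume g: "g \<in> Arr C" and fg: "Cod C f = Dom C g"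
      have gh: "?Fa g \<in> hom D (?Fo (Cod C f)) (?Fo (Cod C g))" using Fh[OF g] by (simp add: fg)
      have "Comp C g f \<in> Arr C" using C.Comp_hom[of f "Dom C f" "Cod C f" g "Cod C g"] f g fg by (auto simp: hom_def)
      then show "?Fa (Comp C g f) = Comp D (?Fa g) (?Fa f)"
        by (intro ai) (use Fa[of "Comp C g f"] ch[OF Fh[OF f] gh] Fa(2)[OF f] Fa(2)[OF g] in \<open>auto dest: ho(1)\<close>)
    qed
    show "is_functor D C Go Ga"
      using oG h i c by (auto simp: is_functor_def hom_def)
  qed (use Fo Fa oG aG oi ai in \<open>auto intro: the_inv_into_f_f bij_betw_imp_inj_on[OF o] bij_betw_imp_inj_on[OF a]\<close>)
qed

definition alg_mod :: "('o, 'a) ring2 \<Rightarrow> ('o, 'a, 'p, 'b) talg \<Rightarrow> ('o, 'a, 'p, 'b) amod" where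
  "alg_mod R X = \<lparr>mcat = tcat X, mact = Rn (rcat R) (tcat X) (tact X),
     mbeta = Rn2 (rcat R) (rcat R) (Rn2 (rcat R \<otimes>\<^sub>0 rcat R) (tcat X) (tbeta X)), mgamma = tgamma X\<rparr>"

definition alg_mod_mor :: "('o, 'a) ring2 \<Rightarrow> ('o, 'a, 'p, 'b) talg_mor \<Rightarrow> ('o, 'a, 'p, 'b) amod_mor" where
  "alg_mod_mor R f = \<lparr>msrc = alg_mod R (tsrc f), mtgt = alg_mod R (ttgt f), marr = tarr f,
     mdelta = Rn2 (rcat R) (tcat (tsrc f)) (tdelta f)\<rparr>"

lemma alg_mod_sel [simp]:
  "mcat (alg_mod R X) = tcat X" "mact (alg_mod R X) = Rn (rcat R) (tcat X) (tact X)"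
  "mbeta (alg_mod R X) = Rn2 (rcat R) (rcat R) (Rn2 (rcat R \<otimes>\<^sub>0 rcat R) (tcat X) (tbeta X))" "mgamma (alg_mod R X) = tgamma X"
  "msrc (alg_mod_mor R f) = alg_mod R (tsrc f)" "mtgt (alg_mod_mor R f) = alg_mod R (ttgt f)" "marr (alg_mod_mor R f) = tarr f"
  "mdelta (alg_mod_mor R f) = Rn2 (rcat R) (tcat (tsrc f)) (tdelta f)"
  by (simp_all add: alg_mod_def alg_mod_mor_def)

section \<open>The bijections on objects and on morphisms\<close>

context two_ring
begin

lemma T_algebra_action:
  assumes "T_algebra R X"
  shows "strict_action R (tcat X) (tact X)" "spc_normal (tcat X)"
    "tbeta X \<in> cells (tact X \<circ>\<^sub>F (idF A \<otimes>\<^sub>1 tact X) \<circ>\<^sub>F Ac A A (tcat X)) (tact X \<circ>\<^sub>F (c \<otimes>\<^sub>1 idF (tcat X)))"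
    "tgamma X \<in> cells (idF (tcat X)) (tact X \<circ>\<^sub>F (u \<otimes>\<^sub>1 idF (tcat X)) \<circ>\<^sub>F Lc (tcat X))"
  using assms by (auto simp: T_algebra_def Let_def intro: strict_action[OF two_ring_axioms])

text \<open>Formulated for data of the right type before any axiom is imposed, so that it serves
  both to send algebras to modules and to recognise an algebra built from a module.\<close>

lemma T_algebra_iff:
  assumes a: "strict_action R (tcat X) (tact X)" and n: "spc_normal (tcat X)"
    and b: "tbeta X \<in> cells (tact X \<circ>\<^sub>F (idF A \<otimes>\<^sub>1 tact X) \<circ>\<^sub>F Ac A A (tcat X)) (tact X \<circ>\<^sub>F (c \<otimes>\<^sub>1 idF (tcat X)))"
    and g: "tgamma X \<in> cells (idF (tcat X)) (tact X \<circ>\<^sub>F (u \<otimes>\<^sub>1 idF (tcat X)) \<circ>\<^sub>F Lc (tcat X))"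
  shows "T_algebra R X \<longleftrightarrow> A_module R (alg_mod R X)"
proof -
  interpret X: strict_action R "tcat X" "tact X" by (rule a)
  have t: "Rn2 A A (Rn2 (A \<otimes>\<^sub>0 A) (tcat X) (tbeta X)) = X.trans (tbeta X)" by (simp add: X.trans_def)
  have "T_algebra R X \<longleftrightarrow>
    (\<forall>x \<in> Obj A. \<forall>y \<in> Obj A. \<forall>z \<in> Obj A. \<forall>m \<in> Obj (tcat X).
      (X.trans (tbeta X) \<diamondop> actO mu x y \<diamondop> z \<diamondop> m) \<cdot>\<^bsub>tcat X\<^esub> (X.trans (tbeta X) \<diamondop> x \<diamondop> y \<diamondop> actO X.\<phi>' z m)
      = actL X.\<phi>' (ralpha R \<diamondop> x \<diamondop> y \<diamondop> z) m \<cdot>\<^bsub>tcat X\<^esub> (X.trans (tbeta X) \<diamondop> x \<diamondop> actO mu y z \<diamondop> m) \<cdot>\<^bsub>tcat X\<^esub> actR X.\<phi>' x (X.trans (tbeta X) \<diamondop> y \<diamondop> z \<diamondop> m)) \<and>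
    (\<forall>a \<in> Obj A. \<forall>m \<in> Obj (tcat X). (X.trans (tbeta X) \<diamondop> a \<diamondop> rone R \<diamondop> m) \<cdot>\<^bsub>tcat X\<^esub> actR X.\<phi>' a (tgamma X \<diamondop> m) = actL X.\<phi>' (rrho R \<diamondop> a) m) \<and>
    (\<forall>a \<in> Obj A. \<forall>m \<in> Obj (tcat X). (X.trans (tbeta X) \<diamondop> rone R \<diamondop> a \<diamondop> m) \<cdot>\<^bsub>tcat X\<^esub> (tgamma X \<diamondop> actO X.\<phi>' a m) = actL X.\<phi>' (rlam R \<diamondop> a) m)"
    unfolding T_algebra_def Let_def X.T1_iff[OF b] X.T2_iff[OF b g] X.T3_iff[OF b g]
    using X.M_spc n X.phi_strict b g by blast
  also have "\<dots> \<longleftrightarrow> A_module R (alg_mod R X)"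
    unfolding A_module_def alg_mod_sel t
    using X.M_spc n X.phi'_arrow X.trans_cell(1)[OF b] g[unfolded X.gd_eq] by blast
  finally show ?thesis .
qed

lemma alg_mod_module: "T_algebra R X ==> A_module R (alg_mod R X)"
  using T_algebra_iff[OF T_algebra_action] by blast

lemma alg_mod_inj:
  assumes X: "T_algebra R X" and Y: "T_algebra R Y" and e: "alg_mod R X = alg_mod R Y"
  shows "X = Y"
proof -
  note x = T_algebra_action[OF X] and y = T_algebra_action[OF Y]
  have t: "tcat X = tcat Y" using arg_cong[OF e, of mcat] by simp
  interpret X: strict_action R "tcat X" "tact X" by (rule x(1))
  interpret Y: strict_action R "tcat Y" "tact Y" by (rule y(1))
  have p: "tact X = tact Y"
    by (rule strict_eqI[OF X.phi_strict _ _ rcat_spc X.M_spc]) (use Y.phi_strict arg_cong[OF e, of mact] t in simp_all)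
  have "tbeta X = tbeta Y"
    by (rule X.trans_inj[OF x(3)]) (use y(3) arg_cong[OF e, of mbeta] in \<open>simp_all add: t p X.trans_def Y.trans_def\<close>)
  then show ?thesis using t p arg_cong[OF e, of mgamma] by simp
qed

text \<open>\<open>En\<close> makes the action strict, \<open>trans_surj\<close> transposes
  \<open>\<beta>\<close> back, and by \<open>gd_eq\<close> the cell \<open>\<gamma>\<close> can be
  kept as it is.\<close>

lemma alg_mod_surj:
  assumes Y: "A_module R Y"
  obtains X where "T_algebra R X" "alg_mod R X = Y"
proof -
  interpret Y: A_module R Y by (rule Y)
  note p = tens.En_props[OF tens[OF rcat_spc Y.mcat_spc] Y.mact_arrow Y.mcat_spc]
  let ?p = "En A (mcat Y) (mcat Y) (mact Y)"
  note a = strict_action[OF two_ring_axioms Y.mcat_spc p(1)]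
  interpret X: strict_action R "mcat Y" ?p by (rule a)
  obtain b where b: "b \<in> cells X.dm X.cd" "X.trans b = mbeta Y"
    by (rule X.trans_surj[of "mbeta Y"]) (use Y.mbeta_cell in \<open>auto simp: p(2)\<close>)
  let ?X = "\<lparr>tcat = mcat Y, tact = ?p, tbeta = b, tgamma = mgamma Y\<rparr>"
  have m: "alg_mod R ?X = Y" using b(2) by (simp add: alg_mod_def p(2) X.trans_def)
  have "T_algebra R ?X"
    by (subst T_algebra_iff) (use a b(1) Y.mcat_normal Y.mgamma_cell Y m in \<open>simp_all add: X.gd_eq p(2)\<close>)
  then show thesis using m by (rule that)
qed

lemma T_algebra_pair:
  assumes "T_algebra R X" "T_algebra R Y" "H \<in> arrows (tcat X) (tcat Y)"
  shows "action_pair R (tcat X) (tact X) (tcat Y) (tact Y) H"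
  using T_algebra_action(1)[OF assms(1)] T_algebra_action(1)[OF assms(2)] assms(3)
  by (simp add: action_pair_def action_pair_axioms_def)

lemma T_algebra_morphismD:
  assumes "T_algebra_morphism R f"
  shows "T_algebra R (tsrc f)" "T_algebra R (ttgt f)" "tarr f \<in> arrows (tcat (tsrc f)) (tcat (ttgt f))"
    "tdelta f \<in> cells (tact (ttgt f) \<circ>\<^sub>F (idF A \<otimes>\<^sub>1 tarr f)) (tarr f \<circ>\<^sub>F tact (tsrc f))"
  using assms by (simp_all add: T_algebra_morphism_def Let_def)

lemma T_algebra_morphism_iff:
  assumes X: "T_algebra R (tsrc f)" and Y: "T_algebra R (ttgt f)" and H: "tarr f \<in> arrows (tcat (tsrc f)) (tcat (ttgt f))"
    and d: "tdelta f \<in> cells (tact (ttgt f) \<circ>\<^sub>F (idF A \<otimes>\<^sub>1 tarr f)) (tarr f \<circ>\<^sub>F tact (tsrc f))"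
  shows "T_algebra_morphism R f \<longleftrightarrow> A_module_morphism R (alg_mod_mor R f)"
proof -
  interpret P: action_pair R "tcat (tsrc f)" "tact (tsrc f)" "tcat (ttgt f)" "tact (ttgt f)" "tarr f" by (rule T_algebra_pair[OF X Y H])
  note x = T_algebra_action[OF X] and y = T_algebra_action[OF Y]
  let ?D = "Rn2 A (tcat (tsrc f)) (tdelta f)"
  have t: "Rn2 A A (Rn2 (A \<otimes>\<^sub>0 A) (tcat (tsrc f)) (tbeta (tsrc f))) = P.X.trans (tbeta (tsrc f))"
    "Rn2 A A (Rn2 (A \<otimes>\<^sub>0 A) (tcat (ttgt f)) (tbeta (ttgt f))) = P.Y.trans (tbeta (ttgt f))"
    by (simp_all add: P.X.trans_def P.Y.trans_def)
  show ?thesis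
    unfolding T_algebra_morphism_def Let_def P.M1_iff[OF d x(3) y(3)] P.M2_iff[OF d x(4) y(4)]
      A_module_morphism_def A_module_morphism_axioms_def alg_mod_sel t
    using X Y H d P.Rn2_delta(1)[OF d] alg_mod_module[OF X] alg_mod_module[OF Y] by blast
qed

lemma alg_mod_mor_inj:
  assumes f: "T_algebra_morphism R f" and g: "T_algebra_morphism R g" and e: "alg_mod_mor R f = alg_mod_mor R g"
  shows "f = g"
proof -
  note f = T_algebra_morphismD[OF f] and g = T_algebra_morphismD[OF g]
  have s: "tsrc f = tsrc g" "ttgt f = ttgt g" "tarr f = tarr g"
    using arg_cong[OF e, of msrc] arg_cong[OF e, of mtgt] arg_cong[OF e, of marr] alg_mod_inj f g by simp_all
  interpret P: action_pair R "tcat (tsrc f)" "tact (tsrc f)" "tcat (ttgt f)" "tact (ttgt f)" "tarr f" by (rule T_algebra_pair[OF f(1-3)])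
  have "tdelta f = tdelta g"
    by (rule tens.Rn2_inj[OF tens[OF rcat_spc P.X.M_spc] f(4) _ P.dd_arrow]) (use g(4) arg_cong[OF e, of mdelta] in \<open>simp_all add: s\<close>)
  then show ?thesis using s by simp
qed

lemma alg_mod_mor_surj:
  assumes h: "A_module_morphism R h"
  obtains f where "T_algebra_morphism R f" "alg_mod_mor R f = h"
proof -
  interpret h: A_module_morphism R h by (rule h)
  obtain X where X: "T_algebra R X" "alg_mod R X = msrc h" by (rule alg_mod_surj[OF h.X.A_module_axioms])
  obtain Y where Y: "T_algebra R Y" "alg_mod R Y = mtgt h" by (rule alg_mod_surj[OF h.Y.A_module_axioms])
  have m: "mcat (msrc h) = tcat X" "mcat (mtgt h) = tcat Y" "mact (msrc h) = Rn A (tcat X) (tact X)" "mact (mtgt h) = Rn A (tcat Y) (tact Y)"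
    by (simp_all add: X(2)[symmetric] Y(2)[symmetric])
  note H = h.marr_arrow[unfolded m]
  interpret P: action_pair R "tcat X" "tact X" "tcat Y" "tact Y" "marr h" by (rule T_algebra_pair[OF X(1) Y(1) H])
  obtain d where d: "d \<in> cells P.dd P.dc" "Rn2 A (tcat X) d = mdelta h"
    by (rule tens.Rn2_exists[OF tens[OF rcat_spc P.X.M_spc] P.dd_strict P.dc_arrow, of "mdelta h"])
      (use h.mdelta_cell[unfolded m] in \<open>auto simp: P.Rn_dd P.Rn_dc\<close>)
  let ?f = "\<lparr>tsrc = X, ttgt = Y, tarr = marr h, tdelta = d\<rparr>"
  have e: "alg_mod_mor R ?f = h" by (simp add: alg_mod_mor_def X(2) Y(2) d(2))
  have "T_algebra_morphism R ?f"
    by (subst T_algebra_morphism_iff) (use X(1) Y(1) H d(1) h e in simp_all)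
  then show thesis using e by (rule that)
qed

end

lemma T_Alg_sel [simp]:
  "X \<in> Obj (T_Alg R) \<longleftrightarrow> T_algebra R X" "f \<in> Arr (T_Alg R) \<longleftrightarrow> T_algebra_morphism R f" "Dom (T_Alg R) = tsrc" "Cod (T_Alg R) = ttgt"
  "Id (T_Alg R) X = \<lparr>tsrc = X, ttgt = X, tarr = idF (tcat X), tdelta = id2 (tact X)\<rparr>"
  "Comp (T_Alg R) g f = \<lparr>tsrc = tsrc f, ttgt = ttgt g, tarr = tarr g \<circ>\<^sub>F tarr f,
       tdelta = (tarr g *\<^sub>L tdelta f) \<cdot>\<^sub>V (tdelta g *\<^sub>R (idF (rcat R) \<otimes>\<^sub>1 tarr f))\<rparr>"
  by (simp_all add: T_Alg_def)

section \<open>Compatibility with identities and composition\<close>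

context two_ring
begin

text \<open>(M1) and (M2) are not computed for the identity: its transpose is the identity of a
  module, and \<open>T_algebra_morphism_iff\<close> reflects the axioms. Composites are treated
  likewise.\<close>

lemma alg_mod_mor_Id:
  fixes X :: "('o, 'a, 'p, 'b) talg"
  assumes X: "T_algebra R X"
  shows "T_algebra_morphism R (Id (T_Alg R) X)" "alg_mod_mor R (Id (T_Alg R) X) = Id (A_Mod R) (alg_mod R X)"
proof -
  interpret X: strict_action R "tcat X" "tact X" by (rule T_algebra_action(1)[OF X])
  note i = id2_cell[OF X.phi_arrow]
  have "Rn2 A (tcat X) (id2 (tact X)) = id2 X.\<phi>'"
  proof (rule bilin_cell_eqI[OF X.AM.Rn2_app(1)[OF i X.phi_arrow] id2_cell[OF X.phi'_arrow] X.phi'_arrow X.M_spc X.M_spc])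
    fix a m assume a: "a \<in> Obj A" "m \<in> Obj (tcat X)"
    show "Rn2 A (tcat X) (id2 (tact X)) \<diamondop> a \<diamondop> m = id2 X.\<phi>' \<diamondop> a \<diamondop> m"
      unfolding X.AM.Rn2_app(3)[OF i X.phi_arrow a] id_delta(2)[OF X.phi'_arrow X.M_spc a] X.phi_app(1)[OF a]
      using a arrows_src_tgt[OF X.phi_arrow] by simp
  qed
  then show e: "alg_mod_mor R (Id (T_Alg R) X) = Id (A_Mod R) (alg_mod R X)" by (simp add: alg_mod_mor_def)
  interpret C: category "A_Mod R :: (('o, 'a, 'p, 'b) amod, ('o, 'a, 'p, 'b) amod_mor) cat" by (rule A_Mod_category)
  have "A_module_morphism R (alg_mod_mor R (Id (T_Alg R) X))"
    unfolding e using C.Id_hom[of "alg_mod R X"] alg_mod_module[OF X] unfolding hom_def by simp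
  then show "T_algebra_morphism R (Id (T_Alg R) X)"
    by (subst T_algebra_morphism_iff) (use X i idF_arrow[OF X.M_spc] X.boundaries(8,9) in simp_all)
qed

lemma alg_mod_mor_Comp:
  fixes f g :: "('o, 'a, 'p, 'b) talg_mor"
  assumes f: "T_algebra_morphism R f" and g: "T_algebra_morphism R g" and fg: "ttgt f = tsrc g"
  shows "T_algebra_morphism R (Comp (T_Alg R) g f)"
    "alg_mod_mor R (Comp (T_Alg R) g f) = Comp (A_Mod R) (alg_mod_mor R g) (alg_mod_mor R f)"
proof -
  note F = T_algebra_morphismD[OF f, unfolded fg] and G = T_algebra_morphismD[OF g]
  let ?M = "tcat (tsrc f)" and ?N = "tcat (tsrc g)" and ?L = "tcat (ttgt g)"
  note H = compF_arrow[OF F(3) G(3)]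
  interpret f: action_pair R ?M "tact (tsrc f)" ?N "tact (tsrc g)" "tarr f" by (rule T_algebra_pair[OF F(1-3)])
  interpret g: action_pair R ?N "tact (tsrc g)" ?L "tact (ttgt g)" "tarr g" by (rule T_algebra_pair[OF G(1-3)])
  interpret h: action_pair R ?M "tact (tsrc f)" ?L "tact (ttgt g)" "tarr g \<circ>\<^sub>F tarr f" by (rule T_algebra_pair[OF F(1) G(2) H])
  let ?d = "(tarr g *\<^sub>L tdelta f) \<cdot>\<^sub>V (tdelta g *\<^sub>R (idF A \<otimes>\<^sub>1 tarr f))"
  note K = tens1_arrow[OF f.iA F(3)]
  have b: "g.dd \<circ>\<^sub>F (idF A \<otimes>\<^sub>1 tarr f) = h.dd" "g.dc \<circ>\<^sub>F (idF A \<otimes>\<^sub>1 tarr f) = tarr g \<circ>\<^sub>F f.dd" "tarr g \<circ>\<^sub>F f.dc = h.dc"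
    by (simp_all add: f.calc g.calc)
  have d2: "tdelta g *\<^sub>R (idF A \<otimes>\<^sub>1 tarr f) \<in> cells h.dd (tarr g \<circ>\<^sub>F f.dd)"
    using whisk_arrows(2)[OF G(4) g.dd_arrow K] unfolding b .
  have d1: "tarr g *\<^sub>L tdelta f \<in> cells (tarr g \<circ>\<^sub>F f.dd) h.dc"
    using whisk_arrows(1)[OF F(4) f.dd_arrow G(3)] unfolding b .
  have d: "?d \<in> cells h.dd h.dc" by (rule vcomp_cell[OF d2 d1])
  note c = comp_delta[OF f.X.phi'_arrow f.Y.phi'_arrow g.Y.phi'_arrow F(3) G(3) f.Rn2_delta(1)[OF F(4)] g.Rn2_delta(1)[OF G(4)]]
  have "Rn2 A ?M ?d = hom_post ?M (tarr g) *\<^sub>L Rn2 A ?M (tdelta f) \<cdot>\<^sub>V hom_pre (tarr f) ?L *\<^sub>L Rn2 A ?N (tdelta g)"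
  proof (rule bilin_cell_eqI[OF h.Rn2_delta(1)[OF d] c(1) _ f.X.M_spc g.Y.M_spc])
    show "hom_pre (tarr g \<circ>\<^sub>F tarr f) ?L \<circ>\<^sub>F g.Y.\<phi>' \<in> arrows A (ihom ?M ?L)"
      by (rule compF_arrow[OF g.Y.phi'_arrow hom_pre_arrow[OF H g.Y.M_spc]])
    fix a m assume a: "a \<in> Obj A" and m: "m \<in> Obj ?M"
    interpret H: spc_arrow ?M ?N "tarr f" by (rule spc_arrow[OF F(3)])
    have w: "PGen (a, m) \<in> Obj (A \<otimes>\<^sub>0 ?M)" using a m by simp
    have o: "fobj (idF A \<otimes>\<^sub>1 tarr f) (PGen (a, m)) = PGen (a, fobj (tarr f) m)" using tens1_app[OF f.iA F(3) a m] a by simp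
    show "Rn2 A ?M ?d \<diamondop> a \<diamondop> m = (hom_post ?M (tarr g) *\<^sub>L Rn2 A ?M (tdelta f) \<cdot>\<^sub>V hom_pre (tarr f) ?L *\<^sub>L Rn2 A ?N (tdelta g)) \<diamondop> a \<diamondop> m"
      unfolding h.Rn2_delta(2)[OF d a m] c(2)[OF a m] f.Rn2_delta(2)[OF F(4) a m] g.Rn2_delta(2)[OF G(4) a H.fobj_closed[OF m]]
        vcomp_at[OF d2 h.dd_arrow w] whiskL_at[OF F(4) f.dd_arrow w] whiskR_at[OF K w] o ..
  qed
  then show e: "alg_mod_mor R (Comp (T_Alg R) g f) = Comp (A_Mod R) (alg_mod_mor R g) (alg_mod_mor R f)"
    by (simp add: alg_mod_mor_def)
  interpret C: category "A_Mod R :: (('o, 'a, 'p, 'b) amod, ('o, 'a, 'p, 'b) amod_mor) cat" by (rule A_Mod_category)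
  have m: "A_module_morphism R (alg_mod_mor R f)" "A_module_morphism R (alg_mod_mor R g)"
    using T_algebra_morphism_iff[OF T_algebra_morphismD[OF f]] T_algebra_morphism_iff[OF T_algebra_morphismD[OF g]] f g by simp_all
  have "A_module_morphism R (alg_mod_mor R (Comp (T_Alg R) g f))"
    unfolding e using C.Comp_hom[of "alg_mod_mor R f" "alg_mod R (tsrc f)" "alg_mod R (tsrc g)" "alg_mod_mor R g" "alg_mod R (ttgt g)"] m
    unfolding hom_def by (simp add: fg)
  then show "T_algebra_morphism R (Comp (T_Alg R) g f)"
    by (subst T_algebra_morphism_iff) (use F(1) G(2) H d in simp_all)
qed

end

theorem mainTheorem1:
  fixes R :: "('o, 'a) ring2"
  assumes "two_ring R"
  shows "isomorphic_categories
    (A_Mod R :: (('o, 'a, 'p, 'b) amod, ('o, 'a, 'p, 'b) amod_mor) cat)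
    (T_Alg R :: (('o, 'a, 'p, 'b) talg, ('o, 'a, 'p, 'b) talg_mor) cat)"
proof -
  interpret two_ring R by fact
  show ?thesis
  proof (rule isomorphic_transport[where Go = "alg_mod R" and Ga = "alg_mod_mor R"])
    show "category (A_Mod R :: (('o, 'a, 'p, 'b) amod, ('o, 'a, 'p, 'b) amod_mor) cat)" by (rule A_Mod_category)
    show "bij_betw (alg_mod R) (Obj (T_Alg R)) (Obj (A_Mod R :: (('o, 'a, 'p, 'b) amod, ('o, 'a, 'p, 'b) amod_mor) cat))"
    proof (intro bij_betw_imageI inj_onI equalityI subsetI)
      fix Y :: "('o, 'a, 'p, 'b) amod" assume "Y \<in> Obj (A_Mod R)"
      then obtain X where "T_algebra R X" "alg_mod R X = Y" using alg_mod_surj by auto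
      then show "Y \<in> alg_mod R ` Obj (T_Alg R)" by auto
    qed (auto intro: alg_mod_inj alg_mod_module)
    have mm: "A_module_morphism R (alg_mod_mor R f)" if "T_algebra_morphism R f" for f :: "('o, 'a, 'p, 'b) talg_mor"
      using T_algebra_morphism_iff[OF T_algebra_morphismD[OF that]] that by simp
    show "bij_betw (alg_mod_mor R) (Arr (T_Alg R)) (Arr (A_Mod R :: (('o, 'a, 'p, 'b) amod, ('o, 'a, 'p, 'b) amod_mor) cat))"
    proof (intro bij_betw_imageI inj_onI equalityI subsetI)
      fix h :: "('o, 'a, 'p, 'b) amod_mor" assume "h \<in> Arr (A_Mod R)"
      then obtain f where "T_algebra_morphism R f" "alg_mod_mor R f = h" using alg_mod_mor_surj by auto
      then show "h \<in> alg_mod_mor R ` Arr (T_Alg R)" by auto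
    qed (auto intro: alg_mod_mor_inj mm)
  qed (use T_algebra_morphismD alg_mod_mor_Id alg_mod_mor_Comp in \<open>auto simp del: T_Alg_sel(5,6) A_Mod_sel(5,6)\<close>)
qed

end
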